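(* Let $K$ be a number field and let $\mathscr{D}G_K:=\varprojlim_{L/K}D_{L/K}$, the inverse limit over finite Galois extensions $L/K$ (inside a fixed algebraic closure $\bar K$) of the finite monoids $D_{L/K}$. Let $e=e_S\in\mathscr{D}G_K$ be the idempotent for $S\subseteq P_K$. Then the regular $\mathcal{H}$-class of $e$ is isomorphic (as a profinite group) to the maximal Galois group $G_{K,S}$ with the ramifications restricted on $S$.
   Context: $P_K$ is the set of non-zero maximal ideals of $O_K$, $I_K$ the monoid of non-zero integral ideals of $K$; $\mathbb{N}$ contains $0$. $G_{K,S}$ is the Galois group over $K$ of the maximal extension of $K$ in $\bar K$ unramified at all $\mathfrak p\in P_K\setminus S$ (no condition at infinite places). For a finite Galois extension $L/K$ define $\mathfrak{f}=\mathfrak{f}_{L/K}\in I_K$ by $v_{\mathfrak p}(\mathfrak f):=\min\{e\in\mathbb{N}\mid \mathrm{Gal}^e(L_{\mathfrak P}/K_{\mathfrak p})=1\}$ for each $\mathfrak p\in P_K$, where $\mathfrak P$ is any prime of $L$ over $\mathfrak p$ and $\mathrm{Gal}^e$ denotes the ramification subgroup in the upper numbering. For $\mathfrak d\mid\mathfrak f$ let $L^{(\mathfrak f/\mathfrak d)}$ be the subfield of $L$ fixed by the subgroup of $\mathrm{Gal}(L/K)$ generated by the ramification subgroups $\mathrm{Gal}^{v_{\mathfrak p}(\mathfrak f/\mathfrak d)}(L_{\mathfrak P}/K_{\mathfrak p})$ for all $\mathfrak p\in P_K$ and all $\mathfrak P\mid\mathfrak p$; it is Galois over $K$. $D_{L/K}:=\coprod_{\mathfrak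 d\mid\mathfrak f}\{\mathfrak d\}\times \mathrm{Gal}(L^{(\mathfrak f/\mathfrak d)}/K)$ is a finite monoid under $(\mathfrak d,\sigma)\cdot(\mathfrak d',\sigma'):=(\mathfrak d'',\sigma\sigma')$, where $\mathfrak d''=\gcd(\mathfrak f,\mathfrak d\mathfrak d')$ and the product $\sigma\sigma'$ is taken in $\mathrm{Gal}(L^{(\mathfrak f/\mathfrak d'')}/K)$ after restricting both factors. For $L'\supseteq L\supseteq K$ the transition map $D_{L'/K}\to D_{L/K}$ is $(\mathfrak d',\sigma')\mapsto(\gcd(\mathfrak d',\mathfrak f_{L/K}),\sigma'|)$, with $\sigma'|$ the restriction of $\sigma'$ to $L^{(\mathfrak f_{L/K}/\gcd(\mathfrak d',\mathfrak f_{L/K}))}$. Let $P_{L/K}$ be the set of primes of $K$ ramified in $L$ (the prime factors of $\mathfrak f_{L/K}$). For $T\subseteq P_{L/K}$ let $\mathfrak e_T\mid\mathfrak f_{L/K}$ be the divisor with $v_{\mathfrak p}(\mathfrak e_T)=0$ for $\mathfrak p\in T$ and $v_{\mathfrak p}(\mathfrak e_T)=v_{\mathfrak p}(\mathfrak f_{L/K})$ otherwise, and $e_{L,T}:=(\mathfrak e_T,1)\in D_{L/K}$. For $S\subseteq P_K$, the idempotent for $S$ is $e_S:=(e_{L,S\cap P_{L/K}})_L\in\mathscr{D}G_K$. In a monoid $D$, $x\,\mathcal{H}\,y$ means $xD=yD$ and $Dx=Dy$. An $\mathcal{H}$-class is regular if it contains an idempotent $e$; it is then a group under the multiplication of $D$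 with identity $e$, equal to $(eDe)^\times$. *)

theory Defs
  imports "HOL-Algebra.Algebra" "HOL-Analysis.Analysis"
begin

text \<open>
  Conventions. All fields are subsets of one ambient field \<open>\<Omega>\<close>, which the theorem takes to be an
  algebraic closure of \<open>K\<close>. Maps between fields are extensional functions on their domain (as in
  \<^const>\<open>Bij\<close>), so that a Galois group has one function per automorphism.
\<close>

section \<open>Number fields, integers and ideals\<close>

definition number_field :: "('a, 'm) ring_scheme \<Rightarrow> 'a set \<Rightarrow> bool" where
  "number_field \<Omega> K \<longleftrightarrow>
     field \<Omega> \<and> subfield K \<Omega> \<and>
     (\<forall>n::nat. 0 < n \<longrightarrow> [n] \<cdot>\<^bsub>\<Omega>\<^esub> \<one>\<^bsub>\<Omega>\<^esub> \<noteq> \<zero>\<^bsub>\<Omega>\<^esub>) \<and>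
     ring.finite_dimension \<Omega> (generate_field \<Omega> {}) K"

text \<open>Polynomials of \<open>HOL-Algebra\<close> are coefficient lists with the leading coefficient first.\<close>

definition integral_element :: "('a, 'm) ring_scheme \<Rightarrow> 'a \<Rightarrow> bool" where
  "integral_element \<Omega> x \<longleftrightarrow>
     (\<exists>p. p \<noteq> [] \<and> hd p = \<one>\<^bsub>\<Omega>\<^esub> \<and> set p \<subseteq> range (\<lambda>n::int. [n] \<cdot>\<^bsub>\<Omega>\<^esub> \<one>\<^bsub>\<Omega>\<^esub>) \<and>
          ring.eval \<Omega> p x = \<zero>\<^bsub>\<Omega>\<^esub>)"

definition ring_of_integers :: "('a, 'm) ring_scheme \<Rightarrow> 'a set \<Rightarrow> ('a, 'm) ring_scheme" where
  "ring_of_integers \<Omega> F = \<Omega>\<lparr>carrier := {x \<in> F. integral_element \<Omega> x}\<rparr>"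

definition ideal_monoid :: "('a, 'm) ring_scheme \<Rightarrow> 'a set \<Rightarrow> 'a set monoid" where
  "ideal_monoid \<Omega> F =
     \<lparr>carrier = {I. ideal I (ring_of_integers \<Omega> F) \<and> I \<noteq> {\<zero>\<^bsub>\<Omega>\<^esub>}},
      monoid.mult = ideal_prod (ring_of_integers \<Omega> F),
      one = carrier (ring_of_integers \<Omega> F)\<rparr>"

definition primes :: "('a, 'm) ring_scheme \<Rightarrow> 'a set \<Rightarrow> 'a set set" where
  "primes \<Omega> F = {\<pp>. maximalideal \<pp> (ring_of_integers \<Omega> F) \<and> \<pp> \<noteq> {\<zero>\<^bsub>\<Omega>\<^esub>}}"

definition primes_over :: "('a, 'm) ring_scheme \<Rightarrow> 'a set \<Rightarrow> 'a set \<Rightarrow> 'a set \<Rightarrow> 'a set set" where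
  "primes_over \<Omega> K L \<pp> = {\<PP> \<in> primes \<Omega> L. \<PP> \<inter> carrier (ring_of_integers \<Omega> K) = \<pp>}"

definition ideal_val :: "('a, 'm) ring_scheme \<Rightarrow> 'a set \<Rightarrow> 'a set \<Rightarrow> 'a set \<Rightarrow> nat" where
  "ideal_val \<Omega> F \<pp> \<aa> =
     (GREATEST n::nat. (\<pp> [^]\<^bsub>ideal_monoid \<Omega> F\<^esub> n) divides\<^bsub>ideal_monoid \<Omega> F\<^esub> \<aa>)"

text \<open>Ideals associated in the monoid of ideals are equal, so \<^const>\<open>somegcd\<close> is \<open>the\<close> gcd here.\<close>

abbreviation ideal_gcd :: "('a, 'm) ring_scheme \<Rightarrow> 'a set \<Rightarrow> 'a set \<Rightarrow> 'a set \<Rightarrow> 'a set" where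
  "ideal_gcd \<Omega> F \<equiv> somegcd (ideal_monoid \<Omega> F)"

definition ideal_quot :: "('a, 'm) ring_scheme \<Rightarrow> 'a set \<Rightarrow> 'a set \<Rightarrow> 'a set \<Rightarrow> 'a set" where
  "ideal_quot \<Omega> F \<ff> \<dd> =
     (THE \<cc>. \<cc> \<in> carrier (ideal_monoid \<Omega> F) \<and> \<ff> = \<dd> \<otimes>\<^bsub>ideal_monoid \<Omega> F\<^esub> \<cc>)"


section \<open>Galois groups\<close>

definition Aut_over :: "('a, 'm) ring_scheme \<Rightarrow> 'a set \<Rightarrow> ('a \<Rightarrow> 'a) monoid" where
  "Aut_over R F = BijGroup (carrier R)
     \<lparr>carrier := {\<sigma> \<in> Bij (carrier R). \<sigma> \<in> ring_hom R R \<and> (\<forall>x\<in>F. \<sigma> x = x)}\<rparr>"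

abbreviation Gal :: "('a, 'm) ring_scheme \<Rightarrow> 'a set \<Rightarrow> 'a set \<Rightarrow> ('a \<Rightarrow> 'a) monoid" where
  "Gal \<Omega> L K \<equiv> Aut_over (\<Omega>\<lparr>carrier := L\<rparr>) K"

definition fixed_field :: "'a set \<Rightarrow> ('a \<Rightarrow> 'a) set \<Rightarrow> 'a set" where
  "fixed_field L H = {x \<in> L. \<forall>\<sigma>\<in>H. \<sigma> x = x}"

definition finite_extensions :: "('a, 'm) ring_scheme \<Rightarrow> 'a set \<Rightarrow> 'a set set" where
  "finite_extensions \<Omega> K = {L. subfield L \<Omega> \<and> K \<subseteq> L \<and> ring.finite_dimension \<Omega> K L}"

definition finite_galois_extensions :: "('a, 'm) ring_scheme \<Rightarrow> 'a set \<Rightarrow> 'a set set" where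
  "finite_galois_extensions \<Omega> K =
     {L \<in> finite_extensions \<Omega> K. fixed_field L (carrier (Gal \<Omega> L K)) = K}"

text \<open>The topology generated by the cosets of \<open>Gal(M/F)\<close>, for \<open>F/K\<close> finite Galois with \<open>F \<subseteq> M\<close>.\<close>

definition krull_topology :: "('a, 'm) ring_scheme \<Rightarrow> 'a set \<Rightarrow> 'a set \<Rightarrow> ('a \<Rightarrow> 'a) topology" where
  "krull_topology \<Omega> M K = topology_generated_by
     {\<sigma> <#\<^bsub>Gal \<Omega> M K\<^esub> carrier (Gal \<Omega> M F) | \<sigma> F.
        \<sigma> \<in> carrier (Gal \<Omega> M K) \<and> F \<in> finite_galois_extensions \<Omega> K \<and> F \<subseteq> M}"


section \<open>Ramified primes and the maximal extension unramified outside \<open>S\<close>\<close>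

text \<open>
  Residue fields are finite, so separability of the residue extension is automatic and
  \<open>\<pp>\<close> is unramified iff every ramification index \<open>v\<^sub>\<PP>(\<pp> O\<^sub>F)\<close> is \<open>1\<close>.
\<close>

definition unramified_at :: "('a, 'm) ring_scheme \<Rightarrow> 'a set \<Rightarrow> 'a set \<Rightarrow> 'a set \<Rightarrow> bool" where
  "unramified_at \<Omega> K F \<pp> \<longleftrightarrow>
     (\<forall>\<PP>\<in>primes_over \<Omega> K F \<pp>. ideal_val \<Omega> F \<PP> (Idl\<^bsub>ring_of_integers \<Omega> F\<^esub> \<pp>) = 1)"

definition ramified_primes :: "('a, 'm) ring_scheme \<Rightarrow> 'a set \<Rightarrow> 'a set \<Rightarrow> 'a set set" where
  "ramified_primes \<Omega> K L = {\<pp> \<in> primes \<Omega> K. \<not> unramified_at \<Omega> K L \<pp>}"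

text \<open>An infinite algebraic extension is unramified at \<open>\<pp>\<close> if all its finite subextensions are.\<close>

definition unramified_outside :: "('a, 'm) ring_scheme \<Rightarrow> 'a set \<Rightarrow> 'a set set \<Rightarrow> 'a set \<Rightarrow> bool" where
  "unramified_outside \<Omega> K S M \<longleftrightarrow>
     subfield M \<Omega> \<and> K \<subseteq> M \<and>
     (\<forall>\<pp>\<in>primes \<Omega> K - S. \<forall>F\<in>finite_extensions \<Omega> K. F \<subseteq> M \<longrightarrow> unramified_at \<Omega> K F \<pp>)"

definition max_unramified_extension :: "('a, 'm) ring_scheme \<Rightarrow> 'a set \<Rightarrow> 'a set set \<Rightarrow> 'a set" where
  "max_unramified_extension \<Omega> K S = (GREATEST M. unramified_outside \<Omega> K S M)"


section \<open>Completions\<close>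

text \<open>
  \<open>elem_val \<Omega> F \<pp> x\<close> is the normalised \<open>\<pp>\<close>-adic valuation of \<open>x \<noteq> 0\<close> in \<open>F\<close>, computed by writing
  \<open>x = a / b\<close> with algebraic integers \<open>a\<close> and \<open>b\<close> of \<open>F\<close>.
\<close>

definition elem_val :: "('a, 'm) ring_scheme \<Rightarrow> 'a set \<Rightarrow> 'a set \<Rightarrow> 'a \<Rightarrow> int" where
  "elem_val \<Omega> F \<pp> x =
     (let A = ring_of_integers \<Omega> F in
      THE n. \<exists>a \<in> carrier A - {\<zero>\<^bsub>\<Omega>\<^esub>}. \<exists>b \<in> carrier A - {\<zero>\<^bsub>\<Omega>\<^esub>}.
        a = b \<otimes>\<^bsub>\<Omega>\<^esub> x \<and>
        n = int (ideal_val \<Omega> F \<pp> (PIdl\<^bsub>A\<^esub> a)) - int (ideal_val \<Omega> F \<pp> (PIdl\<^bsub>A\<^esub> b)))"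

definition val_ge :: "('a, 'm) ring_scheme \<Rightarrow> 'a set \<Rightarrow> 'a set \<Rightarrow> int \<Rightarrow> 'a \<Rightarrow> bool" where
  "val_ge \<Omega> F \<pp> m x \<longleftrightarrow> x = \<zero>\<^bsub>\<Omega>\<^esub> \<or> m \<le> elem_val \<Omega> F \<pp> x"

definition cauchy_ring :: "('a, 'm) ring_scheme \<Rightarrow> 'a set \<Rightarrow> 'a set \<Rightarrow> (nat \<Rightarrow> 'a) ring" where
  "cauchy_ring \<Omega> F \<pp> =
     \<lparr>carrier = {s. range s \<subseteq> F \<and>
                    (\<forall>m. \<exists>N. \<forall>i\<ge>N. \<forall>j\<ge>N. val_ge \<Omega> F \<pp> m (s i \<ominus>\<^bsub>\<Omega>\<^esub> s j))},
      monoid.mult = (\<lambda>s t n. s n \<otimes>\<^bsub>\<Omega>\<^esub> t n),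
      one = (\<lambda>n. \<one>\<^bsub>\<Omega>\<^esub>),
      ring.zero = (\<lambda>n. \<zero>\<^bsub>\<Omega>\<^esub>),
      ring.add = (\<lambda>s t n. s n \<oplus>\<^bsub>\<Omega>\<^esub> t n)\<rparr>"

definition null_sequences :: "('a, 'm) ring_scheme \<Rightarrow> 'a set \<Rightarrow> 'a set \<Rightarrow> (nat \<Rightarrow> 'a) set" where
  "null_sequences \<Omega> F \<pp> =
     {s. range s \<subseteq> F \<and> (\<forall>m. \<exists>N. \<forall>i\<ge>N. val_ge \<Omega> F \<pp> m (s i))}"

definition completion :: "('a, 'm) ring_scheme \<Rightarrow> 'a set \<Rightarrow> 'a set \<Rightarrow> (nat \<Rightarrow> 'a) set ring" where
  "completion \<Omega> F \<pp> = cauchy_ring \<Omega> F \<pp> Quot null_sequences \<Omega> F \<pp>"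

definition completion_embed :: "('a, 'm) ring_scheme \<Rightarrow> 'a set \<Rightarrow> 'a set \<Rightarrow> 'a \<Rightarrow> (nat \<Rightarrow> 'a) set" where
  "completion_embed \<Omega> F \<pp> x = null_sequences \<Omega> F \<pp> +>\<^bsub>cauchy_ring \<Omega> F \<pp>\<^esub> (\<lambda>n. x)"

text \<open>
  For \<open>\<PP>\<close> over \<open>\<pp>\<close> the completion \<open>K\<^sub>\<pp>\<close> is regarded, as usual, as a subfield of \<open>L\<^sub>\<PP>\<close>: it consists of
  the classes of the \<open>\<PP>\<close>-adic Cauchy sequences with terms in \<open>K\<close>.
\<close>

definition completion_subfield ::
  "('a, 'm) ring_scheme \<Rightarrow> 'a set \<Rightarrow> 'a set \<Rightarrow> 'a set \<Rightarrow> (nat \<Rightarrow> 'a) set set" where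
  "completion_subfield \<Omega> K L \<PP> =
     {Z \<in> carrier (completion \<Omega> L \<PP>). \<exists>s\<in>Z. range s \<subseteq> K}"

text \<open>
  The elements of valuation \<open>\<ge> m\<close> in the completion, for the extension of the \<open>\<PP>\<close>-adic valuation.
  For \<open>m = 0\<close> this is the valuation ring.
\<close>

definition completion_val_ge ::
  "('a, 'm) ring_scheme \<Rightarrow> 'a set \<Rightarrow> 'a set \<Rightarrow> int \<Rightarrow> (nat \<Rightarrow> 'a) set set" where
  "completion_val_ge \<Omega> L \<PP> m =
     {Z \<in> carrier (completion \<Omega> L \<PP>). \<exists>s\<in>Z. \<exists>N. \<forall>n\<ge>N. val_ge \<Omega> L \<PP> m (s n)}"


section \<open>Ramification groups\<close>

abbreviation local_Gal ::
  "('a, 'm) ring_scheme \<Rightarrow> 'a set \<Rightarrow> 'a set \<Rightarrow> 'a set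
     \<Rightarrow> ((nat \<Rightarrow> 'a) set \<Rightarrow> (nat \<Rightarrow> 'a) set) monoid" where
  "local_Gal \<Omega> K L \<PP> \<equiv> Aut_over (completion \<Omega> L \<PP>) (completion_subfield \<Omega> K L \<PP>)"

text \<open>
  Numbering as in Serre's \<open>Local Fields\<close>, Chapter IV: \<open>G\<^sub>i\<close> is the group of all \<open>\<tau>\<close> with
  \<open>v(\<tau> x - x) \<ge> i + 1\<close> for all integral \<open>x\<close>, so \<open>G\<^sub>0 = G\<^sup>0\<close> is the inertia group. Only indices \<open>\<ge> 0\<close>
  occur.
\<close>

definition lower_ramification ::
  "('a, 'm) ring_scheme \<Rightarrow> 'a set \<Rightarrow> 'a set \<Rightarrow> 'a set \<Rightarrow> nat
     \<Rightarrow> ((nat \<Rightarrow> 'a) set \<Rightarrow> (nat \<Rightarrow> 'a) set) set" where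
  "lower_ramification \<Omega> K L \<PP> i =
     {\<tau> \<in> carrier (local_Gal \<Omega> K L \<PP>).
        \<forall>Z \<in> completion_val_ge \<Omega> L \<PP> 0.
          \<tau> Z \<ominus>\<^bsub>completion \<Omega> L \<PP>\<^esub> Z \<in> completion_val_ge \<Omega> L \<PP> (int i + 1)}"

text \<open>
  The Herbrand function \<open>\<phi>(u) = \<integral>\<^sub>0\<^sup>u dt / [G\<^sub>0 : G\<^sub>t]\<close>, where \<open>G\<^sub>t = G\<^sub>\<lceil>\<^sub>t\<^sub>\<rceil>\<close> for real \<open>t \<ge> 0\<close>. It is an
  increasing bijection of \<open>[0, \<infinity>)\<close>, and \<open>G\<^sup>v = G\<^sub>\<psi>\<^sub>(\<^sub>v\<^sub>)\<close> for its inverse \<open>\<psi>\<close>.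
\<close>

definition herbrand_phi ::
  "('a, 'm) ring_scheme \<Rightarrow> 'a set \<Rightarrow> 'a set \<Rightarrow> 'a set \<Rightarrow> real \<Rightarrow> real" where
  "herbrand_phi \<Omega> K L \<PP> u =
     integral {0..u} (\<lambda>t. real (card (lower_ramification \<Omega> K L \<PP> (nat \<lceil>t\<rceil>)))
                          / real (card (lower_ramification \<Omega> K L \<PP> 0)))"

definition herbrand_psi ::
  "('a, 'm) ring_scheme \<Rightarrow> 'a set \<Rightarrow> 'a set \<Rightarrow> 'a set \<Rightarrow> real \<Rightarrow> real" where
  "herbrand_psi \<Omega> K L \<PP> v = (THE u. 0 \<le> u \<and> herbrand_phi \<Omega> K L \<PP> u = v)"

definition upper_ramification ::
  "('a, 'm) ring_scheme \<Rightarrow> 'a set \<Rightarrow> 'a set \<Rightarrow> 'a set \<Rightarrow> real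
     \<Rightarrow> ((nat \<Rightarrow> 'a) set \<Rightarrow> (nat \<Rightarrow> 'a) set) set" where
  "upper_ramification \<Omega> K L \<PP> v =
     lower_ramification \<Omega> K L \<PP> (nat \<lceil>herbrand_psi \<Omega> K L \<PP> v\<rceil>)"

text \<open>
  The image of \<open>Gal\<^sup>v(L\<^sub>\<PP>/K\<^sub>\<pp>)\<close> under the canonical injection \<open>Gal(L\<^sub>\<PP>/K\<^sub>\<pp>) \<rightarrow> Gal(L/K)\<close>,
  restriction of automorphisms to \<open>L\<close>.
\<close>

definition global_upper_ramification ::
  "('a, 'm) ring_scheme \<Rightarrow> 'a set \<Rightarrow> 'a set \<Rightarrow> 'a set \<Rightarrow> real \<Rightarrow> ('a \<Rightarrow> 'a) set" where
  "global_upper_ramification \<Omega> K L \<PP> v =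
     {\<sigma> \<in> carrier (Gal \<Omega> L K). \<exists>\<tau> \<in> upper_ramification \<Omega> K L \<PP> v.
        \<forall>x\<in>L. \<tau> (completion_embed \<Omega> L \<PP> x) = completion_embed \<Omega> L \<PP> (\<sigma> x)}"


section \<open>The monoids \<open>D\<^bsub>L/K\<^esub>\<close> and their inverse limit\<close>

definition ram_conductor :: "('a, 'm) ring_scheme \<Rightarrow> 'a set \<Rightarrow> 'a set \<Rightarrow> 'a set" where
  "ram_conductor \<Omega> K L =
     (THE \<ff>. \<ff> \<in> carrier (ideal_monoid \<Omega> K) \<and>
        (\<forall>\<pp>\<in>primes \<Omega> K. \<forall>\<PP>\<in>primes_over \<Omega> K L \<pp>.
           ideal_val \<Omega> K \<pp> \<ff> =
             (LEAST e::nat. upper_ramification \<Omega> K L \<PP> (real e) = {\<one>\<^bsub>local_Gal \<Omega> K L \<PP>\<^esub>})))"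

text \<open>\<open>ram_subfield \<Omega> K L \<cc>\<close> is the field \<open>L\<^sup>(\<^sup>\<cc>\<^sup>)\<close>.\<close>

definition ram_subfield :: "('a, 'm) ring_scheme \<Rightarrow> 'a set \<Rightarrow> 'a set \<Rightarrow> 'a set \<Rightarrow> 'a set" where
  "ram_subfield \<Omega> K L \<cc> = fixed_field L (generate (Gal \<Omega> L K)
     (\<Union>\<pp>\<in>primes \<Omega> K. \<Union>\<PP>\<in>primes_over \<Omega> K L \<pp>.
        global_upper_ramification \<Omega> K L \<PP> (real (ideal_val \<Omega> K \<pp> \<cc>))))"

text \<open>\<open>D_field \<Omega> K L \<dd>\<close> is the field \<open>L\<^sup>(\<^sup>\<ff>\<^sup>/\<^sup>\<dd>\<^sup>)\<close>.\<close>

definition D_field :: "('a, 'm) ring_scheme \<Rightarrow> 'a set \<Rightarrow> 'a set \<Rightarrow> 'a set \<Rightarrow> 'a set" where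
  "D_field \<Omega> K L \<dd> = ram_subfield \<Omega> K L (ideal_quot \<Omega> K (ram_conductor \<Omega> K L) \<dd>)"

definition D_monoid ::
  "('a, 'm) ring_scheme \<Rightarrow> 'a set \<Rightarrow> 'a set \<Rightarrow> ('a set \<times> ('a \<Rightarrow> 'a)) monoid" where
  "D_monoid \<Omega> K L =
     \<lparr>carrier = (SIGMA \<dd> : {\<dd> \<in> carrier (ideal_monoid \<Omega> K).
                              \<dd> divides\<^bsub>ideal_monoid \<Omega> K\<^esub> ram_conductor \<Omega> K L}.
                   carrier (Gal \<Omega> (D_field \<Omega> K L \<dd>) K)),
      monoid.mult = (\<lambda>(\<dd>, \<sigma>) (\<dd>', \<sigma>').
                let \<dd>'' = ideal_gcd \<Omega> K (ram_conductor \<Omega> K L) (\<dd> \<otimes>\<^bsub>ideal_monoid \<Omega> K\<^esub> \<dd>');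
                    M = D_field \<Omega> K L \<dd>''
                in (\<dd>'', restrict \<sigma> M \<otimes>\<^bsub>Gal \<Omega> M K\<^esub> restrict \<sigma>' M)),
      one = (\<one>\<^bsub>ideal_monoid \<Omega> K\<^esub>, \<one>\<^bsub>Gal \<Omega> (D_field \<Omega> K L \<one>\<^bsub>ideal_monoid \<Omega> K\<^esub>) K\<^esub>)\<rparr>"

definition D_transition ::
  "('a, 'm) ring_scheme \<Rightarrow> 'a set \<Rightarrow> 'a set \<Rightarrow> 'a set \<times> ('a \<Rightarrow> 'a) \<Rightarrow> 'a set \<times> ('a \<Rightarrow> 'a)" where
  "D_transition \<Omega> K L = (\<lambda>(\<dd>', \<sigma>').
     let \<dd> = ideal_gcd \<Omega> K \<dd>' (ram_conductor \<Omega> K L)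
     in (\<dd>, restrict \<sigma>' (D_field \<Omega> K L \<dd>)))"

text \<open>
  The inverse limit of the \<open>D\<^bsub>L/K\<^esub>\<close>, inside their product; \<open>D_transition \<Omega> K L\<close> does not depend
  on the source \<open>L'\<close>.
\<close>

definition DG :: "('a, 'm) ring_scheme \<Rightarrow> 'a set \<Rightarrow> ('a set \<Rightarrow> 'a set \<times> ('a \<Rightarrow> 'a)) monoid" where
  "DG \<Omega> K =
     (let I = finite_galois_extensions \<Omega> K; P = product_group I (D_monoid \<Omega> K)
      in P\<lparr>carrier := {x \<in> carrier P.
            \<forall>L\<in>I. \<forall>L'\<in>I. L \<subseteq> L' \<longrightarrow> D_transition \<Omega> K L (x L') = x L}\<rparr>)"

definition DG_topology ::
  "('a, 'm) ring_scheme \<Rightarrow> 'a set \<Rightarrow> ('a set \<Rightarrow> 'a set \<times> ('a \<Rightarrow> 'a)) topology" where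
  "DG_topology \<Omega> K = subtopology
     (product_topology (\<lambda>L. discrete_topology (carrier (D_monoid \<Omega> K L)))
        (finite_galois_extensions \<Omega> K))
     (carrier (DG \<Omega> K))"

definition idem_ideal :: "('a, 'm) ring_scheme \<Rightarrow> 'a set \<Rightarrow> 'a set \<Rightarrow> 'a set set \<Rightarrow> 'a set" where
  "idem_ideal \<Omega> K L T =
     (THE \<ee>. \<ee> \<in> carrier (ideal_monoid \<Omega> K) \<and>
        (\<forall>\<pp>\<in>primes \<Omega> K. ideal_val \<Omega> K \<pp> \<ee> =
            (if \<pp> \<in> T then 0 else ideal_val \<Omega> K \<pp> (ram_conductor \<Omega> K L))))"

definition idem_component ::
  "('a, 'm) ring_scheme \<Rightarrow> 'a set \<Rightarrow> 'a set \<Rightarrow> 'a set set \<Rightarrow> 'a set \<times> ('a \<Rightarrow> 'a)" where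
  "idem_component \<Omega> K L T =
     (idem_ideal \<Omega> K L T, \<one>\<^bsub>Gal \<Omega> (D_field \<Omega> K L (idem_ideal \<Omega> K L T)) K\<^esub>)"

definition idem_family :: "('a, 'm) ring_scheme \<Rightarrow> 'a set \<Rightarrow> 'a set set \<Rightarrow> 'a set \<Rightarrow> 'a set \<times> ('a \<Rightarrow> 'a)" where
  "idem_family \<Omega> K S =
     (\<lambda>L\<in>finite_galois_extensions \<Omega> K. idem_component \<Omega> K L (S \<inter> ramified_primes \<Omega> K L))"


section \<open>\<open>\<H>\<close>-classes and isomorphism of topological groups\<close>

definition green_H :: "('a, 'm) monoid_scheme \<Rightarrow> 'a \<Rightarrow> 'a \<Rightarrow> bool" where
  "green_H D x y \<longleftrightarrow>
     x <#\<^bsub>D\<^esub> carrier D = y <#\<^bsub>D\<^esub> carrier D \<and> carrier D #>\<^bsub>D\<^esub> x = carrier D #>\<^bsub>D\<^esub> y"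

definition H_class :: "('a, 'm) monoid_scheme \<Rightarrow> 'a \<Rightarrow> 'a set" where
  "H_class D x = {y \<in> carrier D. green_H D x y}"

definition H_class_group :: "('a, 'm) monoid_scheme \<Rightarrow> 'a \<Rightarrow> ('a, 'm) monoid_scheme" where
  "H_class_group D e = D\<lparr>carrier := H_class D e, one := e\<rparr>"

text \<open>An isomorphism of profinite groups is a group isomorphism that is a homeomorphism.\<close>

definition topological_group_iso ::
  "('a, 'm) monoid_scheme \<Rightarrow> 'a topology \<Rightarrow> ('b, 'n) monoid_scheme \<Rightarrow> 'b topology \<Rightarrow> bool" where
  "topological_group_iso G T H U \<longleftrightarrow>
     group G \<and> group H \<and> (\<exists>h \<in> iso G H. homeomorphic_map T U h)"

end

theory Submission imports Defs "HOL-Computational_Algebra.Fundamental_Theorem_Algebra"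
begin

text \<open>
An isomorphism \<open>h\<close> of \<open>\<Omega>\<close> with a subfield of the complex numbers reduces Galois theory to embeddings into
\<open>\<complex>\<close>, and approximation by sequences reduces the local Galois groups to decomposition groups.

The full Herbrand theorem is not needed. For \<open>K \<subseteq> L \<subseteq> L'\<close> and \<open>i(s)\<close> the valuation of \<open>s \<pi> - \<pi>\<close>, the inequality
\<open>\<Sum> i'(t) \<ge> e i(s)\<close> over the \<open>t\<close> restricting to \<open>s\<close> already shows that the conductor of \<open>L\<close> divides that of \<open>L'\<close>.

The subfield of \<open>L\<close> attached to \<open>gcd(\<ff>, \<ee>\<^sub>T \<dd>)\<close> is the intersection of those attached to \<open>\<ee>\<^sub>T\<close> and \<open>\<dd>\<close>, so the
\<open>\<H>\<close>-class of \<open>e\<^sub>S\<close> consists of the families whose ideals are those of \<open>e\<^sub>S\<close>. It is thus the inverse limit of the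
Galois groups of the subfields attached to \<open>\<ee>\<^sub>T\<close>. This subfield is the largest one unramified outside \<open>S\<close>, because
its defining subgroup is generated by the inertia groups outside \<open>S\<close>, and these fields exhaust the maximal extension.
\<close>

text \<open>The exponent of the conductor is governed by the last jump: G^n = 1 means n |G_0| >
  |G_1| + ... + |G_j| for the last nontrivial G_j, and counting turns this into (sum of i(s)) + (max
  of i(s)) < (n + 1) |G_0|. In a tower the left side grows at least by the factor e and |G_0| at
  most by e, so triviality of G^n descends to the smaller field. Because its right side is positive,
  the inequality for i also shows that inertia maps onto inertia. The values i(t) are usually read
  off from a generator of the completed ring. Here weak approximation gives an x in the number field
  itself with x - t x of valuation i(t) on inertia and 0 elsewhere, and powers x^(q^n) approximate
  Teichmueller representatives without a limit. Whether the field of a family at \<open>L\<close>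
  lies in its field at \<open>L'\<close> is read off from the family: outside its field a map is
  \<open>undefined\<close>, which an injective restriction forbids. Products with a factor having
  the ideals of e_S stay in the limit because their fields are intersections.\<close>

abbreviation iff_infix (infixr "<->" 25) where "A <-> B == A = (B::bool)"
abbreviation "pdeg == Polynomial.degree"
abbreviation "pcf == Polynomial.coeff"
abbreviation "plc == Polynomial.lead_coeff"

section \<open>Dedekind domains\<close>

text \<open>Same record as \<open>ideal_monoid\<close>, but for an arbitrary ring;
  \<open>ideal_monoid_nzideals\<close> identifies the two, so ideal arithmetic can be developed in
  an abstract Dedekind domain.\<close>

definition nzideals :: "('a, 'm) ring_scheme => 'a set monoid" where
 "nzideals R = \<lparr>carrier = {I. ideal I R & I ~= {\<zero>\<^bsub>R\<^esub>}}, monoid.mult = ideal_prod R, one = carrier R\<rparr>"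

definition ival :: "('a, 'm) ring_scheme => 'a set => 'a set => nat" where
 "ival R P I = (GREATEST n::nat. (P [^]\<^bsub>nzideals R\<^esub> n) divides\<^bsub>nzideals R\<^esub> I)"

definition maxs :: "('a, 'm) ring_scheme => 'a set set" where
 "maxs R = {P. maximalideal P R & P ~= {\<zero>\<^bsub>R\<^esub>}}"

lemma (in cring) ideal_intro:
 assumes "I <= carrier R" "\<zero>:I" "!!x y. x:I ==> y:I ==> x \<oplus> y:I"
  "!!x y. x:I ==> y:carrier R ==> y \<otimes> x:I"
 shows "ideal I R"
proof (rule idealI)
 show "ring R" by (rule ring_axioms)
 show "subgroup I (add_monoid R)"
 proof
  show "I <= carrier (add_monoid R)" using assms by simp
  show "x \<otimes>\<^bsub>add_monoid R\<^esub> y:I" if "x:I" "y:I" for x y using assms that by simp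
  show "\<one>\<^bsub>add_monoid R\<^esub>:I" using assms by simp
  show "inv\<^bsub>add_monoid R\<^esub> x:I" if x: "x:I" for x
  proof -
   have "\<ominus> x = (\<ominus> \<one>) \<otimes> x" using x assms by (auto simp: l_minus)
   thus ?thesis using assms(4)[OF x] by (simp add: a_inv_def)
  qed
 qed
 show "!!a x. a:I ==> x:carrier R ==> x \<otimes> a:I" using assms by simp
 thus "!!a x. a:I ==> x:carrier R ==> a \<otimes> x:I" using assms by (metis m_comm subsetD)
qed

text \<open>Axioms chosen to be checkable for rings of integers. \<open>finite_quotient\<close>
  stands for the Noetherian condition; \<open>integrally_closed\<close> says, without a fraction
  field, that a fraction b/a mapping a nonzero ideal into itself lies in \<open>R\<close>.\<close>

locale dedekind = domain R for R :: "('a, 'm) ring_scheme" (structure) +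
 assumes finite_quotient: "ideal I R ==> I ~= {\<zero>} ==> finite (carrier (R Quot I))"
  and prime_maximal: "primeideal P R ==> P ~= {\<zero>} ==> maximalideal P R"
  and integrally_closed: "[|ideal J R; J ~= {\<zero>}; a:carrier R; b:carrier R; a ~= \<zero>;
   !!x. x:J ==> EX y:J. b \<otimes> x = a \<otimes> y|] ==> EX c:carrier R. b = a \<otimes> c"
begin

abbreviation nz where "nz I == ideal I R & I ~= {\<zero>}"

lemma idealE:
 assumes "ideal I R"
 shows "\<zero>:I" "!!x. x:I ==> x:carrier R" "!!x y. x:I ==> y:I ==> x \<oplus> y:I"
  "!!x y. x:I ==> y:carrier R ==> x \<otimes> y:I" "!!x y. x:I ==> y:carrier R ==> y \<otimes> x:I"
  "!!x. x:I ==> \<ominus> x:I" "!!x y. x:I ==> y:I ==> x \<ominus> y:I"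
proof -
 interpret ideal I R by fact
 show "\<zero>:I" and 1: "!!x. x:I ==> x:carrier R" and 2: "!!x y. x:I ==> y:I ==> x \<oplus> y:I"
  "!!x y. x:I ==> y:carrier R ==> x \<otimes> y:I" "!!x y. x:I ==> y:carrier R ==> y \<otimes> x:I" and 3:
   "!!x. x:I ==> \<ominus> x:I" "!!x y. x:I ==> y:I ==> x \<ominus> y:I" by (auto simp: I_r_closed I_l_closed a_minus_def)
qed

text \<open>An ideal above \<open>I\<close> is a union of cosets of \<open>I\<close>, so it is
  recovered from a subset of the finite quotient.\<close>

lemma finite_above:
 assumes "ideal I R" "I ~= {\<zero>}" shows "finite {J. ideal J R & I <= J}"
proof (rule finite_imageD)
 let ?f = "%J. (%x. I +> x) ` J"
 have "?f ` {J. ideal J R & I <= J} <= Pow (carrier (R Quot I))"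
  using idealE by (auto simp: FactRing_def A_RCOSETS_def')
 thus "finite (?f ` {J. ideal J R & I <= J})"
  using finite_quotient[OF assms] finite_subset by auto
 have sub: "J <= J'" if "ideal J R" "I <= J" "ideal J' R" "I <= J'" and eq: "?f J = ?f J'" for J J'
 proof
  fix x assume x: "x:J"
  then obtain y where y: "y:J'" "I +> x = I +> y" using eq by blast
  have c: "x:carrier R" "y:carrier R" using idealE(2)[OF that(1) x] idealE(2)[OF that(3) y(1)] .
  thus "x:J'" using idealE(3)[OF that(3)] y quotient_eq_iff_same_a_r_cos[OF assms(1) c] that(4)
   by (fastforce simp: a_minus_def a_assoc l_neg)
 qed
 show "inj_on ?f {J. ideal J R & I <= J}"
 proof (rule inj_onI)
  fix J J' assume "J:{J. ideal J R & I <= J}" "J':{J. ideal J R & I <= J}" "?f J = ?f J'"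
  thus "J = J'" using sub[of J J'] sub[of J' J] by auto
 qed
qed

lemma prod_subset: assumes "ideal I R" "ideal J R" shows "I \<cdot> J <= I" "I \<cdot> J <= J"
 using ideal_prod_inter[OF assms] by auto

lemma prod_least:
 assumes "ideal C R" "!!x y. x:I ==> y:J ==> x \<otimes> y:C"
 shows "I \<cdot> J <= C"
proof
 fix s assume "s:I \<cdot> J" thus "s:C"
  by (induct s rule: ideal_prod.induct) (auto simp: assms idealE(3)[OF assms(1)])
qed

lemma prod_mono: "I <= I' ==> J <= J' ==> I \<cdot> J <= I' \<cdot> J'"
proof
 fix s assume s: "I <= I'" "J <= J'" "s:I \<cdot> J"
 show "s:I' \<cdot> J'" using s(3) by (induct s rule: ideal_prod.induct) (use s in \<open>auto intro: ideal_prod.intros\<close>)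
qed

lemma nz_ex: "nz I ==> EX x:I. x ~= \<zero>" using idealE by auto

lemma nz_prod: assumes "nz I" "nz J" shows "nz (I \<cdot> J)"
proof -
 obtain x y where xy: "x:I" "y:J" "x ~= \<zero>" "y ~= \<zero>" using assms nz_ex by meson
 hence "x \<otimes> y:I \<cdot> J" "x \<otimes> y ~= \<zero>"
  using assms idealE(2) by (auto intro: ideal_prod.prod simp: integral_iff)
 thus ?thesis using assms ideal_prod_is_ideal by auto
qed

lemma nz_carrier: "nz (carrier R)"
 using oneideal one_not_zero by blast

lemma nz_super: "nz I ==> ideal J R ==> I <= J ==> nz J"
 using nz_ex by auto

lemma prod_carrier: "ideal I R ==> carrier R \<cdot> I = I"
 using ideal_prod_one ideal_prod_commute oneideal by simp

lemma PIdl_iff: "x:PIdl a <-> (EX r:carrier R. x = r \<otimes> a)"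
 by (auto simp: cgenideal_def)

lemma PIdl_nz: "a:carrier R ==> a ~= \<zero> ==> nz (PIdl a)"
 using cgenideal_ideal cgenideal_self by auto

lemma maxD:
 assumes "P:maxs R"
 shows "nz P" "maximalideal P R" "primeideal P R" "P ~= carrier R" "\<one> ~: P"
  "!!J. ideal J R ==> P <= J ==> J ~= carrier R ==> J = P"
proof -
 have m: "maximalideal P R" "P ~= {\<zero>}" using assms by (auto simp: maxs_def)
 interpret maximalideal P R by fact
 show 1: "nz P" "maximalideal P R" "primeideal P R" and 2: "P ~= carrier R" using m is_ideal maximalideal_prime I_notcarr by auto
 show "\<one> ~: P" "!!J. ideal J R ==> P <= J ==> J ~= carrier R ==> J = P" using one_imp_carrier 2 I_maximal idealE(2) by auto
qed

lemma primeD: "primeideal P R ==> a:carrier R ==> b:carrier R ==> a \<otimes> b:P ==> a:P \<or> b:P"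
 by (rule primeideal.I_prime)

lemma ex_max:
 assumes "nz I" "I ~= carrier R"
 shows "EX P:maxs R. I <= P"
proof -
 let ?A = "{J. ideal J R & I <= J & J ~= carrier R}"
 have "?A <= {J. ideal J R & I <= J}" by auto
 hence "finite ?A" using finite_above assms finite_subset by blast
 moreover have "?A ~= {}" using assms by auto
 ultimately have "EX P:?A. ALL J:?A. P <= J --> P = J" by (rule finite_has_maximal)
 then obtain P where "P:?A" and PJ: "ALL J:?A. P <= J --> P = J" by auto
 hence P: "ideal P R" "I <= P" "P ~= carrier R" by auto
 have "J = P \<or> J = carrier R" if "ideal J R" "P <= J" for J
  using PJ that P by auto
 hence "maximalideal P R" using P by (intro maximalidealI) auto
 thus ?thesis using P nz_super[OF assms(1) P(1,2)] by (auto simp: maxs_def)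
qed

text \<open>Noetherian induction, with the finite number of ideals above \<open>I\<close> as
  measure.\<close>

lemma nz_induct [consumes 1, case_names step]:
 assumes "nz I" and step: "!!I. nz I ==> (!!J. nz J ==> I \<subset> J ==> Q J) ==> Q I"
 shows "Q I"
 using assms(1)
proof (induction "card {J. ideal J R & I <= J}" arbitrary: I rule: less_induct)
 case less
 show ?case
 proof (rule step[OF less(2)])
  fix J assume J: "nz J" "I \<subset> J"
  have "{K. ideal K R & J <= K} \<subset> {K. ideal K R & I <= K}" using less(2) J by auto
  thus "Q J" using less J less finite_above by (meson psubset_card_mono)
 qed
qed

definition prodl :: "'a set list => 'a set" where "prodl Ps = foldr (%P I. P \<cdot> I) Ps (carrier R)"

lemma prodl_simps [simp]: "prodl [] = carrier R" "prodl (P # Ps) = P \<cdot> prodl Ps"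
 by (auto simp: prodl_def)

lemma prodl_nz: "set Ps <= maxs R ==> nz (prodl Ps)"
proof (induction Ps)
 case Nil thus ?case using nz_carrier by simp
next
 case (Cons P Ps) thus ?case using nz_prod[OF maxD(1)] by simp
qed

lemma prodl_append:
 "set Ps <= maxs R ==> set Qs <= maxs R ==> prodl (Ps @ Qs) = prodl Ps \<cdot> prodl Qs"
proof (induction Ps)
 case Nil thus ?case using prodl_nz prod_carrier by simp
next
 case (Cons P Ps) thus ?case
  using prodl_nz prodl_nz maxD by (simp add: ideal_prod_assoc)
qed

text \<open>If a product a b lies in \<open>I\<close> but neither factor does, then (I + aR)(I + bR)
  is contained in \<open>I\<close>, and both of these ideals are strictly larger than
  \<open>I\<close>.\<close>

lemma contains_prodl: "nz I ==> EX Ps. set Ps <= maxs R & prodl Ps <= I"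
proof (induction I rule: nz_induct)
 case 2: (step I)
 consider "I = carrier R" | "primeideal I R" | "I ~= carrier R" "~ primeideal I R" by auto
 thus ?case
 proof cases
  case 1 thus ?thesis by (intro exI[of _ "[]"]) simp
 next
  case p: 2
  hence "I:maxs R" using 2 prime_maximal by (auto simp: maxs_def)
  thus ?thesis using 2 by (intro exI[of _ "[I]"]) (simp add: ideal_prod_one)
 next
  case 3
  then obtain a b where ab: "a:carrier R" "b:carrier R" "a \<otimes> b:I" "a ~: I" "b ~: I"
   using 2 is_cring by (metis ideal.primeidealCD)
  define A where "A c = I <+>\<^bsub>R\<^esub> PIdl c" for c
  have A: "ideal (A c) R" "I <= A c" "c:A c" if "c:carrier R" for c
  proof -
   show "ideal (A c) R" using add_ideals 2 that cgenideal_ideal by (simp add: A_def)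
   have "x \<oplus> \<zero>:A c" if "x:I" for x
    using that idealE[OF cgenideal_ideal[OF \<open>c:carrier R\<close>]] by (auto simp: A_def set_add_def')
   thus "I <= A c" using 2 idealE(2) by auto
   show "c:A c" using that idealE(1) 2(1) cgenideal_self[OF that] by (fastforce simp: A_def set_add_def')
  qed
  have Am: "EX i r. i:I & r:carrier R & x = i \<oplus> r \<otimes> c" if "x:A c" for x c
   using that by (auto simp: A_def set_add_def' cgenideal_def)
  have "nz (A a)" "nz (A b)" using nz_super[OF 2(1) A(1,2)] ab by auto
  moreover have "I \<subset> A a" "I \<subset> A b" using A A ab by auto
  ultimately obtain Ps Qs where PQ: "set Ps <= maxs R" "prodl Ps <= A a"
   "set Qs <= maxs R" "prodl Qs <= A b" using 2(2)[of "A a"] 2(2)[of "A b"] by auto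
  have "A a \<cdot> A b <= I"
  proof (rule prod_least)
   show "ideal I R" using 2 by simp
   fix x y assume "x:A a" "y:A b"
   then obtain i r j s where *: "i:I" "r:carrier R" "x = i \<oplus> r \<otimes> a"
    "j:I" "s:carrier R" "y = j \<oplus> s \<otimes> b" using Am by metis
   have c: "i:carrier R" "j:carrier R" using * idealE[OF conjunct1[OF 2(1)]] by auto
   have "x \<otimes> y = i \<otimes> y \<oplus> (j \<otimes> (r \<otimes> a) \<oplus> (a \<otimes> b) \<otimes> (r \<otimes> s))"
    using * c ab by algebra
   thus "x \<otimes> y:I" using * c ab 2 by (simp add: idealE)
  qed
  thus ?thesis using PQ prod_mono[OF PQ(2) PQ(4)] prodl_append[OF PQ(1,3)] by (intro exI[of _ "Ps @ Qs"]) simp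
 qed
qed

lemma prime_contains:
 assumes P: "primeideal P R" and "ideal I R" "ideal J R" "I \<cdot> J <= P"
 shows "I <= P \<or> J <= P"
proof (rule ccontr)
 assume "~ ?thesis"
 then obtain x y where xy: "x:I" "x ~: P" "y:J" "y ~: P" by auto
 thus False using primeD[OF P] idealE(2)[OF assms(2)] idealE[OF assms(3)] subsetD[OF assms(4) ideal_prod.prod[of x I y J R]]
  by auto
qed

lemma prime_contains_prodl:
 "primeideal P R ==> set Ps <= maxs R ==> prodl Ps <= P ==> P ~= carrier R ==> P:set Ps"
proof (induction Ps)
 case Nil thus ?case using idealE primeideal.axioms by (metis prodl_simps subsetI subset_antisym)
next
 case (Cons Q Ps)
 have n: "nz (prodl Ps)" "Q:maxs R" using Cons prodl_nz by auto
 hence "Q <= P \<or> prodl Ps <= P" using prime_contains[OF Cons(2)] Cons maxD by auto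
 moreover have "P = Q" if "Q <= P" using maxD(6)[OF n(2)] that Cons primeideal.axioms by blast
 ultimately show ?case using Cons by auto
qed

lemma prodl_remove:
 "set Ps <= maxs R ==> P:set Ps ==> prodl Ps = P \<cdot> prodl (remove1 P Ps)"
proof (induction Ps)
 case (Cons Q Ps)
 have Q: "ideal Q R" "ideal P R" and r: "ideal (prodl (remove1 P Ps)) R" using Cons(2,3) maxD(1) prodl_nz[of "remove1 P Ps"]
  by fastforce+
 show ?case
 proof (cases "Q = P")
  case False
  hence "prodl (Q # Ps) = Q \<cdot> (P \<cdot> prodl (remove1 P Ps))" using Cons by auto
  also have "\<dots> = P \<cdot> (Q \<cdot> prodl (remove1 P Ps))"
   using Q r by (metis ideal_prod_assoc ideal_prod_commute)
  finally show ?thesis by simp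
 qed simp
qed simp

text \<open>The ideal \<open>C\<close> is a P^(-1), written inside \<open>R\<close>. The element
  \<open>b\<close> represents a fraction b/a in P^(-1) that is not in \<open>R\<close>; the
  strictness in \<open>max_divides\<close> and the lying-over theorem rest on it.\<close>

lemma max_invertible:
 assumes P: "P:maxs R" and a: "a:P" "a ~= \<zero>"
 shows "EX C. nz C & P \<cdot> C = PIdl a & (EX b:C. b ~: PIdl a)"
proof -
 note Pi = maxD[OF P]
 have ac: "a:carrier R" using idealE(2)[OF conjunct1[OF Pi(1)] a(1)] .
 have nza: "nz (PIdl a)" using PIdl_nz ac a by simp
 \<comment> \<open>A shortest product of maximal ideals inside (a): removing its factor
   \<open>P\<close> leaves a product that is not contained in (a), and this supplies
   \<open>b\<close>.\<close>
 obtain Ps where Ps: "set Ps <= maxs R" "prodl Ps <= PIdl a"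
  and min: "!!Qs. length Qs < length Ps ==> ~ (set Qs <= maxs R & prodl Qs <= PIdl a)"
  using ex_has_least_nat[of "%Ps. set Ps <= maxs R & prodl Ps <= PIdl a" _ length] contains_prodl nza by (meson not_less)
 have PP: "P:set Ps" using prime_contains_prodl[OF Pi(3) Ps(1)] Ps Pi cgenideal_minimal[OF conjunct1[OF Pi(1)] a(1)] by simp
 define Qs where "Qs = remove1 P Ps"
 have Qs: "set Qs <= maxs R" "length Qs < length Ps" and pQ: "prodl Ps = P \<cdot> prodl Qs"
  using Ps set_remove1_subset[of P Ps] PP length_pos_if_in_set[OF PP] prodl_remove by (auto simp: Qs_def length_remove1)
 obtain b where b: "b:prodl Qs" "b ~: PIdl a" using min Qs by auto
 have bc: "b:carrier R" using idealE(2)[OF conjunct1[OF prodl_nz[OF Qs(1)]] b(1)] .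
 define C where "C = {c:carrier R. ALL x:P. x \<otimes> c:PIdl a}"
 have Ca: "PIdl a <= C" using nza idealE Pi by (auto simp: C_def)
 have C: "ideal C R"
 proof (rule ideal_intro)
  show "x \<oplus> y:C" if "x:C" "y:C" for x y
   using that nza Pi(1) idealE by (auto simp: C_def r_distr)
  show "y \<otimes> x:C" if "x:C" "y:carrier R" for x y
  proof -
   have "z \<otimes> (y \<otimes> x):PIdl a" if z: "z:P" for z
   proof -
    show ?thesis using z \<open>x:C\<close> \<open>y:carrier R\<close> nza idealE idealE(2)[OF conjunct1[OF Pi(1)] z]
     by (simp add: C_def m_lcomm)
   qed
   thus ?thesis using that by (simp add: C_def)
  qed
  show "\<zero>:C" using Ca nza idealE by auto
 qed (auto simp: C_def)
 have nzC: "nz C" using nz_super[OF nza C Ca] .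
 have PC: "P \<cdot> C <= PIdl a" using nza by (intro prod_least) (auto simp: C_def)
 have bC: "b:C" using subsetD[OF Ps(2)] ideal_prod.prod[OF _ b(1)] bc by (auto simp: C_def pQ)
 \<comment> \<open>\<open>B\<close> is P P^(-1). It contains \<open>P\<close>, so maximality leaves
   only \<open>P\<close> and \<open>R\<close>; if it were \<open>P\<close>, the fraction b/a would
   map \<open>P\<close> into itself and hence lie in \<open>R\<close>.\<close>
 define B where "B = {y:carrier R. a \<otimes> y:P \<cdot> C}"
 have PCi: "ideal (P \<cdot> C) R" using nz_prod Pi nzC by simp
 have B: "ideal B R"
 proof (rule ideal_intro)
  show "x \<oplus> y:B" if "x:B" "y:B" for x y
   using that ac PCi idealE by (auto simp: B_def r_distr)
  show "y \<otimes> x:B" if "x:B" "y:carrier R" for x y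
   using that ac PCi idealE(5)[of "P \<cdot> C" "a \<otimes> x" y] by (auto simp: B_def m_lcomm)
 qed (use ac PCi idealE(1) in \<open>auto simp: B_def\<close>)
 have PB: "P <= B"
 proof
  fix x assume x: "x:P"
  have "x \<otimes> a:P \<cdot> C" using Ca cgenideal_self[OF ac] ideal_prod.prod[OF x] by auto
  moreover have "x:carrier R" using idealE(2)[OF conjunct1[OF Pi(1)] x] .
  ultimately show "x:B" using ac by (simp add: B_def m_comm)
 qed
 have "B ~= P"
 proof
  assume BP: "B = P"
  have "EX c:carrier R. b = a \<otimes> c"
  proof (rule integrally_closed[of P])
   fix x assume x: "x:P"
   have xb: "x \<otimes> b:P \<cdot> C" using x bC by (rule ideal_prod.prod)
   hence "x \<otimes> b:PIdl a" using PC by auto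
   then obtain y where y: "y:carrier R" "x \<otimes> b = y \<otimes> a" unfolding PIdl_iff by auto
   hence "y:B" using xb ac by (simp add: B_def m_comm)
   moreover have "b \<otimes> x = a \<otimes> y" using y ac bc idealE(2)[OF conjunct1[OF Pi(1)] x] by (simp add: m_comm)
   ultimately show "EX y:P. b \<otimes> x = a \<otimes> y" using BP by auto
  qed (use Pi(1) ac bc a in auto)
  thus False using b ac m_comm unfolding PIdl_iff by simp
 qed
 hence "\<one>:B" using Pi(6)[OF B PB] by auto
 thus ?thesis using PC nzC bC b cgenideal_minimal[OF PCi] ac by (fastforce simp: B_def)
qed

lemma PIdl_prod:
 assumes "a:carrier R" "ideal I R"
 shows "x:(PIdl a) \<cdot> I <-> (EX y:I. x = a \<otimes> y)"
proof
 assume "x:(PIdl a) \<cdot> I"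
 thus "EX y:I. x = a \<otimes> y"
 proof (induct x rule: ideal_prod.induct)
  case (prod i j)
  then obtain r where r: "r:carrier R" "i = r \<otimes> a" unfolding PIdl_iff by auto
  show ?case using idealE(5)[OF assms(2) prod(2) r(1)] r assms idealE(2)[OF assms(2) prod(2)] by (auto simp: m_ac)
 next
  case (sum s1 s2)
  then obtain y z where "y:I" "s1 = a \<otimes> y" "z:I" "s2 = a \<otimes> z" by auto
  thus ?case using idealE[OF assms(2)] assms by (intro bexI[of _ "y \<oplus> z"]) (auto simp: r_distr)
 qed
next
 assume "EX y:I. x = a \<otimes> y"
 thus "x:(PIdl a) \<cdot> I" using ideal_prod.prod[OF cgenideal_self[OF assms(1)]] by auto
qed

lemma PIdl_cancel:
 assumes "a:carrier R" "a ~= \<zero>" "ideal I R" "ideal J R" "(PIdl a) \<cdot> I <= (PIdl a) \<cdot> J"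
 shows "I <= J"
proof
 fix x assume x: "x:I"
 then obtain y where y: "y:J" "a \<otimes> x = a \<otimes> y" using assms PIdl_prod by blast
 thus "x:J" using assms idealE(2)[OF assms(3) x] idealE(2)[OF assms(4) y(1)] m_lcancel by simp
qed

text \<open>The cofactor is P^(-1) J, realised as (D J)/a with D = a P^(-1). If it were equal to
  \<open>J\<close>, the fraction b/a would map \<open>J\<close> into itself and lie in
  \<open>R\<close>. The strict growth drives the induction in \<open>factorization\<close>.\<close>

lemma max_divides:
 assumes P: "P:maxs R" and J: "nz J" "J <= P"
 shows "EX C. nz C & J = P \<cdot> C & J \<subset> C"
proof -
 note Pi = maxD[OF P]
 obtain a where a: "a:P" "a ~= \<zero>" using nz_ex[OF Pi(1)] by auto
 have ac: "a:carrier R" using idealE(2)[OF conjunct1[OF Pi(1)] a(1)] .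
 obtain D b where D: "nz D" "P \<cdot> D = PIdl a" "b:D" "b ~: PIdl a"
  using max_invertible[OF P a] by auto
 define C where "C = {y:carrier R. a \<otimes> y:D \<cdot> J}"
 have DJ: "nz (D \<cdot> J)" using nz_prod D J by simp
 have C: "ideal C R"
 proof (rule ideal_intro)
  show "x \<oplus> y:C" if "x:C" "y:C" for x y
   using that ac idealE[OF conjunct1[OF DJ]] by (auto simp: C_def r_distr)
  show "y \<otimes> x:C" if "x:C" "y:carrier R" for x y
   using that ac idealE(5)[OF conjunct1[OF DJ], of "a \<otimes> x" y] by (auto simp: C_def m_lcomm)
 qed (use ac idealE(1)[OF conjunct1[OF DJ]] in \<open>auto simp: C_def\<close>)
 have "D \<cdot> J <= D \<cdot> P" using J by (intro prod_mono) auto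
 hence sub: "D \<cdot> J <= PIdl a" using D Pi ideal_prod_commute by simp
 have aC: "(PIdl a) \<cdot> C = D \<cdot> J"
 proof (rule Set.set_eqI)
  fix x
  have "EX y:carrier R. x = a \<otimes> y" if "x:D \<cdot> J"
   using subsetD[OF sub that] m_comm[OF _ ac] unfolding PIdl_iff by auto
  thus "x:(PIdl a) \<cdot> C <-> x:D \<cdot> J" unfolding PIdl_prod[OF ac C] by (auto simp: C_def)
 qed
 have JC: "J = P \<cdot> C"
 proof -
  have PC: "ideal (P \<cdot> C) R" using ideal_prod_is_ideal C Pi by simp
  have "(PIdl a) \<cdot> (P \<cdot> C) = P \<cdot> ((PIdl a) \<cdot> C)"
   using Pi C cgenideal_ideal ac by (metis ideal_prod_assoc ideal_prod_commute)
  also have "\<dots> = (PIdl a) \<cdot> J" using aC D J Pi by (metis ideal_prod_assoc)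
  finally show ?thesis using PIdl_cancel[OF ac a(2) PC, of J] PIdl_cancel[OF ac a(2) _ PC, of J] J by simp
 qed
 have sJC: "J <= C" using JC prod_subset[OF conjunct1[OF Pi(1)] C] by simp
 have "J ~= C"
 proof
  assume "J = C"
  hence eq: "(PIdl a) \<cdot> J = D \<cdot> J" using aC by simp
  have "EX c:carrier R. b = a \<otimes> c"
  proof (rule integrally_closed[of J])
   show "b:carrier R" using idealE(2)[OF conjunct1[OF D(1)] D(3)] .
   show "EX y:J. b \<otimes> x = a \<otimes> y" if "x:J" for x
    using ideal_prod.prod[OF D(3) that, of R] PIdl_prod[OF ac, of J "b \<otimes> x"] J eq by simp
  qed (use J ac a in auto)
  thus False using D m_comm[OF ac] unfolding PIdl_iff by auto
 qed
 thus ?thesis using JC sJC nz_super[OF J(1) C sJC] by auto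
qed

lemma max_cancel:
 assumes P: "P:maxs R" and "ideal I R" "ideal J R" "P \<cdot> I <= P \<cdot> J"
 shows "I <= J"
proof -
 note Pi = maxD[OF P]
 obtain a where a: "a:P" "a ~= \<zero>" using nz_ex[OF Pi(1)] by auto
 have ac: "a:carrier R" using idealE(2)[OF conjunct1[OF Pi(1)] a(1)] .
 obtain D where D: "nz D" "P \<cdot> D = PIdl a" using max_invertible[OF P a] by auto
 have e: "D \<cdot> (P \<cdot> Z) = (PIdl a) \<cdot> Z" if "ideal Z R" for Z
  using D Pi that by (metis ideal_prod_assoc ideal_prod_commute)
 have "D \<cdot> (P \<cdot> I) <= D \<cdot> (P \<cdot> J)" by (rule prod_mono[OF subset_refl assms(4)])
 thus ?thesis using PIdl_cancel[OF ac a(2) assms(2,3)] unfolding e[OF assms(2)] e[OF assms(3)] by simp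
qed

lemma factorization: "nz I ==> EX Ps. set Ps <= maxs R & I = prodl Ps"
proof (induction I rule: nz_induct)
 case (step I)
 show ?case
 proof (cases "I = carrier R")
  case True thus ?thesis by (intro exI[of _ "[]"]) simp
 next
  case False
  then obtain P where P: "P:maxs R" "I <= P" using ex_max step(1) by auto
  then obtain C where C: "nz C" "I = P \<cdot> C" "I \<subset> C" using max_divides[OF _ step(1)] by metis
  then obtain Ps where "set Ps <= maxs R" "C = prodl Ps" using step by auto
  thus ?thesis using P C by (intro exI[of _ "P # Ps"]) simp
 qed
qed

lemma prodl_cancel:
 "set Ps <= maxs R ==> ideal I R ==> ideal J R ==> prodl Ps \<cdot> I <= prodl Ps \<cdot> J ==> I <= J"
proof (induction Ps)
 case Nil thus ?case using prod_carrier by simp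
next
 case (Cons P Ps)
 have P: "P:maxs R" "ideal P R" "ideal (prodl Ps) R" using Cons prodl_nz maxD by auto
 thus ?case using Cons max_cancel[OF P(1) ideal_prod_is_ideal[OF P(3) Cons(3)] ideal_prod_is_ideal[OF P(3) Cons(4)]]
  by (auto simp: ideal_prod_assoc)
qed

lemma ideal_cancel:
 assumes "nz A" "ideal I R" "ideal J R" shows "A \<cdot> I <= A \<cdot> J <-> I <= J"
proof -
 obtain Ps where "set Ps <= maxs R" "A = prodl Ps" using factorization assms by auto
 thus ?thesis using prodl_cancel[OF _ assms(2,3)] prod_mono[of A A I J] by auto
qed

lemma ideal_cancel_eq:
 assumes "nz A" "ideal I R" "ideal J R" shows "A \<cdot> I = A \<cdot> J <-> I = J"
 using ideal_cancel[OF assms] ideal_cancel[OF assms(1,3,2)] by auto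

lemma contains_divides:
 assumes "nz I" "nz J" shows "J <= I <-> (EX C. nz C & J = I \<cdot> C)"
proof
 show "EX C. nz C & J = I \<cdot> C ==> J <= I" using prod_subset assms by auto
 have "set Ps <= maxs R ==> nz J ==> J <= prodl Ps ==> EX C. nz C & J = prodl Ps \<cdot> C" for Ps J
 proof (induction Ps arbitrary: J)
  case Nil thus ?case using prod_carrier by auto
 next
  case (Cons P Ps)
  have P: "P:maxs R" "ideal P R" "ideal (prodl Ps) R" using Cons prodl_nz maxD(1) by auto
  obtain J' where J': "nz J'" "J = P \<cdot> J'" using max_divides[OF P(1) Cons(3)] Cons(4) prod_subset[OF P(2,3)] by auto
  then obtain C where "nz C" "J' = prodl Ps \<cdot> C" using Cons.IH[OF _ J'(1)] Cons(2) max_cancel[OF P(1)] P Cons(4) by auto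
  thus ?case using J' P by (intro exI[of _ C]) (simp add: ideal_prod_assoc)
 qed
 thus "J <= I ==> EX C. nz C & J = I \<cdot> C" using factorization[OF assms(1)] assms by auto
qed

lemma nzideals_simps [simp]:
 "carrier (nzideals R) = {I. nz I}" "I \<otimes>\<^bsub>nzideals R\<^esub> J = I \<cdot> J"
  "\<one>\<^bsub>nzideals R\<^esub> = carrier R"
 by (simp_all add: nzideals_def)

lemma nzideals_divides: "nz I ==> nz J ==> I divides\<^bsub>nzideals R\<^esub> J <-> J <= I"
 using contains_divides by (simp add: factor_def)

sublocale nzi: comm_monoid_cancel "nzideals R"
proof (rule comm_monoid_cancelI)
 show "comm_monoid (nzideals R)"
 proof (rule comm_monoidI)
  show "x \<otimes>\<^bsub>nzideals R\<^esub> y:carrier (nzideals R)" if "x:carrier (nzideals R)" "y:carrier (nzideals R)" for x y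
   using that nz_prod[of x y] by simp
  show "x \<otimes>\<^bsub>nzideals R\<^esub> y = y \<otimes>\<^bsub>nzideals R\<^esub> x" if "x:carrier (nzideals R)"
   "y:carrier (nzideals R)" for x y
   using that ideal_prod_commute[of x y] by simp
  show "x \<otimes>\<^bsub>nzideals R\<^esub> y \<otimes>\<^bsub>nzideals R\<^esub> z = x \<otimes>\<^bsub>nzideals R\<^esub> (y \<otimes>\<^bsub>nzideals R\<^esub> z)"
   if "x:carrier (nzideals R)" "y:carrier (nzideals R)" "z:carrier (nzideals R)" for x y z
   using that ideal_prod_assoc[of x y z] by simp
  show "\<one>\<^bsub>nzideals R\<^esub> \<otimes>\<^bsub>nzideals R\<^esub> x = x" if "x:carrier (nzideals R)" for x
   using that prod_carrier[of x] by simp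
  show "\<one>\<^bsub>nzideals R\<^esub>:carrier (nzideals R)" using nz_carrier by simp
 qed
 show "x = y" if "x \<otimes>\<^bsub>nzideals R\<^esub> z = y \<otimes>\<^bsub>nzideals R\<^esub> z"
   "x:carrier (nzideals R)" "y:carrier (nzideals R)" "z:carrier (nzideals R)" for x y z
  using that ideal_cancel_eq[of z x y] ideal_prod_commute[of x z] ideal_prod_commute[of y z] by auto
qed

section \<open>Exponents of a maximal ideal in an ideal\<close>

abbreviation ppow :: "'a set => nat => 'a set" where "ppow P n == P [^]\<^bsub>nzideals R\<^esub> n"

lemma ppow_nz: "nz P ==> nz (ppow P n)"
 using nzi.nat_pow_closed by simp

lemma ppow_anti: assumes "nz P" "m <= n" shows "ppow P n <= ppow P m"
proof -
 have "ppow P (m + k) <= ppow P m" for k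
  using prod_subset[of "ppow P m" "ppow P k"] ppow_nz[OF assms(1)] nzi.nat_pow_mult assms by simp
 thus ?thesis using assms le_Suc_ex by blast
qed

lemma ppow_inj: assumes "P:maxs R" "ppow P m = ppow P n" shows "m = n"
proof -
 note Pi = maxD[OF assms(1)]
 have "~ m < n" if "ppow P m = ppow P n" for m n
 proof
  assume "m < n"
  thus False using ideal_cancel_eq[OF ppow_nz[OF Pi(1)] oneideal, of P m] Pi that ppow_nz[OF Pi(1)] ppow_anti[OF Pi(1), of
   "Suc m" n] ppow_anti[OF Pi(1), of m "Suc m"] by (simp add: ideal_prod_one)
 qed
 from this[OF assms(2)] this[OF assms(2)[symmetric]] show ?thesis by simp
qed

text \<open>Finitely many ideals lie above \<open>I\<close> and the powers of \<open>P\<close> are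
  distinct. Hence the \<open>GREATEST\<close> in \<open>ival\<close> is attained, which
  \<open>ival_iff\<close> turns into a usable rule.\<close>

lemma ival_bound: assumes "P:maxs R" "nz I" shows "finite {n. I <= ppow P n}"
proof -
 have "ppow P ` {n. I <= ppow P n} <= {J. ideal J R & I <= J}"
  using ppow_nz[OF maxD(1)[OF assms(1)]] by auto
 hence "finite (ppow P ` {n. I <= ppow P n})" using finite_above assms finite_subset by blast
 moreover have "inj_on (ppow P) {n. I <= ppow P n}" using ppow_inj[OF assms(1)] by (intro inj_onI)
 ultimately show ?thesis by (rule finite_imageD)
qed

lemma ival_iff: assumes "P:maxs R" "nz I" shows "n <= ival R P I <-> I <= ppow P n"
proof -
 let ?A = "{n. I <= ppow P n}"
 have eq: "(ppow P n divides\<^bsub>nzideals R\<^esub> I) = (n:?A)" for n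
  using nzideals_divides[OF ppow_nz[OF maxD(1)[OF assms(1)]] assms(2)] by simp
 have 0: "0:?A" and bd: "!!y. y:?A ==> y <= Max ?A" and G: "ival R P I = (GREATEST n. n:?A)"
  using assms idealE ival_bound[OF assms] unfolding ival_def eq by auto
 have "n <= ival R P I" if "n:?A" for n unfolding G using Greatest_le_nat[of "%n. n:?A" n "Max ?A"] that bd by simp
 moreover have "n:?A" if "n <= ival R P I" for n
  using ppow_anti[OF maxD(1)[OF assms(1)] that] GreatestI_nat[of "%n. n:?A" 0 "Max ?A"] 0 bd unfolding G by auto
 ultimately show ?thesis by auto
qed

lemma ival_decomp: assumes "P:maxs R" "nz I"
 shows "EX J. nz J & I = ppow P (ival R P I) \<cdot> J & ~ J <= P"
proof -
 obtain J where J: "nz J" "I = ppow P (ival R P I) \<cdot> J"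
  using contains_divides[OF ppow_nz[OF maxD(1)[OF assms(1)]] assms(2)] ival_iff[OF assms, of "ival R P I"] by auto
 have "~ J <= P"
 proof
  assume "J <= P"
  hence "ppow P (ival R P I) \<cdot> J <= ppow P (ival R P I) \<cdot> P" by (rule prod_mono[OF subset_refl])
  hence "Suc (ival R P I) <= ival R P I" unfolding ival_iff[OF assms] using J by simp
  thus False by simp
 qed
 thus ?thesis using J by auto
qed

lemma ival_unique:
 assumes "P:maxs R" "nz J" "~ J <= P"
 shows "ival R P (ppow P n \<cdot> J) = n"
proof -
 note Pi = maxD[OF assms(1)] note nzp = ppow_nz[OF Pi(1)]
 have nz: "nz (ppow P n \<cdot> J)" using nz_prod[OF nzp assms(2)] .
 have "n <= ival R P (ppow P n \<cdot> J)" unfolding ival_iff[OF assms(1) nz]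
  using prod_subset(1)[OF conjunct1[OF nzp] conjunct1[OF assms(2)]] .
 moreover have "~ Suc n <= ival R P (ppow P n \<cdot> J)"
  unfolding ival_iff[OF assms(1) nz] using ideal_cancel[OF nzp] assms Pi by simp
 ultimately show ?thesis by simp
qed

lemma ival_prod:
 assumes "P:maxs R" "nz I" "nz J"
 shows "ival R P (I \<cdot> J) = ival R P I + ival R P J"
proof -
 note Pi = maxD[OF assms(1)] note nzp = ppow_nz[OF Pi(1)]
 obtain I' where I': "nz I'" "I = ppow P (ival R P I) \<cdot> I'" "~ I' <= P" using ival_decomp assms by metis
 obtain J' where J': "nz J'" "J = ppow P (ival R P J) \<cdot> J'" "~ J' <= P" using ival_decomp assms by metis
 have n: "~ I' \<cdot> J' <= P" and nz': "nz (I' \<cdot> J')"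
  using prime_contains[OF Pi(3) conjunct1[OF I'(1)] conjunct1[OF J'(1)]] I' J' nz_prod[OF I'(1) J'(1)] by auto
 let ?a = "ppow P (ival R P I)" let ?b = "ppow P (ival R P J)"
 have "(?a \<cdot> I') \<cdot> (?b \<cdot> J') = (?a \<cdot> ?b) \<cdot> (I' \<cdot> J')"
  using nzi.m_ac nzi.m_lcomm nzi.m_assoc[of ?a I' "?b \<cdot> J'"] nzp I' J' nz' nz_prod[of ?b J'] by simp
 also have "?a \<cdot> ?b = ppow P (ival R P I + ival R P J)"
  using nzi.nat_pow_mult Pi by simp
 finally show ?thesis using ival_unique[OF assms(1) nz' n] I' J' by simp
qed

lemma ival_pos: "P:maxs R ==> nz I ==> 0 < ival R P I <-> I <= P"
 using ival_iff[of P I 1] maxD prod_carrier by (simp add: Suc_le_eq)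

lemma ival_self: "P:maxs R ==> ival R P P = 1"
 using ival_unique[of P "carrier R" 1] maxD[of P] nz_carrier prod_carrier ideal_prod_one maxD[of P] using idealE by auto

lemma ival_other: "P:maxs R ==> Q:maxs R ==> P ~= Q ==> ival R P Q = 0"
 using ival_pos maxD maxD(6)[of Q P] maxD by auto

lemma ival_carrier: "P:maxs R ==> ival R P (carrier R) = 0"
 using ival_pos nz_carrier maxD[of P] maxD[of P] idealE by auto

lemma ival_subset:
 assumes "nz I" "nz J" shows "I <= J <-> (ALL P:maxs R. ival R P J <= ival R P I)"
proof
 assume "I <= J"
 then obtain C where "nz C" "I = J \<cdot> C" using contains_divides assms by auto
 thus "ALL P:maxs R. ival R P J <= ival R P I" using ival_prod assms by simp
next
 have "set Ps <= maxs R ==> nz I ==> (ALL P:maxs R. ival R P (prodl Ps) <= ival R P I) ==> I <= prodl Ps" for Ps I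
 proof (induction Ps arbitrary: I)
  case Nil thus ?case using idealE by auto
 next
  case (Cons Q Ps)
  have Q: "Q:maxs R" "nz Q" "nz (prodl Ps)" using Cons prodl_nz maxD by auto
  have e: "ival R P (prodl (Q # Ps)) = ival R P Q + ival R P (prodl Ps)" if "P:maxs R" for P
   using ival_prod[OF that Q(2,3)] by simp
  have "I <= Q" using ival_pos Cons e[OF Q(1)] ival_self[OF Q(1)] by fastforce
  then obtain C where C: "nz C" "I = Q \<cdot> C" using contains_divides[OF Q(2) Cons(3)] by auto
  show ?case using C prod_mono Cons.IH[OF _ C(1)] Cons Cons e ival_prod[OF _ Q(2) C(1)] by simp
 qed
 thus "ALL P:maxs R. ival R P J <= ival R P I ==> I <= J"
  using factorization[OF assms(2)] assms by auto
qed

lemma ival_eqI: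
 assumes "nz I" "nz J" "!!P. P:maxs R ==> ival R P I = ival R P J" shows "I = J"
 using ival_subset[OF assms(1,2)] ival_subset[OF assms(2,1)] assms by auto

lemma finite_ival_pos: assumes "nz I" shows "finite {P:maxs R. 0 < ival R P I}"
proof -
 have "{P:maxs R. 0 < ival R P I} <= {J. ideal J R & I <= J}" using ival_pos assms maxD by auto
 thus ?thesis using finite_above assms finite_subset by blast
qed

lemma ex_ideal_ival:
 assumes "finite A" "A <= maxs R"
 shows "EX I. nz I & (ALL P:maxs R. ival R P I = (if P:A then k P else 0))"
 using assms
proof (induction A)
 case empty thus ?case using nz_carrier ival_carrier by auto
next
 case (insert Q A)
 then obtain I where I: "nz I" "ALL P:maxs R. ival R P I = (if P:A then k P else 0)" by auto
 have Q: "Q:maxs R" "nz Q" using insert maxD by auto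
 have pw: "ival R P (ppow Q n) = (if P = Q then n else 0)" if "P:maxs R" for P n
 proof (induction n)
  case 0 thus ?case using ival_carrier that by simp
 next
  case (Suc n)
  thus ?case using ival_prod[OF that ppow_nz[OF Q(2)] Q(2)] ival_self[OF Q(1)] ival_other[OF that Q(1)] by auto
 qed
 have "ival R P (ppow Q (k Q) \<cdot> I) = (if P:insert Q A then k P else 0)" if "P:maxs R" for P
  using ival_prod[OF that ppow_nz[OF Q(2)] I(1)] pw[OF that] I that insert by auto
 thus ?case using nz_prod[OF ppow_nz[OF Q(2)] I(1)] by blast
qed

lemma ex1_ideal_ival:
 assumes "finite {P:maxs R. k P ~= 0}"
 shows "EX! I. I:carrier (nzideals R) & (ALL P:maxs R. ival R P I = k P)"
proof -
 obtain I where "nz I" "ALL P:maxs R. ival R P I = (if P:{P:maxs R. k P ~= 0} then k P else 0)"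
  using ex_ideal_ival[OF assms] by auto
 thus ?thesis using ival_eqI by (intro ex1I[of _ I]) auto
qed

text \<open>Mutual divisibility is equality here, so the choice made by \<open>somegcd\<close> is
  forced to be the ideal with the minimal exponents.\<close>

lemma gcd_ideal:
 assumes "nz I" "nz J"
 shows "nz (somegcd (nzideals R) I J)"
  "!!P. P:maxs R ==> ival R P (somegcd (nzideals R) I J) = min (ival R P I) (ival R P J)"
proof -
 have "finite {P:maxs R. min (ival R P I) (ival R P J) ~= 0}"
  using finite_ival_pos[OF assms(1)] by (rule rev_finite_subset) auto
 then obtain D where D: "nz D" "!!P. P:maxs R ==> ival R P D = min (ival R P I) (ival R P J)"
  using ex1_ideal_ival[of "%P. min (ival R P I) (ival R P J)"] by auto
 have g: "E gcdof\<^bsub>nzideals R\<^esub> I J <-> E = D" if "nz E" for E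
 proof
  assume "E gcdof\<^bsub>nzideals R\<^esub> I J"
  hence E: "I <= E" "J <= E" "!!F. nz F ==> I <= F ==> J <= F ==> E <= F"
   using that assms nzideals_divides by (auto simp: isgcd_def)
  have "E <= D" using E(3)[OF D(1)] ival_subset assms D by simp
  moreover have "D <= E" using E ival_subset[OF D(1) that] D ival_subset[OF assms(1) that] ival_subset[OF assms(2) that] by simp
  ultimately show "E = D" by simp
 next
  assume "E = D"
  thus "E gcdof\<^bsub>nzideals R\<^esub> I J"
   using assms D by (auto simp: isgcd_def nzideals_divides ival_subset)
 qed
 have "somegcd (nzideals R) I J = D"
  unfolding somegcd_def using g D by (intro some_equality) auto
 thus "nz (somegcd (nzideals R) I J)"
  "!!P. P:maxs R ==> ival R P (somegcd (nzideals R) I J) = min (ival R P I) (ival R P J)"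
  using D by auto
qed

section \<open>Congruences modulo prime powers\<close>

lemma comaximal:
 assumes "nz I" "nz J" "!!Q. Q:maxs R ==> ival R Q I = 0 \<or> ival R Q J = 0"
 shows "EX i:I. EX j:J. i \<oplus> j = \<one>"
proof -
 let ?S = "I <+>\<^bsub>R\<^esub> J"
 have S: "ideal ?S R" using add_ideals assms by simp
 have "x \<oplus> \<zero>:?S" if "x:I" for x using that idealE[OF conjunct1[OF assms(2)]] by (auto simp: set_add_def')
 hence IS: "I <= ?S" using idealE[OF conjunct1[OF assms(1)]] by auto
 have "\<zero> \<oplus> x:?S" if "x:J" for x using that idealE[OF conjunct1[OF assms(1)]] by (auto simp: set_add_def')
 hence JS: "J <= ?S" using idealE[OF conjunct1[OF assms(2)]] by auto
 have "?S = carrier R"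
 proof (rule ccontr)
  assume "?S ~= carrier R"
  then obtain Q where "Q:maxs R" "?S <= Q" using ex_max[OF nz_super[OF assms(1) S IS]] by auto
  thus False using IS JS assms(3)[of Q] ival_pos[of Q I] ival_pos[of Q J] assms(1,2) by auto
 qed
 hence "\<one>:?S" by simp
 thus ?thesis by (force simp: set_add_def')
qed

lemma ival_ppow: "P:maxs R ==> Q:maxs R ==> ival R P (ppow Q n) = (if P = Q then n else 0)"
proof (induction n)
 case 0 thus ?case using ival_carrier by simp
next
 case (Suc n)
 thus ?case
  using ival_prod[OF Suc(2) ppow_nz[OF maxD(1)[OF Suc(3)]] maxD(1)[OF Suc(3)]] ival_self ival_other by auto
qed

lemma inverse_mod_ppow:
 assumes P: "P:maxs R" and d: "d:carrier R" "d ~: P"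
 shows "EX e:carrier R. d \<otimes> e \<ominus> \<one>:ppow P n"
proof -
 have d0: "d ~= \<zero>" using d idealE[OF conjunct1[OF maxD(1)[OF P]]] by auto
 note nzd = PIdl_nz[OF d(1) d0] and nzp = ppow_nz[OF maxD(1)[OF P], of n]
 have "EX i:PIdl d. EX j:ppow P n. i \<oplus> j = \<one>"
  using ival_ppow[OF _ P] ival_pos[OF P nzd] cgenideal_self[OF d(1)] d by (intro comaximal nzd nzp) auto
 then obtain r j where rj: "r:carrier R" "j:ppow P n" "r \<otimes> d \<oplus> j = \<one>" by (auto simp: cgenideal_def)
 have j: "j:carrier R" using idealE(2)[OF conjunct1[OF nzp] rj(2)] .
 have "d \<otimes> r \<ominus> (r \<otimes> d \<oplus> j) = \<ominus> j" using rj(1) d j by algebra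
 thus ?thesis using rj idealE(6)[OF conjunct1[OF nzp] rj(2)] rj by metis
qed

text \<open>Let \<open>J\<close> be the product of the primes of \<open>A\<close> other than
  \<open>P\<close> and write 1 = i + j with i in \<open>J\<close> and j in P^n; the element b i has
  both properties.\<close>

lemma weak_approximation:
 assumes P: "P:maxs R" and A: "finite A" "A <= maxs R" and b: "b:carrier R"
 shows "EX x:carrier R. x \<ominus> b:ppow P n & (ALL Q:A - {P}. x:Q)"
proof -
 obtain J where J: "nz J" "ALL Q:maxs R. ival R Q J = (if Q:A - {P} then 1 else 0)"
  using ex_ideal_ival[of "A - {P}" "%_. 1"] A by auto
 note nzp = ppow_nz[OF maxD(1)[OF P], of n]
 have "EX i:J. EX j:ppow P n. i \<oplus> j = \<one>"
  using ival_ppow[OF _ P] J by (intro comaximal J(1) nzp) auto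
 then obtain i j where ij: "i:J" "j:ppow P n" "i \<oplus> j = \<one>" by auto
 have c: "i:carrier R" "j:carrier R" using idealE(2)[OF conjunct1[OF J(1)] ij(1)] idealE(2)[OF conjunct1[OF nzp] ij(2)] .
 have "b \<otimes> i \<ominus> b \<otimes> (i \<oplus> j) = b \<otimes> (\<ominus> j)" using c b by algebra
 hence 1: "b \<otimes> i \<ominus> b:ppow P n" using idealE(5)[OF conjunct1[OF nzp] idealE(6)[OF conjunct1[OF nzp] ij(2)] b] ij
  b by simp
 have "b \<otimes> i:Q" if Q: "Q:A - {P}" for Q
 proof -
  have Qm: "Q:maxs R" using Q A by auto
  thus ?thesis using idealE(5)[OF conjunct1[OF maxD(1)[OF Qm]] _ b] ij ival_pos[OF Qm J(1)] J Q by auto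
 qed
 thus ?thesis using 1 b c by auto
qed

text \<open>Packages the residue field as statements about elements of \<open>R\<close>: its order
  kills 1, every class satisfies x^q = x, and the unit group is cyclic.\<close>

lemma residue_field_facts:
 assumes P: "P:maxs R"
 defines "q == card (carrier (R Quot P))"
 shows "0 < q" "[q] \<cdot> \<one>:P" "!!x. x:carrier R ==> x [^] q \<ominus> x:P"
  "EX a:carrier R. a ~: P & (ALL x:carrier R - P. EX i::nat. x \<ominus> a [^] i:P)"
proof -
 note Pi = maxD[OF P]
 have zero: "\<zero>\<^bsub>R Quot P\<^esub> = P" by (simp add: FactRing_def)
 have surj: "EX x:carrier R. Z = P +> x" if "Z:carrier (R Quot P)" for Z
  using that by (auto simp: FactRing_def A_RCOSETS_def')
 interpret P: maximalideal P R by (rule Pi)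
 interpret F: field "R Quot P" using P.quotient_is_field is_cring by simp
 interpret h: ring_hom_ring R "R Quot P" "(+>) P" by (rule P.rcos_ring_hom_ring)
 have fin: "finite (carrier (R Quot P))" using finite_quotient Pi by simp
 have z: "P +> x = \<zero>\<^bsub>R Quot P\<^esub> <-> x:P" if "x:carrier R" for x
  unfolding zero using P.rcos_const_imp_mem[OF that] a_rcos_zero[OF conjunct1[OF Pi(1)]] by auto
 show q0: "0 < q" unfolding q_def using fin card_gt_0_iff by auto
 have "[q] \<cdot>\<^bsub>R Quot P\<^esub> \<one>\<^bsub>R Quot P\<^esub> = \<zero>\<^bsub>R Quot P\<^esub>"
  using group.pow_order_eq_1[OF F.a_group] by (simp add: q_def Coset.order_def add_pow_def)
 moreover have hn: "P +> ([n] \<cdot> \<one>) = [n] \<cdot>\<^bsub>R Quot P\<^esub> \<one>\<^bsub>R Quot P\<^esub>" for n :: nat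
  by (induction n) (simp_all add: z idealE(1)[OF conjunct1[OF Pi(1)]] del: h.hom_zero)
 ultimately show "[q] \<cdot> \<one>:P" using z[OF add.nat_pow_closed[OF one_closed]] by simp
 have diff: "x \<ominus> y:P <-> P +> x = P +> y" if "x:carrier R" "y:carrier R" for x y
  using quotient_eq_iff_same_a_r_cos[OF conjunct1[OF Pi(1)] that] .
 have fmul: "Z [^]\<^bsub>R Quot P\<^esub> q = Z" if Z: "Z:carrier (R Quot P)" for Z
 proof (cases "Z = \<zero>\<^bsub>R Quot P\<^esub>")
  case True thus ?thesis using q0 F.nat_pow_zero by simp
 next
  case False
  hence "Z [^]\<^bsub>R Quot P\<^esub> (Suc (q - 1)) = Z" using Z group.pow_order_eq_1[OF F.field_mult_group]
   by (simp add: Multiplicative_Group.nat_pow_mult_of q_def Coset.order_def)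
  thus ?thesis using q0 by simp
 qed
 show "x [^] q \<ominus> x:P" if "x:carrier R" for x
  using that diff[of "x [^] q" x] fmul h.hom_nat_pow by simp
 obtain Z where Z: "Z:carrier (R Quot P)" "Z ~= \<zero>\<^bsub>R Quot P\<^esub>"
  "carrier (R Quot P) - {\<zero>\<^bsub>R Quot P\<^esub>} = {Z [^]\<^bsub>R Quot P\<^esub> i | i::nat. i:UNIV}"
   using F.finite_field_mult_group_has_gen[OF fin] by auto
 obtain a where a: "a:carrier R" "Z = P +> a" by (rule bexE[OF surj[OF Z(1)]])
 show "EX a:carrier R. a ~: P & (ALL x:carrier R - P. EX i::nat. x \<ominus> a [^] i:P)"
 proof (intro bexI conjI ballI)
  show "a:carrier R" "a ~: P" using a Z z[OF a(1)] by auto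
  fix x assume x: "x:carrier R - P"
  hence "P +> x:carrier (R Quot P) - {\<zero>\<^bsub>R Quot P\<^esub>}" using z by simp
  then obtain i :: nat where "P +> x = Z [^]\<^bsub>R Quot P\<^esub> i" unfolding Z by auto
  thus "EX i::nat. x \<ominus> a [^] i:P" using x a diff[of x "a [^] i"] h.hom_nat_pow by auto
 qed
qed

end

section \<open>Embeddings into the complex numbers\<close>

text \<open>Closure under \<open>inverse\<close> can be demanded at 0 as well, since
  \<open>inverse 0 = 0\<close>.\<close>

definition csub :: "complex set => bool" where
 "csub E <-> 1:E & (ALL x:E. ALL y:E. x - y:E & x * y:E) & (ALL x:E. inverse x:E)"

lemma csubD:
 assumes "csub E"
 shows "1:E" "0:E" "!!x. x:E ==> - x:E" "!!x y. x:E ==> y:E ==> x + y:E"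
  "!!x y. x:E ==> y:E ==> x - y:E" "!!x y. x:E ==> y:E ==> x * y:E"
  "!!x. x:E ==> inverse x:E" "!!x y. x:E ==> y:E ==> x / y:E"
proof -
 show 1: "1:E" and diff: "!!x y. x:E ==> y:E ==> x - y:E"
  and mult: "!!x y. x:E ==> y:E ==> x * y:E" and inv: "!!x. x:E ==> inverse x:E"
  using assms[unfolded csub_def] by auto
 show 0: "0:E" using diff[OF 1 1] by simp
 show neg: "!!x. x:E ==> - x:E" using diff[OF 0] by simp
 show "!!x y. x:E ==> y:E ==> x + y:E" using diff neg by (metis diff_minus_eq_add)
 show "!!x y. x:E ==> y:E ==> x / y:E" using mult inv by (simp add: divide_inverse)
qed

lemma csub_power: "csub E ==> x:E ==> x ^ n:E"
 by (induction n) (auto simp: csubD)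

lemma csub_sum: "csub E ==> (!!i. i:I ==> f i:E) ==> sum f I:E"
 by (induction I rule: infinite_finite_induct) (auto simp: csubD)

lemma csub_prod: "csub E ==> (!!i. i:I ==> f i:E) ==> prod f I:E"
 by (induction I rule: infinite_finite_induct) (auto simp: csubD)

lemma csub_of_nat: "csub E ==> of_nat n:E"
 by (induction n) (auto simp: csubD)

lemma csub_of_int: "csub E ==> of_int n:E"
 by (cases n rule: int_cases2) (auto simp: csubD csub_of_nat)

definition pols :: "complex set => complex poly set" where
 "pols E = {p. ALL i. pcf p i:E}"

lemma polys_overI: "(!!i. pcf p i:E) ==> p:pols E"
 by (simp add: pols_def)

context
 fixes E assumes E: "csub E"
begin

lemma pols_simps:
 "0:pols E" "1:pols E" "pCons c p:pols E <-> c:E & p:pols E"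
 "p:pols E ==> q:pols E ==> p + q:pols E"
 "p:pols E ==> q:pols E ==> p - q:pols E"
 "p:pols E ==> q:pols E ==> p * q:pols E"
 "c:E ==> p:pols E ==> Polynomial.smult c p:pols E"
 "c:E ==> Polynomial.monom c n:pols E"
 "p:pols E ==> x:E ==> poly p x:E"
proof -
 note E' = csubD[OF E]
 show "0:pols E" "1:pols E" "pCons c p:pols E <-> c:E & p:pols E" using E' by (auto simp: pols_def coeff_pCons split: nat.splits)+
 show "p:pols E ==> q:pols E ==> p + q:pols E"
  "p:pols E ==> q:pols E ==> p - q:pols E"
  "c:E ==> p:pols E ==> Polynomial.smult c p:pols E"
  "c:E ==> Polynomial.monom c n:pols E" "p:pols E ==> q:pols E ==> p * q:pols E" using E'
   by (auto simp: pols_def coeff_mult intro!: csub_sum[OF E])+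
 show "p:pols E ==> x:E ==> poly p x:E"
  by (auto simp: pols_def poly_altdef intro!: csub_sum[OF E] E' csub_power[OF E])
qed

lemma pols_division:
 assumes "f:pols E" "plc f = 1" "p:pols E"
 shows "EX q:pols E. EX s:pols E. p = q * f + s & (s = 0 \<or> pdeg s < pdeg f)"
 using assms(3)
proof (induction "pdeg p" arbitrary: p rule: less_induct)
 case less
 show ?case
 proof (cases "p = 0 \<or> pdeg p < pdeg f")
  case True
  thus ?thesis using less.prems pols_simps by (intro bexI[of _ 0] bexI[of _ p]) auto
 next
  case False
  define m where "m = Polynomial.monom (plc p) (pdeg p - pdeg f)"
  have m: "m:pols E" and f0: "f ~= 0" and lm: "plc m = plc p" using less.prems pols_simps assms False
   by (auto simp: m_def pols_def degree_monom_eq)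
  have dm: "pdeg (m * f) = pdeg p"
   using False f0 by (simp add: m_def degree_mult_eq degree_monom_eq)
  have dl: "plc (m * f) = plc p"
   by (simp only: lead_coeff_mult lm assms(2) mult_1_right)
  show ?thesis
  proof (cases "p - m * f = 0")
   case True
   thus ?thesis using m pols_simps by (intro bexI[of _ m] bexI[of _ 0]) auto
  next
   case nz: False
   have c: "pcf (p - m * f) (pdeg p) = 0" using dl dm by simp
   have "pdeg (p - m * f) <= pdeg p" using dm degree_diff_le by (metis order_refl)
   moreover have "pdeg (p - m * f) ~= pdeg p" using c nz leading_coeff_0_iff by metis
   ultimately have "pdeg (p - m * f) < pdeg p" by simp
   then obtain q s where qs: "q:pols E" "s:pols E" "p - m * f = q * f + s"
    "s = 0 \<or> pdeg s < pdeg f" using less.hyps less.prems m assms(1) pols_simps by metis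
   hence "p = (q + m) * f + s" by (simp add: algebra_simps)
   thus ?thesis using qs m pols_simps by auto
  qed
 qed
qed

lemma pols_monic:
 assumes "p:pols E" "p ~= 0"
 shows "Polynomial.smult (inverse (plc p)) p:pols E"
  "plc (Polynomial.smult (inverse (plc p)) p) = 1"
 using assms csubD[OF E] pols_simps by (auto simp: pols_def)

text \<open>\<open>Z1\<close> and \<open>Z2\<close> are the kernels of two evaluation homomorphisms; if the minimal polynomial of
 the first is killed by the second, then they agree.\<close>

lemma minimal_polynomial_kernel:
 assumes f: "f:pols E" "plc f = 1" "Z1 f"
  and min: "!!g. g:pols E ==> g ~= 0 ==> Z1 g ==> pdeg f <= pdeg g"
  and Z1: "!!p q. p:pols E ==> q:pols E ==> Z1 p ==> Z1 (q * p)"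
   "!!p q. p:pols E ==> q:pols E ==> Z1 p ==> Z1 q ==> Z1 (p - q)"
  and Z1p: "!!p q. p:pols E ==> q:pols E ==> Z1 (p * q) ==> Z1 p \<or> Z1 q"
  and Z2: "!!p q. p:pols E ==> q:pols E ==> Z2 p ==> Z2 (q * p)"
   "!!p q. p:pols E ==> q:pols E ==> Z2 p ==> Z2 q ==> Z2 (p - q)"
  and Z21: "~ Z2 1" and Z2f: "Z2 f" and p: "p:pols E"
 shows "Z1 p <-> Z2 p"
proof -
 have gen: "EX q:pols E. p = q * f" if pE: "p:pols E" and pZ: "Z1 p" for p
 proof -
  obtain q s where qs: "q:pols E" "s:pols E" "p = q * f + s"
   "s = 0 \<or> pdeg s < pdeg f" using pols_division[OF f(1,2) pE] by auto
  show ?thesis using qs min Z1(2)[OF pE _ pZ Z1(1)[OF f(1) qs(1) f(3)]] pols_simps(6)[OF qs(1) f(1)] by fastforce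
 qed
 \<comment> \<open>\<open>g\<close> will generate the kernel of the second evaluation, so f = q g.
   Minimality makes \<open>f\<close> irreducible, and \<open>g\<close> is not constant because the
   second evaluation does not kill 1; hence q = 1 and both kernels are generated by
   \<open>f\<close>.\<close>
 define G where "G g <-> g:pols E & g ~= 0 & Z2 g" for g
 have f0: "f ~= 0" using f by auto
 then obtain g0 where g0: "G g0" "!!h. G h ==> pdeg g0 <= pdeg h"
  using ex_has_least_nat[of G f pdeg] f Z2f by (auto simp: G_def)
 define g where "g = Polynomial.smult (inverse (plc g0)) g0"
 have g: "g:pols E" "plc g = 1" using pols_monic g0 by (auto simp: g_def G_def)
 have "g = [:inverse (plc g0):] * g0" by (simp add: g_def)
 moreover have "[:inverse (plc g0):]:pols E"
  using pols_simps csubD[OF E] g0 by (auto simp: G_def pols_def)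
 ultimately have Zg: "Z2 g" using Z2 g0 by (metis G_def)
 have gen2: "EX q:pols E. p = q * g" if pE: "p:pols E" and pZ: "Z2 p" for p
 proof -
  obtain q s where qs: "q:pols E" "s:pols E" "p = q * g + s"
   "s = 0 \<or> pdeg s < pdeg g" using pols_division[OF g pE] by auto
  show ?thesis using qs g0 Z2(2)[OF pE _ pZ Z2(1)[OF g(1) qs(1) Zg]] pols_simps(6)[OF qs(1) g(1)] unfolding G_def
   by (fastforce simp: g_def)
 qed
 obtain q where q: "q:pols E" "f = q * g" using gen2 f Z2f by auto
 have dgp: "pdeg g ~= 0"
 by (metis g degree_eq_zeroE lead_coeff_pCons one_pCons Zg Z21)
 have "pdeg q = 0" using dgp min g Z1p q f(3) f0 by (fastforce simp: degree_mult_eq)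
 moreover have "plc q = 1" using q f g by (metis lead_coeff_mult mult.right_neutral)
 ultimately have "q = 1" by (metis degree_eq_zeroE lead_coeff_pCons one_pCons)
 hence fg: "f = g" using q by simp
 show ?thesis using gen[OF p] gen2[OF p] fg Z1[OF f(1)] Z2[OF f(1)] f Z2f by auto
qed

end

text \<open>Graphs instead of functions, so that Zorn's lemma can be applied to plain set inclusion.
  The last clause, applied to differences, makes the relation single valued and injective; the
  domain is a priori only a subring.\<close>

definition hom_graph :: "('a, 'm) ring_scheme => (complex \<times> 'a) set => bool" where
 "hom_graph R r <-> r <= UNIV \<times> carrier R & (1, \<one>\<^bsub>R\<^esub>):r &
   (ALL x y x' y'. (x, y):r --> (x', y'):r -->
    (x - x', y \<ominus>\<^bsub>R\<^esub> y'):r & (x * x', y \<otimes>\<^bsub>R\<^esub> y'):r) &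
   (ALL x y. (x, y):r --> (x = 0 <-> y = \<zero>\<^bsub>R\<^esub>))"

lemma hom_graphD:
 assumes "hom_graph R r"
 shows "(x, y):r ==> y:carrier R" "(1, \<one>\<^bsub>R\<^esub>):r"
  "(x, y):r ==> (x', y'):r ==> (x - x', y \<ominus>\<^bsub>R\<^esub> y'):r"
  "(x, y):r ==> (x', y'):r ==> (x * x', y \<otimes>\<^bsub>R\<^esub> y'):r"
  "(x, y):r ==> x = 0 <-> y = \<zero>\<^bsub>R\<^esub>"
 using assms unfolding hom_graph_def by auto

lemma hom_graph_maximal:
 assumes "hom_graph R r0"
 shows "EX r. r0 <= r & hom_graph R r & (ALL r'. hom_graph R r' --> r <= r' --> r' = r)"
proof -
 have "EX M:{r. r0 <= r & hom_graph R r}. ALL s:{r. r0 <= r & hom_graph R r}. M <= s --> s = M"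
 proof (rule subset_Zorn_nonempty)
  show "{r. r0 <= r & hom_graph R r} ~= {}" using assms by auto
  fix C assume C: "C ~= {}" "subset.chain {r. r0 <= r & hom_graph R r} C"
  hence g: "r0 <= r" "hom_graph R r" if "r:C" for r
   using that by (auto simp: subset.chain_def)
  have two: "EX r:C. z:r & z':r" if "z:\<Union> C" "z':\<Union> C" for z z'
   using that C unfolding subset.chain_def by blast
  obtain r1 where r1: "r1:C" using C by auto
  have "hom_graph R (\<Union> C)"
   unfolding hom_graph_def
  proof (intro conjI allI impI)
   show "\<Union> C <= UNIV \<times> carrier R" using g hom_graphD(1) by fastforce
   show "(1, \<one>\<^bsub>R\<^esub>):\<Union> C" using hom_graphD[OF g(2)[OF r1]] r1 by auto
   show "x = 0 <-> y = \<zero>\<^bsub>R\<^esub>" if "(x, y):\<Union> C" for x y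
    using that hom_graphD(5)[OF g(2)] by auto
   fix x y x' y' assume "(x, y):\<Union> C" "(x', y'):\<Union> C"
   then obtain r where r: "r:C" "(x, y):r" "(x', y'):r" using two by meson
   thus "(x - x', y \<ominus>\<^bsub>R\<^esub> y'):\<Union> C" "(x * x', y \<otimes>\<^bsub>R\<^esub> y'):\<Union> C"
    using hom_graphD(3,4)[OF g(2)[OF r(1)] r(2,3)] by auto
  qed
  thus "\<Union> C:{r. r0 <= r & hom_graph R r}" using g[OF r1] r1 by auto
 qed
 thus ?thesis by (smt (verit, best) mem_Collect_eq subset_trans)
qed

text \<open>The map runs from complex numbers to \<open>R\<close>. Extending it requires roots in
  \<open>R\<close>, which an algebraically closed \<open>R\<close> supplies, while the polynomial
  arithmetic takes place over the type \<open>complex\<close>.\<close>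

locale complex_hom = field R for R :: "('a, 'm) ring_scheme" (structure) +
 fixes E :: "complex set" and phi :: "complex => 'a"
 assumes E: "csub E" and closed: "x:E ==> phi x:carrier R" and one: "phi 1 = \<one>"
  and add: "x:E ==> y:E ==> phi (x + y) = phi x \<oplus> phi y"
  and mult: "x:E ==> y:E ==> phi (x * y) = phi x \<otimes> phi y"
begin

lemmas E' = csubD[OF E]

lemma zero: "phi 0 = \<zero>"
proof -
 show ?thesis using closed[OF E'(2)] add[of 0 0] E' by simp
qed

lemma neg: "x:E ==> phi (- x) = \<ominus> phi x"
 using add E' zero closed by (metis add.right_inverse minus_equality add.m_comm)

lemma diff: "x:E ==> y:E ==> phi (x - y) = phi x \<ominus> phi y"
 using add[of x "- y"] E' neg by (simp add: a_minus_def)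

lemma nonzero: "x:E ==> phi x = \<zero> <-> x = 0"
proof
 assume x: "x:E" "phi x = \<zero>"
 show "x = 0" using one mult x E'(7)[OF x(1)] closed right_inverse by fastforce
qed (simp add: zero)

lemma inj: "inj_on phi E"
proof (rule inj_onI)
 fix x y assume *: "x:E" "y:E" "phi x = phi y"
 thus "x = y" using nonzero[of "x - y"] E' diff closed by simp
qed

lemma hom_inverse: "x:E ==> x ~= 0 ==> phi (inverse x) = inv phi x"
 using mult[of "inverse x" x] E' one closed by (intro comm_inv_char[symmetric]) (auto simp: m_comm)

definition ev :: "'a => complex poly => 'a" where
 "ev a p = fold_coeffs (%c y. phi c \<oplus> a \<otimes> y) p \<zero>"

context
 fixes a assumes a: "a:carrier R"
begin

lemma ev_0: "ev a 0 = \<zero>" by (simp add: ev_def)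

lemma ev_pCons: "ev a (pCons c p) = phi c \<oplus> a \<otimes> ev a p"
 by (cases "c = 0 & p = 0") (auto simp: ev_def zero a)

lemma ev_closed: "p:pols E ==> ev a p:carrier R"
 by (induction p) (auto simp: ev_0 ev_pCons pols_simps[OF E] closed a)

lemma ev_add: "p:pols E ==> q:pols E ==> ev a (p + q) = ev a p \<oplus> ev a q"
proof (induction p arbitrary: q)
 case 0 thus ?case by (simp add: ev_0 ev_closed)
next
 case (pCons c p)
 obtain d r where q: "q = pCons d r" by (cases q)
 show ?case using pCons q a closed ev_closed by (simp add: pols_simps[OF E] ev_pCons add r_distr a_ac)
qed

lemma ev_smult: "c:E ==> p:pols E ==> ev a (Polynomial.smult c p) = phi c \<otimes> ev a p"
proof (induction p)
 case 0 thus ?case by (simp add: ev_0 closed)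
next
 case (pCons d p)
 thus ?case using a closed ev_closed by (simp add: pols_simps[OF E] ev_pCons mult r_distr m_lcomm)
qed

lemma ev_mult: "p:pols E ==> q:pols E ==> ev a (p * q) = ev a p \<otimes> ev a q"
proof (induction p)
 case 0 thus ?case by (simp add: ev_0 ev_closed)
next
 case (pCons c p)
 thus ?case using a closed ev_closed by (simp add: pols_simps[OF E] ev_pCons l_distr m_assoc ev_add E' ev_smult zero)
qed

lemma ev_const: "ev a [:c:] = phi c" if "c:E"
 using that a closed by (simp add: ev_pCons ev_0)

lemma ev_diff: assumes "p:pols E" "q:pols E" shows "ev a (p - q) = ev a p \<ominus> ev a q"
proof -
 have "ev a ((p - q) + q) = ev a (p - q) \<oplus> ev a q" using assms pols_simps[OF E] by (intro ev_add) auto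
 thus ?thesis using assms ev_closed pols_simps[OF E] by (simp add: a_minus_def a_assoc r_neg)
qed

text \<open>Evaluation at \<open>b\<close> and evaluation at \<open>a\<close> have the same kernel
  by \<open>minimal_polynomial_kernel\<close>, so sending b to a extends \<open>phi\<close> to a
  well-defined injective map on E[b].\<close>

lemma extension_graph:
 assumes f: "f:pols E" "plc f = 1" "poly f b = 0"
  and min: "!!g. g:pols E ==> g ~= 0 ==> poly g b = 0 ==> pdeg f <= pdeg g"
  and root: "ev a f = \<zero>"
 shows "hom_graph R {(poly p b, ev a p) | p. p:pols E}"
proof -
 have ker: "poly p b = 0 <-> ev a p = \<zero>" if p: "p:pols E" for p
 proof (rule minimal_polynomial_kernel[OF E f(1,2), where ?Z1.0 = "%p. poly p b = 0" and ?Z2.0 = "%p. ev a p = \<zero>"])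
  show "ev a 1 ~= \<zero>" using ev_const[OF E'(1)] one by (simp add: one_pCons)
  show "ev a (q * p) = \<zero>" if "p:pols E" "q:pols E" "ev a p = \<zero>" for p q
   using that ev_mult ev_closed by simp
  show "ev a (p - q) = \<zero>" if "p:pols E" "q:pols E" "ev a p = \<zero>" "ev a q = \<zero>" for p q
   using that ev_diff by simp
 qed (use p root f min in auto)
 show ?thesis
  unfolding hom_graph_def
 proof (intro conjI allI impI)
  show "{(poly p b, ev a p) | p. p:pols E} <= UNIV \<times> carrier R" using ev_closed by auto
  have "(1, \<one>) = (poly [:1:] b, ev a [:1:])" using ev_const[OF E'(1)] one by simp
  thus "(1, \<one>):{(poly p b, ev a p) | p. p:pols E}" using pols_simps[OF E] E' by blast
  show "x = 0 <-> y = \<zero>" if "(x, y):{(poly p b, ev a p) | p. p:pols E}" for x y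
   using that ker by auto
  fix x y x' y' assume "(x, y):{(poly p b, ev a p) | p. p:pols E}"
   "(x', y'):{(poly p b, ev a p) | p. p:pols E}"
  then obtain p q where pq: "p:pols E" "q:pols E" "x = poly p b" "y = ev a p" "x' = poly q b" "y' = ev a q"
   by auto
  hence "(x - x', y \<ominus> y') = (poly (p - q) b, ev a (p - q))" "(x * x', y \<otimes> y') = (poly (p * q) b, ev a (p * q))"
   using ev_diff ev_mult by auto
  thus "(x - x', y \<ominus> y'):{(poly p b, ev a p) | p. p:pols E}"
   "(x * x', y \<otimes> y'):{(poly p b, ev a p) | p. p:pols E}"
   using pols_simps(5,6)[OF E pq(1,2)] by blast+
 qed
qed

end

lemma extension_graph_mono:
 assumes "a:carrier R"
 shows "{(x, phi x) |x. x:E} <= {(poly p b, ev a p) | p. p:pols E}"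
  "(b, a):{(poly p b, ev a p) | p. p:pols E}"
proof -
 have "(x, phi x) = (poly [:x:] b, ev a [:x:])" "[:x:]:pols E" if "x:E" for x
  using that ev_const[OF assms] pols_simps[OF E] by auto
 thus "{(x, phi x) |x. x:E} <= {(poly p b, ev a p) | p. p:pols E}" by blast
 have "(b, a) = (poly [:0, 1:] b, ev a [:0, 1:])"
  using assms by (simp add: ev_pCons[OF assms] ev_0[OF assms] zero one)
 moreover have "[:0, 1:]:pols E" using pols_simps[OF E] E' by simp
 ultimately show "(b, a):{(poly p b, ev a p) | p. p:pols E}" by blast
qed

lemma ev_eval:
 assumes "x:carrier R" "p:pols E"
 shows "eval (map phi (rev (coeffs p))) x = ev x p"
proof -
 have "set cs <= E ==> eval (map phi (rev cs)) x = foldr (%c y. phi c \<oplus> x \<otimes> y) cs \<zero> &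
   eval (map phi (rev cs)) x:carrier R" for cs
 proof (induction cs)
  case (Cons c cs)
  have "set (map phi (rev cs)) <= carrier R" "phi c:carrier R" using Cons closed by auto
  hence "eval (map phi (rev cs) @ [phi c]) x = eval (map phi (rev cs)) x \<otimes> x \<oplus> phi c"
   using eval_append_aux assms by simp
  moreover have c: "phi c:carrier R" "foldr (%c y. phi c \<oplus> x \<otimes> y) cs \<zero>:carrier R" using Cons closed by auto
  ultimately show ?case using Cons assms by (simp add: a_comm m_comm)
 qed simp
 moreover have "set (coeffs p) <= E" using assms by (auto simp: pols_def coeffs_def)
 ultimately show ?thesis by (simp add: ev_def fold_coeffs_def)
qed

end

definition alg_closed_in :: "complex set => bool" where
 "alg_closed_in E <-> (ALL p b. p:pols E --> p ~= 0 --> poly p b = 0 --> b:E)"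

definition min_poly :: "complex set => complex => complex poly => bool" where
 "min_poly E b f <-> f:pols E & plc f = 1 & poly f b = 0 & 0 < pdeg f &
   (ALL g:pols E. g ~= 0 --> poly g b = 0 --> pdeg f <= pdeg g)"

lemma minimal_polynomial_exists:
 assumes E: "csub E" and p: "p:pols E" "p ~= 0" "poly p b = 0"
 obtains f where "min_poly E b f"
proof -
 define G where "G g <-> g:pols E & g ~= 0 & poly g b = 0" for g
 obtain g where g: "G g" "!!h. G h ==> pdeg g <= pdeg h"
  using ex_has_least_nat[of G p pdeg] p by (auto simp: G_def)
 define f where "f = Polynomial.smult (inverse (plc g)) g"
 have f: "f:pols E" "plc f = 1" and d: "pdeg f = pdeg g" "poly f b = 0" using pols_monic[OF E] g by (auto simp: f_def G_def)+
 have "pdeg f ~= 0"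
 using f(2) degree_eq_zeroE d(2) by fastforce
 thus thesis using that[of f] f d g by (simp add: G_def min_poly_def)
qed

lemma (in field) maximal_graph:
 assumes r: "hom_graph R r" and max: "!!r'. hom_graph R r' ==> r <= r' ==> r' = r"
 obtains phi where "complex_hom R (Domain r) phi" "r = {(x, phi x) |x. x:Domain r}"
proof -
 note rD = hom_graphD[OF r]
 have r0: "(0, \<zero>):r" using rD(3)[OF rD(2,2)] by (simp add: a_minus_def r_neg)
 have sv: "y = y'" if "(x, y):r" "(x, y'):r" for x y y'
  using rD(3)[OF that] rD rD(1)[OF that(1)] rD(1)[OF that(2)] by (metis diff_self r_right_minus_eq)
 define phi where "phi x = (THE y. (x, y):r)" for x
 have phi: "(x, y):r <-> x:Domain r & y = phi x" for x y
 proof -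
  have "phi x = y" if "(x, y):r" for y
   unfolding phi_def using that sv by auto
  thus ?thesis by auto
 qed
 \<comment> \<open>The extension to the field of fractions: x is related to y when x u is related to
   y v for some nonzero u related to v. By maximality it is \<open>r\<close> itself, so the domain
   of \<open>r\<close> is closed under \<open>inverse\<close>.\<close>
 define r' where "r' = {(x, y) | x y. y:carrier R & (EX u v. (u, v):r & u ~= 0 & (x * u, y \<otimes> v):r)}"
 have "hom_graph R r'"
  unfolding hom_graph_def
 proof (intro conjI allI impI)
  show "r' <= UNIV \<times> carrier R" "(1, \<one>):r'" using rD(2) by (force simp: r'_def)+
  show "x = 0 <-> y = \<zero>" if "(x, y):r'" for x y
  proof -
   obtain u v where uv: "y:carrier R" "(u, v):r" "u ~= 0" "(x * u, y \<otimes> v):r"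
    using \<open>(x, y):r'\<close> by (auto simp: r'_def)
   thus ?thesis using rD(1)[OF uv(2)] rD(5) by (fastforce simp: integral_iff)
  qed
  fix x y x' y' assume a: "(x, y):r'" "(x', y'):r'"
  obtain u v where uv: "y:carrier R" "(u, v):r" "u ~= 0" "(x * u, y \<otimes> v):r"
   using a by (auto simp: r'_def)
  obtain u' v' where uv': "y':carrier R" "(u', v'):r" "u' ~= 0" "(x' * u', y' \<otimes> v'):r"
   using a by (auto simp: r'_def)
  have c: "v:carrier R" "v':carrier R" and p: "(u * u', v \<otimes> v'):r" using rD uv uv' by auto
  have "(x * u * u' - x' * u' * u, y \<otimes> v \<otimes> v' \<ominus> y' \<otimes> v' \<otimes> v):r" using rD uv uv' by simp
  moreover have "y \<otimes> v \<otimes> v' \<ominus> y' \<otimes> v' \<otimes> v = (y \<ominus> y') \<otimes> (v \<otimes> v')"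
   using c uv uv' by algebra
  moreover have "x * u * u' - x' * u' * u = (x - x') * (u * u')" by (simp add: algebra_simps)
  ultimately show "(x - x', y \<ominus> y'):r'" using p uv uv' by (fastforce simp: r'_def)
  have "(x * u * (x' * u'), y \<otimes> v \<otimes> (y' \<otimes> v')):r" using rD uv uv' by simp
  moreover have "y \<otimes> v \<otimes> (y' \<otimes> v') = (y \<otimes> y') \<otimes> (v \<otimes> v')"
   using c uv uv' by algebra
  moreover have "x * u * (x' * u') = (x * x') * (u * u')" by simp
  ultimately show "(x * x', y \<otimes> y'):r'" using p uv uv' by (fastforce simp: r'_def)
 qed
 moreover have "r <= r'"
 using rD(1) rD(2) by (fastforce simp: r'_def)
 ultimately have rr: "r' = r" using max by simp
 have E: "csub (Domain r)"
  unfolding csub_def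
 proof (intro conjI ballI)
  show "1:Domain r" using rD by auto
  fix x assume x: "x:Domain r"
  show "inverse x:Domain r"
  proof (cases "x = 0")
   case True thus ?thesis using r0 by auto
  next
   case False
   obtain y where y: "(x, y):r" using x by auto
   hence "(inverse x, inv y):r'" using False rD rD field_Units by (fastforce simp: r'_def)
   thus ?thesis using rr by auto
  qed
  fix y assume y: "y:Domain r"
  show "x - y:Domain r" "x * y:Domain r" using x y rD by blast+
 qed
 note E' = csubD[OF E]
 have m: "(x, phi x):r" if "x:Domain r" for x using phi that by simp
 have "complex_hom R (Domain r) phi"
 proof
  show "csub (Domain r)" by (rule E)
  show "phi x:carrier R" if "x:Domain r" for x using rD(1) m that by auto
  show "phi 1 = \<one>" using rD phi by auto
  show "phi (x * y) = phi x \<otimes> phi y" if "x:Domain r" "y:Domain r" for x y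
   using rD(4)[OF m m, OF that] phi by auto
  show "phi (x + y) = phi x \<oplus> phi y" if xy: "x:Domain r" "y:Domain r" for x y
  proof -
   have "(x - (0 - y), phi x \<ominus> (\<zero> \<ominus> phi y)):r" using rD(3) m xy r0 by blast
   moreover have "phi x \<ominus> (\<zero> \<ominus> phi y) = phi x \<oplus> phi y" using rD(1)[OF m[OF xy(2)]] by algebra
   ultimately show ?thesis using phi by auto
  qed
 qed
 moreover have "r = {(x, phi x) |x. x:Domain r}"
 using phi by auto
 ultimately show thesis by (rule that)
qed

lemma (in complex_hom) root_exists:
 assumes "algebraically_closed R" "f:pols E" "0 < pdeg f"
 obtains a where "a:carrier R" "ev a f = \<zero>"
proof -
 define P where "P = map phi (rev (coeffs f))"
 have f0: "f ~= 0" using assms by auto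
 have P: "P:carrier (poly_ring R)"
  using closed nonzero assms unfolding univ_poly_carrier[symmetric] polynomial_def by (auto simp: P_def pols_def coeffs_def)
 hence "size (roots P) ~= 0" using assms algebraically_closed.roots_over_carrier[OF assms(1)]
  by (simp add: splitted_def P_def length_coeffs_degree f0)
 then obtain a where "a :# roots P" by auto
 thus thesis using that ev_eval[OF _ assms(2)] roots_mem_iff_is_root[OF P] by (auto simp: is_root_def P_def)
qed

text \<open>A maximal graph leaves no algebraic number out: a \<open>b\<close> outside the domain
  could still be sent to a root in \<open>R\<close> of the image of its minimal polynomial.\<close>

lemma (in field) maximal_extension:
 assumes ac: "algebraically_closed R" and r0: "hom_graph R r0"
 obtains E phi where "complex_hom R E phi" "alg_closed_in E" "!!x y. (x, y):r0 ==> x:E & phi x = y"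
proof -
 obtain r where r: "r0 <= r" "hom_graph R r" "!!r'. hom_graph R r' ==> r <= r' ==> r' = r"
  using hom_graph_maximal[OF r0] by auto
 obtain phi where phi: "complex_hom R (Domain r) phi" "r = {(x, phi x) |x. x:Domain r}"
  by (rule maximal_graph[OF r(2,3)])
 interpret complex_hom R "Domain r" phi by (rule phi)
 have "alg_closed_in (Domain r)"
  unfolding alg_closed_in_def
 proof (intro allI impI)
  fix p b assume p: "p:pols (Domain r)" "p ~= 0" "poly p b = 0"
  obtain f where "min_poly (Domain r) b f" by (rule minimal_polynomial_exists[OF E p])
  hence f: "f:pols (Domain r)" "plc f = 1" "poly f b = 0" "0 < pdeg f"
   "!!g. g:pols (Domain r) ==> g ~= 0 ==> poly g b = 0 ==> pdeg f <= pdeg g"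
   by (auto simp: min_poly_def)
  obtain a where a: "a:carrier R" "ev a f = \<zero>" by (rule root_exists[OF ac f(1,4)])
  have hg: "hom_graph R {(poly p b, ev a p) | p. p:pols (Domain r)}"
   by (rule extension_graph[OF a(1) f(1,2,3,5) a(2)])
  show "b:Domain r" using extension_graph_mono[OF a(1), of b] extension_graph_mono[OF a(1), of b] r(3)[rule_format, OF hg]
   unfolding phi(2)[symmetric] by auto
 qed
 moreover have "x:Domain r & phi x = y" if "(x, y):r0" for x y
 proof -
  have "(x, y):{(x, phi x) |x. x:Domain r}" using subsetD[OF r(1) that] phi by simp
  thus ?thesis by simp
 qed
 ultimately show thesis using that[OF phi(1)] by simp
qed

text \<open>By the fundamental theorem of algebra \<open>p\<close> has a factor X - b, with b in
  \<open>E\<close> by assumption. Evaluated at \<open>a\<close>, either a = phi b or the quotient,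
  of smaller degree, still kills \<open>a\<close>.\<close>

lemma (in complex_hom) range_algebraic:
 assumes "alg_closed_in E" "a:carrier R" "p:pols E" "p ~= 0" "ev a p = \<zero>"
 shows "a:phi ` E"
 using assms(3-5)
proof (induction "pdeg p" arbitrary: p)
 case 0
 then obtain c where c: "p = [:c:]" by (metis degree_eq_zeroE)
 hence "c:E" using 0(2) pols_simps(3)[OF E] by simp
 hence "phi c = \<zero>" using 0(4) c ev_const[OF assms(2)] by simp
 thus ?case using nonzero[OF \<open>c:E\<close>] c 0(3) by simp
next
 case (Suc n)
 then obtain b where b: "poly p b = 0"
  using fundamental_theorem_of_algebra[of p] constant_degree[of p] by auto
 hence bE: "b:E" using assms(1) Suc by (auto simp: alg_closed_in_def)
 define q where "q = synthetic_div p b"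
 have pq: "p = [:- b, 1:] * q" using synthetic_div_correct'[of b p] b by (simp add: q_def)
 have l: "[:- b, 1:]:pols E" using E' bE pols_simps(1,3)[OF E] by simp
 \<comment> \<open>Synthetic division takes place over all complex numbers; comparing it with
   division inside \<open>E\<close> puts the coefficients of the quotient into
   \<open>E\<close>.\<close>
 have "q:pols E"
 proof -
  obtain u s where us: "u:pols E" "s:pols E" "p = u * [:- b, 1:] + s"
   "s = 0 \<or> pdeg s < pdeg [:- b, 1:]"
   using pols_division[OF E l _ Suc(3)] by auto
  hence "pdeg s = 0" by auto
  then obtain c where c: "s = [:c:]" by (metis degree_eq_zeroE)
  have "c = 0" using us(3) b c by simp
  hence "[:- b, 1:] * q = [:- b, 1:] * u" using us(3) pq c by simp
  hence "q = u" by (metis mult_cancel_left pCons_eq_0_iff one_neq_zero)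
  thus ?thesis using us by simp
 qed
 have q0: "q ~= 0" using pq Suc by auto
 hence "pdeg p = Suc (pdeg q)" unfolding pq by (subst degree_mult_eq) auto
 have evl: "ev a [:- b, 1:] = a \<ominus> phi b"
  using assms(2) closed[OF bE] ev_pCons[OF assms(2)] ev_0[OF assms(2)] neg[OF bE] one by (simp add: a_minus_def a_comm)
 have "(a \<ominus> phi b) \<otimes> ev a q = \<zero>" using Suc(5) pq ev_mult[OF assms(2) l \<open>q:pols E\<close>] evl by simp
 hence "a \<ominus> phi b = \<zero> \<or> ev a q = \<zero>"
  using integral[of "a \<ominus> phi b" "ev a q"] minus_closed[OF assms(2) closed[OF bE]]
   ev_closed[OF assms(2) \<open>q:pols E\<close>] by blast
 thus ?case
 proof
  assume "a \<ominus> phi b = \<zero>"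
  hence "a = phi b" using assms(2) closed[OF bE] by simp
  thus ?thesis using bE by blast
 next
  assume "ev a q = \<zero>"
  thus ?thesis using Suc(1)[OF _ \<open>q:pols E\<close> q0] Suc(2) \<open>pdeg p = Suc (pdeg q)\<close> by simp
 qed
qed

lemma algebraic_over_prime_field:
 assumes nf: "number_field W K" and ac: "algebraic_closure W K" and a: "a:carrier W"
 shows "EX p. set p <= generate_field W {} & p ~= [] & hd p ~= \<zero>\<^bsub>W\<^esub> & ring.eval W p a = \<zero>\<^bsub>W\<^esub>"
proof -
 interpret A: algebraic_closure W K by (rule ac)
 have K: "subfield K W" using nf by (simp add: number_field_def)
 have Q: "subfield (generate_field W {}) W" by (rule A.generate_field_is_subfield) simp
 have fd: "A.finite_dimension (generate_field W {}) (A.simple_extension K a)"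
  using A.telescopic_base_dim[OF Q K] nf A.finite_dimension_simple_extension[OF K a] A.algebraic_extension[OF a]
   by (simp add: number_field_def)
 obtain p where "p:carrier ((generate_field W {}) [X]\<^bsub>W\<^esub>)" "p ~= []" "A.eval p a = \<zero>\<^bsub>W\<^esub>"
  using A.algebraicE[OF subfieldE(1)[OF Q] a] A.finite_dimension_imp_algebraic[OF Q _ fd] A.simple_extension_mem[OF
   subfieldE(1)[OF K] a] A.simple_extension_is_subring[OF subfieldE(1)[OF K] a] by auto
 thus ?thesis unfolding univ_poly_carrier[symmetric] polynomial_def by auto
qed

lemma (in complex_hom) image_subfield: "subfield (phi ` E) R"
proof (rule subfieldI')
 show "subring (phi ` E) R"
 proof (rule subringI)
  show "phi ` E <= carrier R" using closed by auto
  show "\<one>:phi ` E" using one E' by (metis imageI)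
  fix x assume "x:phi ` E"
  then obtain x' where x: "x':E" "x = phi x'" by auto
  thus "\<ominus> x:phi ` E" using neg E' by (metis imageI)
  fix y assume "y:phi ` E"
  then obtain y' where y: "y':E" "y = phi y'" by auto
  show "x \<otimes> y:phi ` E" "x \<oplus> y:phi ` E"
   using x y mult[OF x(1) y(1)] add[OF x(1) y(1)] E'(4,6)[OF x(1) y(1)] by (metis imageI)+
 qed
 fix k assume "k:phi ` E - {\<zero>}"
 then obtain x where x: "x:E" "k = phi x" "x ~= 0" using zero by auto
 thus "inv k:phi ` E" using hom_inverse E' by (metis imageI)
qed

theorem embedding_exists:
 assumes nf: "number_field W K" and ac: "algebraic_closure W K"
 shows "EX E phi. complex_hom W E phi & alg_closed_in E & phi ` E = carrier W"
proof -
 interpret A: algebraic_closure W K by (rule ac)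
 \<comment> \<open>The seed of the extension: the integer multiples of 1. It satisfies the last
   clause of \<open>hom_graph\<close> because \<open>number_field\<close> includes characteristic
   0.\<close>
 define r0 where "r0 = {(of_int n :: complex, [n] \<cdot>\<^bsub>W\<^esub> \<one>\<^bsub>W\<^esub>) | n::int. True}"
 have char: "[n] \<cdot>\<^bsub>W\<^esub> \<one>\<^bsub>W\<^esub> = \<zero>\<^bsub>W\<^esub> <-> n = 0" for n :: int
 proof -
  have nat: "[m] \<cdot>\<^bsub>W\<^esub> \<one>\<^bsub>W\<^esub> ~= \<zero>\<^bsub>W\<^esub>" if "0 < m" for m :: nat
   using nf that by (auto simp: number_field_def)
  show ?thesis
  proof (cases n rule: int_cases3)
   case zero thus ?thesis by (simp add: add_pow_def)
  next
   case (pos m) thus ?thesis using nat by (simp add: add_pow_def int_pow_int)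
  next
   case (neg m)
   hence "[n] \<cdot>\<^bsub>W\<^esub> \<one>\<^bsub>W\<^esub> = \<ominus>\<^bsub>W\<^esub> ([m] \<cdot>\<^bsub>W\<^esub> \<one>\<^bsub>W\<^esub>)"
    using A.add.int_pow_neg_int by simp
   moreover have "\<ominus>\<^bsub>W\<^esub> z ~= \<zero>\<^bsub>W\<^esub>" if "z:carrier W" "z ~= \<zero>\<^bsub>W\<^esub>" for z
    using that by auto
   ultimately show ?thesis using nat neg by simp
  qed
 qed
 have "hom_graph W r0"
  unfolding hom_graph_def
 proof (intro conjI allI impI)
  show "r0 <= UNIV \<times> carrier W" "(1, \<one>\<^bsub>W\<^esub>):r0" by (auto simp: r0_def)
  show "x = 0 <-> y = \<zero>\<^bsub>W\<^esub>" if xy: "(x, y):r0" for x y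
  using xy char by (fastforce simp: r0_def)
  fix x y x' y' assume "(x, y):r0" "(x', y'):r0"
  then obtain n m :: int where nm: "x = of_int n" "y = [n] \<cdot>\<^bsub>W\<^esub> \<one>\<^bsub>W\<^esub>" "x' = of_int m"
   "y' = [m] \<cdot>\<^bsub>W\<^esub> \<one>\<^bsub>W\<^esub>"
   unfolding r0_def by auto
  have "y \<ominus>\<^bsub>W\<^esub> y' = [(n - m)] \<cdot>\<^bsub>W\<^esub> \<one>\<^bsub>W\<^esub>"
   unfolding nm a_minus_def using A.add.int_pow_diff by simp
  thus "(x - x', y \<ominus>\<^bsub>W\<^esub> y'):r0" using nm unfolding r0_def
   by (metis (mono_tags, lifting) mem_Collect_eq of_int_diff)
  have "y \<otimes>\<^bsub>W\<^esub> y' = [(n * m)] \<cdot>\<^bsub>W\<^esub> \<one>\<^bsub>W\<^esub>"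
   using A.add_pow_ldistr_int A.add.int_pow_pow nm by (simp add: mult.commute)
  thus "(x * x', y \<otimes>\<^bsub>W\<^esub> y'):r0" using nm unfolding r0_def
   by (metis (mono_tags, lifting) mem_Collect_eq of_int_mult)
 qed
 then obtain E phi where h: "complex_hom W E phi" "alg_closed_in E"
  by (rule A.maximal_extension[OF A.algebraically_closed_axioms])
 interpret h: complex_hom W E phi by (rule h)
 have "generate_field W {} <= phi ` E"
  by (rule A.generate_field_min_subfield1[OF _ h.image_subfield]) auto
 have "a:phi ` E" if a: "a:carrier W" for a
 proof -
  obtain P where P: "set P <= generate_field W {}" "P ~= []" "hd P ~= \<zero>\<^bsub>W\<^esub>"
   "A.eval P a = \<zero>\<^bsub>W\<^esub>"
   using algebraic_over_prime_field[OF nf ac a] by auto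
  define g where "g = inv_into E phi"
  have g: "g x:E" "phi (g x) = x" if "x:set P" for x
   using that P \<open>generate_field W {} <= phi ` E\<close> by (auto simp: g_def inv_into_into f_inv_into_f)
  define p where "p = Poly (rev (map g P))"
  have "g (hd P) ~= 0" using g[of "hd P"] P h.zero by auto
  hence cp: "coeffs p = rev (map g P)" by (cases P) (auto simp: p_def coeffs_Poly strip_while_def)
  have "p:pols E"
  proof (rule polys_overI)
   fix i show "pcf p i:E"
    using g h.E' nth_mem[of i "rev (map g P)"] by (auto simp: p_def nth_default_def)
  qed
  moreover have "p ~= 0" using cp P by auto
  moreover have "map phi (rev (coeffs p)) = P" using g by (simp add: cp map_idI)
  ultimately show ?thesis
   using h.range_algebraic[OF h(2) a] h.ev_eval[OF a] P by auto
 qed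
 thus ?thesis using h h.closed by auto
qed

section \<open>Galois theory inside the complex numbers\<close>

definition chom :: "complex set => (complex => complex) => bool" where
 "chom L s <-> s 1 = 1 & (ALL x:L. ALL y:L. s (x + y) = s x + s y & s (x * y) = s x * s y)"

lemma chomD:
 assumes s: "chom L s" and L: "csub L"
 shows "s 1 = 1" "s 0 = 0" "!!x y. x:L ==> y:L ==> s (x + y) = s x + s y"
  "!!x y. x:L ==> y:L ==> s (x * y) = s x * s y" "!!x. x:L ==> s (- x) = - s x"
  "!!x y. x:L ==> y:L ==> s (x - y) = s x - s y" "!!x. x:L ==> s x = 0 <-> x = 0"
  "!!x. x:L ==> s (inverse x) = inverse (s x)" "!!x n. x:L ==> s (x ^ n) = s x ^ n"
  "!!p x. p:pols L ==> x:L ==> (!!i. s (pcf p i) = pcf p i) ==> s (poly p x) = poly p (s x)"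
  "inj_on s L"
proof -
 note L' = csubD[OF L]
 show 1: "s 1 = 1" and add: "!!x y. x:L ==> y:L ==> s (x + y) = s x + s y"
  and mult: "!!x y. x:L ==> y:L ==> s (x * y) = s x * s y" using s by (auto simp: chom_def)
 show 0: "s 0 = 0" using add[of 0 0] L' by simp
 show neg: "s (- x) = - s x" if "x:L" for x
  using add[of x "- x"] that L' 0 by (simp add: eq_neg_iff_add_eq_0 add.commute)
 show diff: "s (x - y) = s x - s y" if "x:L" "y:L" for x y
  using add[of x "- y"] that L' neg by simp
 show nz: "s x = 0 <-> x = 0" if "x:L" for x
  using mult[of x "inverse x"] that L' 0 1 by (cases "x = 0") auto
 show "s (inverse x) = inverse (s x)" if "x:L" for x
 proof (cases "x = 0")
  case False
  thus ?thesis using mult[of x "inverse x"] that L' 1 inverse_unique by fastforce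
 qed (simp add: 0)
 show "s (x ^ n) = s x ^ n" if "x:L" for x n
  by (induction n) (use that mult csub_power[OF L that] 1 in auto)
 show "p:pols L ==> x:L ==> (!!i. s (pcf p i) = pcf p i) ==> s (poly p x) = poly p (s x)" for p x
 proof (induction p)
  case 0 thus ?case by simp
 next
  case (pCons c p)
  have c: "c:L" "p:pols L" and fc: "s c = c" "!!i. s (pcf p i) = pcf p i"
   using pCons.prems pols_simps[OF L] pCons.prems(3)[of 0] pCons.prems(3)[of "Suc _"] by auto
  show ?case using pCons.IH[OF c(2) pCons.prems(2) fc(2)] fc add mult pCons.prems c L' pols_simps(9)[OF L c(2) pCons.prems(2)]
   by simp
 qed
 show "inj_on s L" using diff nz L' by (intro inj_onI) (metis right_minus_eq)
qed

definition cgal :: "complex set => complex set => (complex => complex) set" where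
 "cgal L K = {s:extensional L. chom L s & s ` L = L & (ALL x:K. s x = x)}"

lemma cgalD:
 assumes "s:cgal L K"
 shows "chom L s" "s ` L = L" "!!x. x:K ==> s x = x" "!!x. x:L ==> s x:L" "s:extensional L"
 using assms by (auto simp: cgal_def)

lemma cgal_restrictI:
 assumes "csub L" "chom L s" "s ` L = L" "!!x. x:K ==> s x = x" "K <= L"
 shows "restrict s L:cgal L K"
proof -
 have "restrict s L ` L = L" using assms by simp
 moreover have "chom L (restrict s L)" using assms(2) csubD[OF assms(1)] by (auto simp: chom_def)
 ultimately show ?thesis using assms by (auto simp: cgal_def)
qed

lemma cgal_eqI: "s:cgal L K ==> t:cgal L K ==> (!!x. x:L ==> s x = t x) ==> s = t"
 using extensionalityI[of s L t] cgalD by simp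

lemma cgal_id: assumes "csub L" "K <= L" shows "restrict id L:cgal L K"
 by (rule cgal_restrictI[OF assms(1) _ _ _ assms(2)]) (auto simp: chom_def)

lemma cgal_compose:
 assumes "csub L" "K <= L" "s:cgal L K" "t:cgal L K"
 shows "compose L s t:cgal L K"
proof -
 note s = cgalD[OF assms(3)] and t = cgalD[OF assms(4)]
 have "chom L (s \<circ> t)" using chomD[OF s(1) assms(1)] chomD[OF t(1) assms(1)] t(4) by (auto simp: chom_def)
 moreover have "(s \<circ> t) ` L = L" unfolding image_comp[symmetric] using s t by simp
 ultimately have "restrict (s \<circ> t) L:cgal L K"
  using s t by (intro cgal_restrictI assms) auto
 thus ?thesis by (simp add: compose_def comp_def)
qed

lemma cgal_inverse:
 assumes L: "csub L" "K <= L" and "s:cgal L K"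
 shows "EX t:cgal L K. ALL x:L. s (t x) = x & t (s x) = x"
proof -
 note s = cgalD[OF assms(3)] and sh = chomD[OF cgalD(1)[OF assms(3)] L(1)] and L' = csubD[OF L(1)]
 define t where "t = inv_into L s"
 have st: "s (t x) = x" "t x:L" if "x:L" for x
  using that s by (auto simp: t_def f_inv_into_f inv_into_into)
 have ts: "t (s x) = x" if "x:L" for x using that sh by (simp add: t_def)
 have "t 1 = 1" using ts[of 1] sh L' by simp
 moreover have "t (x + y) = t x + t y" "t (x * y) = t x * t y" if "x:L" "y:L" for x y
  using ts[of "t x + t y"] ts[of "t x * t y"] that st sh(3,4) L' by auto
 ultimately have "chom L t" by (simp add: chom_def)
 moreover have "t ` L = L"
 proof
  show "t ` L <= L" using st by auto
  show "L <= t ` L"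
  proof
   fix x assume "x:L"
   hence "x = t (s x)" "s x:L" using ts s by auto
   thus "x:t ` L" by simp
  qed
 qed
 moreover have "t x = x" if "x:K" for x using ts[of x] s(3)[OF that] that L by auto
 ultimately have "restrict t L:cgal L K" using L by (intro cgal_restrictI) auto
 thus ?thesis using st ts s by (intro bexI[of _ "restrict t L"]) auto
qed

definition cgalois :: "complex set => complex set => bool" where
 "cgalois K L <-> csub K & csub L & K <= L & finite (cgal L K) &
   (ALL x:L. (ALL s:cgal L K. s x = x) --> x:K)"

lemma coeff_prod_linear_hom:
 assumes L: "csub L" and t: "chom L t" and f: "!!s. s:S ==> f s:L" and fin: "finite S"
 shows "(\<Prod>s\<in>S. [:- f s, 1:]):pols L &
  (ALL i. t (pcf (\<Prod>s\<in>S. [:- f s, 1:]) i) = pcf (\<Prod>s\<in>S. [:- t (f s), 1:]) i)"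
 using fin f
proof (induction S)
 case empty
 thus ?case using chomD[OF t L] pols_simps[OF L] by simp
next
 case (insert a S)
 note th = chomD[OF t L] and L' = csubD[OF L]
 let ?p = "\<Prod>s\<in>S. [:- f s, 1:]" and ?q = "\<Prod>s\<in>S. [:- t (f s), 1:]"
 have IH: "?p:pols L" "!!i. t (pcf ?p i) = pcf ?q i" and fa: "f a:L" using insert by auto
 have lin: "[:- f a, 1:]:pols L" using pols_simps[OF L] L' fa by simp
 have c: "pcf ?p i:L" for i using IH by (simp add: pols_def)
 have "t (pcf ([:- f a, 1:] * ?p) i) = pcf ([:- t (f a), 1:] * ?q) i" for i
  using c fa L' th IH by (cases i) (auto simp: coeff_pCons)
 thus ?case using insert pols_simps(6)[OF L lin IH(1)] by simp
qed

text \<open>The product runs over the group and not over the orbit, so this is the characteristic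
  polynomial of \<open>x\<close> and roots may repeat; its value at 0 is the norm up to
  sign.\<close>

definition orbit_poly :: "complex set => complex set => complex => complex poly" where
 "orbit_poly K L x = (\<Prod>s\<in>cgal L K. [:- s x, 1:])"

lemma cgal_compose_bij:
 assumes "csub L" "K <= L" "t:cgal L K"
 shows "bij_betw (compose L t) (cgal L K) (cgal L K)"
proof -
 obtain u where u: "u:cgal L K" "!!x. x:L ==> t (u x) = x" "!!x. x:L ==> u (t x) = x"
  using cgal_inverse[OF assms] by auto
 show ?thesis
 proof (rule bij_betw_byWitness[where f' = "compose L u"])
  show "ALL s:cgal L K. compose L u (compose L t s) = s"
  proof
   fix s assume s: "s:cgal L K"
   show "compose L u (compose L t s) = s"
    by (rule cgal_eqI[OF cgal_compose[OF assms(1,2) u(1) cgal_compose[OF assms s]] s]) (use u cgalD[OF s] in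
     \<open>simp add: compose_def\<close>)
  qed
  show "ALL s:cgal L K. compose L t (compose L u s) = s"
  proof
   fix s assume s: "s:cgal L K"
   show "compose L t (compose L u s) = s"
    by (rule cgal_eqI[OF cgal_compose[OF assms cgal_compose[OF assms(1,2) u(1) s]] s]) (use u cgalD[OF s] cgalD[OF u(1)] in
     \<open>simp add: compose_def\<close>)
  qed
 qed (use cgal_compose[OF assms(1,2)] assms(3) u(1) in auto)
qed

lemma orbit_poly:
 assumes G: "cgalois K L" and x: "x:L"
 shows "orbit_poly K L x:pols K" "orbit_poly K L x ~= 0" "poly (orbit_poly K L x) x = 0"
  "poly (orbit_poly K L x) y = 0 <-> (EX s:cgal L K. y = s x)"
proof -
 have g: "csub K" "csub L" "K <= L" "finite (cgal L K)" "!!x. x:L ==> (!!s. s:cgal L K ==> s x = x) ==> x:K"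
  using G by (auto simp: cgalois_def)
 show "orbit_poly K L x ~= 0" using g by (simp add: orbit_poly_def)
 show r: "poly (orbit_poly K L x) y = 0 <-> (EX s:cgal L K. y = s x)" for y
  using g by (simp add: orbit_poly_def poly_prod)
 show "poly (orbit_poly K L x) x = 0" unfolding r using cgal_id[OF g(2,3)] x by (intro bexI[of _ "restrict id L"]) auto
 have sx: "s x:L" if "s:cgal L K" for s using cgalD(4)[OF that x] .
 have "pcf (orbit_poly K L x) i:K" for i
 proof (rule g(5))
  show "pcf (orbit_poly K L x) i:L"
   using coeff_prod_linear_hom[OF g(2) cgalD(1)[OF cgal_id[OF g(2,3)]] _ g(4)] sx by (simp add: orbit_poly_def pols_def)
  fix t assume t: "t:cgal L K"
  have "t (pcf (orbit_poly K L x) i) = pcf (\<Prod>s\<in>cgal L K. [:- t (s x), 1:]) i"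
   using coeff_prod_linear_hom[OF g(2) cgalD(1)[OF t] _ g(4)] sx by (simp add: orbit_poly_def)
  also have "(\<Prod>s\<in>cgal L K. [:- t (s x), 1:]) = (\<Prod>s\<in>cgal L K. [:- compose L t s x, 1:])"
   using x by (simp add: compose_def)
  also have "\<dots> = orbit_poly K L x"
   unfolding orbit_poly_def by (rule prod.reindex_bij_betw[OF cgal_compose_bij[OF g(2,3) t]])
  finally show "t (pcf (orbit_poly K L x) i) = pcf (orbit_poly K L x) i" .
 qed
 thus "orbit_poly K L x:pols K" by (simp add: pols_def)
qed

lemma hom_image_in_orbit:
 assumes G: "cgalois K L" and M: "csub M" "K <= M" and s: "chom M s" "!!x. x:K ==> s x = x"
  and x: "x:L" "x:M"
 shows "EX t:cgal L K. s x = t x"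
proof -
 have K: "csub K" using G by (simp add: cgalois_def)
 note o = orbit_poly[OF G x(1)]
 have "s (poly (orbit_poly K L x) x) = poly (orbit_poly K L x) (s x)"
  using o s x M by (intro chomD(10)[OF s(1) M(1)]) (auto simp: pols_def)
 thus ?thesis using o o chomD[OF s(1) M(1)] by simp
qed

text \<open>An additive group is not a finite union of proper subgroups on which maps agree, because a line
 \<open>y + n x\<close> meets each agreement set in at most one point.\<close>

lemma additive_agreement:
 fixes M :: "complex set"
 assumes fin: "finite R" and M: "csub M"
  and r: "!!r x y. r:insert \<sigma> R ==> x:M ==> y:M ==> r (x + y) = (r x :: complex) + r y"
  and ex: "!!x. x:M ==> EX r:R. \<sigma> x = r x"
 shows "EX r:R. ALL x:M. \<sigma> x = r x"
 using fin r ex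
proof (induction R)
 case empty thus ?case using csubD[OF M] by simp
next
 case (insert r1 R)
 note M' = csubD[OF M]
 show ?case
 proof (cases "ALL x:M. EX r:R. \<sigma> x = r x")
  case True
  have "EX r:R. ALL x:M. \<sigma> x = r x" by (rule insert.IH) (use insert.prems True in auto)
  thus ?thesis by simp
 next
  case False
  then obtain x where x: "x:M" "!!r. r:R ==> \<sigma> x ~= r x" by auto
  hence x1: "\<sigma> x = r1 x" using insert.prems(2) by auto
  have mult: "r (y + of_nat n * x) = r y + of_nat n * r x" "of_nat n * x:M"
   if "r:insert \<sigma> (insert r1 R)" "y:M" for r y n
  proof -
   show m: "of_nat n * x:M" for n using x M' csub_of_nat[OF M] by simp
   show "r (y + of_nat n * x) = r y + of_nat n * r x"
   proof (induction n)
    case (Suc n)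
    show ?case using Suc insert.prems(1)[OF that(1)] that m x M' by (simp add: algebra_simps)
   qed simp
  qed
  have "\<sigma> y = r1 y" if y: "y:M" for y
  proof (rule ccontr)
   assume ne: "\<sigma> y ~= r1 y"
   have "EX r:R. \<sigma> (y + of_nat n * x) = r (y + of_nat n * x)" for n
   proof -
    have "y + of_nat n * x:M" using y mult[of \<sigma> y] M' by simp
    then obtain r where "r:insert r1 R" "\<sigma> (y + of_nat n * x) = r (y + of_nat n * x)"
     using insert.prems(2) by auto
    moreover hence "r ~= r1" using ne x1 mult[of \<sigma> y n] mult[of r1 y n] y by auto
    ultimately show ?thesis by auto
   qed
   then obtain g where g: "!!n::nat. g n:R" "!!n. \<sigma> (y + of_nat n * x) = g n (y + of_nat n * x)" by metis
   \<comment> \<open>If one \<open>r\<close> in \<open>R\<close> agreed with \<open>\<sigma>\<close>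
     at two points of the line y + n x, it would agree at x, against the choice of x. So infinitely
     many n would require infinitely many members of the finite \<open>R\<close>.\<close>
   have "inj g"
   proof (rule injI)
    fix m n assume mn: "g m = g n"
    have "\<sigma> y + of_nat n * \<sigma> x = g n y + of_nat n * g n x"
     "\<sigma> y + of_nat m * \<sigma> x = g n y + of_nat m * g n x"
     using g g mn mult mult g y by auto
    moreover have "b - d = c - a" if "a + b = c + d" for a b c d :: complex
     using that by (simp add: algebra_simps)
    ultimately have "of_nat n * (\<sigma> x - g n x) = g n y - \<sigma> y" "of_nat m * (\<sigma> x - g n x) = g n y - \<sigma> y"
     unfolding right_diff_distrib by auto
    hence "(of_nat n - of_nat m) * (\<sigma> x - g n x) = 0" by (simp add: left_diff_distrib)
    thus "m = n" using x(2)[OF g(1)[of n]] by simp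
   qed
   moreover have "finite (range g)" using g insert finite_subset[of "range g" R] by auto
   ultimately show False using finite_imageD by auto
  qed
  thus ?thesis by simp
 qed
qed

text \<open>Each value s x is a conjugate of x, but the conjugating automorphism might depend on x;
  \<open>additive_agreement\<close> makes it uniform and does the work of a primitive
  element.\<close>

lemma galois_lift:
 assumes GL: "cgalois K L" and GM: "csub M" "K <= M" "M <= L" and s: "chom M s" "!!x. x:K ==> s x = x"
 shows "EX t:cgal L K. ALL x:M. s x = t x"
proof (rule additive_agreement)
 show "finite (cgal L K)" using GL by (simp add: cgalois_def)
 have L: "csub L" using GL by (simp add: cgalois_def)
 show "r (x + y) = r x + r y" if "r:insert s (cgal L K)" "x:M" "y:M" for r x y
  using that chomD(3)[OF s(1) GM(1)] chomD(3)[OF cgalD(1) L] GM by blast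
qed (use hom_image_in_orbit[OF GL GM(1,2) s] GM in auto)

lemma galois_stable:
 assumes GM: "cgalois K M" and L: "csub L" "M <= L" and s: "s:cgal L K"
 shows "restrict s M:cgal M K"
proof -
 have M: "csub M" "K <= M" "csub K" using GM by (auto simp: cgalois_def)
 have sM: "chom N s'" if "chom L s'" "N <= L" for s' N using that by (auto simp: chom_def)
 have st: "t x:M" if "t:cgal L K" "x:M" for t x
  using hom_image_in_orbit[OF GM M(1,2) sM[OF cgalD(1)[OF that(1)] L(2)] cgalD(3)[OF that(1)] that(2,2)] cgalD that by auto
 obtain t where t: "t:cgal L K" "!!x. x:L ==> s (t x) = x" using cgal_inverse[OF L(1) _ s] M L by blast
 have "s ` M = M"
 proof
  show "s ` M <= M" using st[OF s] by auto
  show "M <= s ` M"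
  proof
   fix x assume x: "x:M"
   hence "x = s (t x)" using t L by auto
   thus "x:s ` M" using st[OF t(1) x] by simp
  qed
 qed
 thus ?thesis using sM[OF cgalD(1)[OF s] L(2)] cgalD[OF s] M by (intro cgal_restrictI) auto
qed

section \<open>Normal extensions inside the field of algebraic numbers\<close>

lemma csub_Rats: "csub \<rat>"
 by (auto simp: csub_def)

lemma Rats_subset: "csub F ==> \<rat> <= F"
 by (auto elim!: Rats_cases' simp: csubD csub_of_int)

lemma pols_mono: "K <= L ==> pols K <= pols L"
 by (auto simp: pols_def)

text \<open>Separability in characteristic 0: by minimality f' does not vanish at \<open>x\<close>,
  and f'(x) is the value at \<open>x\<close> of f / (X - x). So every root of this quotient differs
  from \<open>x\<close>, and it has a root because its degree is positive when \<open>x\<close> lies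
  outside \<open>M\<close>.\<close>

lemma min_poly_other_root:
 assumes M: "csub M" and x: "x ~: M" and f: "min_poly M x f"
 obtains y where "y ~= x" "poly f y = 0"
proof -
 have f': "f:pols M" "plc f = 1" "poly f x = 0" "0 < pdeg f"
  "!!g. g:pols M ==> g ~= 0 ==> poly g x = 0 ==> pdeg f <= pdeg g"
  using f by (auto simp: min_poly_def)
 define q where "q = synthetic_div f x"
 have fq: "f = [:- x, 1:] * q" using synthetic_div_correct'[of x f] f' by (simp add: q_def)
 have df: "pdeg f = Suc (pdeg q)" using f' unfolding fq by (subst degree_mult_eq) auto
 have "pdeg q ~= 0"
 proof
  assume "pdeg q = 0"
  then obtain c where c: "q = [:c:]" by (metis degree_eq_zeroE)
  hence "pcf f 0 = - x * c" "pcf f 1 = c" by (simp_all add: fq)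
  moreover have "pcf f 1 = 1" using f' df c by simp
  ultimately have "pcf f 0 = - x" by simp
  moreover have "pcf f 0:M" using f' by (simp add: pols_def)
  ultimately show False using x csubD[OF M] by fastforce
 qed
 then obtain y where y: "poly q y = 0" using fundamental_theorem_of_algebra constant_degree[of q] by auto
 have "pderiv f:pols M"
  using f' csub_of_nat[OF M] csubD[OF M] unfolding pols_def by (auto simp: coeff_pderiv simp del: of_nat_Suc)
 moreover have "pderiv f ~= 0" "pdeg (pderiv f) < pdeg f"
  using f' by (auto simp: pderiv_eq_0_iff degree_pderiv)
 ultimately have "poly (pderiv f) x ~= 0" using f' by (meson leD)
 moreover have "poly (pderiv f) x = poly q x" unfolding fq pderiv_mult by (simp add: pderiv_pCons)
 ultimately show thesis using that[of y] y fq by auto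
qed

text \<open>\<open>E\<close> is the field of all algebraic numbers and \<open>phi\<close> an
  isomorphism onto the ambient field. Its inverse \<open>h\<close> carries every field in question
  to a subfield of the complex numbers.\<close>

locale algnum = complex_hom +
 assumes alg_closed: "alg_closed_in E" and surj: "phi ` E = carrier R" and ac: "algebraically_closed R"
  and algebraic: "z:E ==> EX p. p:pols \<rat> & p ~= 0 & poly p z = 0"
begin

definition h :: "'a => complex" where "h = inv_into E phi"

lemma h: "x:carrier R ==> h x:E" "x:carrier R ==> phi (h x) = x" "z:E ==> h (phi z) = z"
 using surj inj by (auto simp: h_def inv_into_into f_inv_into_f)

lemma h_simps:
 "h \<one> = 1" "h \<zero> = 0" "x:carrier R ==> y:carrier R ==> h (x \<oplus> y) = h x + h y"
 "x:carrier R ==> y:carrier R ==> h (x \<otimes> y) = h x * h y"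
 "x:carrier R ==> h (\<ominus> x) = - h x"
 "x:carrier R ==> y:carrier R ==> h (x \<ominus> y) = h x - h y"
 "x:carrier R ==> x ~= \<zero> ==> h (inv x) = inverse (h x)"
 "x:carrier R ==> h x = 0 <-> x = \<zero>"
 "x:carrier R ==> y:carrier R ==> h x = h y <-> x = y"
proof -
 have k: "h y = z" if "z:E" "phi z = y" for y z using h that by auto
 show "h \<one> = 1" "h \<zero> = 0" "x:carrier R ==> y:carrier R ==> h (x \<oplus> y) = h x + h y"
  "x:carrier R ==> y:carrier R ==> h (x \<otimes> y) = h x * h y" "x:carrier R ==> h (\<ominus> x) = - h x"
   "x:carrier R ==> y:carrier R ==> h (x \<ominus> y) = h x - h y" using k one zero by (auto simp: h E' add mult neg diff)
 show inj: "x:carrier R ==> y:carrier R ==> h x = h y <-> x = y" for x y by (metis h)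
 show z: "x:carrier R ==> h x = 0 <-> x = \<zero>" using inj[of x \<zero>] \<open>h \<zero> = 0\<close> by simp
 show "x:carrier R ==> x ~= \<zero> ==> h (inv x) = inverse (h x)"
  using z h hom_inverse E' by (intro k) auto
qed

lemma subfield_image:
 assumes "subfield F R" shows "csub (h ` F)" "h ` F <= E" "phi ` h ` F = F"
proof -
 have F: "F <= carrier R" using subfieldE(3)[OF assms] .
 note s = subringE[OF subfieldE(1)[OF assms]]
 show "h ` F <= E" using F h by auto
 have "phi ` h ` F = (%x. x) ` F" unfolding image_image by (rule image_cong) (use F h in auto)
 thus "phi ` h ` F = F" by simp
 show "csub (h ` F)"
  unfolding csub_def
 proof (intro conjI ballI)
  show "1:h ` F" using h_simps s by simp
  fix x assume "x:h ` F"
  then obtain x' where x: "x':F" "x = h x'" by auto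
  show "inverse x:h ` F"
  proof (cases "x' = \<zero>")
   case True thus ?thesis using x h_simps(2) by simp
  next
   case False
   hence "inv x':F" using subfield_m_inv[OF assms] x by simp
   thus ?thesis using h_simps(7) x F False by (metis imageI subsetD)
  qed
  fix y assume "y:h ` F"
  then obtain y' where y: "y':F" "y = h y'" by auto
  have "x - y = h (x' \<ominus> y')" "x * y = h (x' \<otimes> y')" using x y subsetD[OF F] h_simps by auto
  moreover have "x' \<ominus> y':F" "x' \<otimes> y':F" using x y s by (auto simp: a_minus_def)
  ultimately show "x - y:h ` F" "x * y:h ` F" by auto
 qed
qed

lemma subhom: "csub F ==> F <= E ==> complex_hom R F phi"
 by unfold_locales (simp_all add: closed one add mult subsetD)

lemma subfield_image': "csub F ==> F <= E ==> subfield (phi ` F) R" "F <= E ==> h ` phi ` F = F"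
proof -
 show "csub F ==> F <= E ==> subfield (phi ` F) R" by (rule complex_hom.image_subfield[OF subhom])
 assume F: "F <= E"
 have "h ` phi ` F = (%x. x) ` F" unfolding image_image by (rule image_cong) (use F h in auto)
 thus "h ` phi ` F = F" by simp
qed

lemma csub_Int: "csub F ==> csub (F Int E)"
 using E by (auto simp: csub_def)

text \<open>Extend \<open>phi\<close> from \<open>M\<close> to M[x] by sending x to
  \<open>phi y\<close>, and then maximally. The resulting domain contains all algebraic numbers,
  hence \<open>E\<close>, and composing with \<open>h\<close> leads back into
  \<open>E\<close>.\<close>

lemma hom_extends:
 assumes M: "csub M" "M <= E" and f: "min_poly M x f" and y: "y:E" "poly f y = 0"
 shows "EX s. chom E s & s ` E <= E & (ALL z:M. s z = z) & s x = y"
proof -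
 interpret M: complex_hom R M phi by (rule subhom[OF M])
 have f': "f:pols M" "plc f = 1" "poly f x = 0"
  "!!g. g:pols M ==> g ~= 0 ==> poly g x = 0 ==> pdeg f <= pdeg g"
  using f by (auto simp: min_poly_def)
 have "p:pols M ==> M.ev (phi y) p = phi (poly p y)" for p
 proof (induction p)
  case 0 thus ?case by (simp add: M.ev_0 closed y zero)
 next
  case (pCons c p)
  have c: "c:E" "p:pols M" "poly p y:E"
   using pCons.prems M pols_simps[OF M(1)] pols_mono[OF M(2)] pols_simps(9)[OF E _ y(1)] by auto
  thus ?case using pCons.IH[OF c(2)] y E'(6)[OF y(1) c(3)] by (simp add: M.ev_pCons closed mult add)
 qed
 hence root: "M.ev (phi y) f = \<zero>" using f' y zero by simp
 have "hom_graph R {(poly p x, M.ev (phi y) p) | p. p:pols M}"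
  by (rule M.extension_graph[OF closed[OF y(1)] f' root])
 then obtain F \<psi> where psi: "complex_hom R F \<psi>" "alg_closed_in F"
  "!!a b. (a, b):{(poly p x, M.ev (phi y) p) | p. p:pols M} ==> a:F & \<psi> a = b"
  by (rule maximal_extension[OF ac]) blast
 interpret P: complex_hom R F \<psi> by (rule psi)
 have fixM: "z:F & \<psi> z = phi z" if "z:M" for z
  using psi(3)[OF subsetD[OF M.extension_graph_mono(1)[OF closed[OF y(1)]]]] that by simp
 have "E <= F"
 proof
  fix z assume "z:E"
  then obtain p where p: "p:pols \<rat>" "p ~= 0" "poly p z = 0" using algebraic by auto
  thus "z:F" using psi pols_mono[OF Rats_subset[OF P.E]] unfolding alg_closed_in_def by auto
 qed
 hence c: "\<psi> z:carrier R" if "z:E" for z using P.closed that by auto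
 have "chom E (h \<circ> \<psi>)"
  unfolding chom_def using \<open>E <= F\<close> c P.one h_simps P.add P.mult by (auto simp: subset_iff)
 moreover have "(h \<circ> \<psi>) ` E <= E" using c h by auto
 moreover have "ALL z:M. (h \<circ> \<psi>) z = z" using fixM M h by auto
 moreover have "(h \<circ> \<psi>) x = y" using h y psi(3)[OF M.extension_graph_mono(2)[OF closed[OF y(1)]]] by simp
 ultimately show ?thesis by blast
qed

text \<open>A nonzero rational polynomial with root y has finitely many roots in \<open>L\<close>;
  \<open>s\<close> maps this finite set injectively into itself, hence onto.\<close>

lemma chom_surj:
 assumes L: "csub L" "L <= E" and s: "chom L s" "s ` L <= L"
 shows "s ` L = L"
proof
 show "L <= s ` L"
 proof
  fix y assume y: "y:L"
  then obtain p where p: "p:pols \<rat>" "p ~= 0" "poly p y = 0" using algebraic L by auto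
  have fixed: "s x = x" if "x:\<rat>" for x
  proof -
   have n: "s (of_nat n) = of_nat n" for n
    by (induction n) (auto simp: chomD(1,2)[OF s(1) L(1)] chomD(3)[OF s(1) L(1)] csubD[OF L(1)] csub_of_nat[OF L(1)])
   have z: "s (of_int n) = of_int n" for n :: int
    by (cases n rule: int_cases2) (auto simp: n chomD(5)[OF s(1) L(1)] csub_of_nat[OF L(1)])
   from that show ?thesis
    by (elim Rats_cases')
     (simp add: divide_inverse z chomD(4,8)[OF s(1) L(1)] csub_of_int[OF L(1)] csubD(7)[OF L(1)])
  qed
  define Z where "Z = {z:L. poly p z = 0}"
  have "finite Z" unfolding Z_def using poly_roots_finite[OF p(2)] by simp
  moreover have "s ` Z <= Z"
  proof
   fix w assume "w:s ` Z"
   then obtain z where z: "z:L" "poly p z = 0" "w = s z" by (auto simp: Z_def)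
   have "poly p w = s (poly p z)" unfolding z(3) by (rule chomD(10)[OF s(1) L(1) _ z(1), symmetric]) (use p fixed pols_mono[OF
    Rats_subset[OF L(1)]] in \<open>auto simp: pols_def\<close>)
   thus "w:Z" using z chomD[OF s(1) L(1)] s by (auto simp: Z_def)
  qed
  moreover have "inj_on s Z" using chomD(11)[OF s(1) L(1)] by (rule inj_on_subset) (auto simp: Z_def)
  ultimately have "s ` Z = Z" by (rule endo_inj_surj)
  thus "y:s ` L" using y p by (auto simp: Z_def)
 qed
qed (rule s(2))

text \<open>An element x outside \<open>M\<close> has a second conjugate y. An embedding of
  \<open>E\<close> over \<open>M\<close> taking x to y restricts to an automorphism of
  \<open>L\<close> by normality, and it moves x.\<close>

lemma normal_imp_galois:
 assumes M: "csub M" "M <= L" and L: "csub L" "L <= E" and fin: "finite (cgal L M)"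
  and normal: "!!s. chom L s ==> (ALL x:M. s x = x) ==> s ` L <= L"
 shows "cgalois M L"
proof -
 have "x:M" if x: "x:L" "ALL s:cgal L M. s x = x" for x
 proof (rule ccontr)
  assume nx: "x ~: M"
  obtain p where p: "p:pols \<rat>" "p ~= 0" "poly p x = 0" using algebraic x(1) L by auto
  then obtain f where f: "min_poly M x f" using minimal_polynomial_exists[OF M(1) _ p(2,3)] pols_mono[OF Rats_subset[OF M(1)]]
   by auto
  obtain y where y: "y ~= x" "poly f y = 0" by (rule min_poly_other_root[OF M(1) nx f])
  have ME: "M <= E" using M L by simp
  have yE: "y:E" using alg_closed y f pols_mono[OF ME] unfolding alg_closed_in_def by (auto simp: min_poly_def)
  obtain s where s: "chom E s" "s ` E <= E" "ALL z:M. s z = z" "s x = y"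
   using hom_extends[OF M(1) ME f yE y(2)] by auto
  have sL: "chom L s" using s(1) L by (auto simp: chom_def)
  have "s ` L = L" by (rule chom_surj[OF L sL normal[OF sL s(3)]])
  hence "restrict s L:cgal L M" using s M by (intro cgal_restrictI[OF L(1) sL]) auto
  thus False using x s y by auto
 qed
 thus ?thesis using M L fin by (auto simp: cgalois_def)
qed

lemma galois_intermediate:
 assumes G: "cgalois K L" and L: "L <= E" and M: "csub M" "K <= M" "M <= L"
 shows "cgalois M L"
proof (rule normal_imp_galois[OF M(1,3) _ L])
 show L': "csub L" using G by (simp add: cgalois_def)
 have "cgal L M <= cgal L K" using M by (auto simp: cgal_def)
 thus "finite (cgal L M)" using G finite_subset by (auto simp: cgalois_def)
 show "s ` L <= L" if s: "chom L s" "ALL x:M. s x = x" for s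
 proof
  fix y assume "y:s ` L"
  then obtain x where x: "x:L" "y = s x" by auto
  have "EX t:cgal L K. s x = t x"
   by (rule hom_image_in_orbit[OF G L' _ s(1) _ x(1) x(1)]) (use s M in auto)
  thus "y:L" using x cgalD by auto
 qed
qed

text \<open>An automorphism is determined by the images of the generators \<open>Y\<close>, and each
  image is a root of a fixed rational polynomial.\<close>

lemma finite_cgal:
 assumes K: "K <= L" and L: "csub L" "L <= E" and Y: "finite Y" "Y <= L"
  and gen: "!!F. csub F ==> K <= F ==> Y <= F ==> L <= F" and Kf: "csub K"
 shows "finite (cgal L K)"
proof -
 have "ALL y:Y. EX p. p:pols \<rat> & p ~= 0 & poly p y = 0" using algebraic Y L by auto
 then obtain p where p: "!!y. y:Y ==> p y:pols \<rat> & p y ~= 0 & poly (p y) y = 0" by metis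
 let ?r = "%s. restrict s Y"
 have "?r ` cgal L K <= (\<Pi>\<^sub>E y\<in>Y. {z. poly (p y) z = 0})"
 proof (intro image_subsetI PiE_I)
  fix s y assume s: "s:cgal L K" and y: "y:Y"
  have "s c = c" if "c:\<rat>" for c using cgalD[OF s] Rats_subset[OF Kf] that by auto
  hence "s (poly (p y) y) = poly (p y) (s y)"
   using p[OF y] y Y Rats_subset[OF L(1)] by (intro chomD(10)[OF cgalD(1)[OF s] L(1)]) (auto simp: pols_def)
  thus "restrict s Y y:{z. poly (p y) z = 0}" using p[OF y] y chomD[OF cgalD(1)[OF s] L(1)] by simp
 qed auto
 moreover have "finite (\<Pi>\<^sub>E y\<in>Y. {z. poly (p y) z = 0})" using Y p by (intro finite_PiE poly_roots_finite) auto
 ultimately have "finite (?r ` cgal L K)" by (rule finite_subset)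
 moreover have "inj_on ?r (cgal L K)"
 proof (rule inj_onI)
  fix s t assume st: "s:cgal L K" "t:cgal L K" "?r s = ?r t"
  note sh = chomD[OF cgalD(1)[OF st(1)] L(1)] and th = chomD[OF cgalD(1)[OF st(2)] L(1)]
  have "csub {z:L. s z = t z}" using sh th csubD[OF L(1)] by (auto simp: csub_def)
  moreover have "s y = t y" if "y:Y" for y using st that by (metis restrict_apply')
  ultimately have "L <= {z:L. s z = t z}" using cgalD[OF st(1)] cgalD(3)[OF st(2)] K Y by (intro gen) auto
  thus "s = t" by (intro cgal_eqI[OF st(1,2)]) auto
 qed
 ultimately show ?thesis by (rule finite_imageD)
qed

abbreviation "alg_over F x == ((%F x. ~ ring.transcendental R F x) over F) x"

lemma Gal_iff:
 "rho:carrier (Gal R L K) <-> rho:extensional L & bij_betw rho L L & rho \<one> = \<one> &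
   (ALL x:L. ALL y:L. rho (x \<oplus> y) = rho x \<oplus> rho y & rho (x \<otimes> y) = rho x \<otimes> rho y) & (ALL x:K. rho x
    = x)"
proof -
 have "rho x:L" if "bij_betw rho L L" "x:L" for x using that by (auto simp: bij_betw_def)
 thus ?thesis by (auto simp: Aut_over_def Bij_def ring_hom_def)
qed

definition conj :: "'a set => ('a => 'a) => complex => complex" where
 "conj L rho = restrict (h \<circ> rho \<circ> phi) (h ` L)"

lemma conj_apply: "L <= carrier R ==> x:L ==> conj L rho (h x) = h (rho x)"
 by (simp add: conj_def h subset_iff)

lemma GalD:
 assumes "rho:carrier (Gal R L K)"
 shows "!!x. x:L ==> rho x:L" "rho ` L = L" "!!x. x:K ==> rho x = x" "rho:extensional L" "rho \<one> = \<one>"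
  "!!x y. x:L ==> y:L ==> rho (x \<oplus> y) = rho x \<oplus> rho y"
  "!!x y. x:L ==> y:L ==> rho (x \<otimes> y) = rho x \<otimes> rho y" "inj_on rho L"
 using assms unfolding Gal_iff bij_betw_def by auto

lemma conj_in:
 assumes L: "subfield L R" "K <= L" and s: "rho:carrier (Gal R L K)"
 shows "conj L rho:cgal (h ` L) (h ` K)"
proof -
 have Lc: "L <= carrier R" using subfieldE(3)[OF L(1)] .
 note s' = GalD[OF s] and c = conj_apply[OF Lc]
 have cc: "x:carrier R" if "x:L" for x using that Lc by auto
 note sr = subringE[OF subfieldE(1)[OF L(1)]]
 have "chom (h ` L) (conj L rho)"
  unfolding chom_def
 proof (intro conjI ballI)
  show "conj L rho 1 = 1" using c[of \<one>] sr s' h_simps(1) by simp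
  fix x y assume "x:h ` L" "y:h ` L"
  then obtain x' y' where xy: "x':L" "y':L" "x = h x'" "y = h y'" by auto
  show "conj L rho (x + y) = conj L rho x + conj L rho y" "conj L rho (x * y) = conj L rho x * conj L rho y"
   using c[of "x' \<oplus> y'"] xy sr s' cc c h_simps(3) c[of "x' \<otimes> y'"] h_simps(4) by auto
 qed
 moreover have "conj L rho ` h ` L = h ` L"
 proof -
  have "conj L rho ` h ` L = h ` rho ` L" unfolding image_image by (rule image_cong) (simp_all add: c)
  thus ?thesis using s' by simp
 qed
 moreover have "conj L rho z = z" if "z:h ` K" for z
  using that c s' L by auto
 ultimately show ?thesis by (auto simp: cgal_def conj_def)
qed

lemma conj_inj: assumes "L <= carrier R" shows "inj_on (conj L) (carrier (Gal R L K))"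
proof (rule inj_onI)
 fix rho tau assume s: "rho:carrier (Gal R L K)" "tau:carrier (Gal R L K)" "conj L rho = conj L tau"
 show "rho = tau"
 proof (rule extensionalityI[OF GalD(4)[OF s(1)] GalD(4)[OF s(2)]])
  fix x assume x: "x:L"
  hence "h (rho x) = h (tau x)" using conj_apply[OF assms x] s by metis
  thus "rho x = tau x" using h_simps(9) GalD(1)[OF s(1) x] GalD(1)[OF s(2) x] assms by auto
 qed
qed

lemma conj_surj:
 assumes L: "subfield L R" "K <= L" and s: "s:cgal (h ` L) (h ` K)"
 shows "EX rho:carrier (Gal R L K). conj L rho = s"
proof -
 have Lc: "L <= carrier R" using subfieldE(3)[OF L(1)] .
 have cc: "x:carrier R" if "x:L" for x using that Lc by auto
 note sr = subringE[OF subfieldE(1)[OF L(1)]] and s' = cgalD[OF s]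
 note F = subfield_image[OF L(1)]
 note sh = chomD[OF s'(1) F(1)]
 define rho where "rho = restrict (phi \<circ> s \<circ> h) L"
 have hs: "h (rho x) = s (h x)" if "x:L" for x
  using that s'(4) F h(3) by (auto simp: rho_def)
 have sL: "rho x:L" if "x:L" for x
  using that s' F by (auto simp: rho_def)
 have eqI: "x = y" if "x:L" "y:L" "h x = h y" for x y using that h_simps cc by simp
 have "rho:carrier (Gal R L K)"
  unfolding Gal_iff
 proof (intro conjI ballI)
  show "rho:extensional L" by (simp add: rho_def)
  have "inj_on rho L" using sh(11) hs by (intro inj_onI) (metis eqI imageI inj_onD)
  moreover have "rho ` L = L"
  proof -
   have "rho ` L = phi ` s ` h ` L" unfolding image_image by (rule image_cong) (simp_all add: rho_def)
   thus ?thesis using s' F by simp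
  qed
  ultimately show "bij_betw rho L L" "rho \<one> = \<one>" using sr sh(1) h_simps one by (auto simp: bij_betw_def rho_def)
  show "rho x = x" if "x:K" for x
   using that L s' h(2)[OF cc] by (auto simp: rho_def)
  fix x y assume xy: "x:L" "y:L"
  show "rho (x \<oplus> y) = rho x \<oplus> rho y"
   by (rule eqI) (use xy sr sL hs cc h_simps(3) sh(3) in simp_all)
  show "rho (x \<otimes> y) = rho x \<otimes> rho y"
   by (rule eqI) (use xy sr sL hs cc h_simps(4) sh(4) in simp_all)
 qed
 moreover have "conj L rho = s"
 proof (rule extensionalityI[of _ "h ` L"])
  show "conj L rho:extensional (h ` L)" by (simp add: conj_def)
  show "s:extensional (h ` L)" by (rule s')
  show "conj L rho z = s z" if "z:h ` L" for z using that conj_apply[OF Lc] hs by auto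
 qed
 ultimately show ?thesis by auto
qed

lemma fixed_field_iff:
 assumes L: "subfield L R" "K <= L" and x: "x:L"
 shows "(ALL rho:carrier (Gal R L K). rho x = x) <-> (ALL s:cgal (h ` L) (h ` K). s (h x) = h x)"
proof -
 have Lc: "L <= carrier R" using subfieldE(3)[OF L(1)] .
 have e: "conj L rho (h x) = h x <-> rho x = x" if "rho:carrier (Gal R L K)" for rho
  using conj_apply[OF Lc x] h_simps(9) GalD(1)[OF that x] x Lc by auto
 show ?thesis using e conj_in[OF L] conj_surj[OF L] by metis
qed

lemma finite_extension_generators:
 assumes K: "subfield K R" and F: "F:finite_extensions R K"
 obtains Y where "finite Y" "Y <= F" "!!L. subfield L R ==> K <= L ==> Y <= L ==> F <= L"
proof -
 obtain n where "dimension n K F" using F by (auto simp: finite_extensions_def)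
 then obtain Us where Us: "set Us <= carrier R" "Span K Us = F" using exists_base[OF K] by auto
 have sub: "set Us <= F" using Span_base_incl[OF K Us(1)] Us by simp
 have inc: "F <= L" if L: "subfield L R" "K <= L" "set Us <= L" for L
 proof -
  note sr = subringE[OF subfieldE(1)[OF L(1)]]
  have "set Vs <= L ==> Span K Vs <= L" for Vs
  proof (induction Vs)
   case Nil thus ?case using sr by simp
  next
   case (Cons v Vs)
   hence IH: "Span K Vs <= L" "v:L" by auto
   show ?case
   proof
    fix x assume "x:Span K (v # Vs)"
    then obtain k w where "k:K" "w:Span K Vs" "x = k \<otimes> v \<oplus> w" using line_extension_mem_iff by auto
    thus "x:L" using subsetD[OF IH(1)] IH subsetD[OF L(2)] sr by simp
   qed
  qed
  thus ?thesis using that Us by auto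
 qed
 show thesis by (rule that[of "set Us"]) (use sub inc in auto)
qed

lemma finite_cgal_image:
 assumes K: "subfield K R" and F: "F:finite_extensions R K"
 shows "finite (cgal (h ` F) (h ` K))"
proof -
 have F': "subfield F R" "K <= F" using F by (auto simp: finite_extensions_def)
 obtain Y where Y: "finite Y" "Y <= F" "ALL L. subfield L R --> K <= L --> Y <= L --> F <= L"
  using finite_extension_generators[OF K F] by auto
 note FI = subfield_image[OF F'(1)] and KI = subfield_image[OF K]
 show ?thesis
 proof (rule finite_cgal[of _ _ "h ` Y"])
  fix L assume L: "csub L" "h ` K <= L" "h ` Y <= L"
  have "subfield (phi ` (L Int E)) R" using subfield_image'(1)[OF csub_Int[OF L(1)]] by simp
  moreover have m: "x:phi ` (L Int E)" if "h x:L" "x:carrier R" for x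
   using that h by (metis IntI image_eqI)
  hence "K <= phi ` (L Int E)" "Y <= phi ` (L Int E)"
   using L subfieldE[OF K] subfieldE[OF F'(1)] Y by (auto simp: subset_iff)
  ultimately have "F <= phi ` (L Int E)" using Y by simp
  thus "h ` F <= L" using h by auto
 qed (use F'(2) FI KI Y in auto)
qed

lemma galois_image:
 assumes K: "subfield K R" and L: "L:finite_galois_extensions R K"
 shows "cgalois (h ` K) (h ` L)"
proof -
 have L': "subfield L R" "K <= L" "L:finite_extensions R K" "fixed_field L (carrier (Gal R L K)) = K"
  using L by (auto simp: finite_galois_extensions_def finite_extensions_def)
 have "z:h ` K" if z: "z:h ` L" "ALL s:cgal (h ` L) (h ` K). s z = z" for z
 proof -
  obtain x where x: "x:L" "z = h x" using z by auto
  thus ?thesis using L' fixed_field_iff[OF L'(1,2) x(1)] z by (auto simp: fixed_field_def)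
 qed
 thus ?thesis
  using subfield_image[OF K] subfield_image[OF L'(1)] L' finite_cgal_image[OF K L'(3)] by (auto simp: cgalois_def)
qed

lemma galois_from_image:
 assumes K: "subfield K R" and L: "L:finite_extensions R K" and G: "cgalois (h ` K) (h ` L)"
 shows "L:finite_galois_extensions R K"
proof -
 have L': "subfield L R" "K <= L" using L by (auto simp: finite_extensions_def)
 have "x:K" if "x:L" "ALL rho:carrier (Gal R L K). rho x = x" for x
 proof -
  have "h x:h ` K" using fixed_field_iff[OF L' that(1)] that G by (auto simp: cgalois_def)
  thus ?thesis using h_simps(9) that(1) subfieldE(3)[OF K] subfieldE[OF L'(1)] by auto
 qed
 moreover have "rho x = x" if "rho:carrier (Gal R L K)" "x:K" for rho x using GalD that by simp
 ultimately show ?thesis using L L' by (auto simp: finite_galois_extensions_def fixed_field_def)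
qed

lemma ev_h: "x:carrier R ==> q:pols E ==> ev x q = phi (poly q (h x))"
proof (induction q)
 case 0 thus ?case by (simp add: ev_0 zero)
next
 case (pCons c q)
 note x = pCons.prems(1)
 have c: "c:E" "q:pols E" "poly q (h x):E"
  using pCons.prems pols_simps[OF E] pols_simps(9)[OF E _ h(1)[OF x]] by auto
 thus ?case using pCons.IH[OF x c(2)] h(1,2)[OF x] E'(6)[OF h(1)[OF x] c(3)] by (simp add: ev_pCons[OF x] mult add)
qed

lemma algebraic_over_subfield:
 assumes K: "subfield K R" and x: "x:carrier R"
 shows "alg_over K x"
proof -
 obtain p where p: "p:pols \<rat>" "p ~= 0" "poly p (h x) = 0" using algebraic[OF h(1)[OF x]] by auto
 have pE: "p:pols E" using p pols_mono Rats_subset[OF E] by auto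
 define P where "P = map phi (rev (coeffs p))"
 have rk: "phi c:K" if "c:\<rat>" for c
  using that Rats_subset[OF subfield_image(1)[OF K]] subfield_image(3)[OF K] by auto
 have "P:carrier (K[X])" using rk nonzero pE p unfolding univ_poly_carrier[symmetric] polynomial_def
  by (auto simp: P_def pols_def coeffs_def)
 moreover have "P ~= []" using p by (simp add: P_def)
 moreover have "eval P x = \<zero>" using ev_eval[OF x pE] p zero ev_h[OF x pE] by (simp add: P_def)
 ultimately show ?thesis by (rule algebraicI)
qed

text \<open>Adjoin all complex roots of rational polynomials that kill the elements of
  \<open>Y\<close>. A homomorphism over \<open>K\<close> sends roots to roots, so the resulting
  field is normal.\<close>

lemma galois_closure:
 assumes K: "subfield K R" and Y: "finite Y" "Y <= carrier R"
 shows "EX L:finite_galois_extensions R K. Y <= L"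
proof -
 have "ALL y:Y. EX p. p:pols \<rat> & p ~= 0 & poly p (h y) = 0" using algebraic h Y by auto
 then obtain p where p: "!!y. y:Y ==> p y:pols \<rat> & p y ~= 0 & poly (p y) (h y) = 0" by metis
 define Z where "Z = (\<Union>y\<in>Y. {z. poly (p y) z = 0})"
 have "finite Z" unfolding Z_def using Y p by (intro finite_UN_I poly_roots_finite) auto
 then obtain zs where zs: "set zs = Z" using finite_list by auto
 have ZE: "Z <= E"
 proof
  fix z assume "z:Z"
  then obtain y where "y:Y" "poly (p y) z = 0" by (auto simp: Z_def)
  thus "z:E" using p alg_closed pols_mono[OF Rats_subset[OF E]] unfolding alg_closed_in_def by auto
 qed
 define L where "L = finite_extension K (map phi zs)"
 have xs: "set (map phi zs) <= carrier R" using ZE zs closed by auto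
 have alg: "alg_over K x" if "x:set (map phi zs)" for x using algebraic_over_subfield[OF K] that xs by auto
 have Lf: "subfield L R" unfolding L_def by (rule finite_extension_is_subfield[OF K xs alg])
 have KL: "K <= L" unfolding L_def by (rule finite_extension_incl[OF subfieldE(3)[OF K] xs])
 have ZL: "phi ` Z <= L" and Le: "L:finite_extensions R K"
  using finite_extension_mem[OF subfieldE(1)[OF K] xs] zs Lf KL finite_extension_finite_dimension(1)[OF K xs alg]
   unfolding L_def by (auto simp: finite_extensions_def)
 note LI = subfield_image[OF Lf] and KI = subfield_image[OF K]
 have ZhL: "Z <= h ` L"
 proof
  fix z assume z: "z:Z"
  hence "z = h (phi z)" "phi z:L" using h ZE ZL by auto
  thus "z:h ` L" by simp
 qed
 have gen: "h ` L <= F" if F: "csub F" "h ` K <= F" "Z <= F" for F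
 proof -
  have "subring (phi ` (F Int E)) R" using subfield_image'(1)[OF csub_Int[OF F(1)]] subfieldE by simp
  moreover have "K <= phi ` (F Int E)"
  proof
   fix x assume x: "x:K"
   hence "x = phi (h x)" "h x:F Int E" using h subfieldE[OF K] F by auto
   thus "x:phi ` (F Int E)" by simp
  qed
  moreover have "set (map phi zs) <= phi ` (F Int E)" using zs ZE F by auto
  ultimately have "L <= phi ` (F Int E)" unfolding L_def by (rule finite_extension_subring_incl)
  thus ?thesis using h by auto
 qed
 have "cgalois (h ` K) (h ` L)"
 proof (rule normal_imp_galois)
  show "finite (cgal (h ` L) (h ` K))" by (rule finite_cgal_image[OF K Le])
  fix s assume s: "chom (h ` L) s" "ALL x:h ` K. s x = x"
  note sh = chomD[OF s(1) LI(1)]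
  have "csub {z:h ` L. s z:h ` L}"
   using sh csubD[OF LI(1)] by (auto simp: csub_def simp del: image_iff)
  moreover have "Z <= {z:h ` L. s z:h ` L}"
  proof
   fix z assume z: "z:Z"
   then obtain y where y: "y:Y" "poly (p y) z = 0" by (auto simp: Z_def)
   have "s c = c" if "c:\<rat>" for c using s Rats_subset[OF KI(1)] that by auto
   hence "s (poly (p y) z) = poly (p y) (s z)"
    using p[OF y(1)] Rats_subset[OF LI(1)] z ZhL by (intro sh(10)) (auto simp: pols_def)
   thus "z:{z:h ` L. s z:h ` L}" using ZhL y sh by (auto simp: Z_def)
  qed
  moreover have "h ` K <= {z:h ` L. s z:h ` L}" using s KL by auto
  ultimately show "s ` h ` L <= h ` L" using gen by blast
 qed (use KI LI KL in auto)
 hence "L:finite_galois_extensions R K" by (rule galois_from_image[OF K Le])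
 moreover have "Y <= L"
 proof
  fix y assume y: "y:Y"
  hence "phi (h y):L" using ZL p by (auto simp: Z_def)
  thus "y:L" using h y Y by auto
 qed
 ultimately show ?thesis by auto
qed

lemma galois_closure_two:
 assumes K: "subfield K R" and F: "F:finite_extensions R K" "F':finite_extensions R K"
 shows "EX L:finite_galois_extensions R K. F <= L & F' <= L"
proof -
 obtain Y where Y: "finite Y" "Y <= F" "ALL L. subfield L R --> K <= L --> Y <= L --> F <= L"
  using finite_extension_generators[OF K F(1)] by auto
 obtain Y' where Y': "finite Y'" "Y' <= F'" "ALL L. subfield L R --> K <= L --> Y' <= L --> F' <= L"
  using finite_extension_generators[OF K F(2)] by auto
 have "F <= carrier R" "F' <= carrier R" using F by (auto simp: finite_extensions_def)
 then obtain L where L: "L:finite_galois_extensions R K" "Y Un Y' <= L"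
  using galois_closure[OF K, of "Y Un Y'"] Y Y' by blast
 thus ?thesis using Y[rule_format] Y'(3)[rule_format, of L] by (auto simp: finite_galois_extensions_def finite_extensions_def)
qed

lemma finite_extension_sub:
 assumes K: "subfield K R" and L: "L:finite_extensions R K" and M: "subfield M R" "K <= M" "M <= L"
 shows "M:finite_extensions R K"
proof -
 note sr = subringE[OF subfieldE(1)[OF M(1)]]
 have "subalgebra K M R" using sr(6) M subring.axioms[OF subfieldE(1)[OF M(1)]]
  by (intro subalgebra.intro subalgebra_axioms.intro) auto
 thus ?thesis using M subalbegra_incl_imp_finite_dimension[OF K _ _ M(3)] L by (simp add: finite_extensions_def)
qed

end

section \<open>Rings of ints\<close>

text \<open>The complex numbers as a module over the integers, so that \<open>zm.span\<close> and
  \<open>zm.subspace\<close> speak of additive subgroups.\<close>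

interpretation zm: Modules.module "%(n::int) (x::complex). of_int n * x"
 by unfold_locales (simp_all add: algebra_simps)

lemma int_subgroup_generator:
 fixes N :: "int set"
 assumes "0:N" "!!n m. n:N ==> m:N ==> n - m:N" "!!n k. n:N ==> k * n:N"
 shows "EX n0:N. ALL n:N. n0 dvd n"
proof (cases "N <= {0}")
 case True thus ?thesis using assms by auto
next
 case False
 then obtain n where n: "n:N" "n ~= 0" by auto
 have "\<bar>n\<bar>:N" using n assms(3)[OF n(1), of "-1"] by (cases "n >= 0") auto
 hence ex: "EX k::nat. 0 < k & int k:N" using n by (intro exI[of _ "nat \<bar>n\<bar>"]) auto
 define k where "k = (LEAST k::nat. 0 < k & int k:N)"
 have k: "0 < k" "int k:N" using LeastI_ex[OF ex] by (auto simp: k_def)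
 have le: "k <= j" if "0 < j" "int j:N" for j unfolding k_def using that by (intro Least_le) auto
 have "int k dvd m" if m: "m:N" for m
 proof -
  have r: "m mod int k:N" using assms(2)[OF m assms(3)[OF k(2)]] by (metis minus_div_mult_eq_mod)
  have "m mod int k = 0"
  proof (rule ccontr)
   assume "m mod int k ~= 0"
   hence p: "0 < m mod int k" "m mod int k < int k" using k by auto
   hence "k <= nat (m mod int k)" using r by (intro le) auto
   thus False using p by simp
  qed
  thus ?thesis by auto
 qed
 thus ?thesis using k by auto
qed

text \<open>Induction on the generators: the coefficients \<open>N\<close> occurring at
  \<open>b\<close> form a subgroup of the integers, generated by one \<open>n0\<close>. An element
  realising \<open>n0\<close>, together with generators of the part inside the span of
  \<open>B\<close>, generates \<open>S\<close>.\<close>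

lemma subgroup_finitely_generated:
 assumes "finite B" "zm.subspace S" "S <= zm.span B"
 shows "EX C. finite C & C <= S & S = zm.span C"
 using assms
proof (induction B arbitrary: S)
 case empty
 hence "S = zm.span {}" using zm.subspace_0[OF empty(1)] by auto
 thus ?case by blast
next
 case (insert b B)
 define N where "N = {n::int. EX z:zm.span B. of_int n * b + z:S}"
 note sub = zm.subspace_0[OF insert(4)] zm.subspace_diff[OF insert(4)] zm.subspace_scale[OF insert(4)] zm.subspace_add[OF
  insert(4)]
 have "EX n0:N. ALL n:N. n0 dvd n"
 proof (rule int_subgroup_generator)
  show "0:N" using sub(1) zm.span_zero by (force simp: N_def)
  show "n - m:N" if nm: "n:N" "m:N" for n m
  proof -
   obtain z w where "z:zm.span B" "of_int n * b + z:S" "w:zm.span B" "of_int m * b + w:S"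
    using nm by (auto simp: N_def)
   hence "z - w:zm.span B" "of_int (n - m) * b + (z - w):S"
    using zm.span_diff sub by (auto simp: algebra_simps)
   thus ?thesis by (auto simp: N_def)
  qed
  show "k * n:N" if n: "n:N" for n k
  proof -
   obtain z where "z:zm.span B" "of_int n * b + z:S" using n by (auto simp: N_def)
   thus ?thesis using zm.span_scale sub(3)[of "of_int n * b + z" k] by (auto simp: N_def algebra_simps)
  qed
 qed
 then obtain n0 z0 where n0: "z0:zm.span B" "of_int n0 * b + z0:S" "!!n. n:N ==> n0 dvd n"
  by (auto simp: N_def)
 define s0 where "s0 = of_int n0 * b + z0"
 obtain C where C: "finite C" "C <= S Int zm.span B" "S Int zm.span B = zm.span C"
  using insert.IH[of "S Int zm.span B"] zm.subspace_inter[OF insert(4) zm.subspace_span] by blast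
 have "S <= zm.span (insert s0 C)"
 proof
  fix s assume s: "s:S"
  then obtain n where n: "s - of_int n * b:zm.span B" using insert zm.span_breakdown_eq[of s b B] by auto
  hence "n:N" using s by (auto simp: N_def intro!: bexI)
  then obtain m where m: "n = n0 * m" using n0 by auto
  have "s - of_int m * s0:S" using s n0 sub by (simp add: s0_def)
  moreover have "s - of_int m * s0 = (s - of_int n * b) - of_int m * z0" by (simp add: s0_def m algebra_simps)
  hence "s - of_int m * s0:zm.span B" using n zm.span_scale[OF n0(1)] zm.span_diff by metis
  ultimately show "s:zm.span (insert s0 C)" using C unfolding zm.span_breakdown_eq by auto
 qed
 moreover have "insert s0 C <= S" using C n0 by (auto simp: s0_def)
 hence "zm.span (insert s0 C) <= S" using zm.span_minimal insert by simp
 ultimately show ?case using C(1) \<open>insert s0 C <= S\<close> by auto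
qed

lemma span_lessThan:
 "z:zm.span (f ` {..<n::nat}) ==> EX c. z = (\<Sum>k<n. of_int (c k) * f k)"
proof (induction n arbitrary: z)
 case 0 thus ?case by simp
next
 case (Suc n)
 hence "z:zm.span (insert (f n) (f ` {..<n}))" by (simp add: lessThan_Suc)
 then obtain k where "z - of_int k * f n:zm.span (f ` {..<n})" unfolding zm.span_breakdown_eq by auto
 then obtain c where c: "z - of_int k * f n = (\<Sum>k<n. of_int (c k) * f k)" using Suc.IH by auto
 hence "z = (\<Sum>i<n. of_int (c i) * f i) + of_int k * f n" by (simp add: algebra_simps)
 also have "\<dots> = (\<Sum>i<Suc n. of_int ((c(n := k)) i) * f i)" by simp
 finally show ?case by blast
qed

lemma algebraic_int_relation:
 fixes x :: complex
 assumes "x ^ n = (\<Sum>k<n. of_int (c k) * x ^ k)" shows "algebraic_int x"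
proof -
 define p where "p = Polynomial.monom 1 n - (\<Sum>k<n. Polynomial.monom (of_int (c k) :: complex) k)"
 have cf: "pcf p i = (if i = n then 1 else if i < n then - of_int (c i) else 0)" for i
  by (auto simp: p_def coeff_sum)
 hence "pdeg p = n"
  by (intro antisym degree_le le_degree) auto
 hence "plc p = 1" using cf by simp
 moreover have "ALL i. pcf p i:\<int>" using cf by auto
 moreover have "poly p x = 0" using assms by (simp add: p_def poly_monom poly_sum)
 ultimately show ?thesis by (rule algebraic_int.intros)
qed

lemma algebraic_int_relation_ex:
 fixes x :: complex
 assumes "algebraic_int x" shows "EX n c. x ^ n = (\<Sum>k<n. of_int (c k) * x ^ k)"
proof -
 obtain p where p: "plc p = 1" "ALL i. pcf p i:\<int>" "poly p x = 0"
  using assms by (auto elim: algebraic_int.cases)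
 have "ALL i. EX j. pcf p i = of_int j" using p by (auto elim: Ints_cases)
 then obtain c where c: "!!i. pcf p i = of_int (c i)" by metis
 let ?n = "pdeg p"
 have "0 = (\<Sum>k\<le>?n. of_int (c k) * x ^ k)" using p by (simp add: poly_altdef c)
 also have "\<dots> = (\<Sum>k<?n. of_int (c k) * x ^ k) + x ^ ?n" using p c by (simp add: lessThan_Suc_atMost[symmetric])
 finally show ?thesis using exI[of _ ?n, OF exI[of _ "%k. - c k"]] by (auto simp: sum_negf eq_neg_iff_add_eq_0 add.commute)
qed

text \<open>The subgroup generated by all x^k a is finitely generated, so finitely many of the x^k a
  with k < n already generate it. Expressing x^n a through these gives a monic relation for
  x.\<close>

lemma algebraic_int_criterion:
 fixes x :: complex
 assumes B: "finite B" and a: "a ~= 0" and x: "!!k. x ^ k * a:zm.span B"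
 shows "algebraic_int x"
proof -
 define P where "P n = zm.span ((%k. x ^ k * a) ` {..<n::nat})" for n
 have mono: "P m <= P n" if "m <= n" for m n unfolding P_def using that by (intro zm.span_mono) auto
 define T where "T = zm.span (range (%k. x ^ k * a))"
 have TP: "EX n. z:P n" if "z:T" for z
  using that unfolding T_def
 proof (induction rule: zm.span_induct_alt)
  case base thus ?case using zm.span_zero by (auto simp: P_def)
 next
  case (step c y z)
  then obtain k n where k: "y = x ^ k * a" "z:P n" by auto
  have "y:P (Suc k)" unfolding k P_def by (rule zm.span_base) auto
  thus ?case using zm.span_add zm.span_scale mono k unfolding P_def by (meson max.cobounded1 max.cobounded2 subsetD)+
 qed
 have "T <= zm.span B" unfolding T_def using x by (intro zm.span_minimal zm.subspace_span) auto
 then obtain C where C: "finite C" "C <= T" "T = zm.span C"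
  using subgroup_finitely_generated[OF B, of T] T_def by auto
 have "EX n. C <= P n" using C(1,2)
 proof (induction C)
  case (insert c C)
  then obtain n m where "C <= P n" "c:P m" using TP by blast
  thus ?case using mono by (meson insert_subset max.cobounded1 max.cobounded2 subset_trans subsetD)
 qed simp
 then obtain n where "T <= P n" using C(3) zm.span_minimal unfolding P_def by auto
 moreover have "x ^ n * a:T" unfolding T_def by (rule zm.span_base) auto
 ultimately obtain c where "x ^ n * a = (\<Sum>k<n. of_int (c k) * (x ^ k * a))" using span_lessThan unfolding P_def by blast
 hence "x ^ n * a = (\<Sum>k<n. of_int (c k) * x ^ k) * a" by (simp add: sum_distrib_right mult.assoc)
 thus ?thesis using a by (intro algebraic_int_relation) simp
qed

text \<open>Sum and product act on the finitely generated group spanned by the monomials x^i y^j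
  with i < n and j < m; the monic relations bring overflowing exponents back.\<close>

lemma algebraic_int_add_mult:
 fixes x y :: complex
 assumes "algebraic_int x" "algebraic_int y"
 shows "algebraic_int (x + y)" "algebraic_int (x * y)"
proof -
 obtain n c where n: "x ^ n = (\<Sum>k<n. of_int (c k) * x ^ k)" using algebraic_int_relation_ex assms by blast
 obtain m d where m: "y ^ m = (\<Sum>k<m. of_int (d k) * y ^ k)" using algebraic_int_relation_ex assms by blast
 have "n ~= 0" using n by (cases n) auto
 have "m ~= 0" using m by (cases m) auto
 define B where "B = (%(i, j). x ^ i * y ^ j) ` ({..<n} \<times> {..<m})"
 have base: "x ^ i * y ^ j:zm.span B" if "i < n" "j < m" for i j
  using that by (intro zm.span_base) (auto simp: B_def)
 have stab: "u * z:zm.span B" if u: "!!b. b:B ==> u * b:zm.span B" and z: "z:zm.span B" for u z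
  using z
 proof (induction rule: zm.span_induct_alt)
  case base thus ?case using zm.span_zero by simp
 next
  case (step k y z)
  have "u * (of_int k * y + z) = of_int k * (u * y) + u * z" by (simp add: algebra_simps)
  thus ?case using step u zm.span_add zm.span_scale by simp
 qed
 have xs: "x * z:zm.span B" if "z:zm.span B" for z
 proof (rule stab[OF _ that])
  fix b assume "b:B"
  then obtain i j where ij: "i < n" "j < m" "b = x ^ i * y ^ j" by (auto simp: B_def)
  show "x * b:zm.span B"
  proof (cases "Suc i < n")
   case True thus ?thesis using base[of "Suc i" j] ij by (simp add: mult.assoc)
  next
   case False
   hence "x * b = x ^ n * y ^ j" using ij by (metis Suc_lessI mult.assoc power_Suc)
   also have "\<dots> = (\<Sum>k<n. of_int (c k) * (x ^ k * y ^ j))" unfolding n by (simp add: sum_distrib_right mult.assoc)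
   also have "\<dots>:zm.span B" using base ij by (intro zm.span_sum zm.span_scale) auto
   finally show ?thesis .
  qed
 qed
 have ys: "y * z:zm.span B" if "z:zm.span B" for z
 proof (rule stab[OF _ that])
  fix b assume "b:B"
  then obtain i j where ij: "i < n" "j < m" "b = x ^ i * y ^ j" by (auto simp: B_def)
  show "y * b:zm.span B"
  proof (cases "Suc j < m")
   case True thus ?thesis using base[of i "Suc j"] ij by (simp add: mult.left_commute)
  next
   case False
   hence "y * b = x ^ i * y ^ m" using ij by (metis Suc_lessI mult.left_commute power_Suc)
   also have "\<dots> = (\<Sum>k<m. of_int (d k) * (x ^ i * y ^ k))" unfolding m by (simp add: sum_distrib_left mult.left_commute)
   also have "\<dots>:zm.span B" using base ij by (intro zm.span_sum zm.span_scale) auto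
   finally show ?thesis .
  qed
 qed
 have one: "1:zm.span B" and fB: "finite B" using base[of 0 0] \<open>n ~= 0\<close> \<open>m ~= 0\<close> by (auto simp: B_def)
 have crit: "algebraic_int u" if "!!z. z:zm.span B ==> u * z:zm.span B" for u
 proof (rule algebraic_int_criterion[OF fB, of 1])
  fix k show "u ^ k * 1:zm.span B" by (induction k) (use one that in \<open>auto simp: mult.assoc\<close>)
 qed simp
 show "algebraic_int (x + y)" by (rule crit) (use xs ys zm.span_add in \<open>simp add: distrib_right\<close>)
 show "algebraic_int (x * y)" by (rule crit) (use xs ys in \<open>simp add: mult.assoc\<close>)
qed

lemma algebraic_int_ring:
 fixes x y :: complex
 shows "algebraic_int (0 :: complex)" "algebraic_int (1 :: complex)" "algebraic_int (of_int n :: complex)"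
  "algebraic_int x ==> algebraic_int y ==> algebraic_int (x + y)"
  "algebraic_int x ==> algebraic_int y ==> algebraic_int (x - y)"
  "algebraic_int x ==> algebraic_int y ==> algebraic_int (x * y)"
  "(!!i. i:I ==> algebraic_int (f i :: complex)) ==> algebraic_int (sum f I)"
proof -
 show 0: "algebraic_int (0 :: complex)" "algebraic_int (1 :: complex)" "algebraic_int (of_int n :: complex)"
  by auto
 show add: "algebraic_int x ==> algebraic_int y ==> algebraic_int (x + y)" for x y :: complex by (rule algebraic_int_add_mult)
 show "algebraic_int x ==> algebraic_int y ==> algebraic_int (x - y)"
  using add[of x "- y"] by simp
 show "algebraic_int x ==> algebraic_int y ==> algebraic_int (x * y)" by (rule algebraic_int_add_mult)
 show "(!!i. i:I ==> algebraic_int (f i :: complex)) ==> algebraic_int (sum f I)"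
  by (induction I rule: infinite_finite_induct) (auto intro: add)
qed

lemma algebraic_int_scale:
 fixes z :: complex
 assumes "algebraic z" shows "EX n::int. n ~= 0 & algebraic_int (of_int n * z)"
proof -
 obtain p where p: "ALL i. pcf p i:\<int>" "p ~= 0" "poly p z = 0"
  using assms by (auto simp: algebraic_def)
 have "ALL i. EX j. pcf p i = of_int j" using p by (auto elim: Ints_cases)
 then obtain c where c: "!!i. pcf p i = of_int (c i)" by metis
 let ?n = "pdeg p"
 define a where "a = c ?n"
 have a: "a ~= 0" using p c[of ?n] by (auto simp: a_def)
 have "?n ~= 0"
 using degree_eq_zeroE p(2,3) by fastforce
 \<comment> \<open>Multiplying a relation of degree n with leading coefficient a by a^(n-1) turns it
   into a monic integral relation for a z.\<close>
 have "0 = of_int a ^ (?n - 1) * (\<Sum>k\<le>?n. of_int (c k) * z ^ k)" using p by (simp add: poly_altdef c)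
 also have "\<dots> = of_int a ^ (?n - 1) * (\<Sum>k<?n. of_int (c k) * z ^ k) + of_int a ^ (?n - 1) * (of_int a * z ^ ?n)"
  by (simp add: lessThan_Suc_atMost[symmetric] a_def distrib_left)
 also have "of_int a ^ (?n - 1) * (of_int a * z ^ ?n) = (of_int a * z) ^ ?n"
  using \<open>?n ~= 0\<close> by (simp add: power_mult_distrib power_eq_if[of _ ?n])
 also have "of_int a ^ (?n - 1) * (\<Sum>k<?n. of_int (c k) * z ^ k) = (\<Sum>k<?n. of_int (c k * a ^ (?n - 1 - k)) * (of_int a * z) ^ k)"
  unfolding sum_distrib_left
 proof (rule sum.cong[OF refl])
  fix k assume "k:{..<?n}"
  hence "?n - 1 = (?n - 1 - k) + k" by auto
  thus "of_int a ^ (?n - 1) * (of_int (c k) * z ^ k) = of_int (c k * a ^ (?n - 1 - k)) * (of_int a * z) ^ k"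
   using power_add by (auto simp: power_mult_distrib)
 qed
 finally have "(of_int a * z) ^ ?n = (\<Sum>k<?n. of_int (- (c k * a ^ (?n - 1 - k))) * (of_int a * z) ^ k)"
  by (simp add: sum_negf eq_neg_iff_add_eq_0 add.commute)
 hence "algebraic_int (of_int a * z)" by (rule algebraic_int_relation)
 thus ?thesis using a by auto
qed

text \<open>The integer is, up to sign, the lowest nonzero coefficient of an integral relation for
  \<open>a\<close>; powers of X are cancelled until the constant term is nonzero.\<close>

lemma algebraic_int_divides_int:
 fixes a :: complex
 assumes "algebraic_int a" "a ~= 0"
 obtains m :: int and q where "m ~= 0" "!!i. pcf q i:\<int>" "of_int m = a * poly q a"
proof -
 obtain p where p: "plc p = 1" "ALL i. pcf p i:\<int>" "poly p a = 0"
  using assms by (auto elim: algebraic_int.cases)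
 have "p ~= 0" using p by auto
 have "p ~= 0 ==> ALL i. pcf p i:\<int> ==> poly p a = 0 ==>
  EX m q. m ~= 0 & (ALL i. pcf q i:\<int>) & of_int m = a * poly q a" for p
 proof (induction p)
  case (pCons c p)
  have cp: "c:\<int>" "ALL i. pcf p i:\<int>"
   using pCons.prems(2)[rule_format, of 0] pCons.prems(2)[rule_format, of "Suc _"] by auto
  show ?case
  proof (cases "c = 0")
   case True
   thus ?thesis using pCons.IH cp pCons.prems assms by simp
  next
   case False
   obtain m where m: "c = of_int m" using cp by (auto elim: Ints_cases)
   have "of_int (- m) = a * poly p a" using pCons.prems m by (simp add: neg_eq_iff_add_eq_0)
   thus ?thesis using cp m False by (intro exI[of _ "- m"] exI[of _ p]) auto
  qed
 qed simp
 thus thesis using that p \<open>p ~= 0\<close> by auto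
qed

lemma chom_algebraic_int:
 assumes L: "csub L" and s: "chom L s" and x: "x:L" "algebraic_int x"
 shows "algebraic_int (s x)"
proof -
 have fixed: "s c = c" if "c:\<int>" for c
 proof -
  have n: "s (of_nat n) = of_nat n" for n
   by (induction n) (auto simp: chomD(1,2)[OF s L] chomD(3)[OF s L] csubD[OF L] csub_of_nat[OF L])
  from that obtain k where "c = of_int k" by (rule Ints_cases)
  thus ?thesis by (cases k rule: int_cases2) (auto simp: n chomD(5)[OF s L] csub_of_nat[OF L])
 qed
 obtain p where p: "plc p = 1" "ALL i. pcf p i:\<int>" "poly p x = 0"
  using x by (auto elim: algebraic_int.cases)
 have "pcf p i:L" for i using p csub_of_int[OF L] by (metis Ints_cases)
 hence "s (poly p x) = poly p (s x)" using p fixed x by (intro chomD(10)[OF s L]) (auto simp: pols_def)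
 thus ?thesis using p chomD(2)[OF s L] by (intro algebraic_int.intros[of p]) auto
qed

text \<open>Expanding \<open>\<Prod>\<^sub>t (t y\<^sub>t - s y\<^sub>t)\<close> kills every conjugate of \<open>x\<close> but \<open>x\<close> itself in the trace sum,
 which replaces the dual basis of the trace form.\<close>

lemma integers_finitely_generated:
 assumes G: "cgalois \<rat> L" and alg: "!!z. z:L ==> algebraic z"
 shows "EX B. finite B & {z:L. algebraic_int z} <= zm.span B"
proof -
 have L: "csub L" and fin: "finite (cgal L \<rat>)" and QL: "\<rat> <= L" using G by (auto simp: cgalois_def)
 define i where "i = restrict id L"
 have i: "i:cgal L \<rat>" "!!x. x:L ==> i x = x" using cgal_id[OF L QL] by (auto simp: i_def)
 have "EX y:L. algebraic_int y & s y ~= y" if s: "s:cgal L \<rat> - {i}" for s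
 proof -
  obtain y where y: "y:L" "s y ~= y" using s i cgal_eqI[of s L \<rat> i] by auto
  obtain n :: int where n: "n ~= 0" "algebraic_int (of_int n * y)" using algebraic_int_scale[OF alg[OF y(1)]] by auto
  show ?thesis using n y csubD(6)[OF L] csub_of_int[OF L] chomD(4)[OF cgalD(1) L, of s \<rat>] s cgalD[of s L \<rat>] by auto
 qed
 then obtain y where y: "!!s. s:cgal L \<rat> - {i} ==> y s:L & algebraic_int (y s) & s (y s) ~= y s" by metis
 have gs: "s x:L" "algebraic_int (s x)" if "s:cgal L \<rat>" "x:L" "algebraic_int x" for s x
  using cgalD(4)[OF that(1,2)] chom_algebraic_int[OF L cgalD(1)[OF that(1)] that(2,3)] by auto
 have tr: "(\<Sum>s\<in>cgal L \<rat>. s x):\<int>" if x: "x:L" "algebraic_int x" for x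
 proof -
  have xL: "(\<Sum>s\<in>cgal L \<rat>. s x):L" using gs x by (intro csub_sum[OF L]) auto
  have "t (\<Sum>s\<in>cgal L \<rat>. s x) = (\<Sum>s\<in>cgal L \<rat>. s x)" if t: "t:cgal L \<rat>" for t
  proof -
   have "t (\<Sum>s\<in>S. s x) = (\<Sum>s\<in>S. t (s x))" if "finite S" "S <= cgal L \<rat>" for S
    using that
   proof (induction S)
    case empty thus ?case using chomD[OF cgalD(1)[OF t] L] by simp
   next
    case (insert s S)
    have "(\<Sum>s\<in>S. s x):L" using gs x insert by (intro csub_sum[OF L]) auto
    thus ?case using insert gs x chomD[OF cgalD(1)[OF t] L] by simp
   qed
   hence "t (\<Sum>s\<in>cgal L \<rat>. s x) = (\<Sum>s\<in>cgal L \<rat>. compose L t s x)" using fin x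
    by (simp add: compose_def)
   also have "\<dots> = (\<Sum>s\<in>cgal L \<rat>. s x)" by (rule sum.reindex_bij_betw[OF cgal_compose_bij[OF L QL t]])
   finally show ?thesis .
  qed
  hence "(\<Sum>s\<in>cgal L \<rat>. s x):\<rat>" using G xL by (auto simp: cgalois_def)
  thus ?thesis using gs x by (intro rational_algebraic_int_is_int algebraic_int_ring(7)) auto
 qed
 \<comment> \<open>The factors are introduced one at a time. A new factor splits the sum into t (y
   t) times the sum for x, minus the sum for the integer x (y t); both are covered by the induction
   hypothesis, at the cost of at most doubling the spanning set.\<close>
 have main: "EX Z. finite Z & (ALL x:L. algebraic_int x --> (\<Sum>s\<in>cgal L \<rat>. s x * (\<Prod>t\<in>A. t (y t) - s (y t))):zm.span Z)"
  if "finite A" "A <= cgal L \<rat> - {i}" for A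
  using that
 proof (induction A)
  case empty
  have "(\<Sum>s\<in>cgal L \<rat>. s x):zm.span {1}" if x: "x:L" "algebraic_int x" for x
  proof -
   obtain k where "(\<Sum>s\<in>cgal L \<rat>. s x) = of_int k * 1" using tr[OF x] by (auto elim: Ints_cases)
   moreover have "of_int k * 1:zm.span {1}" by (intro zm.span_scale zm.span_base) simp
   ultimately show ?thesis by simp
  qed
  thus ?case by auto
 next
  case (insert t A)
  then obtain Z where Z: "finite Z" "!!x. x:L ==> algebraic_int x ==>
    (\<Sum>s\<in>cgal L \<rat>. s x * (\<Prod>t\<in>A. t (y t) - s (y t))):zm.span Z" by auto
  have t: "y t:L" "algebraic_int (y t)" using y insert by auto
  let ?Z = "(%z. t (y t) * z) ` Z Un Z"
  have sc: "t (y t) * z:zm.span ?Z" if "z:zm.span Z" for z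
   using that
  proof (induction rule: zm.span_induct_alt)
   case base thus ?case using zm.span_zero by simp
  next
   case (step k u z)
   have "t (y t) * (of_int k * u + z) = of_int k * (t (y t) * u) + t (y t) * z" by (simp add: algebra_simps)
   moreover have "t (y t) * u:zm.span ?Z" using step by (intro zm.span_base) auto
   ultimately show ?case using step zm.span_add zm.span_scale by simp
  qed
  have "(\<Sum>s\<in>cgal L \<rat>. s x * (\<Prod>t\<in>insert t A. t (y t) - s (y t))):zm.span ?Z" if x: "x:L"
   "algebraic_int x" for x
  proof -
   have e: "(\<Sum>s\<in>cgal L \<rat>. s x * (\<Prod>t\<in>insert t A. t (y t) - s (y t))) =
    t (y t) * (\<Sum>s\<in>cgal L \<rat>. s x * (\<Prod>t\<in>A. t (y t) - s (y t))) -
    (\<Sum>s\<in>cgal L \<rat>. s (x * y t) * (\<Prod>t\<in>A. t (y t) - s (y t)))"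
    unfolding sum_distrib_left sum_subtractf[symmetric] using insert x t chomD[OF cgalD(1) L]
     by (intro sum.cong) (simp_all add: algebra_simps)
   have f: "(\<Sum>s\<in>cgal L \<rat>. s (x * y t) * (\<Prod>t\<in>A. t (y t) - s (y t))):zm.span ?Z"
    using Z x t csubD(6)[OF L] algebraic_int_ring(6) zm.span_mono[of Z ?Z] by auto
   have g: "t (y t) * (\<Sum>s\<in>cgal L \<rat>. s x * (\<Prod>t\<in>A. t (y t) - s (y t))):zm.span ?Z"
    by (rule sc[OF Z(2)[OF x]])
   show ?thesis unfolding e by (rule zm.span_diff[OF g f])
  qed
  thus ?case using Z by (intro exI[of _ ?Z]) auto
 qed
 define D where "D = (\<Prod>t\<in>cgal L \<rat> - {i}. t (y t) - y t)"
 obtain Z where Z: "finite Z" "!!x. x:L ==> algebraic_int x ==>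
   (\<Sum>s\<in>cgal L \<rat>. s x * (\<Prod>t\<in>cgal L \<rat> - {i}. t (y t) - s (y t))):zm.span Z"
  using main[of "cgal L \<rat> - {i}"] fin by auto
 have "x:zm.span ((%z. z / D) ` Z)" if x: "x:L" "algebraic_int x" for x
 proof -
  \<comment> \<open>For s other than the identity the factor with t = s vanishes, so only the term x
    D survives; D is nonzero by the choice of the y t.\<close>
  have "(\<Prod>t\<in>cgal L \<rat> - {i}. t (y t) - s (y t)) = 0" if "s:cgal L \<rat> - {i}" for s
   using that fin by auto
  hence "(\<Sum>s\<in>cgal L \<rat>. s x * (\<Prod>t\<in>cgal L \<rat> - {i}. t (y t) - s (y t))) = i x * (\<Prod>t\<in>cgal L \<rat> - {i}. t (y t) - i (y t))"
   by (subst sum.remove[OF fin i(1)]) simp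
  also have "\<dots> = x * D" using i x y by (auto simp: D_def)
  finally have xD: "x * D:zm.span Z" using Z(2)[OF x] by simp
  have "z / D:zm.span ((%z. z / D) ` Z)" if "z:zm.span Z" for z
   using that
  proof (induction rule: zm.span_induct_alt)
   case base thus ?case using zm.span_zero by simp
  next
   case (step k u z)
   have "(of_int k * u + z) / D = of_int k * (u / D) + z / D" by (simp add: add_divide_distrib)
   moreover have "u / D:zm.span ((%z. z / D) ` Z)" using step by (intro zm.span_base) auto
   ultimately show ?case using step zm.span_add zm.span_scale by metis
  qed
  from this[OF xD] show ?thesis using y fin by (auto simp: D_def)
 qed
 thus ?thesis using Z by auto
qed

lemma algebraic_int_poly:
 fixes z :: complex
 shows "ALL i. pcf q i:\<int> ==> algebraic_int z ==> algebraic_int (poly q z)"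
proof (induction q)
 case (pCons c q)
 have c: "c:\<int>" "ALL i. pcf q i:\<int>"
  using pCons.prems(1)[rule_format, of 0] pCons.prems(1)[rule_format, of "Suc _"] by auto
 show ?case using algebraic_int_ring(4)[OF int_imp_algebraic_int[OF c(1)] algebraic_int_ring(6)[OF pCons.prems(2) pCons.IH[OF
  c(2) pCons.prems(2)]]] by auto
qed (simp add: algebraic_int_ring)

lemma Ints_pols: "csub F ==> ALL i. pcf p i:\<int> ==> p:pols F"
 by (metis Ints_cases csub_of_int polys_overI)

section \<open>Rings of integers are Dedekind domains\<close>

context algnum
begin

abbreviation prime_field :: "'a set" where "prime_field == generate_field R {}"

lemma prime_field_subfield: "subfield prime_field R"
 by (rule generate_field_is_subfield) simp

lemma prime_field_image: "h ` prime_field = \<rat>"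
proof
 have RE: "\<rat> <= E" by (rule Rats_subset[OF E])
 have "subfield (phi ` \<rat>) R" by (rule subfield_image'(1)[OF csub_Rats RE])
 hence "prime_field <= phi ` \<rat>" by (intro generate_field_min_subfield1) auto
 hence "h ` prime_field <= h ` phi ` \<rat>" by auto
 thus "h ` prime_field <= \<rat>" unfolding subfield_image'(2)[OF RE] .
 show "\<rat> <= h ` prime_field" by (rule Rats_subset[OF subfield_image(1)[OF prime_field_subfield]])
qed

lemma phi_of_int: "phi (of_int n) = [n] \<cdot> \<one>"
proof -
 have nat: "phi (of_nat m) = [m] \<cdot> \<one>" for m :: nat
  by (induction m) (auto simp: zero add one E'(1) csub_of_nat[OF E] a_comm closed)
 show ?thesis
 proof (cases n rule: int_cases2)
  case (nonneg m) thus ?thesis using nat by (simp add: add_pow_def int_pow_int)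
 next
  case (nonpos m)
  thus ?thesis using nat add.int_pow_neg_int neg csub_of_nat[OF E] by simp
 qed
qed

lemma integral_element_iff:
 assumes x: "x:carrier R" shows "integral_element R x <-> algebraic_int (h x)"
proof
 assume "integral_element R x"
 then obtain P where P: "P ~= []" "hd P = \<one>" "set P <= range (%n::int. [n] \<cdot> \<one>)" "eval P x = \<zero>"
  by (auto simp: integral_element_def)
 have hP: "EX n::int. h c = of_int n & phi (h c) = c" if c: "c:set P" for c
 proof -
  obtain n :: int where "c = [n] \<cdot> \<one>" using c P by auto
  thus ?thesis using h(3)[of "of_int n"] csub_of_int[OF E] by (simp add: phi_of_int)
 qed
 define p where "p = Poly (rev (map h P))"
 have "h (hd P) = 1" using P h_simps by simp
 hence cp: "coeffs p = rev (map h P)" by (cases P) (auto simp: p_def coeffs_Poly strip_while_def)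
 have p0: "p ~= 0" using cp P by auto
 have ints: "ALL i. pcf p i:\<int>"
 proof
  fix i show "pcf p i:\<int>"
  proof (cases "i < length P")
   case True
   hence "rev (map h P) ! i:h ` set P" using nth_mem[of i "rev (map h P)"] by simp
   moreover have "h c:\<int>" if "c:set P" for c using hP[OF that] by auto
   ultimately show ?thesis by (auto simp: p_def nth_default_def)
  qed (simp add: p_def nth_default_def)
 qed
 hence pE: "p:pols E" by (intro Ints_pols[OF E])
 have "plc p = last (coeffs p)" using p0 by (simp add: last_coeffs_eq_coeff_degree)
 also have "\<dots> = 1" using P \<open>h (hd P) = 1\<close> by (simp add: cp last_rev hd_map)
 finally have lc: "plc p = 1" .
 show "algebraic_int (h x)" using lc ints nonzero pols_simps(9)[OF E pE h(1)[OF x]] ev_eval[OF x pE] ev_h[OF x pE] P(4) hP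
  algebraic_int.intros by (fastforce simp: cp map_idI)
next
 assume "algebraic_int (h x)"
 then obtain p where p: "plc p = 1" "ALL i. pcf p i:\<int>" "poly p (h x) = 0"
  by (auto elim: algebraic_int.cases)
 have pE: "p:pols E" using p by (intro Ints_pols[OF E])
 have p0: "p ~= 0" using p by auto
 define P where "P = map phi (rev (coeffs p))"
 have "P ~= []" using p0 by (simp add: P_def)
 moreover have "hd P = \<one>" using p0 p one by (simp add: P_def hd_map hd_rev last_coeffs_eq_coeff_degree)
 moreover have "set P <= range (%n::int. [n] \<cdot> \<one>)"
 proof
  fix c assume "c:set P"
  then obtain z where z: "z:set (coeffs p)" "c = phi z" by (auto simp: P_def)
  have "set (coeffs p) <= \<int>" using p by (auto simp: coeffs_def)
  then obtain n where "z = of_int n" using z by (metis Ints_cases subsetD)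
  with z show "c:range (%n::int. [n] \<cdot> \<one>)" using phi_of_int by simp
 qed
 moreover have "eval P x = \<zero>" using ev_eval[OF x pE] ev_h[OF x pE] p zero by (simp add: P_def)
 ultimately show "integral_element R x" unfolding integral_element_def by auto
qed

definition ints :: "'a set => 'a set" where "ints F = {x:F. integral_element R x}"

lemma roi: "ring_of_integers R F = R\<lparr>carrier := ints F\<rparr>"
 by (simp add: ring_of_integers_def ints_def)

lemma ints_iff: "F <= carrier R ==> x:ints F <-> x:F & algebraic_int (h x)"
 using integral_element_iff by (auto simp: ints_def)

lemma ints_subring: assumes "subfield F R" shows "subring (ints F) R"
proof (rule subringI)
 note s = subringE[OF subfieldE(1)[OF assms]]
 have F: "x:carrier R" if "x:F" for x using that s by auto
 show "ints F <= carrier R" "\<one>:ints F" using s ints_iff[OF s(1)] h_simps by (auto simp: ints_def)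
 show "\<ominus> x:ints F" if "x:ints F" for x using that s ints_iff[OF s(1)] h_simps F by simp
 show "x \<otimes> y:ints F" if "x:ints F" "y:ints F" for x y
  using that s ints_iff[OF s(1)] h_simps F algebraic_int_ring(6) by simp
 show "x \<oplus> y:ints F" if "x:ints F" "y:ints F" for x y
  using that s ints_iff[OF s(1)] h_simps F algebraic_int_ring(4) by simp
qed

text \<open>The bound by a trace argument is available for the Galois field \<open>L\<close>; the
  integers of \<open>F\<close> are a subgroup of those of \<open>L\<close>.\<close>

lemma integers_fg:
 assumes F: "subfield F R" "F <= L" and L: "L:finite_galois_extensions R prime_field"
 shows "EX C. finite C & C <= h ` ints F & h ` ints F = zm.span C"
proof -
 have Ls: "subfield L R" and G: "cgalois \<rat> (h ` L)" using L galois_image[OF prime_field_subfield L] prime_field_image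
  by (auto simp: finite_galois_extensions_def finite_extensions_def)
 have alg: "Polynomial.algebraic z" if "z:h ` L" for z
  using algebraic subfield_image[OF Ls] that by (auto simp: algebraic_altdef pols_def)
 obtain B where B: "finite B" "{z:h ` L. algebraic_int z} <= zm.span B"
  using integers_finitely_generated[OF G alg] by auto
 note s = subringE[OF subfieldE(1)[OF F(1)]]
 have hO: "h ` ints F = {z:h ` F. algebraic_int z}" using ints_iff[OF s(1)] by auto
 have Fc: "csub (h ` F)" by (rule subfield_image[OF F(1)])
 have "zm.subspace (h ` ints F)"
  unfolding hO using csubD[OF Fc] csub_of_int[OF Fc] algebraic_int_ring by (intro zm.subspaceI) auto
 moreover have "h ` ints F <= zm.span B" unfolding hO using B F by auto
 ultimately show ?thesis using subgroup_finitely_generated[OF B(1)] by simp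
qed

lemma dedekind_integers:
 assumes F: "subfield F R" "F <= L" and L: "L:finite_galois_extensions R prime_field"
 shows "dedekind (ring_of_integers R F)"
proof -
 let ?Q = "R\<lparr>carrier := ints F\<rparr>"
 note s = subringE[OF subfieldE(1)[OF F(1)]] and os = subringE[OF ints_subring[OF F(1)]]
 interpret Q: domain ?Q by (rule subdomain_is_domain[OF subdomainI'[OF ints_subring[OF F(1)]]])
 have Oc: "x:carrier R" if "x:ints F" for x using that os by auto
 have Qm: "x \<ominus>\<^bsub>?Q\<^esub> y = x \<ominus> y" if "x:ints F" "y:ints F" for x y
 proof -
  show ?thesis using Q.minus_equality[of "\<ominus> y" y] that os Oc l_neg by (simp add: a_minus_def)
 qed
 obtain C where C: "finite C" "C <= h ` ints F" "h ` ints F = zm.span C" using integers_fg[OF assms] by auto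
 have id: "\<zero>:I" "x:I ==> x:ints F" "x:I ==> y:ints F ==> x \<otimes> y:I" if "ideal I ?Q" for I x y
 proof -
  interpret I: ideal I ?Q by (rule that)
  show "\<zero>:I" "x:I ==> x:ints F" "x:I ==> y:ints F ==> x \<otimes> y:I" using I.zero_closed I.Icarr I.I_r_closed by auto
 qed
 have fin: "finite (carrier (?Q Quot I))" if I: "ideal I ?Q" "I ~= {\<zero>}" for I
 proof -
  obtain a where a: "a:I" "a ~= \<zero>" using id[OF I(1)] I by auto
  have aO: "a:ints F" using id(2)[OF I(1) a(1)] .
  hence aF: "a:F" "algebraic_int (h a)" "h a ~= 0" using ints_iff[OF s(1)] h_simps a Oc by auto
  obtain m :: int and q where q: "m ~= 0" "!!i. pcf q i:\<int>" "of_int m = h a * poly q (h a)"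
   by (rule algebraic_int_divides_int[OF aF(2,3)]) blast
  have hF: "csub (h ` F)" by (rule subfield_image[OF F(1)])
  have "poly q (h a):h ` F"
   using q aF by (intro pols_simps(9)[OF hF] Ints_pols[OF hF]) auto
  then obtain c where c: "c:F" "h c = poly q (h a)" by auto
  hence cO: "c:ints F" using ints_iff[OF s(1)] algebraic_int_poly q aF by auto
  have acI: "a \<otimes> c:I" using id(3)[OF I(1) a(1) cO] .
  \<comment> \<open>The ideal contains the rational integer m = a c, so every coset has a
    representative whose coefficients on the generators \<open>C\<close> are reduced modulo
    m.\<close>
  define T where "T = (%n. phi (\<Sum>c\<in>C. of_int (n c) * c)) ` (C \<rightarrow>\<^sub>E {0..<\<bar>m\<bar>})"
  have finT: "finite T" unfolding T_def using C by (intro finite_imageI finite_PiE) auto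
  have "carrier (?Q Quot I) <= (%t. I +>\<^bsub>?Q\<^esub> t) ` T"
  proof
   fix Y assume "Y:carrier (?Q Quot I)"
   then obtain x where x: "x:ints F" "Y = I +>\<^bsub>?Q\<^esub> x" by (auto simp: FactRing_def A_RCOSETS_defs a_r_coset_def)
   then obtain n where n: "h x = (\<Sum>c\<in>C. of_int (n c) * c)" using C(3) zm.span_finite[OF C(1)] by auto
   define r where "r = restrict (%c. n c mod \<bar>m\<bar>) C"
   define t where "t = phi (\<Sum>c\<in>C. of_int (r c) * c)"
   have rT: "r:C \<rightarrow>\<^sub>E {0..<\<bar>m\<bar>}" using q by (auto simp: r_def)
   have "(\<Sum>c\<in>C. of_int (r c) * c):h ` ints F" unfolding C using zm.span_base by (intro zm.span_sum zm.span_scale) auto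
   then obtain t' where t': "t':ints F" "h t' = (\<Sum>c\<in>C. of_int (r c) * c)" by auto
   hence tt: "t = t'" using h(2)[OF Oc, of t'] by (simp add: t_def)
   have mdvd: "m dvd n c - r c" if "c:C" for c
   proof -
    show ?thesis using that abs_dvd_iff by (fastforce simp: r_def)
   qed
   have "(\<Sum>c\<in>C. of_int ((n c - r c) div m) * c):h ` ints F" unfolding C using zm.span_base
    by (intro zm.span_sum zm.span_scale) auto
   then obtain w where w: "w:ints F" "h w = (\<Sum>c\<in>C. of_int ((n c - r c) div m) * c)" by auto
   have "h (x \<ominus> t') = (\<Sum>c\<in>C. of_int (n c - r c) * c)"
    using h_simps Oc x t' n by (simp add: sum_subtractf left_diff_distrib)
   also have "\<dots> = (\<Sum>c\<in>C. of_int (m * ((n c - r c) div m)) * c)"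
    using mdvd by simp
   also have "\<dots> = of_int m * h w" unfolding w sum_distrib_left by simp
   also have "\<dots> = h ((a \<otimes> c) \<otimes> w)" using Oc[OF w(1)] Oc[OF aO] Oc[OF cO] h_simps c q by simp
   finally show "Y:(%t. I +>\<^bsub>?Q\<^esub> t) ` T"
    using x rT tt Q.quotient_eq_iff_same_a_r_cos[OF I(1), of x t'] x(1) t' Qm id(3)[OF I(1) acI w(1)] h_simps(9) Oc[OF x(1)]
     Oc[OF t'(1)] Oc[OF aO] Oc[OF cO] Oc[OF w(1)] by (auto simp: T_def t_def)
  qed
  thus ?thesis using finT finite_subset by blast
 qed
 have max: "maximalideal P ?Q" if P: "primeideal P ?Q" "P ~= {\<zero>}" for P
 proof -
  interpret P: primeideal P ?Q by (rule P)
  have Pi: "ideal P ?Q" by (rule P.is_ideal)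
  show ?thesis
  proof (rule maximalidealI[OF Pi])
   show "carrier ?Q ~= P" by (rule P.I_notcarr)
   fix J assume J: "ideal J ?Q" "P <= J" "J <= carrier ?Q"
   show "J = P \<or> J = carrier ?Q"
   proof (rule disjCI)
    assume "J ~= carrier ?Q"
    hence one: "\<one> ~: J" using ideal.one_imp_carrier[OF J(1)] by auto
    \<comment> \<open>Finiteness of the quotient makes two powers a^i and a^j congruent modulo
      \<open>P\<close>. Cancelling a^i puts 1 - a^(j-i) into \<open>P\<close>, and then
      \<open>J\<close> contains 1.\<close>
    have "a:P" if a: "a:J" for a
    proof (rule ccontr)
     assume aP: "a ~: P"
     have aO: "a:ints F" using id(2)[OF J(1) a] .
     have pw: "a [^] n:ints F" "a [^] n ~: P" for n :: nat
     proof -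
      show p: "a [^] n:ints F" for n :: nat by (induction n) (use aO os(3,6) in auto)
      show "a [^] n ~: P"
      proof (induction n)
       case 0 thus ?case using one J by auto
      next
       case (Suc n) thus ?case using P.I_prime[of "a [^] n" a] p aO aP by auto
      qed
     qed
     let ?f = "%n::nat. P +>\<^bsub>?Q\<^esub> (a [^] n)"
     have "range ?f <= carrier (?Q Quot P)" using pw by (auto simp: FactRing_def A_RCOSETS_defs a_r_coset_def)
     hence "~ inj ?f" using finite_imageD fin[OF Pi P(2)] finite_subset by blast
     then obtain i j where ij: "i < j" "?f i = ?f j" unfolding inj_def by (metis linorder_neqE_nat)
     then obtain k where k: "j = Suc (i + k)" using less_iff_Suc_add by auto
     have "a [^] i \<ominus> a [^] j:P" using Q.quotient_eq_iff_same_a_r_cos[OF Pi, of "a [^] i" "a [^] j"] pw ij Qm by simp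
     moreover have "a [^] i \<ominus> a [^] j = a [^] i \<otimes> (\<one> \<ominus> a [^] k \<otimes> a)"
     proof -
      have c: "a [^] i:carrier R" "a [^] k:carrier R" "a:carrier R" using aO Oc by auto
      have "a [^] j = a [^] i \<otimes> (a [^] k \<otimes> a)" using c by (simp add: k nat_pow_mult[symmetric] m_assoc)
      moreover have "a [^] i \<ominus> a [^] i \<otimes> (a [^] k \<otimes> a) = a [^] i \<otimes> (\<one> \<ominus> a [^] k \<otimes> a)"
       using c by algebra
      ultimately show ?thesis by simp
     qed
     moreover have d: "\<one> \<ominus> a [^] k \<otimes> a:ints F" using os pw aO by (simp add: a_minus_def)
     ultimately have dJ: "\<one> \<ominus> a [^] k \<otimes> a:J" and akJ: "a [^] k \<otimes> a:J"
      using J P.I_prime[of "a [^] i" "\<one> \<ominus> a [^] k \<otimes> a"] pw id(3)[OF J(1) a pw(1)[of k]] m_comm Oc aO by auto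
     interpret J: ideal J ?Q by (rule J)
     have "(\<one> \<ominus> a [^] k \<otimes> a) \<oplus> a [^] k \<otimes> a:J" using J.a_closed[OF dJ akJ] by simp
     moreover have "(\<one> \<ominus> a [^] k \<otimes> a) \<oplus> a [^] k \<otimes> a = \<one>"
      using Oc[OF pw(1)[of k]] Oc[OF aO] by algebra
     ultimately show False using one by simp
    qed
    thus "J = P" using J by auto
   qed
  qed
 qed
 have ic: "EX c:ints F. b = a \<otimes> c"
  if J: "ideal J ?Q" "J ~= {\<zero>}" and ab: "a:ints F" "b:ints F" "a ~= \<zero>"
   and ex: "!!x. x:J ==> EX y:J. b \<otimes> x = a \<otimes> y" for J a b
 proof -
  obtain j where j: "j:J" "j ~= \<zero>" using id[OF J(1)] J by auto
  have ha: "h a ~= 0" using h_simps ab Oc by simp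
  \<comment> \<open>Multiplication by b/a maps \<open>J\<close> into itself, so all z^k h(j) stay in
    the finitely generated group of integers, and z is an algebraic integer.\<close>
  define z where "z = h b / h a"
  have "z ^ k * h j:h ` J" for k
  proof (induction k)
   case 0 thus ?case using j by simp
  next
   case (Suc k)
   then obtain x where x: "x:J" "z ^ k * h j = h x" by auto
   then obtain y where y: "y:J" "b \<otimes> x = a \<otimes> y" using ex by auto
   hence "h b * h x = h a * h y" using h_simps Oc ab id[OF J(1)] x by metis
   thus ?case using x y ha by (simp add: mult.assoc z_def)
  qed
  moreover have "h ` J <= zm.span C" using id[OF J(1)] C by auto
  ultimately have "algebraic_int z"
   using h_simps j Oc id[OF J(1)] by (intro algebraic_int_criterion[OF C(1), of "h j"]) auto
  moreover have "z:h ` F" unfolding z_def using ab ints_iff[OF s(1)] csubD[OF subfield_image(1)[OF F(1)]] by simp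
  ultimately obtain c where c: "c:ints F" "z = h c" using ints_iff[OF s(1)] by auto
  have "h b = h (a \<otimes> c)" using h_simps Oc ab c ha by (simp add: z_def field_simps)
  thus ?thesis using c h_simps(9) Oc ab by auto
 qed
 show ?thesis
  unfolding roi
 proof (rule dedekind.intro[OF Q.domain_axioms dedekind_axioms.intro])
  fix J a b
  assume "ideal J ?Q" "J ~= {\<zero>\<^bsub>?Q\<^esub>}" "a:carrier ?Q" "b:carrier ?Q" "a ~= \<zero>\<^bsub>?Q\<^esub>"
   and ex: "!!x. x:J ==> EX y:J. b \<otimes>\<^bsub>?Q\<^esub> x = a \<otimes>\<^bsub>?Q\<^esub> y"
  thus "EX c:carrier ?Q. b = a \<otimes>\<^bsub>?Q\<^esub> c" using ic by simp
 qed (use fin max in simp_all)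
qed

end

section \<open>Discrete valuations and ramification groups\<close>

locale dval =
 fixes L :: "complex set" and v :: "complex => int"
 assumes L: "csub L"
  and vmult: "[|x:L; y:L; x ~= 0; y ~= 0|] ==> v (x * y) = v x + v y"
  and vadd: "[|x:L; y:L; x ~= 0; y ~= 0; x + y ~= 0|] ==> min (v x) (v y) <= v (x + y)"
begin

lemmas L' = csubD[OF L]

text \<open>The valuation is unconstrained at 0; \<open>vge\<close> treats 0 as having infinite
  valuation.\<close>

definition vge :: "int => complex => bool" where "vge n x <-> x = 0 \<or> n <= v x"

lemma v_one: "v 1 = 0" using vmult[of 1 1] L' by simp

lemma v_minus: assumes "x:L" shows "v (- x) = v x"
proof (cases "x = 0")
 case False
 show ?thesis using vmult[of "-1" x] assms False L' vmult[of "-1" "-1"] v_one by simp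
qed simp

lemma v_inverse: "x:L ==> x ~= 0 ==> v (inverse x) = - v x"
 using vmult[of x "inverse x"] L' v_one by simp

lemma v_power: "x:L ==> x ~= 0 ==> v (x ^ n) = int n * v x"
 by (induction n) (auto simp: v_one vmult csub_power[OF L] algebra_simps)

lemma v_prod: "finite I ==> (!!i. i:I ==> f i:L & f i ~= 0) ==> v (prod f I) = (\<Sum>i\<in>I. v (f i))"
 by (induction I rule: finite_induct) (auto simp: v_one vmult csub_prod[OF L])

lemma vge_0 [simp]: "vge n 0" by (simp add: vge_def)

lemma vge_1: "vge 0 1" by (simp add: vge_def v_one)

lemma vge_mono: "vge n x ==> m <= n ==> vge m x" by (auto simp: vge_def)

lemma vge_add: "x:L ==> y:L ==> vge n x ==> vge n y ==> vge n (x + y)"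
 using vadd[of x y] by (cases "x = 0"; cases "y = 0"; cases "x + y = 0") (auto simp: vge_def)

lemma vge_minus: "x:L ==> vge n (- x) <-> vge n x" by (simp add: vge_def v_minus)

lemma vge_diff: "x:L ==> y:L ==> vge n x ==> vge n y ==> vge n (x - y)"
 using vge_add[of x "- y" n] vge_minus L' by simp

lemma vge_diff_commute: "x:L ==> y:L ==> vge n (x - y) <-> vge n (y - x)"
 using vge_minus[of "x - y" n] L' by simp

lemma vge_mult: "x:L ==> y:L ==> vge m x ==> vge n y ==> vge (m + n) (x * y)"
 by (cases "x = 0"; cases "y = 0") (auto simp: vge_def vmult)

lemma vge_mult0: "x:L ==> y:L ==> vge m x ==> vge 0 y ==> vge m (x * y)" "x:L ==> y:L ==> vge m x ==> vge 0 y ==> vge m (y * x)"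
 using vge_mult[of x y m 0] by (auto simp: mult.commute)

lemma vge_power0: "x:L ==> vge 0 x ==> vge 0 (x ^ n)"
 by (induction n) (auto simp: vge_1 csub_power[OF L] intro: vge_mult0)

lemma vge_sum: "(!!i. i:I ==> f i:L & vge n (f i)) ==> vge n (sum f I)"
 by (induction I rule: infinite_finite_induct) (auto intro!: vge_add csub_sum[OF L])

lemma vge_prod0: "(!!i. i:I ==> f i:L & vge 0 (f i)) ==> vge 0 (prod f I)"
 by (induction I rule: infinite_finite_induct) (auto intro!: vge_mult0 csub_prod[OF L] simp: vge_1)

lemma vge_trans: "x:L ==> y:L ==> z:L ==> vge n (x - y) ==> vge n (y - z) ==> vge n (x - z)"
 using vge_add[of "x - y" "y - z" n] L' by simp

lemma v_eq_of_close: assumes "x:L" "y:L" "x ~= 0" "vge n (y - x)" "v x < n" shows "y ~= 0" "v y = v x"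
proof -
 show y0: "y ~= 0" using assms v_minus by (auto simp: vge_def)
 have "vge (v x) (x + (y - x))" using assms L' by (intro vge_add) (auto simp: vge_def)
 hence 1: "v x <= v y" using y0 by (simp add: vge_def)
 show "v y = v x"
 proof (rule ccontr)
  assume "v y ~= v x"
  thus False using assms vge_diff[of y "y - x" "v x + 1"] assms L' 1 assms by (auto simp: vge_def)
 qed
qed

text \<open>A monic polynomial of degree n cannot have more than n well-separated roots, even
  approximately. Dividing out X - r costs at most \<open>C\<close> of the precision at the other
  roots, and in degree 0 the polynomial is 1, of valuation 0.\<close>

lemma approximate_roots:
 assumes "finite R" "n < card R" "R <= L" "0 <= C"
  and sep: "!!r s. r:R ==> s:R ==> r ~= s ==> v (r - s) <= C"
  and f: "f:pols L" "plc f = 1" "pdeg f = n"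
  and root: "!!r. r:R ==> vge N (poly f r)"
 shows "N <= int n * C"
 using assms(1-3) sep f root
proof (induction n arbitrary: R f N)
 case 0
 then obtain r where r: "r:R" by fastforce
 have "f = 1" using 0 by (metis degree_eq_zeroE lead_coeff_pCons(2) one_pCons)
 thus ?case using 0(8)[OF r] by (simp add: vge_def v_one)
next
 case (Suc n)
 then obtain r where r: "r:R" by fastforce
 define g where "g = synthetic_div f r"
 have fg: "f = [:- r, 1:] * g + [:poly f r:]" using synthetic_div_correct'[of r f] by (simp add: g_def)
 have g0: "g ~= 0"
 proof
  assume "g = 0"
  hence "f = [:poly f r:]" using fg by simp
  hence "pdeg f = 0" by (metis degree_pCons_0)
  thus False using Suc by simp
 qed
 have rL: "r:L" and dg: "pdeg g = n" using r Suc by (auto simp: g_def degree_synthetic_div)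
 have lg: "plc g = 1"
 proof -
  have "pcf f (Suc n) = pcf g n" using dg by (subst fg) (simp add: coeff_eq_0)
  thus ?thesis using Suc dg by simp
 qed
 have lin: "[:- r, 1:]:pols L" using rL L' pols_simps[OF L] by simp
 have gL: "g:pols L"
 proof -
  obtain u s where us: "u:pols L" "s:pols L" "f = u * [:- r, 1:] + s"
   "s = 0 \<or> pdeg s < pdeg [:- r, 1:]"
   using pols_division[OF L lin _ Suc(6)] by auto
  hence "pdeg s = 0" by auto
  then obtain c where c: "s = [:c:]" by (metis degree_eq_zeroE)
  have "[:- r, 1:] * g = [:- r, 1:] * u" using us fg c by simp
  thus ?thesis using us by (metis mult_cancel_left pCons_eq_0_iff one_neq_zero)
 qed
 have "N - C <= int n * C"
 proof (rule Suc.IH[of "R - {r}" g])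
  show "finite (R - {r})" "n < card (R - {r})" "R - {r} <= L" using Suc r by auto
  show "v (a - b) <= C" if "a:R - {r}" "b:R - {r}" "a ~= b" for a b using that Suc by simp
  fix s assume s: "s:R - {r}"
  hence sL: "s:L" using Suc by auto
  have "(s - r) * poly g s = poly f s - poly f r" by (subst fg) (simp add: algebra_simps)
  moreover have "vge N (poly f s - poly f r)"
   using Suc(9) r s pols_simps(9)[OF L Suc(6)] sL rL by (intro vge_diff) auto
  ultimately have v: "vge N ((s - r) * poly g s)" by simp
  show "vge (N - C) (poly g s)" using v vmult[of "s - r" "poly g s"] sL rL L' s r Suc(5)[of s r] pols_simps(9)[OF L gL sL]
   by (fastforce simp: vge_def)
 qed (use gL lg dg in auto)
 thus ?case by (simp add: algebra_simps)
qed

end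

text \<open>\<open>q\<close> stands for the order of the residue field. The powers x^(q^n)
  approximate the Teichmueller representative of x: they stay congruent to x, and a change of x
  within its residue class alters them only from precision n + 1 on.\<close>

locale rval = dval +
 fixes q :: nat and uz :: complex
 assumes pi: "uz:L" "uz ~= 0" "v uz = 1"
  and q: "0 < q" "vge 1 (of_nat q)" and frob: "x:L ==> vge 0 x ==> vge 1 (x ^ q - x)"
begin

text \<open>x^q - y^q is x - y times a sum of q terms, each congruent to y^(q-1) modulo the maximal
  ideal, and q itself lies in that ideal.\<close>

lemma pow_q_close:
 assumes x: "x:L" "y:L" "vge 0 x" "vge 0 y" and k: "1 <= k" "vge k (x - y)"
 shows "vge (k + 1) (x ^ q - y ^ q)"
proof -
 have diff: "vge 1 (x ^ i - y ^ i)" for i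
 proof (induction i)
  case (Suc i)
  have "x ^ Suc i - y ^ Suc i = x * (x ^ i - y ^ i) + (x - y) * y ^ i" by (simp add: algebra_simps)
  moreover have "vge 1 (x * (x ^ i - y ^ i))" using Suc x csub_power[OF L] L' by (intro vge_mult0(2)) auto
  moreover have "vge 1 ((x - y) * y ^ i)"
   using x csub_power[OF L] L' vge_mono[OF k(2) k(1)] vge_power0 by (intro vge_mult0(1)) auto
  ultimately show ?case using x csub_power[OF L] L' vge_add by simp
 qed simp
 let ?S = "\<Sum>i<q. y ^ (q - Suc i) * x ^ i"
 have SL: "?S:L" using x csub_power[OF L] L' by (intro csub_sum[OF L]) auto
 have "?S - of_nat q * y ^ (q - 1) = (\<Sum>i<q. y ^ (q - Suc i) * (x ^ i - y ^ i))"
 proof -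
  have "of_nat q * y ^ (q - 1) = (\<Sum>i<q. y ^ (q - 1))" by simp
  also have "\<dots> = (\<Sum>i<q. y ^ (q - Suc i) * y ^ i)" by (intro sum.cong) (auto simp flip: power_add)
  finally show ?thesis by (simp add: sum_subtractf right_diff_distrib)
 qed
 moreover have "vge 1 (\<Sum>i<q. y ^ (q - Suc i) * (x ^ i - y ^ i))"
 proof (rule vge_sum)
  fix i
  show "y ^ (q - Suc i) * (x ^ i - y ^ i):L & vge 1 (y ^ (q - Suc i) * (x ^ i - y ^ i))"
   using diff x csub_power[OF L] L' vge_power0 by (intro conjI vge_mult0(2)) auto
 qed
 ultimately have 1: "vge 1 (?S - of_nat q * y ^ (q - 1))" by simp
 have 2: "vge 1 (of_nat q * y ^ (q - 1))"
  using q x csub_power[OF L] csub_of_nat[OF L] vge_power0 by (intro vge_mult0(1)) auto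
 have "of_nat q * y ^ (q - 1):L" using x csub_power[OF L] csub_of_nat[OF L] L' by simp
 hence "vge 1 ((?S - of_nat q * y ^ (q - 1)) + of_nat q * y ^ (q - 1))"
  using SL 1 2 L' by (intro vge_add)
 hence "vge (k + 1) ((x - y) * ?S)" using k x SL L' by (intro vge_mult) auto
 thus ?thesis by (simp add: power_diff_sumr2)
qed

lemma pow_qn_close:
 assumes x: "x:L" "y:L" "vge 0 x" "vge 0 y" "vge 1 (x - y)"
 shows "vge (int n + 1) (x ^ (q ^ n) - y ^ (q ^ n))"
proof (induction n)
 case (Suc n)
 have "vge (int n + 1 + 1) ((x ^ (q ^ n)) ^ q - (y ^ (q ^ n)) ^ q)"
  using Suc x csub_power[OF L] vge_power0 by (intro pow_q_close) auto
 thus ?case by (simp add: power_mult[symmetric] mult.commute)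
qed (use x in simp)

lemma pow_qn: "x:L ==> vge 0 x ==> vge 1 (x ^ (q ^ n) - x)"
proof (induction n)
 case (Suc n)
 have "vge 1 ((x ^ (q ^ n)) ^ q - x ^ (q ^ n))" using Suc csub_power[OF L] vge_power0 by (intro frob) auto
 hence "vge 1 (((x ^ (q ^ n)) ^ q - x ^ (q ^ n)) + (x ^ (q ^ n) - x))"
  using Suc csub_power[OF L] L' by (intro vge_add) auto
 thus ?case by (simp add: power_mult[symmetric] mult.commute)
qed simp

lemma split_pi: assumes "x:L" "vge 1 x" shows "x / uz:L" "vge 0 (x / uz)" "x = uz * (x / uz)"
 using assms pi L' vmult v_inverse by (auto simp: vge_def divide_inverse)

lemma split_unit: assumes "x:L" "x ~= 0" "0 <= v x"
 obtains u where "u:L" "u ~= 0" "v u = 0" "x = uz ^ nat (v x) * u"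
proof -
 let ?u = "x * inverse (uz ^ nat (v x))"
 have p: "uz ^ nat (v x):L" "uz ^ nat (v x) ~= 0" using pi csub_power[OF L] by auto
 have v: "v ?u = 0" using assms vmult v_inverse[OF p] v_power[OF pi(1,2)] p L'(7)[OF p(1)] pi by auto
 show thesis using that[OF _ _ v] assms p L'(6)[OF assms(1) L'(7)[OF p(1)]] by simp
qed

end

locale galois_rval = rval +
 fixes K :: "complex set"
 assumes G: "cgalois K L"
begin

lemma K: "csub K" "K <= L" "finite (cgal L K)" using G by (auto simp: cgalois_def)

definition ram :: "nat => (complex => complex) set" where
 "ram j = {s:cgal L K. ALL x:L. vge 0 x --> vge (int j + 1) (s x - x)}"

definition idm :: "complex => complex" where "idm = restrict id L"

text \<open>The function i of ramification theory, read off at the uniformiser. By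
  \<open>ram_iff\<close> this single value decides to which ramification groups a nontrivial inertia
  element belongs.\<close>

definition ii :: "(complex => complex) => int" where "ii s = v (s uz - uz)"

lemma idm: "idm:cgal L K" "x:L ==> idm x = x" "idm:ram j"
 using cgal_id[OF L K(2)] by (auto simp: idm_def ram_def)

lemma finite_ram: "finite (ram j)" using K by (simp add: ram_def)

lemma ram_anti: "i <= j ==> ram j <= ram i" unfolding ram_def by (auto intro: vge_mono)

lemma ramD: assumes "s:ram 0"
 shows "s:cgal L K" "!!x. x:L ==> s x:L" "!!x. x:L ==> vge 0 x ==> vge 1 (s x - x)" "chom L s"
 using assms cgalD by (auto simp: ram_def)

text \<open>Units keep valuation 0 under \<open>s\<close>, so v (s y) = k v y with k = v (s uz).
  Since \<open>s\<close> is onto, k divides 1, and k cannot be negative.\<close>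

lemma inertia_val:
 assumes s: "s:ram 0" and x: "x:L" "x ~= 0"
 shows "v (s x) = v x" "s x ~= 0"
proof -
 note s' = ramD[OF s] and sh = chomD[OF ramD(4)[OF s] L]
 show "s x ~= 0" using sh x by simp
 have unit: "v (s u) = 0" if u: "u:L" "u ~= 0" "v u = 0" for u
  using v_eq_of_close[OF u(1) s'(2)[OF u(1)] u(2) s'(3)[OF u(1)]] u by (simp add: vge_def)
 define k where "k = v (s uz)"
 have spi: "s uz:L" "s uz ~= 0" using s' pi sh by auto
 have pos: "v (s y) = k * v y" if y: "y:L" "y ~= 0" "0 <= v y" for y
 proof -
  obtain u where u: "u:L" "u ~= 0" "v u = 0" "y = uz ^ nat (v y) * u" by (rule split_unit[OF y])
  have "s y = s uz ^ nat (v y) * s u" using sh u(1) pi csub_power[OF L] by (subst u(4)) simp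
  thus ?thesis
   using unit[OF u(1-3)] vmult v_power[OF spi] spi csub_power[OF L] u sh s'(2) y(3) by (simp add: k_def)
 qed
 have all: "v (s y) = k * v y" if y: "y:L" "y ~= 0" for y
 proof (cases "0 <= v y")
  case False
  have y': "inverse y:L" "inverse y ~= 0" "0 <= v (inverse y)" using y False v_inverse L' by auto
  show ?thesis using pos[OF y'] v_inverse y sh(8)[OF y(1)] v_inverse s'(2)[OF y(1)] sh(7)[OF y(1)] by simp
 qed (rule pos[OF y])
 have "uz:s ` L" using cgalD[OF s'(1)] pi by simp
 then obtain y where y: "y:L" "s y = uz" by auto
 have y0: "y ~= 0" using y sh pi by auto
 have "k * v y = 1" using all[OF y(1) y0] y pi by simp
 moreover have "k >= 0"
 proof -
  have "vge 1 (uz + (s uz - uz))" using pi spi L' s' by (intro vge_add) (auto simp: vge_def)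
  thus ?thesis using spi by (simp add: vge_def k_def)
 qed
 ultimately show "v (s x) = v x" using all[OF x] by (simp add: zmult_eq_1_iff)
qed

lemma inertia_vge: assumes "s:ram 0" "x:L" shows "vge n (s x) <-> vge n x"
 using inertia_val[OF assms] chomD[OF ramD(4)[OF assms(1)] L] by (cases "x = 0") (auto simp: vge_def)

text \<open>Expand x in powers of \<open>uz\<close> with digits that are q^m-th powers. Inertia
  moves such digits only beyond precision m, so the movement of x is governed by that of
  \<open>uz\<close>; the tail keeps its high valuation.\<close>

lemma ram_uniformizer:
 assumes s: "s:ram 0" and m: "vge (int m) (s uz - uz)" and x: "x:L" "vge 0 x"
 shows "vge (int m) (s x - x)"
proof -
 note s' = ramD[OF s] and sh = chomD[OF ramD(4)[OF s] L]
 have "EX t:L. vge 0 t & vge (int N) (x - t) & vge (int m) (s t - t)" if "x:L" "vge 0 x" for N x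
  using that
 proof (induction N arbitrary: x)
  case 0 thus ?case using L' sh(2) by (intro bexI[of _ 0]) auto
 next
  case (Suc N)
  let ?a = "x ^ (q ^ m)"
  have a: "?a:L" "vge 0 ?a" using Suc csub_power[OF L] vge_power0 by auto
  obtain z where z: "z:L" "vge 0 z" "x - ?a = uz * z"
   using split_pi[of "x - ?a"] a Suc L' pow_qn[OF Suc(2,3), of m] vge_diff_commute by auto
  obtain t where t: "t:L" "vge 0 t" "vge (int N) (z - t)" "vge (int m) (s t - t)" using Suc.IH[OF z(1,2)] by auto
  define t' where "t' = ?a + uz * t"
  have "x - t' = uz * (z - t)" using z by (simp add: t'_def algebra_simps)
  moreover have "vge (1 + int N) (uz * (z - t))" using pi z t L' by (intro vge_mult) (auto simp: vge_def)
  ultimately have 1: "vge (int (Suc N)) (x - t')" by simp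
  have "s t' - t' = (s ?a - ?a) + (s uz * (s t - t) + (s uz - uz) * t)"
   using sh a t pi L' by (simp add: t'_def algebra_simps)
  moreover have "vge (int m) (s ?a - ?a)"
  proof -
   have "vge (int m + 1) (s x ^ (q ^ m) - x ^ (q ^ m))"
    using Suc s' inertia_vge[OF s] by (intro pow_qn_close) auto
   thus ?thesis using sh(9)[OF Suc(2)] vge_mono by simp
  qed
  moreover have "vge (int m) (s uz * (s t - t))"
   using t pi s' L' inertia_vge[OF s pi(1)] by (intro vge_mult0(2)) (auto simp: vge_def)
  moreover have "vge (int m) ((s uz - uz) * t)" using t pi s' L' m by (intro vge_mult0(1)) auto
  ultimately have 2: "vge (int m) (s t' - t')" using a t pi s' L' by (simp add: vge_add)
  have "vge 0 t'" unfolding t'_def using a t pi L' by (intro vge_add vge_mult0(2)) (auto simp: vge_def)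
  moreover have "t':L" using a t pi L' by (simp add: t'_def)
  ultimately show ?case using 1 2 by auto
 qed
 then obtain t where t: "t:L" "vge (int m) (x - t)" "vge (int m) (s t - t)" using x by auto
 have eq: "s x - x = (s (x - t) - (x - t)) + (s t - t)" and xt: "x - t:L" using sh x t L'(5)[OF x(1) t(1)] by auto
 have sxt: "s (x - t):L" "s t - t:L" using s'(2)[OF xt] L'(5)[OF s'(2)[OF t(1)] t(1)] by auto
 show ?thesis using inertia_vge[OF s xt] t vge_diff[OF sxt(1) xt _ t(2)] vge_add[OF L'(5)[OF sxt(1) xt] sxt(2) _ t(3)]
  unfolding eq by simp
qed

lemma ii_pos: assumes "s:ram 0" "s ~= idm" shows "s uz ~= uz" "1 <= ii s"
proof -
 note s' = ramD[OF assms(1)] and sh = chomD[OF ramD(4)[OF assms(1)] L]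
 show ne: "s uz ~= uz"
 proof
  assume "s uz = uz"
  hence all: "vge (int m) (s x - x)" if "x:L" "vge 0 x" for m x using ram_uniformizer[OF assms(1) _ that] by simp
  have int: "s x = x" if "x:L" "vge 0 x" for x
  proof (rule ccontr)
   assume "s x ~= x"
   hence "int m <= v (s x - x)" for m using all[OF that] by (simp add: vge_def)
   from this[of "nat (v (s x - x) + 1)"] show False by linarith
  qed
  have "s x = x" if "x:L" for x
  proof (cases "vge 0 x")
   case True thus ?thesis using int that by simp
  next
   case False
   thus ?thesis using sh(8)[OF that] int[OF L'(7)[OF that]] that v_inverse by (auto simp: vge_def)
  qed
  hence "s = idm" using idm s' by (intro cgal_eqI[of _ L K]) auto
  thus False using assms by simp
 qed
 show "1 <= ii s" using ne s' pi by (fastforce simp: vge_def ii_def)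
qed

lemma ram_iff: "s:ram j <-> s:ram 0 & (s = idm \<or> int j + 1 <= ii s)"
proof
 assume s: "s:ram j"
 hence "s:ram 0" using ram_anti by auto
 moreover have "vge (int j + 1) (s uz - uz)" using s pi by (auto simp: ram_def vge_def)
 ultimately show "s:ram 0 & (s = idm \<or> int j + 1 <= ii s)" using ii_pos by (auto simp: vge_def ii_def)
next
 assume s: "s:ram 0 & (s = idm \<or> int j + 1 <= ii s)"
 show "s:ram j"
 proof (cases "s = idm")
  case False
  hence "vge (int (j + 1)) (s uz - uz)" using s by (simp add: vge_def ii_def)
  hence "vge (int (j + 1)) (s x - x)" if "x:L" "vge 0 x" for x using ram_uniformizer s that by blast
  thus ?thesis using s by (auto simp: ram_def add.commute)
 qed (use idm in simp)
qed

lemma ram_compose: assumes "s:ram 0" "t:ram 0" shows "compose L s t:ram 0"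
proof -
 note s = ramD[OF assms(1)] and t = ramD[OF assms(2)]
 have "vge 1 (s (t x) - x)" if x: "x:L" "vge 0 x" for x
  using vge_trans[of "s (t x)" "t x" x 1] s t x inertia_vge[OF assms(2)] by auto
 thus ?thesis using cgal_compose[OF L K(2) s(1) t(1)] by (auto simp: ram_def compose_def)
qed

lemma ram_inverse: assumes "s:ram 0"
 shows "EX t:ram 0. ALL x:L. s (t x) = x & t (s x) = x"
proof -
 obtain t where t: "t:cgal L K" "ALL x:L. s (t x) = x & t (s x) = x"
  using cgal_inverse[OF L K(2) ramD(1)[OF assms]] by auto
 have "vge 1 (t x - x)" if x: "x:L" "vge 0 x" for x
 proof -
  have tx: "t x:L" using cgalD(4)[OF t(1) x(1)] .
  show ?thesis using vge_diff_commute[OF x(1) tx] ramD(3)[OF assms tx] inertia_vge[OF assms tx] x t x by simp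
 qed
 thus ?thesis using t t by (auto simp: ram_def)
qed

end

section \<open>The last jump in the upper numbering\<close>

context galois_rval
begin

text \<open>For nontrivial inertia this is |G_0| (phi(j) + 1), where j is the last index with G_j
  nontrivial and phi is the Herbrand function.\<close>

definition ram_sum :: int where
 "ram_sum = (\<Sum>s\<in>ram 0 - {idm}. ii s) + Max (ii ` (ram 0 - {idm}))"

text \<open>States phi(j) < n for every nontrivial G_j, that is G^n = 1, with the denominator |G_0|
  of the Herbrand function cleared.\<close>

definition triv :: "nat => bool" where
 "triv n <-> (ALL j. ram j ~= {idm} --> (\<Sum>i=1..j. card (ram i)) < n * card (ram 0))"

text \<open>Double counting of the pairs (i, s) with s in G_i: a nontrivial s occurs exactly for the
  i below i(s).\<close>

lemma sum_card_ram:
 "(\<Sum>i\<le>c. int (card (ram i))) = int c + 1 + (\<Sum>s\<in>ram 0 - {idm}. min (ii s) (int c + 1))"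
proof -
 have "(\<Sum>i\<le>c. int (card (ram i))) = (\<Sum>i\<le>c. \<Sum>s\<in>ram 0. if s:ram i then 1 else 0)"
  using ram_anti finite_ram by (intro sum.cong) (auto simp flip: sum.inter_filter intro!: arg_cong[of _ _ card])
 also have "\<dots> = (\<Sum>s\<in>ram 0. \<Sum>i\<le>c. if s:ram i then 1 else 0)" by (rule sum.swap)
 also have "\<dots> = (\<Sum>i\<le>c. if idm:ram i then 1 else 0) + (\<Sum>s\<in>ram 0 - {idm}. \<Sum>i\<le>c. if s:ram i then 1 else 0)"
  using finite_ram idm by (subst sum.remove[of _ idm]) auto
 also have "(\<Sum>i\<le>c. if idm:ram i then 1 else 0) = int c + 1" using idm by simp
 also have "(\<Sum>s\<in>ram 0 - {idm}. \<Sum>i\<le>c. if s:ram i then 1 else 0) = (\<Sum>s\<in>ram 0 - {idm}. min (ii s) (int c + 1))"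
 proof (rule sum.cong)
  fix s assume s: "s:ram 0 - {idm}"
  have iff: "s:ram i <-> int i + 1 <= ii s" for i using s ram_iff[of s i] by auto
  have "{i:{..c}. s:ram i} = {..<nat (min (ii s) (int c + 1))}" unfolding iff by auto
  moreover have "(\<Sum>i\<le>c. if s:ram i then 1 else 0) = int (card {i:{..c}. s:ram i})"
   by (simp flip: sum.inter_filter)
  ultimately show "(\<Sum>i\<le>c. if s:ram i then 1 else 0) = min (ii s) (int c + 1)" using ii_pos[of s] s by simp
 qed simp
 finally show ?thesis .
qed

lemma triv_trivial: "ram 0 = {idm} ==> triv n"
 using ram_anti idm unfolding triv_def by auto

lemma triv_iff:
 assumes nt: "ram 0 ~= {idm}"
 shows "triv n <-> ram_sum < (int n + 1) * int (card (ram 0))"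
proof -
 let ?I = "ram 0 - {idm}"
 have ne: "?I ~= {}" and fin: "finite ?I" using nt idm finite_ram by auto
 \<comment> \<open>Membership of s in G_i means i + 1 <= i(s), so the last nontrivial index is the
   largest i(s) minus 1.\<close>
 define j where "j = nat (Max (ii ` ?I) - 1)"
 have "Max (ii ` ?I):ii ` ?I" using fin ne by simp
 then obtain s where s: "s:?I" "Max (ii ` ?I) = ii s" by auto
 have j: "int j + 1 = ii s" using ii_pos[of s] s by (auto simp: j_def)
 have le: "ii t <= int j + 1" if "t:?I" for t using Max_ge[of "ii ` ?I" "ii t"] fin that s j by auto
 have "(\<Sum>i\<le>j. int (card (ram i))) = ram_sum"
 proof -
  show ?thesis using j s le by (simp add: sum_card_ram ram_sum_def)
 qed
 moreover have "(\<Sum>i\<le>j. int (card (ram i))) = int (card (ram 0)) + int (\<Sum>i=1..j. card (ram i))"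
  by (simp add: atMost_atLeast0 sum.atLeast_Suc_atMost)
 ultimately have eq: "ram_sum = int (card (ram 0)) + int (\<Sum>i=1..j. card (ram i))" by simp
 have "triv n <-> (\<Sum>i=1..j. card (ram i)) < n * card (ram 0)"
 proof
  have "ram j ~= {idm}" using s j by (fastforce simp: ram_iff[of s j])
  thus "triv n ==> (\<Sum>i=1..j. card (ram i)) < n * card (ram 0)" by (auto simp: triv_def)
 next
  assume a: "(\<Sum>i=1..j. card (ram i)) < n * card (ram 0)"
  show "triv n" unfolding triv_def
  proof (intro allI impI)
   fix k assume "ram k ~= {idm}"
   then obtain t where t: "t:ram k" "t ~= idm" using idm by auto
   hence "k <= j" using le[of t] by (auto simp: ram_iff[of t k])
   hence "(\<Sum>i=1..k. card (ram i)) <= (\<Sum>i=1..j. card (ram i))" by (intro sum_mono2) auto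
   thus "(\<Sum>i=1..k. card (ram i)) < n * card (ram 0)" using a by simp
  qed
 qed
 also have "\<dots> <-> int (\<Sum>i=1..j. card (ram i)) < int (n * card (ram 0))" by (simp only: of_nat_less_iff)
 also have "\<dots> <-> ram_sum < (int n + 1) * int (card (ram 0))" using eq by (simp add: algebra_simps)
 finally show ?thesis .
qed

lemma compose_inj: assumes "t:cgal L K" shows "inj_on (compose L t) (cgal L K)"
 using cgal_compose_bij[OF L K(2) assms] by (simp add: bij_betw_def)

lemma coeff_vge:
 assumes "finite A" "!!s. s:A ==> f s:L & vge 0 (f s)"
 shows "pcf (\<Prod>s\<in>A. [:- f s, 1:]) i:L & vge 0 (pcf (\<Prod>s\<in>A. [:- f s, 1:]) i)"
 using assms
proof (induction A arbitrary: i rule: finite_induct)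
 case empty
 thus ?case using L' by (cases i) (auto simp: vge_1)
next
 case (insert s A)
 let ?p = "\<Prod>s\<in>A. [:- f s, 1:]"
 have IH: "pcf ?p j:L & vge 0 (pcf ?p j)" for j using insert by simp
 have "vge 0 (- f s * pcf ?p i)"
  using insert L'(3) vge_minus by (intro vge_mult0(1)) auto
 moreover have "- f s * pcf ?p i:L" using insert L' by simp
 moreover have eq: "pcf (\<Prod>s\<in>insert s A. [:- f s, 1:]) i
   = - f s * pcf ?p i + pcf (pCons 0 ?p) i"
  using insert by simp
 moreover have "pcf (pCons 0 ?p) i:L & vge 0 (pcf (pCons 0 ?p) i)"
  using IH L' by (cases i) auto
 ultimately show ?case unfolding eq using vge_add L'(4) by blast
qed

end

section \<open>Ramification groups in a tower\<close>

locale val_ext = S: galois_rval L v q uz K + B: galois_rval L' v' q' uz' K for L v q uz K L' v' q' uz' +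
 fixes e :: nat
 assumes sub: "L <= L'" and rel: "cgalois L L'"
  and e: "0 < e" and ve: "!!x. x:L ==> x ~= 0 ==> v' x = int e * v x"
begin

text \<open>The inertia group of L'/L, cut out of that of L'/K.\<close>

definition H0 :: "(complex => complex) set" where "H0 = {t:B.ram 0. ALL x:L. t x = x}"

lemma finite_H0: "finite H0" using B.finite_ram by (simp add: H0_def)

lemma vge_up: "x:L ==> B.vge n x <-> x = 0 \<or> n <= int e * v x"
 using ve by (auto simp: B.vge_def)

lemma vge_0_iff: "x:L ==> B.vge 0 x <-> S.vge 0 x"
 using e by (simp add: vge_up S.vge_def zero_le_mult_iff)

lemma pi_up: "uz:L'" "v' uz = int e" "B.vge (int e) uz"
 using S.pi sub ve by (auto simp: B.vge_def)

text \<open>With more than e automorphisms, their values at uz' would be more than e separated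
  points, all of them roots up to any precision N of a monic polynomial of degree e whose
  coefficients \<open>H0\<close> barely moves. \<open>approximate_roots\<close> bounds N by e
  C.\<close>

lemma H0_card: "card H0 <= e"
proof (rule ccontr)
 assume big: "~ card H0 <= e"
 let ?R = "(%t. t uz') ` H0"
 have H: "t:B.ram 0" "!!x. x:L ==> t x = x" if "t:H0" for t using that by (auto simp: H0_def)
 have inj: "inj_on (%t. t uz') H0"
 proof (rule inj_onI)
  fix s t assume st: "s:H0" "t:H0" "s uz' = t uz'"
  obtain r where r: "r:B.ram 0" "ALL x:L'. s (r x) = x & r (s x) = x" using B.ram_inverse[OF H(1)[OF st(1)]] by auto
  have c: "compose L' r t:B.ram 0" by (rule B.ram_compose[OF r(1) H(1)[OF st(2)]])
  have "compose L' r t uz' = uz'" using r B.pi by (simp add: compose_def flip: st(3))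
  hence rt: "r (t x) = x" if "x:L'" for x using B.idm(2)[OF that] that B.ii_pos[OF c] by (metis compose_eq)
  have "s x = t x" if x: "x:L'" for x
   using r rt[OF x] B.ramD(2)[OF H(1)[OF st(2)] x] by auto
  thus "s = t" using B.ramD[OF H(1)] st by (intro cgal_eqI[of _ L' K]) auto
 qed
 define C where "C = (\<Sum>r\<in>?R. \<Sum>s\<in>?R. \<bar>v' (r - s)\<bar>)"
 have C: "v' (r - s) <= C" if "r:?R" "s:?R" for r s
 proof -
  have "\<bar>v' (r - s)\<bar> <= (\<Sum>s\<in>?R. \<bar>v' (r - s)\<bar>)" using finite_H0 that by (intro member_le_sum) auto
  moreover have "(\<Sum>s\<in>?R. \<bar>v' (r - s)\<bar>) <= C"
   unfolding C_def by (rule member_le_sum[of r ?R "%r. \<Sum>s\<in>?R. \<bar>v' (r - s)\<bar>"]) (use finite_H0 that in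
    \<open>auto intro: sum_nonneg\<close>)
  ultimately show ?thesis by simp
 qed
 have C0: "0 <= C" unfolding C_def by (intro sum_nonneg) auto
 have bound: "int N <= int e * C" for N
 proof -
  \<comment> \<open>Substitute for the integers of the completed fixed field of \<open>H0\<close>:
    integral elements that \<open>H0\<close> moves only by valuation at least N.\<close>
  define good where "good c <-> c:L' & B.vge 0 c & (ALL t:H0. B.vge (int N) (t c - c))" for c
  \<comment> \<open>Expansion in powers of uz' whose digits are (q'^N)-th powers and therefore
    good.\<close>
  have digits: "EX c w. (ALL j<n. good (c j)) & w:L' & B.vge 0 w & z = (\<Sum>j<n. c j * uz' ^ j) + uz' ^ n * w"
   if "z:L'" "B.vge 0 z" for n z
  proof (induction n)
   case 0 thus ?case using that by auto
  next
   case (Suc n)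
   then obtain c w where cw: "ALL j<n. good (c j)" "w:L'" "B.vge 0 w" "z = (\<Sum>j<n. c j * uz' ^ j) + uz' ^ n * w" by auto
   let ?a = "w ^ (q' ^ N)"
   have a: "?a:L'" "B.vge 0 ?a" using cw csub_power[OF B.L] B.vge_power0 by auto
   have "B.vge (int N) (t ?a - ?a)" if t: "t:H0" for t
   proof -
    have "B.vge (int N + 1) (t w ^ (q' ^ N) - w ^ (q' ^ N))"
     using B.ramD(2,3)[OF H(1)[OF t] cw(2)] cw B.inertia_vge[OF H(1)[OF t] cw(2)] by (intro B.pow_qn_close) auto
    thus ?thesis using chomD(9)[OF B.ramD(4)[OF H(1)[OF t]] B.L cw(2)] B.vge_mono by simp
   qed
   hence ga: "good ?a" using a by (simp add: good_def)
   obtain u where u: "u:L'" "B.vge 0 u" "w - ?a = uz' * u"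
    using B.split_pi[of "w - ?a"] B.L'(5)[OF cw(2) a(1)] B.pow_qn[OF cw(2,3), of N] B.vge_diff_commute[OF a(1) cw(2)] by simp
   have "z = (\<Sum>j<n. c j * uz' ^ j) + uz' ^ n * (?a + uz' * u)" using cw u by (simp add: algebra_simps)
   also have "\<dots> = (\<Sum>j<Suc n. (c(n := ?a)) j * uz' ^ j) + uz' ^ Suc n * u" by (simp add: algebra_simps)
   finally show ?case using cw ga u by (intro exI[of _ "c(n := ?a)"] exI[of _ u]) (auto)
  qed
  have pw: "uz' ^ j:L'" "B.vge 0 (uz' ^ j)" for j using csub_power[OF B.L B.pi(1)] B.vge_power0[OF B.pi(1)] B.pi
   by (auto simp: B.vge_def)
  have good_step: "good (c + uz * d)" if cd: "good c" "good d" for c d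
  proof -
   have dL: "uz * d:L'" "B.vge 0 (uz * d)"
    using cd pi_up B.L' B.vge_mono[OF pi_up(3)] by (auto simp: good_def intro!: B.vge_mult0)
   have "B.vge (int N) (t (c + uz * d) - (c + uz * d))" if t: "t:H0" for t
   proof -
    note tc = chomD[OF B.ramD(4)[OF H(1)[OF t]] B.L]
    have eq: "t (c + uz * d) - (c + uz * d) = (t c - c) + uz * (t d - d)" and m: "t c - c:L'" "t d - d:L'"
     using tc tc(4)[OF pi_up(1), of d] H(2)[OF t S.pi(1)] cd dL B.ramD[OF H(1)[OF t]] B.L' by (auto simp: good_def algebra_simps)
    have "B.vge (int N) (uz * (t d - d))"
     using cd t m pi_up B.vge_mono[OF pi_up(3)] by (intro B.vge_mult0(2)) (auto simp: good_def)
    thus ?thesis unfolding eq using cd t by (intro B.vge_add[OF m(1) B.L'(6)[OF pi_up(1) m(2)]]) (auto simp: good_def)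
   qed
   thus ?thesis using cd dL B.L' by (auto simp: good_def intro!: B.vge_add)
  qed
  \<comment> \<open>Powers of uz' from the e-th on are traded for multiples of \<open>uz\<close>,
    which has the same valuation as uz'^e and is fixed by \<open>H0\<close>. Iterating leaves good
    coefficients on the first e powers.\<close>
  have rep: "EX c. (ALL j<e. good (c j)) & B.vge (int m) (z - (\<Sum>j<e. c j * uz' ^ j))" if "z:L'" "B.vge 0 z" for m z
   using that
  proof (induction m arbitrary: z)
   case 0
   have "B.vge (int N) (t 0)" if "t:H0" for t using chomD[OF B.ramD(4)[OF H(1)[OF that]] B.L] by simp
   thus ?case using 0 B.L' by (auto simp: good_def)
  next
   case (Suc m)
   obtain c w where cw: "ALL j<e. good (c j)" "w:L'" "B.vge 0 w" "z = (\<Sum>j<e. c j * uz' ^ j) + uz' ^ e * w"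
    using digits[OF Suc(2,3), of e] by auto
   define u where "u = uz' ^ e * w / uz"
   have uL: "u:L'" and upi: "uz' ^ e * w = uz * u" using pw cw pi_up B.L' S.pi unfolding u_def by auto
   have "B.vge 0 u"
   proof (cases "w = 0")
    case False
    hence u0: "u ~= 0" using B.pi S.pi by (simp add: u_def)
    show ?thesis using cw False B.vmult[of "uz' ^ e" w] B.vmult upi B.v_power[OF B.pi(1,2)] pw cw B.pi uL u0 pi_up S.pi
     by (auto simp: B.vge_def)
   qed (simp add: u_def)
   then obtain d where d: "ALL j<e. good (d j)" "B.vge (int m) (u - (\<Sum>j<e. d j * uz' ^ j))" using Suc.IH uL by auto
   have "z - (\<Sum>j<e. (c j + uz * d j) * uz' ^ j) = uz * (u - (\<Sum>j<e. d j * uz' ^ j))"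
    using cw upi by (simp add: algebra_simps sum.distrib sum_distrib_left)
   moreover have "B.vge (int e + int m) (uz * (u - (\<Sum>j<e. d j * uz' ^ j)))"
   proof (rule B.vge_mult[OF pi_up(1) _ pi_up(3) d(2)])
    have "(\<Sum>j<e. d j * uz' ^ j):L'" using d pw B.L' by (intro csub_sum[OF B.L]) (auto simp: good_def)
    thus "u - (\<Sum>j<e. d j * uz' ^ j):L'" by (rule B.L'(5)[OF uL])
   qed
   ultimately have "B.vge (int (Suc m)) (z - (\<Sum>j<e. (c j + uz * d j) * uz' ^ j))" using e by (auto elim: B.vge_mono)
   thus ?case using good_step cw d by (intro exI[of _ "%j. c j + uz * d j"]) simp
  qed
  \<comment> \<open>Applied to uz'^e itself, the representation becomes a monic relation of degree e
    for uz', valid up to precision N.\<close>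
  obtain c where c: "ALL j<e. good (c j)" "B.vge (int N) (uz' ^ e - (\<Sum>j<e. c j * uz' ^ j))" using rep[OF pw] by blast
  define p where "p = (\<Sum>j<e. Polynomial.monom (c j) j)"
  define f where "f = Polynomial.monom 1 e - p"
  have cp: "pcf p i = (if i < e then c i else 0)" for i by (simp add: p_def coeff_sum)
  have cf: "pcf f i = (if i = e then 1 else if i < e then - c i else 0)" for i by (auto simp: f_def cp)
  have deg: "pdeg f = e"
   by (rule antisym) (auto intro!: degree_le le_degree simp: cf)
  have fL: "f:pols L'" using c B.L' by (auto simp: pols_def cf good_def)
  have root: "B.vge (int N) (poly f r)" if r: "r:?R" for r
  proof -
   obtain t where t: "t:H0" "r = t uz'" using r by auto
   note tc = chomD[OF B.ramD(4)[OF H(1)[OF t(1)]] B.L] and tL = B.ramD(2)[OF H(1)[OF t(1)]]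
   let ?s = "\<Sum>j<e. c j * uz' ^ j"
   have cL: "c j:L'" if "j < e" for j using c that by (simp add: good_def)
   have sum_t: "t (\<Sum>j<n. c j * uz' ^ j) = (\<Sum>j<n. t (c j) * r ^ j) & (\<Sum>j<n. c j * uz' ^ j):L'" if "n <= e" for n
    using that
   proof (induction n)
    case (Suc n)
    show ?case using Suc tc(3) B.L'(4) tc(4) tc(9)[OF B.pi(1)] cL pw t B.L' by simp
   qed (use tc(2) B.L' in simp)
   have sL: "?s:L'" using sum_t by simp
   have eq: "poly f r = t (uz' ^ e - ?s) + (\<Sum>j<e. (t (c j) - c j) * r ^ j)"
    using tc(6)[OF pw(1)[of e] sL] tc(9)[OF B.pi(1)] sum_t t
     by (simp add: f_def p_def poly_sum poly_monom algebra_simps sum_subtractf)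
   have terms: "(t (c j) - c j) * r ^ j:L' & B.vge (int N) ((t (c j) - c j) * r ^ j)" if "j:{..<e}" for j
   proof
    have j: "j < e" using that by simp
    have d: "t (c j) - c j:L'" and rj: "r ^ j:L'" "B.vge 0 (r ^ j)"
     using cL[OF j] tL B.L' csub_power[OF B.L] B.vge_power0 t B.inertia_vge[OF H(1)[OF t(1)] B.pi(1)] B.pi
      by (auto simp: B.vge_def)
    show "(t (c j) - c j) * r ^ j:L'" using d rj B.L' by simp
    show "B.vge (int N) ((t (c j) - c j) * r ^ j)" using c(1) j t d rj by (intro B.vge_mult0(1)) (auto simp: good_def)
   qed
   have d: "uz' ^ e - ?s:L'" using B.L'(5)[OF pw(1) sL] .
   show ?thesis unfolding eq
   proof (rule B.vge_add)
    show "t (uz' ^ e - ?s):L'" by (rule tL[OF d])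
    show "(\<Sum>j<e. (t (c j) - c j) * r ^ j):L'" using terms by (intro csub_sum[OF B.L]) auto
    show "B.vge (int N) (t (uz' ^ e - ?s))" using B.inertia_vge[OF H(1)[OF t(1)] d] c by simp
    show "B.vge (int N) (\<Sum>j<e. (t (c j) - c j) * r ^ j)" by (rule B.vge_sum[OF terms])
   qed
  qed
  show ?thesis
  proof (rule B.approximate_roots[of ?R e C f])
   show "finite ?R" "e < card ?R" "?R <= L'" using finite_H0 big card_image[OF inj] B.ramD[OF H(1)] B.pi by auto
   show "0 <= C" by (rule C0)
   show "plc f = 1" using deg cf by simp
  qed (use C root fL deg in auto)
 qed
 from bound[of "nat (int e * C + 1)"] C0 show False by simp
qed


lemma restrict_ram: assumes "t:B.ram 0" shows "restrict t L:S.ram 0"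
proof -
 have c: "restrict t L:cgal L K" using galois_stable[OF S.G B.L sub B.ramD(1)[OF assms]] .
 have "S.vge 1 (t x - x)" if x: "x:L" "S.vge 0 x" for x
 proof -
  have tx: "t x - x:L" using cgalD(4)[OF c x(1)] x S.L' by simp
  have "B.vge 1 (t x - x)" using B.ramD[OF assms] x sub vge_0_iff by auto
  thus ?thesis
   using e ve[OF tx] by (auto simp: B.vge_def S.vge_def) (metis int_one_le_iff_zero_less zero_less_mult_pos of_nat_0_less_iff)
 qed
 thus ?thesis using c by (simp add: S.ram_def)
qed

definition fib :: "(complex => complex) => (complex => complex) set" where
 "fib r = {t:B.ram 0. ALL y:L. t y = r y}"

lemma fib_coset:
 assumes t0: "t0:fib r"
 shows "bij_betw (compose L' t0) H0 (fib r)"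
proof (rule bij_betw_imageI)
 have t0': "t0:B.ram 0" "!!y. y:L ==> t0 y = r y" and sub': "H0 <= cgal L' K" using t0 B.ramD by (auto simp: fib_def H0_def)
 show "inj_on (compose L' t0) H0" using B.compose_inj[OF B.ramD(1)[OF t0'(1)]] sub' by (rule inj_on_subset)
 show "compose L' t0 ` H0 = fib r"
 proof
  show "compose L' t0 ` H0 <= fib r"
   using B.ram_compose[OF t0'(1)] t0' sub by (auto simp: H0_def fib_def compose_def)
  show "fib r <= compose L' t0 ` H0"
  proof
   fix t assume t: "t:fib r"
   hence t': "t:B.ram 0" "!!y. y:L ==> t y = r y" by (auto simp: fib_def)
   obtain u where u: "u:B.ram 0" "ALL x:L'. t0 (u x) = x & u (t0 x) = x" using B.ram_inverse[OF t0'(1)] by auto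
   let ?k = "compose L' u t"
   have k: "?k:B.ram 0" using B.ram_compose[OF u(1) t'(1)] .
   have "?k y = y" if "y:L" for y
   using that sub t' t0' u by (auto simp: compose_def)
   hence "?k:H0" using k by (simp add: H0_def)
   moreover have "compose L' t0 ?k = t"
   proof (rule cgal_eqI[of _ L' K])
    show "compose L' t0 ?k:cgal L' K" "t:cgal L' K" using B.ramD[OF B.ram_compose[OF t0'(1) k]] B.ramD[OF t'(1)] by auto
    show "compose L' t0 ?k x = t x" if "x:L'" for x
     using u B.ramD(2)[OF t'(1) that] that by (simp add: compose_def)
   qed
   ultimately show "t:compose L' t0 ` H0" by force
  qed
 qed
qed

end

text \<open>The element \<open>x\<close> of \<open>special\<close> is a uniformiser plus an approximate generator of the residue field that
 lies in all other primes over the same prime of \<open>K\<close>.\<close>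

locale val_ext_special = val_ext +
 assumes special: "EX x:L'. (ALL t:cgal L' K. B.vge 0 (t x) & (t ~: B.ram 0 --> x ~= t x & v' (x - t x) = 0)) &
   (ALL t:B.ram 0 - {B.idm}. x ~= t x & v' (x - t x) = B.ii t)"
begin

text \<open>Let g be the characteristic polynomial over \<open>L\<close> of the special element x,
  and g^r its conjugate under a lift t0 of r. Since g(x) = 0, the value g^r(x) equals (g^r - g)(x)
  and has valuation at least e i(r). It is also the product of the x - t0 s x, whose valuations are
  i'(t0 s) on inertia and 0 elsewhere.\<close>

lemma fib_sum:
 assumes r: "r:S.ram 0" "r ~= S.idm"
 shows "int e * S.ii r <= (\<Sum>t\<in>fib r. B.ii t)"
proof -
 obtain x where x: "x:L'" and x0: "!!t. t:cgal L' K ==> B.vge 0 (t x)"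
  and x1: "!!t. t:cgal L' K ==> t ~: B.ram 0 ==> x ~= t x & v' (x - t x) = 0"
  and x2: "!!t. t:B.ram 0 ==> t ~= B.idm ==> x ~= t x & v' (x - t x) = B.ii t" using special by auto
 note r' = S.ramD[OF r(1)]
 obtain t0 where t0: "t0:cgal L' K" "ALL y:L. r y = t0 y"
  using galois_lift[OF B.G S.L S.K(2) sub r'(4)] cgalD[OF r'(1)] by auto
 let ?H = "cgal L' L"
 have HK: "?H <= cgal L' K" using S.K by (auto simp: cgal_def)
 have fin: "finite ?H" using finite_subset[OF HK B.K(3)] .
 let ?g = "orbit_poly L L' x" and ?gr = "\<Prod>s\<in>?H. [:- t0 (s x), 1:]"
 have sx: "s x:L' & B.vge 0 (s x)" if "s:?H" for s using HK that x0 cgalD(4)[OF that x] by auto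
 have gL: "pcf ?g i:L" for i using orbit_poly[OF rel x] by (simp add: pols_def)
 have gv: "S.vge 0 (pcf ?g i)" for i
  using B.coeff_vge[of ?H "%s. s x" i, OF fin] sx vge_0_iff[OF gL[of i]] by (simp add: orbit_poly_def)
 \<comment> \<open>Each coefficient of g^r - g is r c - c with c integral in \<open>L\<close>, so
   \<open>ram_uniformizer\<close> applies below and the factor e comes from passing to v'.\<close>
 have close: "B.vge (int e * S.ii r) (pcf (?gr - ?g) i) & pcf (?gr - ?g) i:L'" for i
 proof -
  let ?c = "pcf ?g i"
  have c: "pcf (?gr - ?g) i = r ?c - ?c" and d: "r ?c - ?c:L" and pos: "0 <= S.ii r"
   using t0 gL coeff_prod_linear_hom[OF B.L cgalD(1)[OF t0(1)] _ fin] sx r'(2)[OF gL] S.L' S.ii_pos[OF r]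
    by (auto simp: orbit_poly_def)
  have "S.vge (int (nat (S.ii r))) (r uz - uz)" using pos by (simp add: S.vge_def S.ii_def)
  from S.ram_uniformizer[OF r(1) this gL gv, of i] show ?thesis using vge_up[OF d] d sub e pos unfolding c
   by (auto simp: S.vge_def)
 qed
 let ?d = "\<Sum>i\<le>pdeg (?gr - ?g). pcf (?gr - ?g) i * x ^ i"
 have "poly ?gr x = poly (?gr - ?g) x" using orbit_poly[OF rel x] by auto
 also have "\<dots> = ?d" by (rule poly_altdef)
 finally have eq: "poly ?gr x = ?d" .
 have "B.vge (int e * S.ii r) ?d"
 proof (rule B.vge_sum)
  fix i
  show "pcf (?gr - ?g) i * x ^ i:L' & B.vge (int e * S.ii r) (pcf (?gr - ?g) i * x ^ i)"
   using close B.L' B.vge_mult0 csub_power[OF B.L x] B.vge_power0[OF x] x0[OF B.idm(1)] B.idm(2)[OF x] by simp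
 qed
 moreover have "poly ?gr x = (\<Prod>s\<in>?H. x - t0 (s x))" by (simp add: poly_prod)
 ultimately have v: "B.vge (int e * S.ii r) (\<Prod>s\<in>?H. x - t0 (s x))" using eq by simp
 have comp: "compose L' t0 s:cgal L' K" "compose L' t0 s x = t0 (s x)" if "s:?H" for s
  using cgal_compose[OF B.L B.K(2) t0(1)] HK that x by (auto simp: compose_def)
 have nid: "compose L' t0 s ~= B.idm" if s: "s:?H" for s
 proof
  assume a: "compose L' t0 s = B.idm"
  have "r y = y" if y: "y:L" for y
  proof -
   have yL: "y:L'" using y sub by auto
   have "compose L' t0 s y = r y" using yL cgalD(3)[OF s y] t0 y by (simp add: compose_def)
   thus ?thesis using a B.idm(2)[OF yL] by simp
  qed
  hence "r = S.idm" using S.idm r' by (intro cgal_eqI[of _ L K]) auto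
  thus False using r by simp
 qed
 define w where "w s = (if compose L' t0 s:B.ram 0 then B.ii (compose L' t0 s) else 0)" for s
 have ws: "x - t0 (s x):L' & x - t0 (s x) ~= 0" "v' (x - t0 (s x)) = w s" if s: "s:?H" for s
  using x1[OF comp(1)[OF s]] x2[OF _ nid[OF s]] comp[OF s] x sx[OF s] cgalD[OF t0(1)] B.L' by (auto simp: w_def)
 have "int e * S.ii r <= (\<Sum>s\<in>?H. w s)"
  using v B.v_prod[OF fin] ws fin by (auto simp: B.vge_def)
 also have "\<dots> = (\<Sum>s\<in>{s:?H. compose L' t0 s:B.ram 0}. B.ii (compose L' t0 s))"
  unfolding w_def using fin by (simp only: sum.inter_filter)
 also have "\<dots> <= (\<Sum>t\<in>fib r. B.ii t)"
 proof -
  let ?H' = "{s:?H. compose L' t0 s:B.ram 0}"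
  have inj: "inj_on (compose L' t0) ?H'" using B.compose_inj[OF t0(1)] by (rule inj_on_subset) (use HK in auto)
  have "(\<Sum>s\<in>?H'. B.ii (compose L' t0 s)) = (\<Sum>t\<in>compose L' t0 ` ?H'. B.ii t)"
   using sum.reindex[OF inj, of B.ii] by simp
  also have "\<dots> <= (\<Sum>t\<in>fib r. B.ii t)"
  proof (rule sum_mono2)
   show "finite (fib r)" using B.finite_ram by (simp add: fib_def)
   have "compose L' t0 s y = r y" if "s:?H" "y:L" for s y
    using t0 sub that cgalD(3)[OF that] by (auto simp: compose_def)
   thus "compose L' t0 ` ?H' <= fib r" by (auto simp: fib_def)
   fix t assume "t:fib r - compose L' t0 ` ?H'"
   hence t: "t:B.ram 0" "!!y. y:L ==> t y = r y" by (auto simp: fib_def)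
   have "t ~= B.idm"
   proof
    assume "t = B.idm"
    hence "r y = y" if "y:L" for y using t(2)[OF that] B.idm sub that by auto
    hence "r = S.idm" using S.idm r' by (intro cgal_eqI[of _ L K]) auto
    thus False using r by simp
   qed
   thus "0 <= B.ii t" using B.ii_pos[OF t(1)] by simp
  qed
  finally show ?thesis .
 qed
 finally show ?thesis by simp
qed

text \<open>Surjectivity of inertia comes from the inequality: over a nontrivial r the sum is at
  least e i(r) > 0, so its index set is not empty.\<close>

lemma inertia_lift: assumes "r:S.ram 0" shows "fib r ~= {}"
proof (cases "r = S.idm")
 case True
 show ?thesis using True B.idm sub S.idm by (auto simp: fib_def)
next
 case False
 have "0 < int e * S.ii r" using e S.ii_pos[OF assms False] by simp
 thus ?thesis using fib_sum[OF assms False] by auto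
qed

lemma card_ram_ext: "card (B.ram 0) = card H0 * card (S.ram 0)"
proof -
 have "B.ram 0 = (\<Union>r\<in>S.ram 0. fib r)"
 using restrict_ram by (fastforce simp: fib_def)
 moreover have "card (\<Union>r\<in>S.ram 0. fib r) = (\<Sum>r\<in>S.ram 0. card (fib r))"
 proof (rule card_UN_disjoint)
  show "ALL r:S.ram 0. finite (fib r)" using B.finite_ram by (simp add: fib_def)
  show "ALL r:S.ram 0. ALL s:S.ram 0. r ~= s --> fib r Int fib s = {}"
  proof (intro ballI impI)
   fix r s assume rs: "r:S.ram 0" "s:S.ram 0" "r ~= s"
   show "fib r Int fib s = {}"
   proof (rule ccontr)
    assume "fib r Int fib s ~= {}"
    then obtain t where "t:fib r" "t:fib s" by auto
    hence "r y = s y" if "y:L" for y using that by (auto simp: fib_def)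
    hence "r = s" using rs S.ramD by (intro cgal_eqI[of _ L K]) auto
    thus False using rs by simp
   qed
  qed
 qed (rule S.finite_ram)
 moreover have "card (fib r) = card H0" if r: "r:S.ram 0" for r
 proof -
  obtain t0 where "t0:fib r" using inertia_lift[OF r] by auto
  thus ?thesis using bij_betw_same_card[OF fib_coset] by simp
 qed
 ultimately show ?thesis by simp
qed

text \<open>The nontrivial inertia of \<open>L'\<close> splits into that of L'/L and the fibres over
  nontrivial r. The fibres dominate e times the sum over \<open>L\<close>. The remaining summand, e
  times the maximum, is absorbed by writing the fibre of a maximal r as t0 H0, where t0 has the
  largest i' in this fibre.\<close>

lemma ram_sum_ext:
 assumes nt: "S.ram 0 ~= {S.idm}"
 shows "int e * S.ram_sum <= B.ram_sum" "B.ram 0 ~= {B.idm}"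
proof -
 let ?S = "S.ram 0 - {S.idm}" and ?B = "B.ram 0 - {B.idm}"
 have ne: "?S ~= {}" and fin: "finite ?S" "finite ?B" using nt S.idm S.finite_ram B.finite_ram by auto
 have finf: "finite (fib r)" for r using B.finite_ram by (simp add: fib_def)
 have nidm: "B.idm ~: fib r" if "r:?S" for r
 proof
  assume "B.idm:fib r"
  hence "r y = y" if "y:L" for y using that B.idm(2)[of y] sub unfolding fib_def by auto
  hence "r = S.idm" using S.idm S.ramD \<open>r:?S\<close> by (intro cgal_eqI[of _ L K]) auto
  thus False using \<open>r:?S\<close> by simp
 qed
 define m where "m = Max (B.ii ` ?B)"
 have m: "B.ii t <= m" if "t:?B" for t unfolding m_def using fin that by simp
 have part: "(\<Sum>t\<in>?B. B.ii t) = (\<Sum>t\<in>H0 - {B.idm}. B.ii t) + (\<Sum>r\<in>?S. \<Sum>t\<in>fib r. B.ii t)"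
 proof -
  have "?B = (H0 - {B.idm}) Un (\<Union>r\<in>?S. fib r)"
  proof
   show "?B <= (H0 - {B.idm}) Un (\<Union>r\<in>?S. fib r)"
   proof
    fix t assume t: "t:?B"
    show "t:(H0 - {B.idm}) Un (\<Union>r\<in>?S. fib r)"
    proof (cases "restrict t L = S.idm")
     case True
     hence "t y = y" if "y:L" for y using that S.idm(2)[OF that] by (metis restrict_apply')
     thus ?thesis using t by (simp add: H0_def)
    next
     case False
     hence "restrict t L:?S" "t:fib (restrict t L)" using t restrict_ram by (auto simp: fib_def)
     thus ?thesis by auto
    qed
   qed
  qed (use nidm in \<open>auto simp: H0_def fib_def\<close>)
  moreover have "(H0 - {B.idm}) Int (\<Union>r\<in>?S. fib r) = {}"
  proof (rule ccontr)
   assume "(H0 - {B.idm}) Int (\<Union>r\<in>?S. fib r) ~= {}"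
   then obtain t r where t: "t:H0" "r:?S" "t:fib r" by auto
   hence "r y = y" if "y:L" for y using that by (auto simp: H0_def fib_def)
   hence "r = S.idm" using S.idm S.ramD t by (intro cgal_eqI[of _ L K]) auto
   thus False using t by simp
  qed
  moreover have "sum B.ii (\<Union>r\<in>?S. fib r) = (\<Sum>r\<in>?S. \<Sum>t\<in>fib r. B.ii t)"
  proof (rule sum.UNION_disjoint)
   show "ALL r:?S. ALL s:?S. r ~= s --> fib r Int fib s = {}"
   proof (intro ballI impI)
    fix r s assume rs: "r:?S" "s:?S" "r ~= s"
    show "fib r Int fib s = {}"
    proof (rule ccontr)
     assume "fib r Int fib s ~= {}"
     then obtain t where "t:fib r" "t:fib s" by auto
     hence "r y = s y" if "y:L" for y using that by (auto simp: fib_def)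
     hence "r = s" using rs S.ramD by (intro cgal_eqI[of _ L K]) auto
     thus False using rs by simp
    qed
   qed
  qed (use fin finf in auto)
  ultimately show ?thesis using sum.union_disjoint[of "H0 - {B.idm}" "\<Union>r\<in>?S. fib r" B.ii] fin by simp
 qed
 have "Max (S.ii ` ?S):S.ii ` ?S" using fin ne by simp
 then obtain r where r: "r:?S" "Max (S.ii ` ?S) = S.ii r" by auto
 obtain t0 where t0: "t0:fib r" "!!t. t:fib r ==> B.ii t <= B.ii t0"
 proof -
  have "Max (B.ii ` fib r):B.ii ` fib r" using finf inertia_lift r by simp
  then obtain t where "t:fib r" "Max (B.ii ` fib r) = B.ii t" by auto
  thus thesis using that Max_ge[of "B.ii ` fib r"] finf by auto
 qed
 have t0B: "t0:?B" using t0 nidm[OF r(1)] by (auto simp: fib_def)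
 thus "B.ram 0 ~= {B.idm}" by auto
 have t0': "t0:B.ram 0" using t0B by simp
 \<comment> \<open>t0 maps k uz' - uz' to the difference of (t0 k) uz' - uz' and t0 uz' - uz'. Both
   have valuation at least i'(t0 k), because t0 is maximal in the fibre, and t0 preserves
   valuations.\<close>
 have le: "B.ii (compose L' t0 k) <= B.ii k" if k: "k:H0 - {B.idm}" for k
 proof -
  have kH: "k:H0" "k:B.ram 0" "k ~= B.idm" using k by (auto simp: H0_def)
  let ?t = "compose L' t0 k"
  have tf: "?t:fib r" using bij_betwE[OF fib_coset[OF t0(1)]] kH by simp
  have m: "B.ii ?t <= B.ii t0" by (rule t0(2)[OF tf])
  have mem: "?t uz':L'" "t0 uz':L'" "k uz':L'" using B.ramD t0' kH B.pi tf by (auto simp: fib_def)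
  have nz: "k uz' - uz' ~= 0" "k uz' - uz':L'" using B.ii_pos[OF kH(2,3)] mem B.pi B.L' by auto
  have "B.vge (B.ii ?t) ((?t uz' - uz') - (t0 uz' - uz'))"
   using m mem B.pi B.L' by (intro B.vge_diff[of "?t uz' - uz'" "t0 uz' - uz'"]) (auto simp: B.vge_def B.ii_def)
  moreover have "(?t uz' - uz') - (t0 uz' - uz') = t0 (k uz' - uz')"
   using chomD(6)[OF B.ramD(4)[OF t0'] B.L mem(3) B.pi(1)] B.pi by (simp add: compose_def)
  ultimately show ?thesis using nz B.inertia_vge[OF t0' nz(2)] by (simp add: B.vge_def B.ii_def)
 qed
 have idH: "B.idm:H0" using B.idm sub by (auto simp: H0_def)
 have "(\<Sum>t\<in>fib r. B.ii t) = (\<Sum>k\<in>H0. B.ii (compose L' t0 k))"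
  using sum.reindex_bij_betw[OF fib_coset[OF t0(1)], of B.ii] by simp
 also have "\<dots> = B.ii (compose L' t0 B.idm) + (\<Sum>k\<in>H0 - {B.idm}. B.ii (compose L' t0 k))"
  by (rule sum.remove[OF finite_H0 idH])
 also have "B.ii (compose L' t0 B.idm) = B.ii t0" using B.pi B.idm by (simp add: B.ii_def compose_def)
 also have "B.ii t0 + (\<Sum>k\<in>H0 - {B.idm}. B.ii (compose L' t0 k)) <= m + (\<Sum>k\<in>H0 - {B.idm}. B.ii k)"
  using m[OF t0B] le by (intro add_mono sum_mono) auto
 finally have 1: "int e * S.ii r <= m + (\<Sum>k\<in>H0 - {B.idm}. B.ii k)" using fib_sum[of r] r(1) by simp
 have "int e * (\<Sum>s\<in>?S. S.ii s) <= (\<Sum>r\<in>?S. \<Sum>t\<in>fib r. B.ii t)"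
  unfolding sum_distrib_left using fib_sum by (intro sum_mono) auto
 thus "int e * S.ram_sum <= B.ram_sum"
  using 1 part r unfolding S.ram_sum_def B.ram_sum_def m_def[symmetric] by (simp add: algebra_simps)
qed

text \<open>In the criterion \<open>triv_iff\<close> the left side grows at least by the factor e,
  while |G_0| grows by |H0|, which is at most e.\<close>

theorem triv_ext: assumes "B.triv n" shows "S.triv n"
proof (cases "S.ram 0 = {S.idm}")
 case False
 have "int e * S.ram_sum <= B.ram_sum" by (rule ram_sum_ext[OF False])
 also have "B.ram_sum < (int n + 1) * int (card (B.ram 0))" using assms B.triv_iff ram_sum_ext[OF False] by simp
 also have "\<dots> = (int n + 1) * (int (card H0) * int (card (S.ram 0)))" by (simp add: card_ram_ext)
 also have "\<dots> <= (int n + 1) * (int e * int (card (S.ram 0)))" using H0_card by (intro mult_left_mono mult_right_mono) auto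
 finally show ?thesis using S.triv_iff[OF False] by (simp add: mult_less_cancel_left ac_simps)
qed (rule S.triv_trivial)

end

section \<open>Elements controlled at all conjugate primes\<close>

lemma (in dval) vge_close: "x:L ==> y:L ==> vge n (x - y) ==> vge n x <-> vge n y"
 using vge_add[of "x - y" y n] vge_diff[of x "x - y" n] L' by auto

text \<open>The powers of \<open>a\<close> represent all nonzero residue classes.
  \<open>approx\<close> is weak approximation: x is close to b at the given prime and lies in the
  other conjugate primes, so t x has positive valuation unless t preserves v.\<close>

locale approx_rval = galois_rval +
 fixes a :: complex
 assumes a: "a:L" "vge 0 a" "~ vge 1 a"
  and gen: "[|z:L; vge 0 z|] ==> vge 1 z \<or> (EX k. vge 1 (z - a ^ k))"
  and approx: "[|b:L; vge 0 b|] ==> EX x:L. vge (int N) (x - b) &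
   (ALL t:cgal L K. vge 0 (t x) & (vge 1 (t x) \<or> (ALL y:L. y ~= 0 --> v (t y) = v y)))"
begin

lemma special_element:
 "EX x:L. (ALL t:cgal L K. vge 0 (t x) & (t ~: ram 0 --> x ~= t x & v (x - t x) = 0)) &
   (ALL t:ram 0 - {idm}. x ~= t x & v (x - t x) = ii t)"
proof -
 \<comment> \<open>A precision beyond i(t) for every inertia element t, and at least 2, so that
   approximation errors do not affect the valuations of x - t x.\<close>
 define N where "N = nat (\<Sum>t\<in>ram 0. \<bar>ii t\<bar>) + 2"
 have N: "ii t < int N" if "t:ram 0" for t
 proof -
  have "\<bar>ii t\<bar> <= (\<Sum>t\<in>ram 0. \<bar>ii t\<bar>)" using that finite_ram by (intro member_le_sum) auto
  thus ?thesis unfolding N_def by simp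
 qed
 \<comment> \<open>The power of \<open>a\<close> keeps its residue class, but inertia moves it only
   beyond precision N; in \<open>?b\<close> inertia therefore essentially moves only the summand
   \<open>uz\<close>.\<close>
 let ?c = "a ^ (q ^ N)"
 let ?b = "?c + uz"
 have c: "?c:L" "vge 0 ?c" "vge 1 (?c - a)" using a csub_power[OF L] vge_power0 pow_qn by auto
 have pi': "vge 1 uz" using pi by (simp add: vge_def)
 have b: "?b:L" "vge 0 ?b" using c pi L' vge_add vge_mono[OF pi'] by auto
 obtain x where x: "x:L" "vge (int N) (x - ?b)"
  and tx: "!!t. t:cgal L K ==> vge 0 (t x)"
  and tx': "!!t. t:cgal L K ==> vge 1 (t x) \<or> (ALL y:L. y ~= 0 --> v (t y) = v y)"
  using approx[OF b, of N] by auto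
 have x0: "vge 0 x" using tx[OF idm(1)] idm(2)[OF x(1)] by simp
 have "vge 1 (x - ?b)" using vge_mono[OF x(2)] by (simp add: N_def)
 moreover have "vge 1 (?b - a)" using vge_add[of "?c - a" uz 1] c pi' pi a L' by (simp add: algebra_simps)
 ultimately have xa: "vge 1 (x - a)" using vge_trans[OF x(1) b(1) a(1)] by simp
 have nx: "~ vge 1 x" using vge_close[OF x(1) a(1) xa] a by simp
 hence vx: "x ~= 0" "v x = 0" using x0 by (auto simp: vge_def)
 \<comment> \<open>If t x lies in the maximal ideal, then x - t x is a unit because x is one.
   Otherwise t preserves v; if x and t x were congruent, t would fix the residue class of
   \<open>a\<close> and hence all classes, and would belong to inertia.\<close>
 have out: "x ~= t x & v (x - t x) = 0" if t: "t:cgal L K" "t ~: ram 0" for t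
 proof -
  note tD = cgalD[OF t(1)] and th = chomD[OF cgalD(1)[OF t(1)] L]
  have txL: "t x:L" by (rule tD(4)[OF x(1)])
  have "~ vge 1 (x - t x)"
  proof (cases "vge 1 (t x)")
   case True
   show ?thesis
using vge_close[OF x(1) txL] True nx by auto
  next
   case False
   hence pres: "!!y n. y:L ==> vge n (t y) <-> vge n y" using tx'[OF t(1)] th by (auto simp: vge_def)
   show ?thesis
   proof
    assume close: "vge 1 (x - t x)"
    have ta: "t a:L" by (rule tD(4)[OF a(1)])
    have "vge 1 (x - t a)" using vge_trans[OF x(1) txL ta close] th(6)[OF x(1) a(1)] pres[of "x - a" 1] xa x a L' by simp
    moreover have "vge 1 (a - x)" using xa vge_diff_commute[OF x(1) a(1)] by simp
    ultimately have ta1: "vge 1 (t a - a)" using vge_diff_commute[OF a(1) ta] vge_trans[OF a(1) x(1) ta] by simp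
    have pw: "vge 1 (t a ^ k - a ^ k)" for k
    proof (induction k)
     case (Suc k)
     have "t a ^ Suc k - a ^ Suc k = t a * (t a ^ k - a ^ k) + (t a - a) * a ^ k" by (simp add: algebra_simps)
     moreover have m: "t a ^ k - a ^ k:L" "t a - a:L" "a ^ k:L" using ta a csub_power[OF L] L' by auto
     moreover have "vge 1 (t a * (t a ^ k - a ^ k))" using Suc ta m pres[OF a(1)] a by (intro vge_mult0(2)) auto
     moreover have "vge 1 ((t a - a) * a ^ k)" using ta1 m a vge_power0 by (intro vge_mult0(1)) auto
     ultimately show ?case using vge_add L' ta by simp
    qed simp
    have "vge 1 (t z - z)" if z: "z:L" "vge 0 z" for z
     using gen[OF z]
    proof
     assume "vge 1 z"
     thus ?thesis using pres[OF z(1)] z tD(4)[OF z(1)] by (intro vge_diff) auto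
    next
     assume "EX k. vge 1 (z - a ^ k)"
     then obtain k where k: "vge 1 (z - a ^ k)" by auto
     have ak: "a ^ k:L" "t a ^ k:L" using a ta csub_power[OF L] by auto
     have "vge 1 (t z - a ^ k)" using vge_trans[OF tD(4)[OF z(1)] ak(2,1)] pw th(6)[OF z(1) ak(1)] th(9)[OF a(1)] pres[of
      "z - a ^ k" 1] k z ak L' by simp
     moreover have "vge 1 (a ^ k - z)" using k vge_diff_commute[OF z(1) ak(1)] by simp
     ultimately show ?thesis using vge_trans[OF tD(4)[OF z(1)] ak(1) z(1)] by simp
    qed
    thus False using t t by (simp add: ram_def)
   qed
  qed
  moreover have "vge 0 (x - t x)" using x0 tx[OF t(1)] x txL by (intro vge_diff) auto
  ultimately show ?thesis by (auto simp: vge_def)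
 qed
 have inn: "x ~= t x & v (x - t x) = ii t" if t: "t:ram 0" "t ~= idm" for t
 proof -
  note tD = ramD[OF t(1)] and th = chomD[OF ramD(4)[OF t(1)] L]
  have mem: "t x:L" "t ?b:L" "t ?c:L" "t uz:L" "x - ?b:L" using tD x b c pi L'(5) by auto
  have 1: "vge (int N) (t (x - ?b))" using inertia_vge[OF t(1) mem(5)] x by simp
  have "vge (int N + 1) (t a ^ (q ^ N) - a ^ (q ^ N))"
   using tD(2,3)[OF a(1)] a inertia_vge[OF t(1) a(1)] by (intro pow_qn_close) auto
  hence 2: "vge (int N) (t ?c - ?c)" using th(9)[OF a(1)] vge_mono by simp
  have "(x - ?b) - t (x - ?b) - (t ?c - ?c) = (x - t x) - (uz - t uz)"
   using th(6)[OF x(1) b(1)] th(3)[OF c(1) pi(1)] by simp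
  moreover have "vge (int N) ((x - ?b) - t (x - ?b) - (t ?c - ?c))"
   by (rule vge_diff[OF L'(5)[OF mem(5) tD(2)[OF mem(5)]] L'(5)[OF mem(3) c(1)] vge_diff[OF mem(5) tD(2)[OF mem(5)] x(2) 1] 2])
  ultimately have v: "vge (int N) ((x - t x) - (uz - t uz))" by (simp only:)
  show ?thesis using v_eq_of_close[of "uz - t uz" "x - t x" "int N"] v N[OF t(1)] mem x pi L' ii_pos[OF t] v_minus[of
   "t uz - uz"] by (simp add: ii_def)
 qed
 show ?thesis using x tx out inn by auto
qed

text \<open>Expanding \<open>uz \<Prod>\<^sub>t (x - t x)\<close> over \<open>t \<noteq> 1\<close> writes it as a combination of traces of \<open>uz x\<^sup>k\<close>, so one of
 these traces has valuation \<open>1\<close>.\<close>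

lemma trivial_inertia_uniformizer:
 assumes triv: "ram 0 = {idm}"
 shows "EX z:K. z ~= 0 & v z = 1"
proof -
 let ?G = "cgal L K"
 have fin: "finite ?G" by (rule K)
 obtain x where x: "x:L" and x0: "!!t. t:?G ==> vge 0 (t x)"
  and x1: "!!t. t:?G ==> t ~= idm ==> x ~= t x & v (x - t x) = 0" using special_element triv by auto
 have vpi: "vge 0 uz" using pi by (simp add: vge_def)
 \<comment> \<open>\<open>p\<close> replaces \<open>uz\<close>: it agrees with it up to valuation 2
   and is small at the other conjugate primes, so that all its conjugates have positive
   valuation.\<close>
 obtain p where p: "p:L" "vge (int 2) (p - uz)"
  and tp: "!!t. t:?G ==> vge 1 (t p) \<or> (ALL y:L. y ~= 0 --> v (t y) = v y)"
  using approx[OF pi(1) vpi, of 2] by auto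
 have p1: "p ~= 0" "v p = 1" using v_eq_of_close[OF pi(1) p(1) pi(2) p(2)] pi by auto
 have tp1: "vge 1 (t p)" if "t:?G" for t using tp[OF that] p p1 by (auto simp: vge_def)
 define g where "g = (\<Prod>t\<in>?G - {idm}. [:- t x, 1:])"
 define T where "T k = (\<Sum>t\<in>?G. t p * t x ^ k)" for k
 have tL: "t y:L" if "t:?G" "y:L" for t y using cgalD(4)[OF that] .
 have TL: "T k:L" for k unfolding T_def using tL p x csub_power[OF L] L' by (intro csub_sum[OF L]) auto
 have T1: "vge 1 (T k)" for k unfolding T_def using tL p x csub_power[OF L] L'(6) tp1 x0 vge_power0
  by (intro vge_sum conjI vge_mult0(1)) auto
 have TK: "T k:K" for k
 proof -
  have "s (T k) = T k" if s: "s:?G" for s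
  proof -
   note sh = chomD[OF cgalD(1)[OF s] L]
   have "s (sum f A) = (\<Sum>t\<in>A. s (f t)) & sum f A:L" if "finite A" "!!t. t:A ==> f t:L" for f and A ::
    "(complex => complex) set"
    using that by (induction A rule: finite_induct) (auto simp: sh L')
   from this[OF fin, of "%t. t p * t x ^ k"] have "s (T k) = (\<Sum>t\<in>?G. s (t p * t x ^ k))"
    unfolding T_def using tL p x csub_power[OF L] L' by auto
   also have "\<dots> = (\<Sum>t\<in>?G. compose L s t p * compose L s t x ^ k)"
    using tL p x csub_power[OF L] sh by (intro sum.cong) (auto simp: compose_def)
   also have "\<dots> = T k" unfolding T_def by (rule sum.reindex_bij_betw[OF cgal_compose_bij[OF L K(2) s]])
   finally show ?thesis .
  qed
  thus ?thesis using G TL by (auto simp: cgalois_def)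
 qed
 have cg: "pcf g i:L & vge 0 (pcf g i)" for i
  unfolding g_def using fin tL x x0 by (intro coeff_vge) auto
 have pg: "poly g y = (\<Prod>t\<in>?G - {idm}. y - t x)" for y by (simp add: g_def poly_prod)
 have "(\<Sum>k\<le>pdeg g. pcf g k * T k) = (\<Sum>t\<in>?G. t p * poly g (t x))"
  unfolding T_def poly_altdef sum_distrib_left by (subst sum.swap) (simp add: ac_simps)
 also have "\<dots> = (\<Sum>t\<in>{idm}. t p * poly g (t x))"
 proof (rule sum.mono_neutral_right)
  show "ALL t:?G - {idm}. t p * poly g (t x) = 0"
  using pg fin by auto
 qed (use fin idm in auto)
 finally have eq: "(\<Sum>k\<le>pdeg g. pcf g k * T k) = p * poly g x" using idm p x by simp
 have xt: "x - t x:L & x - t x ~= 0" if "t:?G - {idm}" for t using x1 tL x L' that by auto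
 have pg0: "poly g x:L" "poly g x ~= 0" "v (poly g x) = 0"
 proof -
  show "poly g x:L" unfolding pg using xt by (intro csub_prod[OF L]) auto
  show "poly g x ~= 0" unfolding pg using xt fin by simp
  show "v (poly g x) = 0" unfolding pg using x1 xt fin by (subst v_prod) auto
 qed
 \<comment> \<open>The integral combination of the traces is p times a unit, of valuation 1; so the
   traces cannot all have valuation at least 2.\<close>
 have "EX k. ~ vge 2 (T k)"
 proof (rule ccontr)
  assume "\<nexists>k. ~ vge 2 (T k)"
  hence "vge 2 (\<Sum>k\<le>pdeg g. pcf g k * T k)"
   using cg TL L' by (intro vge_sum conjI vge_mult0(2)) auto
  thus False using eq p1 vmult[OF p(1) pg0(1) p1(1) pg0(2)] p1 pg0 by (simp add: vge_def)
 qed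
 then obtain k where "~ vge 2 (T k)" by auto
 thus ?thesis using TK T1[of k] by (auto simp: vge_def)
qed

end

context galois_rval
begin

text \<open>Write an integral x of \<open>F\<close> as x^(q^n) + z w with w integral in
  \<open>F\<close>. Inertia fixes z and moves the power only beyond precision n, so by induction it
  moves x beyond every precision.\<close>

lemma inertia_fixes:
 assumes F: "csub F" "F <= L" and z: "z:K" "z:F" "vge 1 z" and zF: "!!x. x:F ==> vge 1 x ==> vge 0 (x / z)"
  and s: "s:ram 0" and x: "x:F" and z0: "z ~= 0"
 shows "s x = x"
proof -
 note sD = ramD[OF s] and sh = chomD[OF ramD(4)[OF s] L] and F' = csubD[OF F(1)]
 have zL: "z:L" using z F by auto
 have close: "vge (int n) (s x - x)" if "x:F" "vge 0 x" for n x
  using that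
 proof (induction n arbitrary: x)
  case 0
  thus ?case using sD vge_mono[of 1 "s x - x" 0] F by auto
 next
  case (Suc n)
  have xL: "x:L" using Suc F by auto
  let ?c = "x ^ (q ^ n)"
  have c: "?c:F" "?c:L" using Suc csub_power[OF F(1)] F by auto
  have w: "(x - ?c) / z:F" "vge 0 ((x - ?c) / z)" using zF F' c Suc z pow_qn[OF xL Suc(3), of n] vge_diff_commute[OF c(2) xL]
   by auto
  define w where "w = (x - ?c) / z"
  have wF: "w:F" "vge 0 w" "w:L" and xe: "x = ?c + z * w" using w F z0 by (auto simp: w_def)
  have swL: "s w - w:L" and eq: "s x - x = (s ?c - ?c) + z * (s w - w)"
   using sD wF L' xe sh(3)[OF c(2) L'(6)[OF zL wF(3)]] sh(4)[OF zL wF(3)] cgalD(3)[OF sD(1) z(1)] by (auto simp: algebra_simps)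
  have "vge (int n + 1) (s x ^ (q ^ n) - x ^ (q ^ n))"
   using sD(2,3)[OF xL] xL Suc inertia_vge[OF s xL] by (intro pow_qn_close) auto
  hence 1: "vge (int (Suc n)) (s ?c - ?c)" and 2: "vge (1 + int n) (z * (s w - w))"
   using sh(9)[OF xL] vge_mult[OF zL swL z(3) Suc.IH[OF wF(1,2)]] by (auto simp: add.commute)
  show ?case unfolding eq using 1 2 sD(2)[OF c(2)] c L' zL swL by (intro vge_add) auto
 qed
 have int: "s x = x" if "x:F" "vge 0 x" for x
 proof (rule ccontr)
  assume "s x ~= x"
  hence "int n <= v (s x - x)" for n using close[OF that] by (simp add: vge_def)
  from this[of "nat (v (s x - x) + 1)"] show False by linarith
 qed
 show ?thesis
 proof (cases "vge 0 x")
  case True thus ?thesis using int x by simp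
 next
  case False
  have xL: "x:L" using x F by auto
  show ?thesis using sh(8)[OF xL] int[OF F'(7)[OF x]] False xL v_inverse by (auto simp: vge_def)
 qed
qed

end

section \<open>Primes of number fields\<close>

context dedekind
begin

lemma PIdl_mult: assumes "a:carrier R" "b:carrier R" shows "PIdl (a \<otimes> b) = (PIdl a) \<cdot> (PIdl b)"
proof (rule Set.set_eqI)
 fix x
 have "x:(PIdl a) \<cdot> (PIdl b) <-> (EX r:carrier R. x = a \<otimes> (r \<otimes> b))"
  using PIdl_prod[OF assms(1) cgenideal_ideal[OF assms(2)]] PIdl_iff by metis
 also have "\<dots> <-> x:PIdl (a \<otimes> b)" unfolding PIdl_iff using assms by (auto simp: m_lcomm)
 finally show "x:PIdl (a \<otimes> b) <-> x:(PIdl a) \<cdot> (PIdl b)" by simp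
qed

abbreviation pval :: "'a set => 'a => nat" where "pval P a == ival R P (PIdl a)"

lemma pval_mult:
 assumes "P:maxs R" "a:carrier R" "b:carrier R" "a ~= \<zero>" "b ~= \<zero>"
 shows "pval P (a \<otimes> b) = pval P a + pval P b"
 unfolding PIdl_mult[OF assms(2,3)] using PIdl_nz[OF assms(2,4)] PIdl_nz[OF assms(3,5)] by (rule ival_prod[OF assms(1)])

lemma pval_iff:
 assumes "P:maxs R" "a:carrier R" "a ~= \<zero>"
 shows "n <= pval P a <-> a:ppow P n"
proof -
 have I: "ideal (ppow P n) R" using ppow_nz maxD[OF assms(1)] by simp
 show ?thesis using ival_iff[OF assms(1) PIdl_nz[OF assms(2,3)]] cgenideal_minimal[OF I] cgenideal_self[OF assms(2)] by auto
qed

lemma ppow_0_1: assumes "P:maxs R" shows "ppow P 0 = carrier R" "ppow P 1 = P"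
 using maxD[OF assms] by (simp_all add: prod_carrier)

text \<open>Write (b) = P^k J with \<open>J\<close> not inside \<open>P\<close>; any d in
  \<open>J\<close> outside \<open>P\<close> multiplies P^k into (b).\<close>

lemma pval_decomp:
 assumes P: "P:maxs R" and a: "a:carrier R" and b: "b:carrier R" "b ~= \<zero>" and le: "a:ppow P (pval P b)"
 shows "EX d:carrier R - P. EX r:carrier R. d \<otimes> a = r \<otimes> b"
proof -
 obtain J where J: "ideal J R" "PIdl b = ppow P (pval P b) \<cdot> J" "~ J <= P"
  using ival_decomp[OF P PIdl_nz[OF b]] by auto
 then obtain d where d: "d:J" "d ~: P" by auto
 have dR: "d:carrier R" using idealE[OF J(1)] d by simp
 have "d \<otimes> a:PIdl b" using J(2) a dR le d(1) by (metis ideal_prod.prod m_comm)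
 thus ?thesis using d dR PIdl_iff by auto
qed

lemma ex_uniformizer: assumes P: "P:maxs R" shows "EX p:carrier R. p ~= \<zero> & pval P p = 1"
proof -
 have nP: "nz P" using maxD(1)[OF P] .
 obtain p where p: "p:ppow P 1" "p ~: ppow P 2" using ppow_anti[OF nP, of 1 2] ppow_inj[OF P, of 2 1] by auto
 have pR: "p:carrier R" and p0: "p ~= \<zero>" using p idealE ppow_nz[OF nP, of 1] ppow_nz[OF nP] by auto
 have "1 <= pval P p" "~ 2 <= pval P p" using pval_iff[OF P pR p0] p by auto
 thus ?thesis using pR p0 by auto
qed

end

context algnum
begin

text \<open>Containment in a finite Galois extension of the prime field is the form of finiteness
  that \<open>integers_fg\<close> uses.\<close>

definition nf :: "'a set => bool" where
 "nf F <-> subfield F R & (EX L:finite_galois_extensions R prime_field. F <= L)"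

abbreviation roi' ("\<O>") where "\<O> F == ring_of_integers R F"

lemma nf_sub: "nf F ==> subfield F R" "nf F ==> F <= carrier R" "nf F ==> csub (h ` F)"
 using subfield_image by (auto simp: nf_def)

lemma nf_dedekind: "nf F ==> dedekind (\<O> F)" unfolding nf_def using dedekind_integers by auto

lemma nf_mono: "nf L ==> subfield F R ==> F <= L ==> nf F" unfolding nf_def by auto

lemma O_simps [simp]:
 "carrier (\<O> F) = ints F" "x \<otimes>\<^bsub>\<O> F\<^esub> y = x \<otimes> y"
  "x \<oplus>\<^bsub>\<O> F\<^esub> y = x \<oplus> y" "\<one>\<^bsub>\<O> F\<^esub> = \<one>"
   "\<zero>\<^bsub>\<O> F\<^esub> = \<zero>"
 by (simp_all add: roi)

lemma primes_maxs: "primes R F = maxs (\<O> F)"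
 by (simp add: primes_def maxs_def)

lemma ideal_val_ival: "ideal_val R F = ival (\<O> F)"
 by (simp add: ideal_val_def ival_def ideal_monoid_def nzideals_def fun_eq_iff)

lemma ideal_monoid_nzideals: "ideal_monoid R F = nzideals (\<O> F)"
 by (simp add: ideal_monoid_def nzideals_def)

lemma intsD:
 assumes "nf F" "x:ints F" shows "x:F" "x:carrier R" "algebraic_int (h x)" "h x:h ` F"
 using assms nf_sub(2)[OF assms(1)] ints_iff[OF nf_sub(2)[OF assms(1)]] by auto

lemma intsI: "nf F ==> x:F ==> algebraic_int (h x) ==> x:ints F"
 using nf_sub ints_iff by simp

lemma F_closed:
 assumes "nf F" "x:F" "y:F"
 shows "x:carrier R" "x \<oplus> y:F" "x \<otimes> y:F" "x \<ominus> y:F" "\<ominus> x:F" "\<one>:F" "\<zero>:F"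
proof -
 interpret S: subring F R using nf_sub[OF assms(1)] by (simp add: subfield_def subdomain_def subcring_def)
 show "x:carrier R" "x \<oplus> y:F" "x \<otimes> y:F" "\<ominus> x:F" "\<one>:F" "\<zero>:F"
  using assms subringE[OF S.subring_axioms] by auto
 thus "x \<ominus> y:F" using assms subringE[OF S.subring_axioms] by (simp add: a_minus_def)
qed

lemma O_minus: assumes F: "nf F" and "x:ints F" "y:ints F" shows "x \<ominus>\<^bsub>\<O> F\<^esub> y = x \<ominus> y"
proof -
 interpret D: dedekind "\<O> F" by (rule nf_dedekind[OF F])
 have "\<ominus>\<^bsub>\<O> F\<^esub> y:ints F" "\<ominus>\<^bsub>\<O> F\<^esub> y \<oplus> y = \<zero>"
  using D.a_inv_closed D.l_neg assms by auto
 thus ?thesis using intsD[OF F] assms minus_equality by (simp add: a_minus_def)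
qed

lemma O_pow: assumes F: "nf F" and "x:ints F" shows
 "h (x [^]\<^bsub>\<O> F\<^esub> (n::nat)) = h x ^ n & x [^]\<^bsub>\<O> F\<^esub> n:ints F"
proof -
 interpret D: dedekind "\<O> F" by (rule nf_dedekind[OF F])
 show ?thesis
 proof (induction n)
  case (Suc n)
  thus ?case using D.nat_pow_closed[of x "Suc n"] assms intsD[OF F] by (simp add: h_simps)
 qed (use D.one_closed h_simps in auto)
qed

lemma O_nat: assumes F: "nf F" shows "h ([(n::nat)] \<cdot>\<^bsub>\<O> F\<^esub> \<one>\<^bsub>\<O> F\<^esub>) = of_nat n"
proof -
 interpret D: dedekind "\<O> F" by (rule nf_dedekind[OF F])
 have "h ([n] \<cdot>\<^bsub>\<O> F\<^esub> \<one>\<^bsub>\<O> F\<^esub>) = of_nat n & [n] \<cdot>\<^bsub>\<O> F\<^esub> \<one>\<^bsub>\<O> F\<^esub>:ints F"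
 proof (induction n)
  case 0 thus ?case using D.zero_closed h_simps by simp
 next
  case (Suc n)
  show ?case using Suc D.add.nat_pow_closed[of "\<one>\<^bsub>\<O> F\<^esub>" "Suc n"] D.one_closed intsD[OF F] h_simps
   h_simps(3)[of "[n] \<cdot>\<^bsub>\<O> F\<^esub> \<one>\<^bsub>\<O> F\<^esub>" \<one>] by simp
 qed
 thus ?thesis by simp
qed

lemma fraction:
 assumes F: "nf F" and x: "x:F"
 shows "EX a:ints F. EX b:ints F. b ~= \<zero> & a = b \<otimes> x"
proof -
 have xR: "x:carrier R" using F_closed(1)[OF F x x] .
 obtain p where p: "p:pols \<rat>" "p ~= 0" "poly p (h x) = 0" using algebraic h(1)[OF xR] by auto
 then obtain n where n: "n ~= 0" "algebraic_int (of_int n * h x)" using algebraic_int_scale unfolding algebraic_altdef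
  by (auto simp: pols_def)
 have nF: "of_int n:h ` F" using csub_of_int[OF nf_sub(3)[OF F]] .
 then obtain b where b: "b:F" "h b = of_int n" by auto
 have bR: "b:carrier R" using F_closed(1)[OF F b(1) b(1)] .
 have "b:ints F" using intsI[OF F b(1)] b by simp
 moreover have "b ~= \<zero>" using b n h_simps(2) by auto
 moreover have "b \<otimes> x:ints F"
  using intsI[OF F F_closed(3)[OF F b(1) x]] n b h_simps(4)[OF bR xR] by simp
 ultimately show ?thesis by auto
qed

text \<open>Two ways of writing x as a fraction have equal cross products, so exactly one integer
  meets the description in \<open>elem_val\<close>.\<close>

lemma elem_val_frac:
 assumes F: "nf F" and P: "P:primes R F" and ab: "a:ints F" "b:ints F" "a ~= \<zero>" "b ~= \<zero>" "a = b \<otimes> x"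
  and x: "x:F"
 shows "elem_val R F P x = int (ival (\<O> F) P (PIdl\<^bsub>\<O> F\<^esub> a)) - int (ival (\<O> F) P (PIdl\<^bsub>\<O> F\<^esub> b))"
proof -
 interpret D: dedekind "\<O> F" by (rule nf_dedekind[OF F])
 have P': "P:maxs (\<O> F)" using P by (simp add: primes_maxs)
 have uniq: "int (D.pval P c) - int (D.pval P d) = int (D.pval P a) - int (D.pval P b)"
  if cd: "c:ints F" "d:ints F" "c ~= \<zero>" "d ~= \<zero>" "c = d \<otimes> x" for c d
 proof -
  have "c \<otimes> b = a \<otimes> d" using cd ab intsD[OF F] cd ab F_closed[OF F x x] by (simp add: m_ac)
  moreover have "D.pval P (c \<otimes> b) = D.pval P c + D.pval P b" using D.pval_mult[OF P'] cd ab by simp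
  moreover have "D.pval P (a \<otimes> d) = D.pval P a + D.pval P d" using D.pval_mult[OF P'] cd ab by simp
  ultimately show ?thesis by simp
 qed
 show ?thesis unfolding elem_val_def Let_def ideal_val_ival
 proof (rule the_equality)
  show "EX c:carrier (\<O> F) - {\<zero>}. EX d:carrier (\<O> F) - {\<zero>}. c = d \<otimes> x &
    int (D.pval P a) - int (D.pval P b) = int (D.pval P c) - int (D.pval P d)"
   using ab by auto
  fix n assume "EX c:carrier (\<O> F) - {\<zero>}. EX d:carrier (\<O> F) - {\<zero>}. c = d \<otimes> x & n = int (D.pval P c) - int (D.pval P d)"
  then obtain c d where "c:ints F" "d:ints F" "c ~= \<zero>" "d ~= \<zero>" "c = d \<otimes> x"
   "n = int (D.pval P c) - int (D.pval P d)"
   by auto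
  thus "n = int (D.pval P a) - int (D.pval P b)" using uniq by simp
 qed
qed

definition cval :: "'a set => 'a set => complex => int" where "cval F P z = elem_val R F P (phi z)"

lemma cval_h: "x:carrier R ==> cval F P (h x) = elem_val R F P x" by (simp add: cval_def h)

lemma cval_int:
 assumes F: "nf F" and P: "P:primes R F" and a: "a:ints F" "a ~= \<zero>"
 shows "cval F P (h a) = int (ival (\<O> F) P (PIdl\<^bsub>\<O> F\<^esub> a))"
proof -
 interpret D: dedekind "\<O> F" by (rule nf_dedekind[OF F])
 note a' = intsD[OF F a(1)]
 have o: "\<one>:ints F" and P': "P:maxs (\<O> F)" using D.one_closed P by (auto simp: primes_maxs)
 show ?thesis using elem_val_frac[OF F P a(1) o a(2) _ _ a'(1)] a'(2) D.pval_mult[OF P', of \<one> \<one>] o by (simp add: cval_h)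
qed

lemma cval_frac:
 assumes F: "nf F" and P: "P:primes R F" and ab: "a:ints F" "b:ints F" "a ~= \<zero>" "b ~= \<zero>" "h a = h b * h x"
  and x: "x:F"
 shows "cval F P (h x) = cval F P (h a) - cval F P (h b)"
proof -
 have "a = b \<otimes> x" using ab h_simps intsD[OF F] ab F_closed[OF F x x] by (metis m_closed)
 from elem_val_frac[OF F P ab(1-4) this x] show ?thesis
  unfolding cval_h[OF F_closed(1)[OF F x x]] cval_int[OF F P ab(1,3)] cval_int[OF F P ab(2,4)] .
qed

lemma cval_ge_iff:
 assumes F: "nf F" and P: "P:primes R F" and a: "a:ints F"
 shows "a = \<zero> \<or> int n <= cval F P (h a) <-> a:P [^]\<^bsub>nzideals (\<O> F)\<^esub> n"
proof -
 interpret D: dedekind "\<O> F" by (rule nf_dedekind[OF F])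
 have P': "P:maxs (\<O> F)" using P by (simp add: primes_maxs)
 show ?thesis
 proof (cases "a = \<zero>")
  case True
  show ?thesis using True D.idealE D.ppow_nz D.maxD[OF P'] by simp
 next
  case False
  thus ?thesis using D.pval_iff[OF P'] a cval_int[OF F P a] by simp
 qed
qed

lemma cval_dval:
 assumes F: "nf F" and P: "P:primes R F"
 shows "dval (h ` F) (cval F P)"
proof
 interpret D: dedekind "\<O> F" by (rule nf_dedekind[OF F])
 have P': "P:maxs (\<O> F)" using P by (simp add: primes_maxs)
 show "csub (h ` F)" by (rule nf_sub[OF F])
 have mult: "cval F P (h a * h b) = cval F P (h a) + cval F P (h b)"
  if "a:ints F" "b:ints F" "a ~= \<zero>" "b ~= \<zero>" for a b
 proof -
  have c: "a \<otimes> b:ints F" "a \<otimes> b ~= \<zero>" using D.m_closed D.integral_iff that by auto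
  have "cval F P (h (a \<otimes> b)) = cval F P (h a) + cval F P (h b)"
   using D.pval_mult[OF P'] that cval_int[OF F P] c by simp
  thus ?thesis using h_simps intsD[OF F] that by simp
 qed
 have common: "EX a c b. a:ints F & c:ints F & b:ints F & b ~= \<zero> & h a = h b * h x & h c = h b * h y"
  if xyF: "x:F" "y:F" for x y
 proof -
  obtain a b where ab: "a:ints F" "b:ints F" "b ~= \<zero>" "a = b \<otimes> x" using fraction[OF F xyF(1)] by auto
  obtain c d where cd: "c:ints F" "d:ints F" "d ~= \<zero>" "c = d \<otimes> y" using fraction[OF F xyF(2)] by auto
  have xy: "x:carrier R" "y:carrier R" and m: "a \<otimes> d:ints F" "c \<otimes> b:ints F" "b \<otimes> d:ints F"
   "b \<otimes> d ~= \<zero>" using F_closed[OF F] xyF ab cd D.m_closed D.integral_iff by auto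
  have "h (a \<otimes> d) = h (b \<otimes> d) * h x" "h (c \<otimes> b) = h (b \<otimes> d) * h y"
   using ab cd intsD[OF F ab(2)] intsD[OF F cd(2)] xy h_simps(4) by auto
  thus ?thesis using m by auto
 qed
 fix x y assume xy: "x:h ` F" "y:h ` F" "x ~= 0" "y ~= 0"
 then obtain x' y' where x': "x = h x'" "x':F" "y = h y'" "y':F" by auto
 obtain a c b where abc: "a:ints F" "c:ints F" "b:ints F" "b ~= \<zero>" "h a = h b * x" "h c = h b * y"
  using common[OF x'(2,4)] x' by auto
 have R: "a:carrier R" "b:carrier R" "c:carrier R" "x':carrier R" "y':carrier R"
  using intsD[OF F] abc F_closed(1)[OF F] x' by auto
 have nz: "a ~= \<zero>" "c ~= \<zero>" using abc xy h_simps(2) h_simps(8)[OF R(2)] by auto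
 have vx: "cval F P x = cval F P (h a) - cval F P (h b)" "cval F P y = cval F P (h c) - cval F P (h b)"
  using cval_frac[OF F P abc(1,3) nz(1) abc(4)] cval_frac[OF F P abc(2,3) nz(2) abc(4)] abc x' by auto
 show "cval F P (x * y) = cval F P x + cval F P y"
 proof -
  have xyF: "x' \<otimes> y':F" "h (x' \<otimes> y') = x * y" and m: "a \<otimes> c:ints F" "b \<otimes> b:ints F"
   "a \<otimes> c ~= \<zero>" "b \<otimes> b ~= \<zero>"
    using F_closed[OF F x'(2,4)] h_simps(4) R x' D.m_closed D.integral_iff abc nz by auto
  have hm: "h (a \<otimes> c) = h a * h c" "h (b \<otimes> b) = h b * h b" using R h_simps by auto
  have "h (a \<otimes> c) = h (b \<otimes> b) * h (x' \<otimes> y')" unfolding hm xyF using abc by simp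
  from cval_frac[OF F P m this xyF(1)] show ?thesis
   using mult[OF abc(1,2) nz] mult[OF abc(3,3,4,4)] hm xyF vx by simp
 qed
 assume s0: "x + y ~= 0"
 show "min (cval F P x) (cval F P y) <= cval F P (x + y)"
 proof -
  have xyF: "x' \<oplus> y':F" "h (x' \<oplus> y') = x + y" and m: "a \<oplus> c:ints F"
   using F_closed[OF F x'(2,4)] h_simps(3) R x' D.a_closed abc by auto
  have hm: "h (a \<oplus> c) = h b * (x + y)" using R h_simps abc by (simp add: algebra_simps)
  hence nzs: "a \<oplus> c ~= \<zero>" using s0 abc h_simps R by (metis mult_eq_0_iff)
  define n where "n = min (D.pval P a) (D.pval P c)"
  have I: "ideal (D.ppow P n) (\<O> F)" using D.ppow_nz D.maxD[OF P'] by simp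
  have "min (cval F P (h a)) (cval F P (h c)) <= cval F P (h (a \<oplus> c))"
   using D.pval_iff[OF P', of "a \<oplus> c" n] m nzs D.idealE(3)[OF I] D.pval_iff[OF P', of a n] D.pval_iff[OF P', of c n] abc
    nz unfolding cval_int[OF F P abc(1) nz(1)] cval_int[OF F P abc(2) nz(2)] cval_int[OF F P m nzs] n_def by simp
  moreover have "h (a \<oplus> c) = h b * h (x' \<oplus> y')" using hm xyF by simp
  from cval_frac[OF F P m abc(3) nzs abc(4) this xyF(1)] have "cval F P (x + y) = cval F P (h (a \<oplus> c)) - cval F P (h b)"
   using xyF by simp
  ultimately show ?thesis using vx by simp
 qed
qed


abbreviation cvge :: "'a set => 'a set => int => complex => bool" where "cvge F P == dval.vge (cval F P)"

lemma cvge_iff: assumes "nf F" "P:primes R F" shows "cvge F P n z <-> z = 0 \<or> n <= cval F P z"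
 using dval.vge_def[OF cval_dval[OF assms]] by simp

lemma val_ge_cvge: assumes "nf F" "P:primes R F" "x:F" shows "val_ge R F P n x <-> cvge F P n (h x)"
 using cvge_iff[OF assms(1,2)] F_closed[OF assms(1,3,3)] by (simp add: val_ge_def cval_h h_simps)

lemma cvge_ints:
 assumes F: "nf F" and P: "P:primes R F" and a: "a:ints F"
 shows "cvge F P (int n) (h a) <-> a:P [^]\<^bsub>nzideals (\<O> F)\<^esub> n" "cvge F P 0 (h a)" "cvge F P 1 (h a) <-> a:P"
proof -
 interpret D: dedekind "\<O> F" by (rule nf_dedekind[OF F])
 have P': "P:maxs (\<O> F)" using P by (simp add: primes_maxs)
 show 1: "cvge F P (int n) (h a) <-> a:D.ppow P n" for n
  using cval_ge_iff[OF F P a] cvge_iff[OF F P] intsD[OF F a] by (simp add: h_simps)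
 show "cvge F P 0 (h a)" "cvge F P 1 (h a) <-> a:P" using 1[of 0] 1[of 1] D.ppow_0_1[OF P'] a by auto
qed

lemma localization:
 assumes F: "nf F" and P: "P:primes R F" and x: "x:F" "cvge F P 0 (h x)"
 shows "EX d:ints F. d ~: P & d \<otimes> x:ints F"
proof -
 interpret D: dedekind "\<O> F" by (rule nf_dedekind[OF F])
 interpret V: dval "h ` F" "cval F P" by (rule cval_dval[OF F P])
 have P': "P:maxs (\<O> F)" using P by (simp add: primes_maxs)
 obtain a b where ab: "a:ints F" "b:ints F" "b ~= \<zero>" "a = b \<otimes> x" using fraction[OF F x(1)] by auto
 have R: "a:carrier R" "b:carrier R" "x:carrier R" using intsD[OF F] ab F_closed[OF F x(1) x(1)] by auto
 have "cvge F P (cval F P (h b) + 0) (h b * h x)"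
  using x ab intsD[OF F] by (intro V.vge_mult) (auto simp: V.vge_def)
 then obtain d r where d: "d:ints F" "d ~: P" "r:ints F" "d \<otimes> a = r \<otimes> b"
  using D.pval_decomp[OF P', of a b] ab cvge_ints[OF F P ab(1)] cval_int[OF F P ab(2,3)] R h_simps by auto
 show ?thesis using d m_lcancel[OF ab(3) R(2)] ab R intsD[OF F] by (auto simp: m_ac)
qed

text \<open>Clear the denominator of x at \<open>P\<close> by some d outside \<open>P\<close>,
  invert d modulo P^n, and correct the resulting integer by weak approximation so that it lies in
  the other primes.\<close>

lemma integer_approx:
 assumes F: "nf F" and P: "P:primes R F" and x: "x:F" "cvge F P 0 (h x)" and A: "finite A" "A <= primes R F"
 shows "EX y:ints F. cvge F P (int n) (h y - h x) & (ALL Q:A - {P}. y:Q)"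
proof -
 interpret D: dedekind "\<O> F" by (rule nf_dedekind[OF F])
 interpret V: dval "h ` F" "cval F P" by (rule cval_dval[OF F P])
 have P': "P:maxs (\<O> F)" "A <= maxs (\<O> F)" using P A by (auto simp: primes_maxs)
 obtain d where d: "d:ints F" "d ~: P" "d \<otimes> x:ints F" using localization[OF F P x] by auto
 obtain e where e: "e:ints F" "d \<otimes> e \<ominus>\<^bsub>\<O> F\<^esub> \<one>:D.ppow P n"
  using D.inverse_mod_ppow[OF P'(1)] d by auto
 define b where "b = d \<otimes> x \<otimes> e"
 have b: "b:ints F" using D.m_closed d e by (simp add: b_def)
 obtain y where y: "y:ints F" "y \<ominus>\<^bsub>\<O> F\<^esub> b:D.ppow P n" "ALL Q:A - {P}. y:Q"
  using D.weak_approximation[OF P'(1) A(1) P'(2), of b n] b by auto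
 note R = intsD(2)[OF F d(1)] intsD(2)[OF F e(1)] intsD(2)[OF F b] intsD(2)[OF F y(1)] F_closed(1)[OF F x(1) x(1)]
 have de: "d \<otimes> e:ints F" "\<one>:ints F" using D.m_closed D.one_closed d e by auto
 have yb: "y \<ominus> b:ints F" "d \<otimes> e \<ominus> \<one>:ints F"
  using D.minus_closed D.minus_closed y b de O_minus[OF F] by auto
 have 1: "cvge F P (int n) (h y - h b)" using cvge_ints[OF F P yb(1)] y O_minus[OF F y(1) b] h_simps R by simp
 have "cvge F P (int n) (h d * h e - 1)"
  using cvge_ints[OF F P yb(2)] e O_minus[OF F de] h_simps R by simp
 hence "cvge F P (int n) ((h d * h e - 1) * h x)"
  using x intsD[OF F] d e(1) V.L' by (intro V.vge_mult0(1)) auto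
 moreover have "h b = h d * h x * h e" using R h_simps by (simp add: b_def)
 ultimately have "cvge F P (int n) (h b - h x)" by (simp add: algebra_simps)
 thus ?thesis using y V.vge_trans[of "h y" "h b" "h x"] 1 intsD[OF F] b x by auto
qed

end

lemma (in dval) vge_power_diff:
 assumes "x:L" "y:L" "vge 0 x" "vge 0 y" "vge n (x - y)" shows "vge n (x ^ i - y ^ i)"
proof (induction i)
 case (Suc i)
 have p: "x ^ i:L" "y ^ i:L" using assms csub_power[OF L] by auto
 have "x ^ Suc i - y ^ Suc i = x * (x ^ i - y ^ i) + (x - y) * y ^ i" by (simp add: algebra_simps)
 moreover have "vge n (x * (x ^ i - y ^ i))" using Suc assms p L' by (intro vge_mult0(2)) auto
 moreover have "vge n ((x - y) * y ^ i)" using assms p L' vge_power0 by (intro vge_mult0(1)) auto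
 ultimately show ?case using vge_add assms p L' by simp
qed simp

context algnum
begin

text \<open>The residue field statements hold for integers and pass to all P-integral elements, each
  of which is congruent to an integer.\<close>

lemma cval_rval:
 assumes F: "nf F" and P: "P:primes R F"
 shows "EX q p a. rval (h ` F) (cval F P) q p & p:h ` ints F & a:h ` ints F & ~ cvge F P 1 a &
   (ALL z:h ` F. cvge F P 0 z --> cvge F P 1 z \<or> (EX k. cvge F P 1 (z - a ^ k)))"
proof -
 interpret D: dedekind "\<O> F" by (rule nf_dedekind[OF F])
 interpret V: dval "h ` F" "cval F P" by (rule cval_dval[OF F P])
 have P': "P:maxs (\<O> F)" using P by (simp add: primes_maxs)
 define q where "q = card (carrier (\<O> F Quot P))"
 note res = D.residue_field_facts[OF P', folded q_def]
 obtain p where p: "p:ints F" "p ~= \<zero>" "D.pval P p = 1" using D.ex_uniformizer[OF P'] by auto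
 obtain a where a: "a:ints F" "a ~: P" "!!x. x:ints F ==> x ~: P ==> EX i::nat. x \<ominus>\<^bsub>\<O> F\<^esub> a [^]\<^bsub>\<O> F\<^esub> i:P"
  using res by auto
 have near: "EX y:ints F. cvge F P 1 (h y - z)" if "z:h ` F" "cvge F P 0 z" for z
  using integer_approx[OF F P, of _ "{}" 1] that by auto
 have diffP: "cvge F P 1 (h x - h y)" if "x:ints F" "y:ints F" "x \<ominus>\<^bsub>\<O> F\<^esub> y:P" for x y
  using that O_minus[OF F that(1,2)] D.minus_closed[of x y] cvge_ints[OF F P, of "x \<ominus> y"] intsD[OF F] h_simps by simp
 have rv: "rval (h ` F) (cval F P) q (h p)"
 proof
  show "h p:h ` F" "h p ~= 0" "cval F P (h p) = 1"
   using intsD[OF F p(1)] p h_simps cval_int[OF F P p(1,2)] by auto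
  show "0 < q" by (rule res)
  show "cvge F P 1 (of_nat q)" using cvge_ints[OF F P] res(2) O_nat[OF F] D.add.nat_pow_closed[OF D.one_closed] by fastforce
  fix z assume z: "z:h ` F" "cvge F P 0 z"
  obtain y where y: "y:ints F" "cvge F P 1 (h y - z)" using near[OF z] by auto
  have hy: "h y:h ` F" "cvge F P 0 (h y)" using intsD[OF F y(1)] cvge_ints[OF F P y(1)] by auto
  have pw: "h y ^ q:h ` F" "z ^ q:h ` F" and 1: "cvge F P 1 (h y ^ q - h y)" and zy: "cvge F P 1 (z - h y)"
   using csub_power[OF V.L] hy z O_pow[OF F y(1)] diffP[of "y [^]\<^bsub>\<O> F\<^esub> q" y] res y V.vge_diff_commute[OF hy(1)
    z(1)] by auto
  show "cvge F P 1 (z ^ q - z)" using V.vge_trans[OF pw(2) hy(1) z(1)] y V.vge_trans[OF pw(2,1) hy(1)] 1 V.vge_power_diff[OF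
   z(1) hy(1) z(2) hy(2) zy] by simp
 qed
 moreover have "ALL z:h ` F. cvge F P 0 z --> cvge F P 1 z \<or> (EX k. cvge F P 1 (z - h a ^ k))"
 proof (intro ballI impI)
  fix z assume z: "z:h ` F" "cvge F P 0 z"
  obtain y where y: "y:ints F" "cvge F P 1 (h y - z)" using near[OF z] by auto
  have hy: "h y:h ` F" "h a:h ` F" using intsD[OF F] y a by auto
  have zy: "cvge F P 1 (z - h y)" using y V.vge_diff_commute[OF hy(1) z(1)] by simp
  show "cvge F P 1 z \<or> (EX k. cvge F P 1 (z - h a ^ k))"
  proof (cases "y:P")
   case True
   thus ?thesis using V.vge_close[OF z(1) hy(1) zy] cvge_ints[OF F P y(1)] by simp
  next
   case False
   then obtain i where "y \<ominus>\<^bsub>\<O> F\<^esub> a [^]\<^bsub>\<O> F\<^esub> (i::nat):P" using a y by auto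
   thus ?thesis using V.vge_trans[OF z(1) hy(1) csub_power[OF V.L hy(2)] zy] diffP[OF y(1)] O_pow[OF F a(1)] by metis
  qed
 qed
 moreover have "~ cvge F P 1 (h a)" using cvge_ints[OF F P a(1)] a by simp
 ultimately show ?thesis using p a by auto
qed

text \<open>A valuation that is nonnegative on integers and positive exactly on those in
  \<open>P\<close> vanishes on all units at \<open>P\<close>, so its value k at a uniformiser
  determines it. For a restriction k is the ramification index; for a conjugate valuation k will be
  1.\<close>

lemma cval_unique:
 assumes F: "nf F" and P: "P:primes R F" and u: "dval (h ` F) u"
  and u0: "!!x. x:ints F ==> dval.vge u 0 (h x)" and uP: "!!x. x:ints F ==> dval.vge u 1 (h x) <-> x:P"
 shows "EX k>0. ALL z:h ` F. z ~= 0 --> u z = int k * cval F P z"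
proof -
 interpret U: dval "h ` F" u by (rule u)
 obtain q p where "rval (h ` F) (cval F P) q p" and p: "p:h ` ints F" using cval_rval[OF F P] by auto
 then interpret V: rval "h ` F" "cval F P" q p by simp
 have intu: "u (h c) = 0" if "c:ints F" "c ~: P" for c
  using u0[OF that(1)] uP[OF that(1)] that by (auto simp: U.vge_def)
 have unit: "u z = 0" if z: "z:h ` F" "z ~= 0" "cval F P z = 0" for z
 proof -
  obtain x where x: "x:F" "z = h x" using z by auto
  obtain d where d: "d:ints F" "d ~: P" "d \<otimes> x:ints F" using localization[OF F P x(1)] z x by (auto simp: V.vge_def)
  note R = intsD(2)[OF F d(1)] F_closed(1)[OF F x(1) x(1)]
  have dv: "h d ~= 0" "cval F P (h d) = 0"
   using cvge_ints[OF F P d(1)] d by (auto simp: V.vge_def)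
  have "h (d \<otimes> x) = h d * z" using h_simps R x by simp
  moreover have "cval F P (h d * z) = 0" using V.vmult dv z intsD[OF F d(1)] by simp
  ultimately show ?thesis using U.vmult dv z intsD[OF F d(1)] intu[OF d(1,2)] intu[OF d(3)] cvge_ints[OF F P d(3)]
   by (auto simp: V.vge_def)
 qed
 obtain p' where p': "p':ints F" "p = h p'" using p by auto
 have k: "1 <= u p" using V.pi cvge_ints[OF F P p'(1)] uP[OF p'(1)] p' by (simp add: U.vge_def V.vge_def)
 have pos: "u z = u p * cval F P z" if z: "z:h ` F" "z ~= 0" "0 <= cval F P z" for z
 proof -
  obtain w where w: "w:h ` F" "w ~= 0" "cval F P w = 0" "z = p ^ nat (cval F P z) * w" by (rule V.split_unit[OF z])
  show ?thesis using unit[OF w(1-3)] U.v_power[OF V.pi(1,2)] z U.vmult[of "p ^ nat (cval F P z)" w] csub_power[OF U.L V.pi(1)]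
   V.pi w by simp
 qed
 have "u z = u p * cval F P z" if z: "z:h ` F" "z ~= 0" for z
 proof (cases "0 <= cval F P z")
  case False
  have "u (inverse z) = u p * cval F P (inverse z)" using z False V.v_inverse[OF z] V.L'(7)[OF z(1)] by (intro pos) auto
  thus ?thesis using U.v_inverse[OF z] V.v_inverse[OF z] by simp
 qed (rule pos[OF z])
 thus ?thesis using k by (intro exI[of _ "nat (u p)"]) simp
qed

end

section \<open>Primes in extensions and ramification indices\<close>

context algnum
begin

lemma ints_mono: "F <= L ==> ints F <= ints L" by (auto simp: ints_def)

lemma prime_facts:
 assumes F: "nf F" and P: "P:primes R F"
 shows "P <= ints F" "\<zero>:P" "\<one> ~: P" "P ~= {\<zero>}" "ideal P (\<O> F)" "P ~= ints F"
  "!!Q. Q:primes R F ==> P <= Q ==> P = Q"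
proof -
 interpret D: dedekind "\<O> F" by (rule nf_dedekind[OF F])
 have P': "P:maxs (\<O> F)" using P by (simp add: primes_maxs)
 note m = D.maxD[OF P']
 show I: "ideal P (\<O> F)" using m by simp
 show "P <= ints F" "\<zero>:P" "\<one> ~: P" "P ~= {\<zero>}" "P ~= ints F" using D.idealE[OF I] m by auto
 fix Q assume Q: "Q:primes R F" "P <= Q"
 hence Q': "Q:maxs (\<O> F)" by (simp add: primes_maxs)
 thus "P = Q" using m D.maxD[OF Q'] Q by auto
qed

lemma prime_nonzero_int:
 assumes L: "nf L" and P: "P:primes R L" and F: "subfield F R" "F <= L"
 shows "EX b:ints F. b ~= \<zero> & b:P"
proof -
 note nF = nf_mono[OF L F]
 interpret D: dedekind "\<O> L" by (rule nf_dedekind[OF L])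
 obtain a where a: "a:P" "a ~= \<zero>" using prime_facts[OF L P] by auto
 have aL: "a:ints L" using a prime_facts[OF L P] by auto
 note a' = intsD[OF L aL]
 obtain m :: int and q where m: "m ~= 0" "!!i. pcf q i:\<int>" "of_int m = h a * poly q (h a)"
  using algebraic_int_divides_int[OF a'(3)] h_simps a a' by auto
 obtain c where c: "c:L" "h c = poly q (h a)" using pols_simps(9)[OF nf_sub(3)[OF L] Ints_pols[OF nf_sub(3)[OF L]] a'(4)] m(2)
  by fastforce
 have cL: "c:ints L" using intsI[OF L c(1)] c algebraic_int_poly m a' by simp
 have "of_int m:h ` F" using csub_of_int[OF nf_sub(3)[OF nF]] .
 then obtain b where b: "b:F" "h b = of_int m" by auto
 have bF: "b:ints F" using intsI[OF nF b(1)] b by simp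
 have "h b = h (a \<otimes> c)" using b m c h_simps a' intsD[OF L cL] by simp
 hence "b:P" using D.idealE(4)[OF prime_facts(5)[OF L P] a(1)] cL h_simps(9) intsD[OF nF bF] a' intsD[OF L cL] by simp
 moreover have "b ~= \<zero>" using b m h_simps(2) by auto
 ultimately show ?thesis using bF by auto
qed

lemma contraction:
 assumes L: "nf L" and P: "P:primes R L" and F: "subfield F R" "F <= L"
 shows "P Int ints F:primes R F"
proof -
 interpret D: dedekind "\<O> L" by (rule nf_dedekind[OF L])
 interpret C: dedekind "\<O> F" by (rule nf_dedekind[OF nf_mono[OF L F]])
 have P': "P:maxs (\<O> L)" using P by (simp add: primes_maxs)
 note I = prime_facts(5)[OF L P]
 have sub: "x:ints L" if "x:ints F" for x using ints_mono[OF F(2)] that by auto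
 have id: "ideal (P Int ints F) (\<O> F)"
 proof (rule C.ideal_intro)
  show "\<zero>\<^bsub>\<O> F\<^esub>:P Int ints F" using prime_facts[OF L P] C.zero_closed by simp
  fix x y assume "x:P Int ints F" "y:P Int ints F"
  thus "x \<oplus>\<^bsub>\<O> F\<^esub> y:P Int ints F" using D.idealE[OF I] C.a_closed by simp
 next
  fix x y assume "x:P Int ints F" "y:carrier (\<O> F)"
  thus "y \<otimes>\<^bsub>\<O> F\<^esub> x:P Int ints F" using D.idealE[OF I] C.m_closed sub by simp
 qed simp
 have "primeideal (P Int ints F) (\<O> F)"
 proof (rule primeidealI[OF id C.is_cring])
  show "carrier (\<O> F) ~= P Int ints F" using prime_facts[OF L P] C.one_closed by auto
  fix a b assume ab: "a:carrier (\<O> F)" "b:carrier (\<O> F)" "a \<otimes>\<^bsub>\<O> F\<^esub> b:P Int ints F"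
  thus "a:P Int ints F \<or> b:P Int ints F"
   using D.primeD[OF D.maxD(3)[OF P']] sub by auto
 qed
 moreover have "P Int ints F ~= {\<zero>}" using prime_nonzero_int[OF L P F] by auto
 ultimately show ?thesis using C.prime_maximal by (simp add: primes_def)
qed

text \<open>With I = a P^(-1) and c in \<open>I\<close> outside (a), the ideal of all x in the
  integers of \<open>L\<close> with (c/a) x integral contains \<open>P\<close>. It is proper because
  c/a is not integral, so a maximal ideal above it contracts to \<open>P\<close>.\<close>

lemma lying_over:
 assumes L: "nf L" and F: "subfield F R" "F <= L" and P: "P:primes R F"
 shows "EX P':primes R L. P' Int ints F = P"
proof -
 note nF = nf_mono[OF L F]
 interpret D: dedekind "\<O> L" by (rule nf_dedekind[OF L])
 interpret C: dedekind "\<O> F" by (rule nf_dedekind[OF nF])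
 have PF: "P:maxs (\<O> F)" using P by (simp add: primes_maxs)
 have sub: "x:ints L" if "x:ints F" for x using ints_mono[OF F(2)] that by auto
 obtain a where a: "a:P" "a ~= \<zero>" using prime_facts[OF nF P] by auto
 have aF: "a:ints F" using a prime_facts[OF nF P] by auto
 obtain I c where I: "ideal I (\<O> F)" "ideal_prod (\<O> F) P I = PIdl\<^bsub>\<O> F\<^esub> a" "c:I"
  "c ~: PIdl\<^bsub>\<O> F\<^esub> a"
  using C.max_invertible[OF PF a(1)] a by auto
 have cF: "c:ints F" using C.idealE(2)[OF I(1,3)] by simp
 define J where "J = {x:ints L. EX r:ints L. c \<otimes> x = r \<otimes> a}"
 note R = intsD(2)[OF L]
 have J: "ideal J (\<O> L)"
 proof (rule D.ideal_intro)
  have "c \<otimes> \<zero> = \<zero> \<otimes> a" using R sub cF aF by simp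
  thus "\<zero>\<^bsub>\<O> L\<^esub>:J" using D.zero_closed by (auto simp: J_def)
 next
  fix x y assume "x:J" "y:J"
  then obtain r s where rs: "x:ints L" "y:ints L" "r:ints L" "s:ints L" "c \<otimes> x = r \<otimes> a"
   "c \<otimes> y = s \<otimes> a"
   by (auto simp: J_def)
  hence "c \<otimes> (x \<oplus> y) = (r \<oplus> s) \<otimes> a" using R sub cF aF by (simp add: r_distr l_distr)
  thus "x \<oplus>\<^bsub>\<O> L\<^esub> y:J" using rs D.a_closed D.a_closed by (auto simp: J_def)
 next
  fix x y assume "x:J" "y:carrier (\<O> L)"
  then obtain r where rs: "x:ints L" "y:ints L" "r:ints L" "c \<otimes> x = r \<otimes> a" by (auto simp: J_def)
  hence "c \<otimes> (y \<otimes> x) = (y \<otimes> r) \<otimes> a"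
   using R[OF rs(1)] R[OF rs(2)] R[OF rs(3)] R[OF sub[OF cF]] R[OF sub[OF aF]] by (metis m_assoc m_comm)
  thus "y \<otimes>\<^bsub>\<O> L\<^esub> x:J" using rs D.m_closed D.m_closed by (auto simp: J_def)
 qed (auto simp: J_def)
 have PJ: "P <= J"
 proof
  fix x assume x: "x:P"
  hence xF: "x:ints F" using prime_facts[OF nF P] by auto
  have "x \<otimes>\<^bsub>\<O> F\<^esub> c:ideal_prod (\<O> F) P I" using x I(3) by (rule ideal_prod.prod)
  hence "x \<otimes>\<^bsub>\<O> F\<^esub> c:PIdl\<^bsub>\<O> F\<^esub> a" by (simp only: I(2))
  then obtain r where "r:ints F" "x \<otimes> c = r \<otimes> a" using C.PIdl_iff by auto
  thus "x:J" using sub xF cF R m_comm by (auto simp: J_def)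
 qed
 have "\<one> ~: J"
 proof
  assume "\<one>:J"
  then obtain r where r: "r:ints L" "c = r \<otimes> a" using R sub cF by (auto simp: J_def)
  note h' = intsD[OF L r(1)] intsD(4)[OF nF aF] intsD(4)[OF nF cF]
  obtain r' where "r':F" "h r = h r'" using csubD(8)[OF nf_sub(3)[OF nF] h'(6,5)] r h_simps R sub aF r h_simps(8) a by auto
  thus False using I r C.PIdl_iff intsI[OF nF] h' h_simps(9)[OF R[OF r(1)]] F_closed(1)[OF nF] by auto
 qed
 hence "J ~= carrier (\<O> L)" using D.one_closed by auto
 moreover have "J ~= {\<zero>\<^bsub>\<O> L\<^esub>}" using PJ a by auto
 ultimately obtain P' where P': "P':maxs (\<O> L)" "J <= P'" using D.ex_max J by auto
 hence P'p: "P':primes R L" by (simp add: primes_maxs)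
 show ?thesis using P'p PJ P' prime_facts[OF nF P] prime_facts(7)[OF nF P contraction[OF L P'p F]] by auto
qed

lemma cval_restrict:
 assumes L: "nf L" and P: "P:primes R L" and F: "subfield F R" "F <= L"
 shows "EX e>0. ALL z:h ` F. z ~= 0 --> cval L P z = int e * cval F (P Int ints F) z"
proof (rule cval_unique)
 note nF = nf_mono[OF L F]
 interpret V: dval "h ` L" "cval L P" by (rule cval_dval[OF L P])
 have sub: "x:h ` L" if "x:h ` F" for x using that F by auto
 show d: "dval (h ` F) (cval L P)"
  by unfold_locales (use sub V.vmult V.vadd nf_sub(3)[OF nF] in auto)
 show "nf F" "P Int ints F:primes R F" by (rule nF, rule contraction[OF L P F])
 fix x assume x: "x:ints F"
 thus "cvge L P 0 (h x)" "cvge L P 1 (h x) <-> x:P Int ints F" using cvge_ints[OF L P] ints_mono[OF F(2)] by auto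
qed

text \<open>Identifies the exponent that \<open>unramified_at\<close> speaks of with the factor
  found in \<open>cval_restrict\<close>.\<close>

lemma ideal_val_Idl:
 assumes L: "nf L" and P: "P:primes R L" and F: "subfield F R" "F <= L"
  and e: "!!z. z:h ` F ==> z ~= 0 ==> cval L P z = int e * cval F (P Int ints F) z"
 shows "ideal_val R L P (Idl\<^bsub>\<O> L\<^esub> (P Int ints F)) = e"
proof -
 note nF = nf_mono[OF L F]
 interpret D: dedekind "\<O> L" by (rule nf_dedekind[OF L])
 let ?p = "P Int ints F"
 note p = contraction[OF L P F]
 have P': "P:maxs (\<O> L)" and pL: "?p <= carrier (\<O> L)" using P prime_facts[OF L P] by (auto simp: primes_maxs)
 obtain b where b: "b:?p" "b ~= \<zero>" using prime_nonzero_int[OF L P F] by auto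
 have "n <= ival (\<O> L) P (Idl\<^bsub>\<O> L\<^esub> ?p) <-> n <= e" for n
 proof -
  have J: "ideal (D.ppow P n) (\<O> L)" using D.ppow_nz D.maxD[OF P'] by simp
  have "n <= ival (\<O> L) P (Idl\<^bsub>\<O> L\<^esub> ?p) <-> Idl\<^bsub>\<O> L\<^esub> ?p <= D.ppow P n"
   using D.ival_iff[OF P'] D.genideal_ideal[OF pL] D.genideal_self[OF pL] b by auto
  also have "\<dots> <-> ?p <= D.ppow P n" using D.genideal_minimal[OF J] D.genideal_self[OF pL] by auto
  also have "\<dots> <-> (ALL x:?p. cvge L P (int n) (h x))" using cvge_ints(1)[OF L P] prime_facts(1)[OF L P] by auto
  also have "\<dots> <-> n <= e"
  proof
   obtain q z a where "rval (h ` F) (cval F ?p) q z" and z: "z:h ` ints F" using cval_rval[OF nF p] by auto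
   then interpret V: rval "h ` F" "cval F ?p" q z by simp
   obtain x where x: "x:ints F" "z = h x" using z by auto
   have "x:?p" using cvge_ints[OF nF p x(1)] V.pi x by (simp add: V.vge_def)
   moreover assume "ALL x:?p. cvge L P (int n) (h x)"
   ultimately show "n <= e" using V.pi e[OF V.pi(1,2)] x by (auto simp: cvge_iff[OF L P])
  next
   assume n: "n <= e"
   show "ALL x:?p. cvge L P (int n) (h x)"
   proof
    fix x assume x: "x:?p"
    hence "cvge F ?p 1 (h x)" using cvge_ints[OF nF p] by auto
    moreover have "h x:h ` F" using x intsD[OF nF] by auto
    ultimately have "h x = 0 \<or> int e * 1 <= cval L P (h x)"
     using e mult_left_mono[of 1 "cval F ?p (h x)" "int e"] by (auto simp: cvge_iff[OF nF p])
    thus "cvge L P (int n) (h x)" using n by (auto simp: cvge_iff[OF L P])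
   qed
  qed
  finally show ?thesis .
 qed
 thus ?thesis unfolding ideal_val_ival by (meson antisym order_refl)
qed

end

text \<open>The element u is the conjugate s^(-1) t s.\<close>

lemma cgal_id_inverse:
 assumes "csub L" "K <= L" "s:cgal L K" "t:cgal L K"
 obtains u where "u:cgal L K" "!!x. x:L ==> s (u x) = t (s x)"
proof -
 obtain r where r: "r:cgal L K" "ALL x:L. s (r x) = x & r (s x) = x" using cgal_inverse[OF assms(1-3)] by auto
 let ?u = "compose L r (compose L t s)"
 have "?u:cgal L K" using cgal_compose[OF assms(1,2)] r assms by simp
 moreover have "s (?u x) = t (s x)" if "x:L" for x
  using that r cgalD[OF assms(3)] cgalD[OF assms(4)] by (simp add: compose_def)
 ultimately show thesis using that by simp
qed

section \<open>Galois action on primes\<close>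

context algnum
begin

text \<open>A ramification group inside the global Galois group, described by the valuation on
  \<open>L\<close> alone. The congruence already forces \<open>s\<close> to preserve this valuation
  (\<open>inertia_val\<close>), so membership implies membership in the decomposition group.\<close>

definition cram :: "'a set => 'a set => 'a set => nat => (complex => complex) set" where
 "cram K L P j = {s:cgal (h ` L) (h ` K). ALL x:h ` L. cvge L P 0 x --> cvge L P (int j + 1) (s x - x)}"

lemma cramD: "s:cram K L P j ==> s:cgal (h ` L) (h ` K)"
 "s:cram K L P j ==> x:h ` L ==> cvge L P 0 x ==> cvge L P (int j + 1) (s x - x)"
 unfolding cram_def by auto

definition cidm :: "'a set => complex => complex" where "cidm L = restrict id (h ` L)"

definition gx :: "'a set => 'a set => bool" where
 "gx K L <-> nf L & subfield K R & K <= L & cgalois (h ` K) (h ` L)"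

lemma gxD: assumes "gx K L"
 shows "nf L" "nf K" "subfield K R" "K <= L" "h ` K <= h ` L" "cgalois (h ` K) (h ` L)" "csub (h ` L)" "csub (h ` K)"
  "finite (cgal (h ` L) (h ` K))"
 using assms nf_mono by (auto simp: gx_def cgalois_def)

lemma ints_cgal:
 assumes G: "gx K L" and s: "s:cgal (h ` L) (h ` K)" and x: "x:ints L"
 shows "EX y:ints L. h y = s (h x)"
proof -
 note x' = intsD[OF gxD(1)[OF G] x]
 obtain y where y: "y:L" "h y = s (h x)" using cgalD(4)[OF s x'(4)] by auto
 show ?thesis using y intsI[OF gxD(1)[OF G]] chom_algebraic_int[OF gxD(7)[OF G] cgalD(1)[OF s] x'(4,3)] by auto
qed

text \<open>The prime \<open>s\<inverse> P\<close>.\<close>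

definition pullback :: "'a set => 'a set => (complex => complex) => 'a set" where
 "pullback L P s = {x:ints L. cvge L P 1 (s (h x))}"

lemma pullback:
 assumes G: "gx K L" and P: "P:primes R L" and s: "s:cgal (h ` L) (h ` K)"
 shows "pullback L P s:primes R L" "!!z. z:h ` L ==> z ~= 0 ==> cval L P (s z) = cval L (pullback L P s) z"
  "pullback L P s Int ints K = P Int ints K"
proof -
 note L = gxD(1)[OF G]
 interpret D: dedekind "\<O> L" by (rule nf_dedekind[OF L])
 interpret V: dval "h ` L" "cval L P" by (rule cval_dval[OF L P])
 note sD = cgalD[OF s] and sh = chomD[OF cgalD(1)[OF s] V.L]
 let ?Q = "pullback L P s"
 have s0: "cvge L P 0 (s (h x))" if "x:ints L" for x
  using ints_cgal[OF G s that] cvge_ints[OF L P] by metis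
 note R = intsD(2)[OF L] and H = intsD(4)[OF L]
 have Q1: "x:?Q" if "x:ints L" "cvge L P 1 (s (h x))" for x using that by (simp add: pullback_def)
 have Q2: "x:ints L" "cvge L P 1 (s (h x))" if "x:?Q" for x using that by (auto simp: pullback_def)
 have id: "ideal ?Q (\<O> L)"
 proof (rule D.ideal_intro)
  show "\<zero>\<^bsub>\<O> L\<^esub>:?Q" using D.zero_closed h_simps(2) sh(2) by (intro Q1) auto
  fix x y assume xy: "x:?Q" "y:?Q"
  have "s (h (x \<oplus> y)) = s (h x) + s (h y)" using h_simps R Q2 xy sh(3) H by simp
  moreover have "x \<oplus> y:ints L" using D.a_closed Q2[OF xy(1)] Q2[OF xy(2)] by simp
  ultimately show "x \<oplus>\<^bsub>\<O> L\<^esub> y:?Q" using V.vge_add Q2 xy sD H Q1 by simp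
 next
  fix x y assume xy: "x:?Q" "y:carrier (\<O> L)"
  have y: "y:ints L" using xy by simp
  have "s (h (y \<otimes> x)) = s (h y) * s (h x)" using h_simps R Q2[OF xy(1)] y sh(4) H by simp
  moreover have "y \<otimes> x:ints L" using D.m_closed Q2[OF xy(1)] y by simp
  ultimately show "y \<otimes>\<^bsub>\<O> L\<^esub> x:?Q"
   using V.vge_mult0 Q2[OF xy(1)] y s0[OF y] sD(4) H Q1 by simp
 qed (use Q2 in auto)
 have "primeideal ?Q (\<O> L)"
 proof (rule primeidealI[OF id D.is_cring])
  show "carrier (\<O> L) ~= ?Q" using Q2(2) h_simps(1) sh(1) V.v_one by (fastforce simp: V.vge_def)
  fix a b assume ab: "a:carrier (\<O> L)" "b:carrier (\<O> L)" "a \<otimes>\<^bsub>\<O> L\<^esub> b:?Q"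
  hence ab': "a:ints L" "b:ints L" by auto
  show "a:?Q \<or> b:?Q"
  proof (rule ccontr)
   assume n: "~ (a:?Q \<or> b:?Q)"
   have z: "w ~= 0 & cval L P w = 0" if "cvge L P 0 w" "~ cvge L P 1 w" for w using that by (auto simp: V.vge_def)
   show False using V.vmult sD H ab' n Q1[OF ab'(1)] Q1[OF ab'(2)] Q2[OF ab(3)] h_simps R sh(4) by (fastforce simp: V.vge_def)
  qed
 qed
 moreover have PQ: "?Q Int ints K = P Int ints K"
 proof -
  have "s (h x) = h x" "x:ints L" if "x:ints K" for x
   using sD intsD(4)[OF gxD(2)[OF G] that] that ints_mono[OF gxD(4)[OF G]] by auto
  thus ?thesis using cvge_ints[OF L P] by (auto simp: pullback_def)
 qed
 hence "?Q ~= {\<zero>}" using prime_nonzero_int[OF L P gxD(3)[OF G] gxD(4)[OF G]] by auto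
 ultimately show Q: "?Q:primes R L" using D.prime_maximal by (simp add: primes_def)
 show "?Q Int ints K = P Int ints K" by (rule PQ)
 have u: "dval (h ` L) (cval L P \<circ> s)"
 proof
  show "csub (h ` L)" by (rule V.L)
  show "(cval L P \<circ> s) (x * y) = (cval L P \<circ> s) x + (cval L P \<circ> s) y"
   if "x:h ` L" "y:h ` L" "x ~= 0" "y ~= 0" for x y
   using that V.vmult sD sh(4,7) by simp
  show "min ((cval L P \<circ> s) x) ((cval L P \<circ> s) y) <= (cval L P \<circ> s) (x + y)"
   if "x:h ` L" "y:h ` L" "x ~= 0" "y ~= 0" "x + y ~= 0" for x y
   using that V.vadd sD sh(3,7) V.L'(4) by (metis comp_apply)
 qed
 have uv: "dval.vge (cval L P \<circ> s) n (h x) <-> cvge L P n (s (h x))" if "x:ints L" for n x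
  using dval.vge_def[OF u] V.vge_def sh(7) H[OF that] by simp
 \<comment> \<open>The valuation composed with \<open>s\<close> is a multiple of that of the pulled
   back prime. Since \<open>s\<close> is onto, it takes the value 1, so the factor is 1.\<close>
 obtain k where k: "k > 0" "ALL z:h ` L. z ~= 0 --> (cval L P \<circ> s) z = int k * cval L ?Q z"
  using cval_unique[OF L Q u] uv s0 Q1 Q2(2) by blast
 obtain q p a where "rval (h ` L) (cval L P) q p" using cval_rval[OF L P] by auto
 then interpret W: rval "h ` L" "cval L P" q p .
 have "p:s ` h ` L" using sD W.pi by simp
 then obtain y where y: "y:h ` L" "s y = p" by auto
 show "cval L P (s z) = cval L ?Q z" if "z:h ` L" "z ~= 0" for z
  using bspec[OF k(2) that(1)] that zmult_eq_1_iff W.pi(3) k y W.pi sh(2) by auto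
qed

lemma pullback_cvge:
 assumes G: "gx K L" and P: "P:primes R L" and s: "s:cgal (h ` L) (h ` K)" and z: "z:h ` L"
 shows "cvge L P n (s z) <-> cvge L (pullback L P s) n z"
 using pullback(2)[OF G P s z] chomD(7)[OF cgalD(1)[OF s] gxD(7)[OF G] z]
  by (auto simp: cvge_iff[OF gxD(1)[OF G] P] cvge_iff[OF gxD(1)[OF G] pullback(1)[OF G P s]])

lemma cram_conj:
 assumes G: "gx K L" and P: "P:primes R L" and s: "s:cgal (h ` L) (h ` K)" and t: "t:cram K L P j"
 shows "EX u:cram K L (pullback L P s) j. ALL x:h ` L. s (u x) = t (s x)"
proof -
 have tc: "t:cgal (h ` L) (h ` K)" using t by (simp add: cram_def)
 obtain u where u: "u:cgal (h ` L) (h ` K)" "!!x. x:h ` L ==> s (u x) = t (s x)"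
  using cgal_id_inverse[OF gxD(7)[OF G] gxD(5)[OF G] s tc] by auto
 have "cvge L (pullback L P s) (int j + 1) (u x - x)" if x: "x:h ` L" "cvge L (pullback L P s) 0 x" for x
 proof -
  have ux: "u x:h ` L" "u x - x:h ` L" using cgalD(4)[OF u(1) x(1)] csubD(5)[OF gxD(7)[OF G]] x by auto
  have "cvge L P (int j + 1) (t (s x) - s x)" using cramD(2)[OF t cgalD(4)[OF s x(1)]] x pullback_cvge[OF G P s x(1)] by simp
  moreover have "t (s x) - s x = s (u x - x)" using chomD(6)[OF cgalD(1)[OF s] gxD(7)[OF G] ux(1) x(1)] u(2)[OF x(1)] by simp
  ultimately show ?thesis using pullback_cvge[OF G P s ux(2)] by simp
 qed
 thus ?thesis using u u by (auto simp: cram_def)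
qed

text \<open>The product is the value at 0 of the characteristic polynomial, which has coefficients
  in \<open>K\<close>; this is where the signs come from.\<close>

lemma norm_integer:
 assumes G: "gx K L" and x: "x:ints L"
 shows "EX n:ints K. h n = (\<Prod>s\<in>cgal (h ` L) (h ` K). - s (h x))"
proof -
 note x' = intsD[OF gxD(1)[OF G] x]
 let ?N = "\<Prod>s\<in>cgal (h ` L) (h ` K). - s (h x)"
 have "?N:h ` K" using pols_simps(9)[OF gxD(8)[OF G] orbit_poly(1)[OF gxD(6)[OF G] x'(4)]] csubD(2)[OF gxD(8)[OF G]]
  by (fastforce simp: orbit_poly_def poly_prod)
 then obtain n where "n:K" "?N = h n" by auto
 hence n: "n:K" "h n = ?N" by auto
 have ai: "algebraic_int (- s (h x))" if "s:cgal (h ` L) (h ` K)" for s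
  using chom_algebraic_int[OF gxD(7)[OF G] cgalD(1)[OF that] x'(4,3)] by simp
 have "algebraic_int (prod f A)" if "finite A" "!!s. s:A ==> algebraic_int (f s :: complex)" for f and A ::
  "(complex => complex) set"
  using that by (induction A rule: finite_induct) (auto simp: algebraic_int_ring)
 from this[OF gxD(9)[OF G], of "%s. - s (h x)"] show ?thesis using n intsI[OF gxD(2)[OF G] n(1)] ai by auto
qed

text \<open>If \<open>Q\<close> were not a conjugate of \<open>P\<close>, some integer x would be
  congruent to 0 modulo \<open>Q\<close> and to 1 modulo every conjugate of \<open>P\<close>. Up to
  sign its norm would then lie in \<open>Q Int ints K\<close> but not in \<open>P\<close>.\<close>

lemma pullback_transitive:
 assumes G: "gx K L" and P: "P:primes R L" and Q: "Q:primes R L" and eq: "P Int ints K = Q Int ints K"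
 shows "EX s:cgal (h ` L) (h ` K). pullback L P s = Q"
proof (rule ccontr)
 assume no: "~ ?thesis"
 note L = gxD(1)[OF G]
 interpret D: dedekind "\<O> L" by (rule nf_dedekind[OF L])
 interpret V: dval "h ` L" "cval L P" by (rule cval_dval[OF L P])
 interpret W: dval "h ` L" "cval L Q" by (rule cval_dval[OF L Q])
 let ?G = "cgal (h ` L) (h ` K)" and ?A = "pullback L P ` cgal (h ` L) (h ` K)"
 have A: "finite ?A" "?A <= primes R L" "Q ~: ?A" and o: "\<one>:L" "\<one>:ints L"
  using gxD[OF G] pullback[OF G P] no D.one_closed by auto
 have "cvge L Q 0 (h \<one>)" using cvge_ints(2)[OF L Q o(2)] .
 from integer_approx[OF L Q o(1) this A(1,2), of 1]
 obtain y where y: "y:ints L" "cvge L Q 1 (h y - h \<one>)" "ALL T:?A - {Q}. y:T" by auto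
 define x where "x = \<one> \<ominus> y"
 have x: "x:ints L" using D.minus_closed[of \<one> y] y o O_minus[OF L o(2) y(1)] by (simp add: x_def)
 note Rx = intsD[OF L x] intsD[OF L y(1)] intsD[OF L o(2)]
 have hx: "h x = 1 - h y" using h_simps h_simps Rx by (simp add: x_def)
 have xP: "s (h x) ~= 0 & cval L P (s (h x)) = 0" if s: "s:?G" for s
 proof -
  have m: "s (h y):h ` L" "s (h x):h ` L" using cgalD(4)[OF s] Rx by auto
  have c: "cvge L P 1 (s (h x) - 1)" using V.vge_minus[OF m(1)] hx chomD(1,6)[OF cgalD(1)[OF s] V.L] csubD(1)[OF V.L] Rx y A s
   by (simp add: pullback_def)
  show ?thesis using V.v_eq_of_close[of 1 "s (h x)" 1] c m V.v_one V.L' by simp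
 qed
 obtain n where n: "n:ints K" "h n = (\<Prod>s\<in>?G. - s (h x))" using norm_integer[OF G x] by auto
 have nL: "n:ints L" using n ints_mono[OF gxD(4)[OF G]] by auto
 have mem: "s (h x):h ` L" if "s:?G" for s using cgalD(4)[OF that Rx(4)] .
 have sx0: "s (h x) ~= 0" if "s:?G" for s using xP[OF that] by simp
 have "h n ~= 0" unfolding n using sx0 gxD[OF G] by simp
 moreover have "cval L P (h n) = 0" unfolding n using V.v_prod[OF gxD(9)[OF G]] mem xP V.L'(3) V.v_minus by simp
 ultimately have "n ~: P" using cvge_ints[OF L P nL] by (auto simp: V.vge_def)
 moreover have "n:Q"
 proof -
  define i where "i = restrict id (h ` L)"
  have i: "i:?G" using cgal_id[OF V.L gxD(5)[OF G]] by (simp add: i_def)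
  have int: "cvge L Q 0 (- s (h x)) & - s (h x):h ` L" if "s:?G" for s
   using ints_cgal[OF G that x] cvge_ints[OF L Q] W.vge_minus mem[OF that] W.L' by metis
  have "h n = - i (h x) * (\<Prod>s\<in>?G - {i}. - s (h x))" unfolding n by (rule prod.remove[OF gxD(9)[OF G] i])
  moreover have "cvge L Q 1 (- i (h x) * (\<Prod>s\<in>?G - {i}. - s (h x)))"
  proof (rule W.vge_mult0(1))
   show "- i (h x):h ` L" using int i by simp
   show "(\<Prod>s\<in>?G - {i}. - s (h x)):h ` L" using int by (intro csub_prod[OF W.L]) auto
   show "cvge L Q 1 (- i (h x))" using Rx y(2) h_simps hx by (simp add: i_def)
   show "cvge L Q 0 (\<Prod>s\<in>?G - {i}. - s (h x))" using int by (intro W.vge_prod0) auto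
  qed
  ultimately show ?thesis using cvge_ints(3)[OF L Q nL] by simp
 qed
 ultimately show False using eq n by auto
qed

lemma galois_approx:
 assumes G: "gx K L" and P: "P:primes R L"
 shows "EX q p a. approx_rval (h ` L) (cval L P) q p (h ` K) a"
proof -
 note L = gxD(1)[OF G]
 obtain q p a where "rval (h ` L) (cval L P) q p" and a: "a:h ` ints L" "~ cvge L P 1 a"
  "ALL z:h ` L. cvge L P 0 z --> cvge L P 1 z \<or> (EX k. cvge L P 1 (z - a ^ k))"
  using cval_rval[OF L P] by auto
 then interpret V: rval "h ` L" "cval L P" q p by simp
 have "approx_rval (h ` L) (cval L P) q p (h ` K) a"
 proof
  show "cgalois (h ` K) (h ` L)" by (rule gxD[OF G])
  obtain a' where a': "a':ints L" "a = h a'" using a by auto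
  show "a:h ` L" "cvge L P 0 a" "~ cvge L P 1 a" using a' intsD[OF L] cvge_ints[OF L P] a by auto
  show "cvge L P 1 z \<or> (EX k. cvge L P 1 (z - a ^ k))" if "z:h ` L" "cvge L P 0 z" for z using a that by auto
  fix b N assume b: "b:h ` L" "cvge L P 0 b"
  then obtain b' where b': "b':L" "b = h b'" by auto
  let ?A = "pullback L P ` cgal (h ` L) (h ` K)"
  have A: "finite ?A" "?A <= primes R L" using gxD[OF G] pullback[OF G P] by auto
  obtain y where y: "y:ints L" "cvge L P (int N) (h y - h b')" "ALL T:?A - {P}. y:T"
  proof -
   have "cvge L P 0 (h b')" using b b' by simp
   from integer_approx[OF L P b'(1) this A, of N] show thesis using that by auto
  qed
  have "cvge L P 0 (t (h y)) & (cvge L P 1 (t (h y)) \<or> (ALL z:h ` L. z ~= 0 --> cval L P (t z) = cval L P z))"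
   if t: "t:cgal (h ` L) (h ` K)" for t
  proof
   show "cvge L P 0 (t (h y))" using ints_cgal[OF G t y(1)] cvge_ints[OF L P] by metis
   show "cvge L P 1 (t (h y)) \<or> (ALL z:h ` L. z ~= 0 --> cval L P (t z) = cval L P z)"
   proof (cases "pullback L P t = P")
    case True thus ?thesis using pullback[OF G P t] by simp
   next
    case False
    hence "y:pullback L P t" using y t by simp
    thus ?thesis by (simp add: pullback_def)
   qed
  qed
  thus "EX x:h ` L. cvge L P (int N) (x - b) & (ALL t:cgal (h ` L) (h ` K).
    cvge L P 0 (t x) & (cvge L P 1 (t x) \<or> (ALL z:h ` L. z ~= 0 --> cval L P (t z) = cval L P z)))"
   using y b' intsD[OF L y(1)] by blast
 qed
 thus ?thesis by auto
qed

lemma cram_ram: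
 assumes "approx_rval (h ` L) (cval L P) q p (h ` K) a"
 shows "galois_rval.ram (h ` L) (cval L P) (h ` K) j = cram K L P j"
  "galois_rval.idm (h ` L) = cidm L"
proof -
 interpret A: approx_rval "h ` L" "cval L P" q p "h ` K" a by (rule assms)
 show "A.ram j = cram K L P j" "A.idm = cidm L" by (simp_all add: A.ram_def cram_def A.idm_def cidm_def)
qed

text \<open>A nontrivial s moves some integer x, and every prime with s in its inertia group
  contains the nonzero element s x - x. Only finitely many primes do, and the group is
  finite.\<close>

lemma finite_inertia:
 assumes G: "gx K L"
 shows "finite {P:primes R L. cram K L P 0 ~= {cidm L}}"
proof -
 note L = gxD(1)[OF G]
 interpret D: dedekind "\<O> L" by (rule nf_dedekind[OF L])
 let ?G = "cgal (h ` L) (h ` K)"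
 have ex: "EX d:ints L. d ~= \<zero> & (ALL P:primes R L. s:cram K L P 0 --> d:P)" if s: "s:?G" "s ~= cidm L" for s
 proof -
  have "EX x:ints L. s (h x) ~= h x"
  proof (rule ccontr)
   assume no: "~ ?thesis"
   have "s z = cidm L z" if z: "z:h ` L" for z
   proof -
    obtain x where x: "x:L" "z = h x" using z by auto
    obtain a b where ab: "a:ints L" "b:ints L" "b ~= \<zero>" "a = b \<otimes> x" using fraction[OF L x(1)] by auto
    note I = intsD[OF L ab(1)] intsD[OF L ab(2)]
    show ?thesis using z no ab chomD(4)[OF cgalD(1)[OF s(1)] gxD(7)[OF G] I(8) z] h_simps(4)[OF I(6) F_closed(1)[OF L x(1)
     x(1)]] x h_simps(8)[OF I(6)] by (auto simp: cidm_def)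
   qed
   thus False using s cgal_id[OF gxD(7)[OF G] gxD(5)[OF G]] cgal_eqI unfolding cidm_def by simp
  qed
  then obtain x where x: "x:ints L" "s (h x) ~= h x" by auto
  obtain y where y: "y:ints L" "h y = s (h x)" using ints_cgal[OF G s(1) x(1)] by auto
  have d: "y \<ominus> x:ints L" and hd: "h (y \<ominus> x) = s (h x) - h x"
   using D.minus_closed[of y x] x y O_minus[OF L y(1) x(1)] h_simps(6)[OF intsD(2)[OF L y(1)] intsD(2)[OF L x(1)]] by auto
  have "y \<ominus> x ~= \<zero>" using hd x h_simps(2) by auto
  moreover have "y \<ominus> x:P" if P: "P:primes R L" "s:cram K L P 0" for P
  proof -
   show ?thesis using cvge_ints[OF L P(1) d] hd cramD(2)[OF P(2) intsD(4)[OF L x(1)] cvge_ints(2)[OF L P(1) x(1)]] by simp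
  qed
  ultimately show ?thesis using d by auto
 qed
 then obtain d where d: "!!s. s:?G ==> s ~= cidm L ==> d s:ints L & d s ~= \<zero> & (ALL P:primes R L. s:cram K L P 0 --> d s:P)"
  by metis
 have "finite {P:primes R L. d s:P}" if s: "s:?G" "s ~= cidm L" for s
 proof -
  have ds: "d s:carrier (\<O> L)" "d s ~= \<zero>\<^bsub>\<O> L\<^esub>" using d[OF s] by auto
  have "{P:primes R L. d s:P} <= {P:maxs (\<O> L). 0 < ival (\<O> L) P (PIdl\<^bsub>\<O> L\<^esub> d s)}"
  proof
   fix P assume "P:{P:primes R L. d s:P}"
   hence P: "P:primes R L" "d s:P" by auto
   hence P': "P:maxs (\<O> L)" by (simp add: primes_maxs)
   show "P:{P:maxs (\<O> L). 0 < ival (\<O> L) P (PIdl\<^bsub>\<O> L\<^esub> d s)}"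
    using D.ival_pos[OF P' D.PIdl_nz[OF ds]] P' D.cgenideal_minimal[OF prime_facts(5)[OF L P(1)] P(2)] by auto
  qed
  thus ?thesis using D.finite_ival_pos[OF D.PIdl_nz[OF ds]] by (rule finite_subset)
 qed
 hence "finite (\<Union>s\<in>?G - {cidm L}. {P:primes R L. d s:P})" using gxD[OF G] by auto
 moreover have "{P:primes R L. cram K L P 0 ~= {cidm L}} <= (\<Union>s\<in>?G - {cidm L}. {P:primes R L. d s:P})"
 proof
  fix P assume "P:{P:primes R L. cram K L P 0 ~= {cidm L}}"
  hence P: "P:primes R L" "cram K L P 0 ~= {cidm L}" by auto
  obtain q p a where a: "approx_rval (h ` L) (cval L P) q p (h ` K) a" using galois_approx[OF G P(1)] by auto
  interpret A: approx_rval "h ` L" "cval L P" q p "h ` K" a by (rule a)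
  obtain s where s: "s:cram K L P 0" "s ~= cidm L" using P A.idm cram_ram[OF a] by auto
  have sg: "s:?G" using s by (simp add: cram_def)
  thus "P:(\<Union>s\<in>?G - {cidm L}. {P:primes R L. d s:P})" using P s d[OF sg s(2)] s by auto
 qed
 ultimately show ?thesis using finite_subset by simp
qed

end

lemma csub_fixed:
 assumes L: "csub L" and N: "!!t. t:N ==> chom L t"
 shows "csub {z:L. ALL t:N. t z = z}"
proof -
 note c = chomD(1,4,6,8)[OF N L]
 have "t (x - y) = x - y" "t (x * y) = x * y" "t (inverse x) = inverse x"
  if "t:N" "x:L" "y:L" "t x = x" "t y = y" for t x y
  using c[OF that(1)] that by auto
 thus ?thesis unfolding csub_def using csubD[OF L] c(1) by simp
qed

section \<open>Inertia groups and unramified subextensions\<close>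

context algnum
begin

definition ctriv :: "'a set => 'a set => 'a set => nat => bool" where
 "ctriv K L P n <->
  (ALL j. cram K L P j ~= {cidm L} --> (\<Sum>i=1..j. card (cram K L P i)) < n * card (cram K L P 0))"

lemma cram_facts:
 assumes G: "gx K L" and P: "P:primes R L"
 shows "finite (cram K L P j)" "cidm L:cram K L P j" "i <= j ==> cram K L P j <= cram K L P i"
  "EX j. cram K L P j = {cidm L}"
proof -
 obtain q p a where a: "approx_rval (h ` L) (cval L P) q p (h ` K) a" using galois_approx[OF G P] by blast
 interpret A: approx_rval "h ` L" "cval L P" q p "h ` K" a by (rule a)
 note r = cram_ram[OF a]
 show "finite (cram K L P j)" "cidm L:cram K L P j" "i <= j ==> cram K L P j <= cram K L P i"
  using A.finite_ram A.idm A.ram_anti r by auto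
 \<comment> \<open>At least i(s) for every inertia element s, so that only the identity remains in
   the j-th group.\<close>
 define j where "j = nat (\<Sum>s\<in>A.ram 0. \<bar>A.ii s\<bar>)"
 have "s = A.idm" if "s:A.ram j" for s
 proof (rule ccontr)
  assume n: "s ~= A.idm"
  hence s: "s:A.ram 0" "int j + 1 <= A.ii s" using that A.ram_iff[of s j] by auto
  have "\<bar>A.ii s\<bar> <= (\<Sum>s\<in>A.ram 0. \<bar>A.ii s\<bar>)" using s A.finite_ram by (intro member_le_sum) auto
  thus False using s by (simp add: j_def)
 qed
 hence "A.ram j = {A.idm}" using A.idm by blast
 thus "EX j. cram K L P j = {cidm L}" using r by auto
qed

lemma val_ext_instance:
 assumes G': "gx K L'" and G: "gx K L" and sub: "L <= L'" and P: "P:primes R L'"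
 shows "EX q p q' p' e a a'. val_ext_special (h ` L) (cval L (P Int ints L)) q p (h ` K) (h ` L') (cval L' P) q' p' e &
  approx_rval (h ` L) (cval L (P Int ints L)) q p (h ` K) a & approx_rval (h ` L') (cval L' P) q' p' (h ` K) a'"
proof -
 have sL: "subfield L R" using nf_sub(1)[OF gxD(1)[OF G]] .
 let ?P = "P Int ints L"
 have P0: "?P:primes R L" by (rule contraction[OF gxD(1)[OF G'] P sL sub])
 obtain q p a where a: "approx_rval (h ` L) (cval L ?P) q p (h ` K) a" using galois_approx[OF G P0] by auto
 obtain q' p' a' where a': "approx_rval (h ` L') (cval L' P) q' p' (h ` K) a'" using galois_approx[OF G' P] by auto
 interpret A: approx_rval "h ` L" "cval L ?P" q p "h ` K" a by (rule a)
 interpret B: approx_rval "h ` L'" "cval L' P" q' p' "h ` K" a' by (rule a')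
 obtain e where e: "e > 0" "ALL z:h ` L. z ~= 0 --> cval L' P z = int e * cval L ?P z"
  using cval_restrict[OF gxD(1)[OF G'] P sL sub] by auto
 have "val_ext_special (h ` L) (cval L ?P) q p (h ` K) (h ` L') (cval L' P) q' p' e"
 proof unfold_locales
  show s: "h ` L <= h ` L'" using sub by auto
  show "cgalois (h ` L) (h ` L')"
   using galois_intermediate[OF gxD(6)[OF G'] subfield_image(2)[OF nf_sub(1)[OF gxD(1)[OF G']]] gxD(7)[OF G] gxD(5)[OF G] s] .
  show "0 < e" by (rule e)
  show "cval L' P x = int e * cval L ?P x" if "x:h ` L" "x ~= 0" for x using bspec[OF e(2) that(1)] that by simp
  show "EX x:h ` L'. (ALL t:cgal (h ` L') (h ` K). B.vge 0 (t x) & (t ~: B.ram 0 --> x ~= t x & cval L' P (x - t x) = 0)) &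
    (ALL t:B.ram 0 - {B.idm}. x ~= t x & cval L' P (x - t x) = B.ii t)" by (rule B.special_element)
 qed
 thus ?thesis using a a' by blast
qed

lemma ctriv_iff_triv:
 assumes "approx_rval (h ` L) (cval L P) q p (h ` K) a"
 shows "galois_rval.triv (h ` L) (cval L P) (h ` K) n <-> ctriv K L P n"
proof -
 interpret A: approx_rval "h ` L" "cval L P" q p "h ` K" a by (rule assms)
 show ?thesis unfolding A.triv_def ctriv_def cram_ram[OF assms] ..
qed

lemma cram_ext:
 assumes G': "gx K L'" and G: "gx K L" and sub: "L <= L'" and P: "P:primes R L'"
 shows "ctriv K L' P n ==> ctriv K L (P Int ints L) n"
  "r:cram K L (P Int ints L) 0 ==> EX t:cram K L' P 0. ALL y:h ` L. t y = r y"
proof -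
 obtain q p q' p' e a a' where
  v: "val_ext_special (h ` L) (cval L (P Int ints L)) q p (h ` K) (h ` L') (cval L' P) q' p' e" and
  a: "approx_rval (h ` L) (cval L (P Int ints L)) q p (h ` K) a" and a': "approx_rval (h ` L') (cval L' P) q' p' (h ` K) a'"
  using val_ext_instance[OF assms] by auto
 interpret V: val_ext_special "h ` L" "cval L (P Int ints L)" q p "h ` K" "h ` L'" "cval L' P" q' p' e by (rule v)
 show "ctriv K L' P n ==> ctriv K L (P Int ints L) n" using V.triv_ext ctriv_iff_triv[OF a] ctriv_iff_triv[OF a'] by simp
 assume "r:cram K L (P Int ints L) 0"
 thus "EX t:cram K L' P 0. ALL y:h ` L. t y = r y" using cram_ram[OF a'] V.inertia_lift[of r] cram_ram[OF a]
  by (auto simp: V.fib_def)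
qed

text \<open>Conjugation by \<open>s\<close> injects one ramification group into another. With
  transitivity the orders become equal, so all Herbrand data depend only on the prime of
  \<open>K\<close>.\<close>

lemma card_cram_le:
 assumes G: "gx K L" and P: "P:primes R L" and s: "s:cgal (h ` L) (h ` K)"
 shows "card (cram K L P j) <= card (cram K L (pullback L P s) j)"
proof -
 have "ALL t:cram K L P j. EX u. u:cram K L (pullback L P s) j & (ALL x:h ` L. s (u x) = t (s x))"
  using cram_conj[OF G P s] by blast
 from bchoice[OF this] obtain f
  where f: "!!t. t:cram K L P j ==> f t:cram K L (pullback L P s) j & (ALL x:h ` L. s (f t x) = t (s x))"
  by auto
 have "inj_on f (cram K L P j)"
 proof (rule inj_onI)
  fix t u assume tu: "t:cram K L P j" "u:cram K L P j" "f t = f u"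
  have "t x = u x" if x: "x:h ` L" for x
  proof -
   obtain y where y: "y:h ` L" "x = s y" using cgalD(2)[OF s] x by auto
   show ?thesis using tu y f[OF tu(1)] f[OF tu(2)] y by auto
  qed
  thus "t = u" using cramD[OF tu(1)] cramD[OF tu(2)] by (intro cgal_eqI)
 qed
 moreover have "f ` cram K L P j <= cram K L (pullback L P s) j" using f by auto
 ultimately show ?thesis using cram_facts(1)[OF G pullback(1)[OF G P s]] card_inj_on_le by blast
qed

lemma card_cram_eq:
 assumes G: "gx K L" and P: "P:primes R L" and Q: "Q:primes R L" and eq: "P Int ints K = Q Int ints K"
 shows "card (cram K L P j) = card (cram K L Q j)"
proof -
 obtain s where s: "s:cgal (h ` L) (h ` K)" "pullback L P s = Q" using pullback_transitive[OF G P Q eq] by auto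
 obtain t where t: "t:cgal (h ` L) (h ` K)" "pullback L Q t = P" using pullback_transitive[OF G Q P eq[symmetric]] by auto
 show ?thesis using card_cram_le[OF G P s(1), of j] card_cram_le[OF G Q t(1), of j] s t by simp
qed

lemma cram_trivial_iff:
 assumes G: "gx K L" and P: "P:primes R L"
 shows "cram K L P j = {cidm L} <-> card (cram K L P j) = 1"
 using cram_facts(2)[OF G P, of j] by (auto simp: card_1_singleton_iff)

lemma ctriv_eq:
 assumes G: "gx K L" and P: "P:primes R L" and Q: "Q:primes R L" and eq: "P Int ints K = Q Int ints K"
 shows "ctriv K L P n <-> ctriv K L Q n"
 unfolding ctriv_def cram_trivial_iff[OF G P] cram_trivial_iff[OF G Q] card_cram_eq[OF G P Q eq] ..

text \<open>\<open>N\<close> need only be a set stable under conjugation: then the whole Galois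
  group maps its fixed field into itself.\<close>

lemma fixed_galois:
 assumes G: "gx K M" and N: "N <= cgal (h ` M) (h ` K)"
  and conj: "!!s t. s:cgal (h ` M) (h ` K) ==> t:N ==> EX u:N. ALL x:h ` M. s (u x) = t (s x)"
 shows "gx K {x:M. ALL t:N. t (h x) = h x}"
proof -
 let ?F = "{x:M. ALL t:N. t (h x) = h x}"
 let ?M = "h ` M" and ?K = "h ` K"
 define Z where "Z = {z:?M. ALL t:N. t z = z}"
 have hF: "h ` ?F = Z" by (auto simp: Z_def)
 have ND: "chom ?M t" "!!x. x:?K ==> t x = x" if "t:N" for t using cgalD N that by auto
 note M' = csubD[OF gxD(7)[OF G]]
 have Zs: "csub Z"
  unfolding Z_def by (rule csub_fixed[OF gxD(7)[OF G] ND(1)])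
 have ME: "?M <= E" using subfield_image(2)[OF nf_sub(1)[OF gxD(1)[OF G]]] .
 have ZM: "Z <= ?M" and KZ: "?K <= Z" using ND gxD[OF G] by (auto simp: Z_def)+
 have FR: "x:carrier R" if "x:?F" for x using that nf_sub(2)[OF gxD(1)[OF G]] by auto
 have "phi ` h ` ?F = (%x. x) ` ?F" unfolding image_image using h(2)[OF FR] by simp
 hence sF: "subfield ?F R" using subfield_image'(1)[OF Zs subset_trans[OF ZM ME]] unfolding hF by simp
 have stab: "s z:Z" if s: "s:cgal ?M ?K" and z: "z:Z" for s z
 proof -
  have "t (s z) = s z" if t: "t:N" for t
  proof -
   obtain u where u: "u:N" "ALL x:?M. s (u x) = t (s x)" using conj[OF s t] by auto
   have "t (s z) = s (u z)" using u z ZM by auto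
   moreover have "u z = z" using z u unfolding Z_def by simp
   ultimately show ?thesis by simp
  qed
  thus ?thesis using cgalD[OF s] z by (simp add: Z_def)
 qed
 have restr: "restrict s Z:cgal Z ?K" if s: "s:cgal ?M ?K" for s
 proof (rule cgal_restrictI[OF Zs _ _ _ KZ])
  show "chom Z s" using cgalD(1)[OF s] ZM unfolding chom_def by blast
  show "s x = x" if "x:?K" for x using cgalD(3)[OF s that] .
  obtain r where r: "r:cgal ?M ?K" "ALL x:?M. s (r x) = x & r (s x) = x"
   using cgal_inverse[OF gxD(7)[OF G] gxD(5)[OF G] s] by auto
  show "s ` Z = Z"
  proof
   show "s ` Z <= Z" using stab[OF s] by auto
   show "Z <= s ` Z"
   proof
    fix z assume z: "z:Z"
    hence "z = s (r z)" using r ZM by auto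
    thus "z:s ` Z" using stab[OF r(1) z] by simp
   qed
  qed
 qed
 have "cgalois ?K Z" unfolding cgalois_def
 proof (intro conjI ballI impI)
  show "finite (cgal Z ?K)"
  proof (rule finite_subset)
   show "cgal Z ?K <= (%s. restrict s Z) ` cgal ?M ?K"
   proof
    fix t assume t: "t:cgal Z ?K"
    obtain s where s: "s:cgal ?M ?K" "ALL x:Z. t x = s x"
     using galois_lift[OF gxD(6)[OF G] Zs KZ ZM cgalD(1)[OF t]] cgalD[OF t] by auto
    have "t = restrict s Z" by (rule cgal_eqI[OF t restr[OF s(1)]]) (use s in simp)
    thus "t:(%s. restrict s Z) ` cgal ?M ?K" using s by simp
   qed
   show "finite ((%s. restrict s Z) ` cgal ?M ?K)" using gxD[OF G] by simp
  qed
  fix z assume z: "z:Z" "ALL s:cgal Z ?K. s z = z"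
  have "s z = z" if "s:cgal ?M ?K" for s using bspec[OF z(2) restr[OF that]] z by simp
  thus "z:?K"
   by (rule gxD(6)[OF G, unfolded cgalois_def, THEN conjunct2, THEN conjunct2, THEN conjunct2, THEN conjunct2, rule_format, OF
    subsetD[OF ZM z(1)]])
 qed (use gxD(8)[OF G] Zs KZ in auto)
 moreover have "K <= ?F" using ND gxD[OF G] by auto
 moreover have "nf ?F" using nf_mono[OF gxD(1)[OF G] sF] by simp
 ultimately show ?thesis unfolding gx_def using hF gxD[OF G] by simp
qed

lemma primes_over_eq: "primes_over R K L p = {P:primes R L. P Int ints K = p}"
 by (simp add: primes_over_def)

text \<open>Forwards, a uniformiser of \<open>K\<close> at \<open>p\<close> remains one in
  \<open>F\<close>, and \<open>inertia_fixes\<close> applies. Backwards, \<open>F\<close> lies in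
  the common fixed field \<open>M'\<close> of the inertia groups. Since inertia lifts,
  \<open>M'\<close> has trivial inertia over \<open>p\<close>, so \<open>K\<close> contains an
  element of valuation 1 in \<open>M'\<close>, which forces index 1 in \<open>F\<close>.\<close>

lemma unramified_iff:
 assumes G: "gx K M" and F: "subfield F R" "K <= F" "F <= M" and p: "p:primes R K"
 shows "unramified_at R K F p <-> (ALL P:primes_over R K M p. ALL s:cram K M P 0. ALL x:h ` F. s x = x)"
proof -
 note nM = gxD(1)[OF G] and nK = gxD(2)[OF G] and sK = gxD(3)[OF G]
 note nF = nf_mono[OF nM F(1,3)]
 obtain z where z: "z:h ` K" "z ~= 0" "cval K p z = 1"
 proof -
  obtain q z a where "rval (h ` K) (cval K p) q z" using cval_rval[OF nK p] by auto
  then interpret V: rval "h ` K" "cval K p" q z .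
  show thesis using that V.pi by simp
 qed
 have zF: "z:h ` F" using z F by auto
 have eFK: "ideal_val R F Q (Idl\<^bsub>\<O> F\<^esub> p) = 1 <-> cval F Q z = 1" if Q: "Q:primes_over R K F p" for Q
 proof -
  have Q': "Q:primes R F" "Q Int ints K = p" using Q by (auto simp: primes_over_eq)
  obtain e where e: "e > 0" "ALL z:h ` K. z ~= 0 --> cval F Q z = int e * cval K p z"
   using cval_restrict[OF nF Q'(1) sK F(2)] Q' by auto
  have "cval F Q z = int e" using bspec[OF e(2) z(1)] z by simp
  moreover have "ideal_val R F Q (Idl\<^bsub>\<O> F\<^esub> p) = e"
   using ideal_val_Idl[OF nF Q'(1) sK F(2)] e Q' by auto
  ultimately show ?thesis by simp
 qed
 show ?thesis
 proof
  assume u: "unramified_at R K F p"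
  show "ALL P:primes_over R K M p. ALL s:cram K M P 0. ALL x:h ` F. s x = x"
  proof (intro ballI)
   fix P s x assume P: "P:primes_over R K M p" and s: "s:cram K M P 0" and x: "x:h ` F"
   have P': "P:primes R M" "P Int ints K = p" using P by (auto simp: primes_over_eq)
   let ?Q = "P Int ints F"
   have Q: "?Q:primes R F" by (rule contraction[OF nM P'(1) F(1,3)])
   have Qo: "?Q:primes_over R K F p" using Q P' ints_mono[OF F(2)] by (auto simp: primes_over_eq)
   have zQ: "cval F ?Q z = 1" using u eFK[OF Qo] Qo by (auto simp: unramified_at_def)
   obtain e where e: "e > 0" "ALL z:h ` F. z ~= 0 --> cval M P z = int e * cval F ?Q z"
    using cval_restrict[OF nM P'(1) F(1,3)] by auto
   obtain q w a where a: "approx_rval (h ` M) (cval M P) q w (h ` K) a" using galois_approx[OF G P'(1)] by auto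
   interpret A: approx_rval "h ` M" "cval M P" q w "h ` K" a by (rule a)
   interpret B: dval "h ` F" "cval F ?Q" by (rule cval_dval[OF nF Q])
   show "s x = x"
   proof (rule A.inertia_fixes[OF nf_sub(3)[OF nF] _ z(1) zF _ _ _ x z(2)])
    show "h ` F <= h ` M" "A.vge 1 z" "s:A.ram 0" using F e bspec[OF e(2) zF] zQ s cram_ram[OF a] by (auto simp: A.vge_def)
    fix y assume y: "y:h ` F" "A.vge 1 y"
    show "A.vge 0 (y / z)"
    proof (cases "y = 0")
     case False
     have "1 <= int e * cval F ?Q y" using y False bspec[OF e(2) y(1)] by (simp add: A.vge_def)
     hence "1 <= cval F ?Q y" using e by (smt (verit) of_nat_0_less_iff mult_le_0_iff)
     moreover have "cval F ?Q (y / z) = cval F ?Q y - 1"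
      using B.vmult B.v_inverse[OF zF z(2)] y False zF z zQ B.L'(7) by (simp add: divide_inverse)
     ultimately show ?thesis using bspec[OF e(2) B.L'(8)[OF y(1) zF]] False z by (simp add: A.vge_def)
    qed simp
   qed
  qed
 next
  assume fixd: "ALL P:primes_over R K M p. ALL s:cram K M P 0. ALL x:h ` F. s x = x"
  define N where "N = (\<Union>P\<in>primes_over R K M p. cram K M P 0)"
  define M' where "M' = {x:M. ALL t:N. t (h x) = h x}"
  have G': "gx K M'" unfolding M'_def
  proof (rule fixed_galois[OF G])
   show "N <= cgal (h ` M) (h ` K)" using cramD by (auto simp: N_def)
   fix s t assume s: "s:cgal (h ` M) (h ` K)" and "t:N"
   then obtain P where P: "P:primes R M" "P Int ints K = p" "t:cram K M P 0" by (auto simp: N_def primes_over_eq)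
   show "EX u:N. ALL x:h ` M. s (u x) = t (s x)" using cram_conj[OF G P(1) s P(3)] pullback[OF G P(1) s] P
    by (auto simp: N_def primes_over_eq)
  qed
  have M'M: "M' <= M" and FM': "F <= M'" using fixd F by (auto simp: M'_def N_def)
  show "unramified_at R K F p" unfolding unramified_at_def
  proof
   fix Q assume Q: "Q:primes_over R K F p"
   hence Q': "Q:primes R F" "Q Int ints K = p" by (auto simp: primes_over_eq)
   obtain P where P: "P:primes R M" "P Int ints F = Q" using lying_over[OF nM F(1,3) Q'(1)] by auto
   let ?P = "P Int ints M'"
   have P': "?P:primes R M'" by (rule contraction[OF nM P(1) nf_sub(1)[OF gxD(1)[OF G']] M'M])
   have PQ: "?P Int ints F = Q" using P ints_mono[OF FM'] by auto
   obtain q w a where a: "approx_rval (h ` M') (cval M' ?P) q w (h ` K) a" using galois_approx[OF G' P'] by auto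
   interpret A: approx_rval "h ` M'" "cval M' ?P" q w "h ` K" a by (rule a)
   have triv: "A.ram 0 = {A.idm}"
   proof -
    have "r = A.idm" if r: "r:A.ram 0" for r
    proof -
     have r': "r:cram K M' ?P 0" using r cram_ram[OF a] by simp
     obtain t where t: "t:cram K M P 0" "ALL y:h ` M'. t y = r y" using cram_ext(2)[OF G G' M'M P(1) r'] by auto
     have "t:N" using t P P Q' ints_mono[OF F(2)] by (auto simp: N_def primes_over_eq)
     have "r y = y" if y: "y:h ` M'" for y
     proof -
      show ?thesis using bspec[OF t(2) y] y \<open>t:N\<close> unfolding M'_def by auto
     qed
     thus ?thesis using A.idm A.ramD[OF r] by (intro cgal_eqI[of _ "h ` M'" "h ` K"]) auto
    qed
    thus ?thesis using A.idm by blast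
   qed
   obtain y where y: "y:h ` K" "y ~= 0" "cval M' ?P y = 1" using A.trivial_inertia_uniformizer[OF triv] by auto
   obtain e1 where e1: "e1 > 0" "ALL z:h ` F. z ~= 0 --> cval M' ?P z = int e1 * cval F Q z"
    using cval_restrict[OF gxD(1)[OF G'] P' F(1) FM'] PQ by auto
   obtain e2 where e2: "e2 > 0" "ALL z:h ` K. z ~= 0 --> cval F Q z = int e2 * cval K p z"
    using cval_restrict[OF nF Q'(1) sK F(2)] Q' by auto
   have yF: "y:h ` F" using y F by auto
   show "ideal_val R F Q (Idl\<^bsub>\<O> F\<^esub> p) = 1"
    using eFK[OF Q] bspec[OF e2(2) z(1)] z zmult_eq_1_iff y bspec[OF e1(2) yF] bspec[OF e2(2) y(1)] by simp
  qed
 qed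
qed

end

section \<open>Completions and the Herbrand function\<close>

lemma step_function_integral:
 fixes g :: "nat => nat"
 defines "f == %t::real. real (g (nat \<lceil>t\<rceil>)) / real (g 0)"
 assumes g: "!!i. 1 <= g i"
 shows "(f has_integral ((\<Sum>i=1..n. real (g i)) / real (g 0))) {0..real n}"
  "0 <= a ==> a <= b ==> f integrable_on {a..b}"
  "0 <= a ==> a <= b ==> integral {0..a} f + (b - a) / real (g 0) <= integral {0..b} f"
proof -
 \<comment> \<open>At the left endpoint the ceiling is n instead of n + 1; a single point does not
   affect the integral.\<close>
 have unit: "(f has_integral (real (g (Suc n)) / real (g 0))) {real n..real (Suc n)}" for n
 proof (rule has_integral_spike_finite[of "{real n}"])
  show "((%t. real (g (Suc n)) / real (g 0)) has_integral (real (g (Suc n)) / real (g 0))) {real n..real (Suc n)}"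
   using has_integral_const_real[of "real (g (Suc n)) / real (g 0)" "real n" "real (Suc n)"] by simp
  fix t assume t: "t:{real n..real (Suc n)} - {real n}"
  hence "\<lceil>t\<rceil> = int (Suc n)" by (intro ceiling_unique) auto
  hence "nat \<lceil>t\<rceil> = Suc n" by simp
  thus "f t = real (g (Suc n)) / real (g 0)" unfolding f_def by simp
 qed simp
 show 1: "(f has_integral ((\<Sum>i=1..n. real (g i)) / real (g 0))) {0..real n}" for n
 proof (induction n)
  case (Suc n)
  show ?case using has_integral_combine[OF _ _ Suc.IH unit[of n]] by (simp add: add_divide_distrib)
 qed (simp add: has_integral_refl)
 show int: "f integrable_on {a..b}" if ab: "0 <= a" "a <= b" for a b
 proof (rule integrable_on_subinterval)
  show "f integrable_on {0..real (nat \<lceil>b\<rceil>)}" using 1 by auto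
  show "{a..b} <= {0..real (nat \<lceil>b\<rceil>)}" using ab by auto
 qed
 show "integral {0..a} f + (b - a) / real (g 0) <= integral {0..b} f" if ab: "0 <= a" "a <= b"
 proof -
  have "integral {a..b} (%_. 1 / real (g 0)) <= integral {a..b} f"
   using g by (intro integral_le int ab integrable_const_ivl) (auto simp: f_def intro!: divide_right_mono)
  moreover have "integral {0..a} f + integral {a..b} f = integral {0..b} f"
   using ab int by (intro Henstock_Kurzweil_Integration.integral_combine) auto
  ultimately show ?thesis using ab by simp
 qed
qed

text \<open>The integral grows with slope at least 1/g(0), so it takes the value v exactly once, and
  the ceiling of that argument is at most j iff v is at most the value at j. Statements about the
  Herbrand functions thereby become counts.\<close>

lemma herbrand_inverse:
 fixes g :: "nat => nat" and v :: real
 defines "F == %u::real. integral {0..u} (%t::real. real (g (nat \<lceil>t\<rceil>)) / real (g 0))"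
 assumes g: "!!i. 1 <= g i" and v: "0 <= v"
 shows "nat \<lceil>THE u. 0 <= u & F u = v\<rceil> <= j <-> v * real (g 0) <= real (\<Sum>i=1..j. g i)"
proof -
 have g0: "0 < real (g 0)" using g[of 0] by simp
 have F: "F (real n) = (\<Sum>i=1..n. real (g i)) / real (g 0)" for n
  unfolding F_def using step_function_integral(1)[OF g] by (rule integral_unique)
 have inc: "F a + (b - a) / real (g 0) <= F b" if "0 <= a" "a <= b" for a b
  unfolding F_def using step_function_integral(3)[OF g that] .
 have strict: "F a < F b" if "0 <= a" "a < b" for a b
 proof -
  have "0 < (b - a) / real (g 0)" using that g0 by simp
  thus ?thesis using inc[of a b] that by simp
 qed
 have F0: "F 0 = 0" using F[of 0] by simp
 have "EX u. 0 <= u & u <= v * real (g 0) & F u = v"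
 proof (rule IVT')
  show "F 0 <= v" "0 <= v * real (g 0)" "v <= F (v * real (g 0))" using v F0 inc[of 0 "v * real (g 0)"] g0 by auto
  show "continuous_on {0..v * real (g 0)} F" unfolding F_def using v
   by (intro indefinite_integral_continuous_1 step_function_integral(2)[OF g]) auto
 qed
 then obtain u where u: "0 <= u" "F u = v" by auto
 have "(THE u. 0 <= u & F u = v) = u"
 proof (rule the_equality)
  fix w assume "0 <= w & F w = v"
  thus "w = u" using strict[of u w] strict[of w u] u by (cases w u rule: linorder_cases) auto
 qed (use u in simp)
 moreover have "nat \<lceil>u\<rceil> <= j <-> u <= real j" by simp
 moreover have "u <= real j <-> F u <= F (real j)" using strict[of u "real j"] strict[of "real j" u] u
  by (cases u "real j" rule: linorder_cases) auto
 moreover have "\<dots> <-> v * real (g 0) <= real (\<Sum>i=1..j. g i)" using u F g0 by (simp add: pos_le_divide_eq)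
 ultimately show ?thesis by simp
qed

section \<open>Completions as classes of Cauchy sequences\<close>

locale complet = algnum +
 fixes K L P assumes G: "gx K L" and P: "P:primes R L"
begin

lemmas nL = gxD(1)[OF G]

sublocale V: dval "h ` L" "cval L P" by (rule cval_dval[OF gxD(1)[OF G] P])

abbreviation "CR == cauchy_ring R L P"
abbreviation "NS == null_sequences R L P"
abbreviation "C == completion R L P"
abbreviation "emb == completion_embed R L P"
abbreviation "cl s == NS +>\<^bsub>CR\<^esub> s"
abbreviation "cv == cvge L P"
abbreviation "CG m == completion_val_ge R L P m"

lemma Lh: "x:L ==> x:carrier R" "x:L ==> h x:h ` L"
 "x:L ==> y:L ==> x \<oplus> y:L & h (x \<oplus> y) = h x + h y"
 "x:L ==> y:L ==> x \<otimes> y:L & h (x \<otimes> y) = h x * h y"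
 "x:L ==> y:L ==> x \<ominus> y:L & h (x \<ominus> y) = h x - h y"
 "\<one>:L & h \<one> = 1" "\<zero>:L & h \<zero> = 0" "x:L ==> \<ominus> x:L & h (\<ominus> x) = - h x"
 "x:L ==> val_ge R L P m x <-> cv m (h x)"
proof -
 obtain z where "z:L" using csubD[OF V.L] by auto
 thus "\<one>:L & h \<one> = 1" "\<zero>:L & h \<zero> = 0" using F_closed[OF nL] h_simps by auto
qed (use F_closed[OF nL] h_simps val_ge_cvge[OF nL P] in auto)

lemma CR_ops:
 "s \<otimes>\<^bsub>CR\<^esub> t = (%n. s n \<otimes> t n)" "s \<oplus>\<^bsub>CR\<^esub> t = (%n. s n \<oplus> t n)"
  "\<one>\<^bsub>CR\<^esub> = (%n. \<one>)" "\<zero>\<^bsub>CR\<^esub> = (%n. \<zero>)"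
 by (simp_all add: cauchy_ring_def)

lemma Cau: "s:carrier CR <-> (ALL n. s n:L) & (ALL m. EX N. ALL i>=N. ALL j>=N. cv m (h (s i) - h (s j)))"
proof -
 have "val_ge R L P m (s i \<ominus> s j) <-> cv m (h (s i) - h (s j))" if "ALL n. s n:L" for m i j
  using Lh Lh that by simp
 thus ?thesis by (auto simp: cauchy_ring_def image_subset_iff)
qed

lemma Nul: "s:NS <-> (ALL n. s n:L) & (ALL m. EX N. ALL i>=N. cv m (h (s i)))"
 using Lh by (auto simp: null_sequences_def image_subset_iff)

lemma CauD: "s:carrier CR ==> s n:L" "s:carrier CR ==> s n:carrier R" "s:carrier CR ==> h (s n):h ` L"
 using Cau Lh by auto

lemma bounded_below: assumes "s:carrier CR" shows "EX b N. b <= 0 & (ALL i>=N. cv b (h (s i)))"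
proof -
 obtain N where N: "ALL i>=N. ALL j>=N. cv 0 (h (s i) - h (s j))" using assms Cau by blast
 define b where "b = min 0 (cval L P (h (s N)))"
 have "cv b (h (s i))" if "i >= N" for i
 proof -
  have "cv 0 (h (s i) - h (s N))" using N that by simp
  hence "cv b (h (s i) - h (s N))" by (rule V.vge_mono) (simp add: b_def)
  moreover have "cv b (h (s N))" by (auto simp: b_def V.vge_def)
  ultimately have "cv b (h (s N) + (h (s i) - h (s N)))" using CauD[OF assms] V.L'(5) by (intro V.vge_add) auto
  thus ?thesis by simp
 qed
 thus ?thesis by (intro exI[of _ b] exI[of _ N]) (simp add: b_def)
qed

lemma Cau_closed:
 assumes s: "s:carrier CR" and t: "t:carrier CR"
 shows "(%n. s n \<oplus> t n):carrier CR" "(%n. s n \<otimes> t n):carrier CR" "x:L ==> (%n. x):carrier CR"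
  "(%n. \<ominus> s n):carrier CR"
proof -
 note S = CauD[OF s] and T = CauD[OF t]
 show "(%n. s n \<oplus> t n):carrier CR" unfolding Cau
 proof (intro conjI allI)
  fix m
  obtain N M where NM: "ALL i>=N. ALL j>=N. cv m (h (s i) - h (s j))" "ALL i>=M. ALL j>=M. cv m (h (t i) - h (t j))"
   using s t Cau by meson
  have "cv m (h (s i \<oplus> t i) - h (s j \<oplus> t j))" if ij: "i >= max N M" "j >= max N M" for i j
  proof -
   have "cv m ((h (s i) - h (s j)) + (h (t i) - h (t j)))" using NM ij S T V.L'(5) by (intro V.vge_add) auto
   thus ?thesis using Lh S T by (simp add: algebra_simps)
  qed
  thus "EX N. ALL i>=N. ALL j>=N. cv m (h (s i \<oplus> t i) - h (s j \<oplus> t j))" by blast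
 qed (use Lh(3) S T in simp)
 show "(%n. s n \<otimes> t n):carrier CR" unfolding Cau
 proof (intro conjI allI)
  fix m
  obtain b B where b: "ALL i>=B. cv b (h (s i))" using bounded_below[OF s] by auto
  obtain c D where c: "ALL i>=D. cv c (h (t i))" using bounded_below[OF t] by auto
  obtain N M where NM: "ALL i>=N. ALL j>=N. cv (m - c) (h (s i) - h (s j))" "ALL i>=M. ALL j>=M. cv (m - b) (h (t i) - h (t j))"
   using s t Cau by meson
  have "cv m (h (s i \<otimes> t i) - h (s j \<otimes> t j))" if ij: "i >= N + M + B + D" "j >= N + M + B + D" for i j
  proof -
   have "cv (b + (m - b)) (h (s i) * (h (t i) - h (t j)))" using b NM ij S T V.L'(5) by (intro V.vge_mult) auto
   moreover have "cv ((m - c) + c) ((h (s i) - h (s j)) * h (t j))" using c NM ij S T V.L'(5) by (intro V.vge_mult) auto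
   ultimately have "cv m (h (s i) * (h (t i) - h (t j)) + (h (s i) - h (s j)) * h (t j))"
    using S T V.L'(5,6) by (intro V.vge_add) auto
   thus ?thesis using Lh S T by (simp add: algebra_simps)
  qed
  thus "EX N. ALL i>=N. ALL j>=N. cv m (h (s i \<otimes> t i) - h (s j \<otimes> t j))" by auto
 qed (use Lh(4) S T in simp)
 show "(%n. x):carrier CR" if "x:L" using that unfolding Cau by simp
 show "(%n. \<ominus> s n):carrier CR" unfolding Cau
 proof (intro conjI allI)
  fix m
  obtain N where N: "ALL i>=N. ALL j>=N. cv m (h (s i) - h (s j))" using s Cau by blast
  show "EX N. ALL i>=N. ALL j>=N. cv m (h (\<ominus> s i) - h (\<ominus> s j))" using N Lh S by auto
 qed (use Lh(8) S in simp)
qed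

sublocale CR: cring CR
proof (rule cringI)
 show "abelian_group CR"
 proof (rule abelian_groupI, unfold CR_ops)
  show "(%n. \<zero>):carrier CR" using Cau Lh(7) by simp
  fix s assume s: "s:carrier CR"
  show "(%n. \<zero> \<oplus> s n) = s" using CauD(2)[OF s] by simp
  show "EX t:carrier CR. (%n. t n \<oplus> s n) = (%n. \<zero>)"
   using Cau_closed(4)[OF s s] CauD(2)[OF s] by (intro bexI[of _ "%n. \<ominus> s n"]) (auto simp: l_neg)
 next
  fix s t assume st: "s:carrier CR" "t:carrier CR"
  show "(%n. s n \<oplus> t n):carrier CR" by (rule Cau_closed(1)[OF st])
  show "(%n. s n \<oplus> t n) = (%n. t n \<oplus> s n)" using CauD(2) st by (simp add: a_comm)
  fix u assume "u:carrier CR"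
  thus "(%n. s n \<oplus> t n \<oplus> u n) = (%n. s n \<oplus> (t n \<oplus> u n))" using CauD(2) st by (simp add: a_assoc)
 qed
 show "comm_monoid CR"
 proof (rule comm_monoidI, unfold CR_ops)
  show "(%n. \<one>):carrier CR" using Cau Lh(6) by simp
  fix s assume s: "s:carrier CR"
  show "(%n. \<one> \<otimes> s n) = s" using CauD(2)[OF s] by simp
  fix t assume t: "t:carrier CR"
  show "(%n. s n \<otimes> t n):carrier CR" by (rule Cau_closed(2)[OF s t])
  show "(%n. s n \<otimes> t n) = (%n. t n \<otimes> s n)" using CauD(2) s t by (simp add: m_comm)
  fix u assume "u:carrier CR"
  thus "(%n. s n \<otimes> t n \<otimes> u n) = (%n. s n \<otimes> (t n \<otimes> u n))" using CauD(2) s t by (simp add: m_assoc)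
 qed
 fix s t u assume "s:carrier CR" "t:carrier CR" "u:carrier CR"
 thus "(s \<oplus>\<^bsub>CR\<^esub> t) \<otimes>\<^bsub>CR\<^esub> u = s \<otimes>\<^bsub>CR\<^esub> u \<oplus>\<^bsub>CR\<^esub> t \<otimes>\<^bsub>CR\<^esub> u" using CauD(2) by (simp add: CR_ops l_distr)
qed

lemma cauchy_minus: assumes "s:carrier CR" "t:carrier CR"
 shows "s \<ominus>\<^bsub>CR\<^esub> t = (%n. s n \<ominus> t n)" "(%n. s n \<ominus> t n):carrier CR"
proof -
 have "\<ominus>\<^bsub>CR\<^esub> t = (%n. \<ominus> t n)"
 proof (rule CR.minus_equality)
  show "(%n. \<ominus> t n) \<oplus>\<^bsub>CR\<^esub> t = \<zero>\<^bsub>CR\<^esub>" using CauD[OF assms(2)]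
   by (simp add: CR_ops l_neg)
 qed (use assms Cau_closed(4) in auto)
 thus 1: "s \<ominus>\<^bsub>CR\<^esub> t = (%n. s n \<ominus> t n)" by (simp add: a_minus_def CR_ops)
 show "(%n. s n \<ominus> t n):carrier CR" using CR.minus_closed[OF assms] 1 by simp
qed

sublocale NS: ideal NS CR
proof (rule CR.ideal_intro)
 show "NS <= carrier CR"
 proof
  fix s assume s: "s:NS"
  hence sL: "h (s n):h ` L" for n using Nul by auto
  have "EX N. ALL i>=N. ALL j>=N. cv m (h (s i) - h (s j))" for m
  proof -
   obtain N where "ALL i>=N. cv m (h (s i))" using s Nul by blast
   thus ?thesis using V.vge_diff[OF sL sL] by (intro exI[of _ N]) simp
  qed
  thus "s:carrier CR" using s Nul Cau by blast
 qed
 show "\<zero>\<^bsub>CR\<^esub>:NS" using Nul Lh(7) by (simp add: CR_ops)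
 fix s t assume s: "s:NS"
 hence sL: "s n:L" "h (s n):h ` L" for n using Nul by auto
 show "s \<oplus>\<^bsub>CR\<^esub> t:NS" if t: "t:NS" unfolding Nul CR_ops
 proof (intro conjI allI)
  have tL: "t n:L" "h (t n):h ` L" for n using t Nul by auto
  show "s n \<oplus> t n:L" for n using Lh(3) sL tL by blast
  fix m
  obtain N M where NM: "ALL i>=N. cv m (h (s i))" "ALL i>=M. cv m (h (t i))" using s t Nul by meson
  hence "cv m (h (s i \<oplus> t i))" if "i >= max N M" for i using Lh(3)[OF sL(1) tL(1)] V.vge_add[OF sL(2) tL(2)] that by simp
  thus "EX N. ALL i>=N. cv m (h (s i \<oplus> t i))" by blast
 qed
 show "t \<otimes>\<^bsub>CR\<^esub> s:NS" if t: "t:carrier CR" unfolding Nul CR_ops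
 proof (intro conjI allI)
  note T = CauD[OF t]
  show "t n \<otimes> s n:L" for n using Lh(4) sL T by blast
  fix m
  obtain b B where b: "ALL i>=B. cv b (h (t i))" using bounded_below[OF t] by blast
  obtain N where N: "ALL i>=N. cv (m - b) (h (s i))" using s Nul by blast
  have "cv m (h (t i \<otimes> s i))" if "i >= max N B" for i
   using Lh(4)[OF T(1) sL(1)] V.vge_mult[OF T(3) sL(2), of b i "m - b" i] b N that by simp
  thus "EX N. ALL i>=N. cv m (h (t i \<otimes> s i))" by blast
 qed
qed

sublocale C: cring C unfolding completion_def by (rule NS.quotient_is_cring[OF CR.is_cring])

lemma cl_hom: "ring_hom_cring CR C (%s. cl s)"
 unfolding completion_def by (intro ring_hom_cring.intro ring_hom_cring_axioms.intro NS.rcos_ring_hom CR.is_cring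
  NS.quotient_is_cring[OF CR.is_cring])

sublocale cl: ring_hom_cring CR C "%s. cl s" by (rule cl_hom)

lemma cl_eq: assumes "s:carrier CR" "t:carrier CR" shows "cl s = cl t <-> (%n. s n \<ominus> t n):NS"
proof -
 have "s:cl t <-> (%n. s n \<ominus> t n):NS"
  using NS.a_rcos_module_minus[OF CR.ring_axioms assms(2,1)] cauchy_minus[OF assms] by simp
 moreover have "s:cl t <-> cl s = cl t"
  using NS.a_repr_independence'[of s t] NS.a_rcos_self[OF assms(1)] assms by auto
 ultimately show ?thesis by simp
qed

lemma C_rep: assumes "Z:carrier C" shows "EX s:carrier CR. Z = cl s"
 using assms unfolding completion_def FactRing_def A_RCOSETS_defs by (auto simp: a_r_coset_def)

lemma in_class: assumes "s:carrier CR" "t:cl s" shows "t:carrier CR" "cl t = cl s"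
proof -
 show "t:carrier CR" by (rule NS.a_elemrcos_carrier[OF assms])
 show "cl t = cl s" using NS.a_repr_independence'[OF assms(2,1)] by simp
qed

lemma cl_minus: "s:carrier CR ==> t:carrier CR ==> cl s \<ominus>\<^bsub>C\<^esub> cl t = cl (%n. s n \<ominus> t n)"
 using cl.hom_sub cauchy_minus by simp

text \<open>The choice of representative does not matter, since two of them differ by a null
  sequence, whose terms eventually have valuation at least m.\<close>

lemma CG_iff: assumes s: "s:carrier CR" shows "cl s:CG m <-> (EX N. ALL i>=N. cv m (h (s i)))"
proof -
 have iff: "cl s:CG m <-> (EX t:cl s. EX N. ALL i>=N. cv m (h (t i)))"
  using cl.hom_closed[OF s] in_class(1)[OF s] CauD Lh(9) by (auto simp: completion_val_ge_def)
 show ?thesis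
 proof
  assume "cl s:CG m"
  then obtain t N where t: "t:cl s" "ALL i>=N. cv m (h (t i))" using iff by blast
  note t' = in_class[OF s t(1)]
  obtain M where M: "ALL i>=M. cv m (h (s i \<ominus> t i))" using cl_eq[OF s t'(1)] t' unfolding Nul by blast
  have "cv m (h (s i))" if "i >= max N M" for i
  proof -
   show ?thesis using V.vge_close[OF CauD(3)[OF s] CauD(3)[OF t'(1)]] t(2) that M Lh(5)[OF CauD(1)[OF s] CauD(1)[OF t'(1)]]
    by auto
  qed
  thus "EX N. ALL i>=N. cv m (h (s i))" by blast
 next
  assume "EX N. ALL i>=N. cv m (h (s i))"
  thus "cl s:CG m" using iff NS.a_rcos_self[OF s] by blast
 qed
qed

lemma emb_hom:
 assumes "x:L" "y:L"
 shows "emb x = cl (%n. x)" "(%n. x):carrier CR" "emb x:carrier C" "emb x:CG m <-> cv m (h x)"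
  "emb x = emb y <-> x = y" "emb (x \<oplus> y) = emb x \<oplus>\<^bsub>C\<^esub> emb y"
   "emb (x \<otimes> y) = emb x \<otimes>\<^bsub>C\<^esub> emb y"
  "emb x \<ominus>\<^bsub>C\<^esub> emb y = emb (x \<ominus> y)"
proof -
 have c: "(%n. z):carrier CR" if "z:L" for z using that by (simp add: Cau)
 show e: "emb x = cl (%n. x)" for x by (simp add: completion_embed_def)
 show "(%n. x):carrier CR" "emb x:carrier C" and cg: "emb x:CG m <-> cv m (h x)" using c[OF assms(1)] CG_iff[OF c[OF assms(1)]]
  by (auto simp: e)+
 show "emb x = emb y <-> x = y"
 proof
  assume "emb x = emb y"
  hence all: "cv m (h (x \<ominus> y))" for m using Nul cl_eq[OF c[OF assms(1)] c[OF assms(2)]] by (auto simp: e)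
  thus "x = y" using Lh(5)[OF assms] h_simps(9)[OF Lh(1)[OF assms(1)] Lh(1)[OF assms(2)]] all[of
   "cval L P (h (x \<ominus> y)) + 1"] by (simp add: V.vge_def)
 qed simp
 show "emb (x \<oplus> y) = emb x \<oplus>\<^bsub>C\<^esub> emb y" "emb (x \<otimes> y) = emb x \<otimes>\<^bsub>C\<^esub> emb y"
  using cl.hom_add[OF c[OF assms(1)] c[OF assms(2)]] cl.hom_mult[OF c[OF assms(1)] c[OF assms(2)]] by (simp_all add: e CR_ops)
 show "emb x \<ominus>\<^bsub>C\<^esub> emb y = emb (x \<ominus> y)" using cl_minus[OF c[OF assms(1)] c[OF assms(2)]]
  by (simp add: e)
qed

end

section \<open>Local inertia automorphisms as global ones\<close>

context complet
begin

lemma LR: "L <= carrier R" using Lh by auto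

definition inert :: "nat => ('a => 'a) set" where
 "inert j = {rho:carrier (Gal R L K). conj L rho:cram K L P j}"

abbreviation "KS == completion_subfield R K L P"
abbreviation "lram == lower_ramification R K L P"

lemma inertD: assumes "rho:inert 0"
 shows "x:L ==> rho x:L" "x:L ==> cv m (h (rho x)) <-> cv m (h x)" "x:K ==> rho x = x" "rho:carrier (Gal R L K)"
  "x:L ==> y:L ==> rho (x \<oplus> y) = rho x \<oplus> rho y" "x:L ==> y:L ==> rho (x \<otimes> y) = rho x \<otimes> rho y"
   "rho \<one> = \<one>"
  "EX rho':inert 0. ALL x:L. rho (rho' x) = x & rho' (rho x) = x"
  "x:L ==> y:L ==> rho (x \<ominus> y) = rho x \<ominus> rho y"
proof -
 have g: "rho:carrier (Gal R L K)" "conj L rho:cram K L P 0" using assms by (auto simp: inert_def)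
 note gD = GalD[OF g(1)]
 obtain q p a where a: "approx_rval (h ` L) (cval L P) q p (h ` K) a" using galois_approx[OF G P] by auto
 interpret A: approx_rval "h ` L" "cval L P" q p "h ` K" a by (rule a)
 have r: "conj L rho:A.ram 0" using g cram_ram[OF a] by simp
 show cl: "x:L ==> rho x:L" for x by (rule gD)
 show "x:L ==> cv m (h (rho x)) <-> cv m (h x)" "x:K ==> rho x = x" "rho:carrier (Gal R L K)" "rho \<one> = \<one>" and add:
  "x:L ==> y:L ==> rho (x \<oplus> y) = rho x \<oplus> rho y" and "x:L ==> y:L ==> rho (x \<otimes> y) = rho x \<otimes> rho y"
   using A.inertia_vge[OF r Lh(2)] conj_apply[OF LR] gD g by auto
 obtain t where t: "t:A.ram 0" "ALL x:h ` L. conj L rho (t x) = x & t (conj L rho x) = x" using A.ram_inverse[OF r] by auto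
 have tc: "t:cram K L P 0" using t cram_ram[OF a] by simp
 obtain rho' where r': "rho':carrier (Gal R L K)" "conj L rho' = t"
  using conj_surj[OF nf_sub(1)[OF nL] gxD(4)[OF G] cramD(1)[OF tc]] by auto
 have "rho (rho' x) = x & rho' (rho x) = x" if x: "x:L" for x
 proof -
  show ?thesis using h_simps Lh(1) x bspec[OF t(2) Lh(2)[OF x]] conj_apply[OF LR] r'(2) cl GalD(1)[OF r'(1)] by auto
 qed
 thus "EX rho':inert 0. ALL x:L. rho (rho' x) = x & rho' (rho x) = x" using r' tc by (auto simp: inert_def)
 assume xy: "x:L" "y:L"
 have "rho (x \<ominus> y) \<oplus> rho y = rho (x \<ominus> y \<oplus> y)" using gD Lh(5) xy by simp
 also have "x \<ominus> y \<oplus> y = x" using xy Lh by (simp add: a_minus_def a_assoc l_neg)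
 finally show "rho (x \<ominus> y) = rho x \<ominus> rho y" using h_simps Lh(1,5) cl xy Lh by (metis add_diff_cancel_right')
qed

lemma inert_seq:
 assumes r: "rho:inert 0" and s: "s:carrier CR"
 shows "(%n. rho (s n)):carrier CR" "s:NS ==> (%n. rho (s n)):NS"
proof -
 note S = CauD(1)[OF s] and D = inertD[OF r]
 have "cv m (h (rho (s i)) - h (rho (s j))) <-> cv m (h (s i) - h (s j))" for m i j
  using D Lh(5)[OF S S] D(9)[OF S S] Lh(5)[OF D(1)[OF S] D(1)[OF S]] by metis
 thus "(%n. rho (s n)):carrier CR" "s:NS ==> (%n. rho (s n)):NS" using s D by (auto simp: Cau Nul)
qed

text \<open>The continuous extension of \<open>rho\<close> to the completion, acting term by term on
  a chosen Cauchy sequence; \<open>th_cl\<close> frees it from the choice.\<close>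

definition th :: "('a => 'a) => (nat => 'a) set => (nat => 'a) set" where
 "th rho = (\<lambda>Z\<in>carrier C. cl (%n. rho ((SOME s. s:carrier CR & Z = cl s) n)))"

lemma th_cl: assumes r: "rho:inert 0" and s: "s:carrier CR" shows "th rho (cl s) = cl (%n. rho (s n))"
proof -
 define t where "t = (SOME t. t:carrier CR & cl s = cl t)"
 have t: "t:carrier CR" "cl s = cl t" unfolding t_def using someI[of "%t. t:carrier CR & cl s = cl t" s] s by auto
 have "(%n. t n \<ominus> s n):NS" using cl_eq[OF t(1) s] t by simp
 from inert_seq(2)[OF r cauchy_minus(2)[OF t(1) s] this] have "cl (%n. rho (t n)) = cl (%n. rho (s n))"
  using cl_eq[OF inert_seq(1)[OF r t(1)] inert_seq(1)[OF r s]] inertD(9)[OF r CauD(1)[OF t(1)] CauD(1)[OF s]] by simp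
 thus ?thesis unfolding th_def t_def using cl.hom_closed[OF s] by simp
qed

lemma th_emb: "rho:inert 0 ==> x:L ==> th rho (emb x) = emb (rho x)"
 using th_cl[OF _ emb_hom(2)[of x x]] emb_hom(1) inertD(1) by simp

lemma local_Gal_iff:
 "tau:carrier (local_Gal R K L P) <-> tau:extensional (carrier C) & bij_betw tau (carrier C) (carrier C) & tau:ring_hom C C & (ALL Z:KS. tau Z = Z)"
 by (auto simp: Aut_over_def Bij_def)

lemma emb_KS: "x:K ==> emb x:KS"
proof -
 assume x: "x:K"
 hence xL: "x:L" using gxD[OF G] by auto
 have "(%n. x):emb x" using NS.a_rcos_self[OF emb_hom(2)[OF xL xL]] emb_hom(1)[OF xL xL] by simp
 thus ?thesis using emb_hom(3)[OF xL xL] x by (auto simp: completion_subfield_def)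
qed

lemma th_local: assumes r: "rho:inert 0" shows "th rho:carrier (local_Gal R K L P)"
 unfolding local_Gal_iff
proof (intro conjI ballI)
 show "th rho:extensional (carrier C)" by (simp add: th_def)
 obtain rho' where r': "rho':inert 0" "ALL x:L. rho (rho' x) = x & rho' (rho x) = x" using inertD[OF r] by auto
 have inv: "th rho (th rho' Z) = Z & th rho' (th rho Z) = Z" "th rho Z:carrier C" "th rho' Z:carrier C" if Z: "Z:carrier C" for Z
 proof -
  obtain s where s: "s:carrier CR" "Z = cl s" using C_rep[OF Z] by auto
  have "(%n. rho (rho' (s n))) = s" "(%n. rho' (rho (s n))) = s" using r' CauD[OF s(1)] by auto
  thus "th rho (th rho' Z) = Z & th rho' (th rho Z) = Z" using s th_cl[OF r] th_cl[OF r'(1)] inert_seq r r'(1) by simp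
  show "th rho Z:carrier C" "th rho' Z:carrier C" using s th_cl inert_seq r r' by auto
 qed
 thus "bij_betw (th rho) (carrier C) (carrier C)" by (intro bij_betw_byWitness[where f' = "th rho'"]) auto
 show "th rho:ring_hom C C"
 proof (rule ring_hom_memI)
  fix Z W assume "Z:carrier C" "W:carrier C"
  then obtain s t where s: "s:carrier CR" "Z = cl s" "t:carrier CR" "W = cl t" using C_rep by blast
  show "th rho (Z \<otimes>\<^bsub>C\<^esub> W) = th rho Z \<otimes>\<^bsub>C\<^esub> th rho W"
   using s th_cl[OF r s(1)] th_cl[OF r s(3)] th_cl[OF r Cau_closed(2)[OF s(1,3)]] cl.hom_mult[OF s(1,3)] cl.hom_mult[OF
    inert_seq(1)[OF r s(1)] inert_seq(1)[OF r s(3)]] inertD(6)[OF r CauD(1)[OF s(1)] CauD(1)[OF s(3)]] by (simp add: CR_ops)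
  show "th rho (Z \<oplus>\<^bsub>C\<^esub> W) = th rho Z \<oplus>\<^bsub>C\<^esub> th rho W"
   using s th_cl[OF r s(1)] th_cl[OF r s(3)] th_cl[OF r Cau_closed(1)[OF s(1,3)]] cl.hom_add[OF s(1,3)] cl.hom_add[OF
    inert_seq(1)[OF r s(1)] inert_seq(1)[OF r s(3)]] inertD(5)[OF r CauD(1)[OF s(1)] CauD(1)[OF s(3)]] by (simp add: CR_ops)
 next
  show "th rho \<one>\<^bsub>C\<^esub> = \<one>\<^bsub>C\<^esub>"
   using th_emb[OF r, of \<one>] Lh(6) inertD(7)[OF r] cl.hom_one emb_hom(1)[of \<one> \<one>] by (simp add: CR_ops)
 qed (rule inv)
 fix Z assume "Z:KS"
 then obtain s where s: "Z:carrier C" "s:Z" "!!n. s n:K" by (auto simp: completion_subfield_def)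
 obtain t where t: "t:carrier CR" "Z = cl t" using C_rep[OF s(1)] by auto
 have st: "s:cl t" using s(2) unfolding t .
 show "th rho Z = Z" using th_cl[OF r in_class(1)[OF t(1) st]] in_class[OF t(1) st] t inertD(3)[OF r s(3)] by simp
qed

lemma th_lower: assumes r: "rho:inert 0" shows "th rho:lram i <-> rho:inert i"
proof
 assume l: "th rho:lram i"
 have "cv (int i + 1) (conj L rho z - z)" if z: "z:h ` L" "cv 0 z" for z
 proof -
  obtain x where x: "x:L" "z = h x" using z by auto
  have rx: "rho x:L" using inertD(1)[OF r x(1)] .
  show ?thesis using emb_hom(4)[of "rho x \<ominus> x" "rho x \<ominus> x"] Lh(5)[OF rx x(1)] conj_apply[OF LR x(1), of rho] x
   th_emb[OF r x(1)] emb_hom(8)[OF rx x(1)] l emb_hom(4)[OF x(1) x(1)] z by (fastforce simp: lower_ramification_def)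
 qed
 thus "rho:inert i" using r unfolding inert_def cram_def by simp
next
 assume ri: "rho:inert i"
 have "th rho Z \<ominus>\<^bsub>C\<^esub> Z:CG (int i + 1)" if Z: "Z:CG 0" for Z
 proof -
  obtain s where s: "s:carrier CR" "Z = cl s" using C_rep Z by (auto simp: completion_val_ge_def)
  obtain N where N: "ALL n>=N. cv 0 (h (s n))" using Z CG_iff[OF s(1)] s by auto
  note rs = inert_seq(1)[OF r s(1)]
  have "cv (int i + 1) (h (rho (s n) \<ominus> s n))" if n: "n >= N" for n
  proof -
   have "cv (int i + 1) (conj L rho (h (s n)) - h (s n))"
    using cramD[of "conj L rho" K L P i] ri N n CauD[OF s(1)] unfolding inert_def by simp
   thus ?thesis using conj_apply[OF LR CauD(1)[OF s(1)]] Lh(5)[OF CauD(1)[OF rs] CauD(1)[OF s(1)]] by simp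
  qed
  thus ?thesis using th_cl[OF r s(1)] cl_minus[OF rs s(1)] s CG_iff[OF cauchy_minus(2)[OF rs s(1)]] by auto
 qed
 thus "th rho:lram i" using th_local[OF r] by (simp add: lower_ramification_def)
qed

lemma CG_add: "Z:CG m ==> W:CG m ==> Z \<oplus>\<^bsub>C\<^esub> W:CG m"
 and CG_mult: "Z:CG m ==> W:CG k ==> Z \<otimes>\<^bsub>C\<^esub> W:CG (m + k)"
proof -
 have rep: "EX s:carrier CR. Z = cl s & (EX N. ALL i>=N. cv m (h (s i)))" if "Z:CG m" for Z m
  using that CG_iff C_rep by (metis (no_types, lifting) completion_val_ge_def mem_Collect_eq)
 show "Z \<otimes>\<^bsub>C\<^esub> W:CG (m + k)" if ZW: "Z:CG m" "W:CG k"
 proof -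
  obtain s N where s: "s:carrier CR" "Z = cl s" "ALL i>=N. cv m (h (s i))" using rep[OF ZW(1)] by auto
  obtain t M where t: "t:carrier CR" "W = cl t" "ALL i>=M. cv k (h (t i))" using rep[OF ZW(2)] by auto
  have "cv (m + k) (h (s i \<otimes> t i))" if "i >= max N M" for i
   using V.vge_mult[OF CauD(3)[OF s(1)] CauD(3)[OF t(1)]] s(3) t(3) that Lh(4)[OF CauD(1)[OF s(1)] CauD(1)[OF t(1)]] by simp
  hence "EX N. ALL i>=N. cv (m + k) (h (s i \<otimes> t i))" by blast
  thus ?thesis using CG_iff[OF Cau_closed(2)[OF s(1) t(1)]] cl.hom_mult[OF s(1) t(1)] s(2) t(2) by (auto simp: CR_ops)
 qed
 show "Z \<oplus>\<^bsub>C\<^esub> W:CG m" if ZW: "Z:CG m" "W:CG m"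
 proof -
  obtain s N where s: "s:carrier CR" "Z = cl s" "ALL i>=N. cv m (h (s i))" using rep[OF ZW(1)] by auto
  obtain t M where t: "t:carrier CR" "W = cl t" "ALL i>=M. cv m (h (t i))" using rep[OF ZW(2)] by auto
  have "cv m (h (s i \<oplus> t i))" if "i >= max N M" for i
   using V.vge_add[OF CauD(3)[OF s(1)] CauD(3)[OF t(1)]] s(3) t(3) that Lh(3)[OF CauD(1)[OF s(1)] CauD(1)[OF t(1)]] by simp
  hence "EX N. ALL i>=N. cv m (h (s i \<oplus> t i))" by blast
  thus ?thesis using CG_iff[OF Cau_closed(1)[OF s(1) t(1)]] cl.hom_add[OF s(1) t(1)] s(2) t by (auto simp: CR_ops)
 qed
qed


text \<open>\<open>tau\<close> is a ring homomorphism fixing the coefficients, so the image of f(x)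
  is represented by f applied to the terms of any sequence for the image of x.\<close>

lemma local_poly:
 assumes t: "tau:carrier (local_Gal R K L P)" and x: "x:L" and y: "y:carrier CR" "tau (emb x) = cl y"
  and f: "f:pols (h ` K)"
 shows "EX u:L. EX w:carrier CR. h u = poly f (h x) & (ALL n. h (w n) = poly f (h (y n))) & tau (emb u) = cl w"
 using f
proof (induction f)
 case 0
 have "tau (emb \<zero>) = emb \<zero>" using t emb_KS F_closed[OF gxD(2)[OF G]] csubD(1)[OF gxD(8)[OF G]]
  unfolding local_Gal_iff by auto
 thus ?case using Lh(7) emb_hom(1,2) by (intro bexI[of _ "\<zero>"] bexI[of _ "%n. \<zero>"]) auto
next
 case (pCons a f)
 have co: "pcf (pCons a f) i:h ` K" for i using pCons.prems unfolding pols_def by simp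
 hence f: "f:pols (h ` K)" unfolding pols_def using co[of "Suc i" for i] by simp
 obtain b where b: "b:K" "a = h b" using co[of 0] by auto
 have bL: "b:L" using b gxD[OF G] by auto
 obtain u w where uw: "u:L" "w:carrier CR" "h u = poly f (h x)" "ALL n. h (w n) = poly f (h (y n))" "tau (emb u) = cl w"
  using pCons.IH[OF f] by auto
 note Lu = Lh(4)[OF x uw(1)]
 note hom = ring_hom_memE[of tau C C]
 have th: "tau:ring_hom C C" "tau (emb b) = emb b" using t emb_KS[OF b(1)] unfolding local_Gal_iff by auto
 let ?u = "b \<oplus> x \<otimes> u" and ?w = "%n. b \<oplus> y n \<otimes> w n"
 have yw: "(%n. y n \<otimes> w n):carrier CR" by (rule Cau_closed[OF y(1) uw(2)])
 have "emb ?u = emb b \<oplus>\<^bsub>C\<^esub> emb x \<otimes>\<^bsub>C\<^esub> emb u"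
  using emb_hom(6)[OF bL] emb_hom(7)[OF x uw(1)] Lu by simp
 hence "tau (emb ?u) = emb b \<oplus>\<^bsub>C\<^esub> cl y \<otimes>\<^bsub>C\<^esub> cl w"
  using hom[OF th(1)] emb_hom(3)[OF bL bL] emb_hom(3)[OF x x] emb_hom(3)[OF uw(1) uw(1)] th y uw(5) by simp
 also have "cl y \<otimes>\<^bsub>C\<^esub> cl w = cl (%n. y n \<otimes> w n)" using cl.hom_mult[OF y(1) uw(2)]
  by (simp add: CR_ops)
 also have "emb b \<oplus>\<^bsub>C\<^esub> cl (%n. y n \<otimes> w n) = cl ?w"
  using cl.hom_add[OF emb_hom(2)[OF bL bL] yw] emb_hom(1)[OF bL bL] by (simp add: CR_ops)
 finally have 1: "tau (emb ?u) = cl ?w" .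
 have 2: "?w:carrier CR" using Cau_closed(1)[OF emb_hom(2)[OF bL bL] yw] .
 have 3: "h (?w n) = poly (pCons a f) (h (y n))" for n
  using Lh(4)[OF CauD(1)[OF y(1), of n] CauD(1)[OF uw(2), of n]] Lh(3)[OF bL] uw b by simp
 have "?u:L" "h ?u = poly (pCons a f) (h x)" using Lh(3)[OF bL] Lu uw b(2) by auto
 thus ?case using 1 2 3 by (intro bexI[of _ ?u] bexI[of _ ?w] conjI allI)
qed

text \<open>If y_n represents the image of z, the values at y_n of the characteristic polynomial of
  z tend to 0. The polynomial splits over \<open>L\<close>, so y_n converges to one of the finitely
  many conjugates of z.\<close>

lemma local_root:
 assumes t: "tau:carrier (local_Gal R K L P)" and z: "z:h ` L"
 shows "EX w:h ` L. tau (emb (phi z)) = emb (phi w)"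
proof -
 let ?G = "cgal (h ` L) (h ` K)" and ?f = "orbit_poly (h ` K) (h ` L) z"
 obtain x where x: "x:L" "z = h x" using z by auto
 obtain y where y: "y:carrier CR" "tau (emb x) = cl y" using C_rep emb_hom[OF x(1) x(1)] bij_betwE t unfolding local_Gal_iff
  by metis
 obtain u w where uw: "u:L" "w:carrier CR" "h u = poly ?f (h x)" "ALL n. h (w n) = poly ?f (h (y n))" "tau (emb u) = cl w"
  using local_poly[OF t x(1) y orbit_poly(1)[OF gxD(6)[OF G] z]] by blast
 have "tau (emb \<zero>) = emb \<zero>" using t emb_KS F_closed[OF gxD(2)[OF G]] csubD(1)[OF gxD(8)[OF G]]
  unfolding local_Gal_iff by auto
 hence nul: "EX N. ALL i>=N. cv m (h (w i \<ominus> \<zero>))" for m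
  using cl_eq[OF uw(2) emb_hom(2)[of \<zero> \<zero>]] Lh uw emb_hom[of \<zero> \<zero>] h_simps(8) Lh(1)[OF uw(1)] uw
   orbit_poly[OF gxD(6)[OF G] z] x(2) unfolding Nul by metis
 have hw: "h (w i \<ominus> \<zero>) = (\<Prod>s\<in>?G. h (y i) - s z)" for i
  using Lh(5)[OF CauD(1)[OF uw(2)]] Lh uw(4) by (simp add: orbit_poly_def poly_prod)
 have fin: "finite ?G" by (rule gxD[OF G])
 note yL = CauD(3)[OF y(1)] and sL = cgalD(4)[OF _ z]
 have near: "EX s:?G. EX N. ALL i>=N. cv (int m) (h (y i) - s z)" for m
 proof -
  \<comment> \<open>If a product of |G| factors has valuation at least |G| m, some factor has
    valuation at least m.\<close>
  obtain N where N: "ALL i>=N. cv (int (card ?G * m)) (\<Prod>s\<in>?G. h (y i) - s z)" using nul unfolding hw by auto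
  obtain M where M: "ALL i>=M. ALL j>=M. cv (int m) (h (y i) - h (y j))" using y Cau by blast
  let ?n = "max N M"
  have "EX s:?G. cv (int m) (h (y ?n) - s z)"
  proof (rule ccontr)
   assume no: "~ ?thesis"
   hence nz: "h (y ?n) - s z ~= 0 & cval L P (h (y ?n) - s z) < int m" if "s:?G" for s
    using that unfolding V.vge_def by auto
   have sL': "h (y ?n) - s z:h ` L & h (y ?n) - s z ~= 0" if "s:?G" for s
    using V.L'(5)[OF yL sL[OF that]] nz[OF that] by simp
   have "cval L P (\<Prod>s\<in>?G. h (y ?n) - s z) = (\<Sum>s\<in>?G. cval L P (h (y ?n) - s z))" by (rule V.v_prod[OF fin sL'])
   also have "\<dots> < (\<Sum>s\<in>?G. int m)" using nz fin cgal_id[OF V.L gxD(5)[OF G]] by (intro sum_strict_mono) auto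
   finally have "cval L P (\<Prod>s\<in>?G. h (y ?n) - s z) < int (card ?G * m)" by simp
   moreover have "(\<Prod>s\<in>?G. h (y ?n) - s z) ~= 0" using sL' fin by simp
   moreover have "cv (int (card ?G * m)) (\<Prod>s\<in>?G. h (y ?n) - s z)" using N by simp
   ultimately show False unfolding V.vge_def by simp
  qed
  then obtain s where s: "s:?G" "cv (int m) (h (y ?n) - s z)" by auto
  have "cv (int m) (h (y i) - s z)" if "i >= M" for i
   using V.vge_trans[OF yL yL sL[OF s(1)], of "int m" i ?n] M that s by simp
  thus ?thesis using s by auto
 qed
 \<comment> \<open>So far the conjugate may depend on m. If every s failed at some m(s), then for
   the sum of these bounds no s would be left.\<close>
 have "EX s:?G. ALL m. EX N. ALL i>=N. cv (int m) (h (y i) - s z)"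
 proof (rule ccontr)
  assume no: "~ ?thesis"
  hence "ALL s:?G. EX m. ~ (EX N. ALL i>=N. cv (int m) (h (y i) - s z))" by simp
  from bchoice[OF this] obtain m where m: "ALL s:?G. ~ (EX N. ALL i>=N. cv (int (m s)) (h (y i) - s z))" by auto
  define B where "B = (\<Sum>s\<in>?G. m s)"
  obtain s N where s: "s:?G" "ALL i>=N. cv (int B) (h (y i) - s z)" using near[of B] by auto
  have "m s <= B" unfolding B_def using s fin by (intro member_le_sum) auto
  thus False using m s s V.vge_mono[of "int B" _ "int (m s)"] by auto
 qed
 then obtain s where s: "s:?G" "!!m. EX N. ALL i>=N. cv (int m) (h (y i) - s z)" by auto
 obtain v where v: "v:L" "s z = h v" using sL[OF s(1)] by auto
 have "(%n. y n \<ominus> v):NS" unfolding Nul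
 proof (intro conjI allI)
  show "y n \<ominus> v:L" for n using Lh(5)[OF CauD(1)[OF y(1)] v(1)] by simp
  fix m
  obtain N where "ALL i>=N. cv (int (nat m)) (h (y i) - s z)" using s by blast
  hence "ALL i>=N. cv m (h (y i \<ominus> v))"
   using V.vge_mono[of "int (nat m)" _ m] Lh(5)[OF CauD(1)[OF y(1)] v(1)] v by simp
  thus "EX N. ALL i>=N. cv m (h (y i \<ominus> v))" by auto
 qed
 thus ?thesis using sL[OF s(1)] y emb_hom[OF v(1) v(1)] h(2)[OF Lh(1)[OF v(1)]] v cl_eq[OF y(1) emb_hom(2)[OF v(1) v(1)]]
  h(2)[OF Lh(1)[OF x(1)]] x by metis
qed

text \<open>The local group imposes no continuity, but on inertia it is automatic:
  \<open>tau\<close> preserves the valuation ring and hence the powers of its maximal ideal. So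
  \<open>tau\<close> is determined by its values on the dense subfield \<open>L\<close>, and there
  \<open>local_root\<close> and \<open>galois_lift\<close> make it a global automorphism.\<close>

lemma th_surj: assumes l: "tau:lram 0" shows "EX rho:inert 0. tau = th rho"
proof -
 have t: "tau:carrier (local_Gal R K L P)" using l by (simp add: lower_ramification_def)
 hence th: "tau:ring_hom C C" "tau:extensional (carrier C)" "bij_betw tau (carrier C) (carrier C)" "ALL Z:KS. tau Z = Z"
  unfolding local_Gal_iff by auto
 note hom = ring_hom_memE[OF th(1)]
 have pL: "phi z:L" "h (phi z) = z" if "z:h ` L" for z using that h Lh by auto
 have hp: "phi (h x) = x" if "x:L" for x using h Lh that by simp
 have "ALL z:h ` L. EX w. w:h ` L & tau (emb (phi z)) = emb (phi w)" using local_root[OF t] by simp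
 from bchoice[OF this] obtain s where s: "!!z. z:h ` L ==> s z:h ` L & tau (emb (phi z)) = emb (phi (s z))" by auto
 have uniq: "s z = h w" if "z:h ` L" "w:L" "tau (emb (phi z)) = emb w" for z w
  using s[OF that(1)] emb_hom that pL by metis
 have "chom (h ` L) s" unfolding chom_def
 proof (intro conjI ballI)
  show "s 1 = 1" using uniq[of 1 \<one>] Lh V.L'(1) hom hp[of \<one>] cl.hom_one emb_hom(1)[of \<one> \<one>]
   by (simp add: CR_ops)
  fix a b assume ab: "a:h ` L" "b:h ` L"
  note p = pL[OF ab(1)] pL[OF ab(2)] and ps = pL[OF conjunct1[OF s[OF ab(1)]]] pL[OF conjunct1[OF s[OF ab(2)]]]
  have ea: "phi (a + b) = phi a \<oplus> phi b" "phi (a * b) = phi a \<otimes> phi b"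
   using hp Lh(3)[OF p(1,3)] Lh(4)[OF p(1,3)] p by metis+
  have "tau (emb (phi (a + b))) = emb (phi (s a) \<oplus> phi (s b))"
   using emb_hom(6)[OF p(1,3)] emb_hom(6)[OF ps(1,3)] emb_hom(3) p hom s ab ea by simp
  from uniq[OF _ _ this] show "s (a + b) = s a + s b" using V.L'(4)[OF ab] Lh(3)[OF ps(1,3)] ps by simp
  have "tau (emb (phi (a * b))) = emb (phi (s a) \<otimes> phi (s b))"
   using emb_hom(7)[OF p(1,3)] emb_hom(7)[OF ps(1,3)] emb_hom(3) p hom s ab ea by simp
  from uniq[OF _ _ this] show "s (a * b) = s a * s b" using V.L'(6)[OF ab] Lh(4)[OF ps(1,3)] ps by simp
 qed
 moreover have "s z = z" if z: "z:h ` K" for z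
 proof -
  obtain x where x: "x:K" "z = h x" using z by auto
  have xL: "x:L" using x gxD[OF G] by auto
  show ?thesis using uniq x xL th emb_KS[OF x(1)] hp[OF xL] by simp
 qed
 ultimately obtain g where g: "g:cgal (h ` L) (h ` K)" "ALL x:h ` L. s x = g x"
  using galois_lift[OF gxD(6)[OF G] V.L gxD(5)[OF G]] by blast
 obtain rho where r: "rho:carrier (Gal R L K)" "conj L rho = g" using conj_surj[OF nf_sub(1)[OF nL] gxD(4)[OF G] g(1)] by auto
 have hr: "h (rho x) = s (h x)" if "x:L" for x using conj_apply[OF LR that, of rho] r bspec[OF g(2) Lh(2)[OF that]] by simp
 have rL: "rho x:L" if "x:L" for x using GalD(1)[OF r(1) that] .
 have te: "tau (emb x) = emb (rho x)" if x: "x:L" for x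
  using s[OF Lh(2)[OF x]] hp[OF x] hp[OF rL[OF x]] hr[OF x] by simp
 have "cv 1 (g z - z)" if z: "z:h ` L" "cv 0 z" for z
 proof -
  obtain x where x: "x:L" "z = h x" using z by auto
  show ?thesis using hr[OF x(1)] bspec[OF g(2) z(1)] x emb_hom(4)[of "rho x \<ominus> x" "rho x \<ominus> x"] Lh(5)[OF rL[OF
   x(1)] x(1)] te[OF x(1)] emb_hom(8)[OF rL[OF x(1)] x(1)] l emb_hom(4)[OF x(1) x(1)] z
    by (fastforce simp: lower_ramification_def)
 qed
 hence "g:cram K L P 0" using g unfolding cram_def by simp
 hence r0: "rho:inert 0" using r by (simp add: inert_def)
 have CGc: "Z:carrier C" if "Z:CG m" for Z m using that by (simp add: completion_val_ge_def)
 have pres0: "tau W:CG 0" if W: "W:CG 0" for W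
 proof -
  have "tau W \<ominus>\<^bsub>C\<^esub> W:CG 1" using l W by (simp add: lower_ramification_def)
  then obtain d where d: "d:carrier CR" "tau W \<ominus>\<^bsub>C\<^esub> W = cl d" using CGc C_rep by blast
  have "EX N. ALL i>=N. cv 1 (h (d i))" using CG_iff[OF d(1)] \<open>tau W \<ominus>\<^bsub>C\<^esub> W:CG 1\<close> d by simp
  hence "EX N. ALL i>=N. cv 0 (h (d i))" using V.vge_mono[of 1 _ 0] by auto
  hence "W \<oplus>\<^bsub>C\<^esub> (tau W \<ominus>\<^bsub>C\<^esub> W):CG 0" using CG_iff[OF d(1)] d CG_add[OF W] by auto
  moreover have "W \<oplus>\<^bsub>C\<^esub> (tau W \<ominus>\<^bsub>C\<^esub> W) = tau W"
   using CGc[OF W] hom(1)[OF CGc[OF W]] C.a_lcomm[of W "tau W" "\<ominus>\<^bsub>C\<^esub> W"] by (simp add: C.minus_eq C.r_neg)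
  ultimately show ?thesis by simp
 qed
 \<comment> \<open>Dividing by p^m leads into the valuation ring, which \<open>tau\<close>
   preserves; multiplying back uses that \<open>tau\<close> acts on p^m as \<open>rho\<close>, which
   keeps its valuation m.\<close>
 have pres: "tau W:CG (int m)" if W: "W:CG (int m)" for W m
 proof -
  obtain q p a where "rval (h ` L) (cval L P) q p" using cval_rval[OF nL P] by auto
  then interpret A: rval "h ` L" "cval L P" q p .
  have pm: "p ^ m:h ` L" "p ^ m ~= 0" "cval L P (p ^ m) = int m"
   using csub_power[OF V.L A.pi(1)] A.pi V.v_power[OF A.pi(1,2)] by auto
  obtain c where c: "c:L" "h c = p ^ m" using pm by auto
  obtain b where b: "b:L" "h b = inverse (p ^ m)" using V.L'(7)[OF pm(1)] by auto
  have W': "W \<otimes>\<^bsub>C\<^esub> emb b:CG 0" using CG_mult[OF W] emb_hom(4)[OF b(1) b(1)] b V.v_inverse[OF pm(1,2)] pm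
   by (fastforce simp: V.vge_def)
  have eC: "emb b:carrier C" "emb c:carrier C" using emb_hom(3) b c by auto
  have "emb b \<otimes>\<^bsub>C\<^esub> emb c = \<one>\<^bsub>C\<^esub>"
   using emb_hom(7)[OF b(1) c(1)] cl.hom_one emb_hom(1)[of \<one> \<one>] h_simps(9)[of "b \<otimes> c" \<one>] Lh b c pm
    by (auto simp: CR_ops)
  hence "tau W = tau (W \<otimes>\<^bsub>C\<^esub> emb b) \<otimes>\<^bsub>C\<^esub> emb (rho c)"
   using hom(2)[OF CGc[OF W'] eC(2)] te[OF c(1)] CGc[OF W] eC by (simp add: C.m_assoc)
  moreover have "emb (rho c):CG (int m)" using emb_hom(4)[OF rL[OF c(1)] rL[OF c(1)]] inertD(2)[OF r0 c(1)] c pm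
   by (simp add: V.vge_def)
  ultimately show ?thesis using CG_mult[OF pres0[OF W']] by simp
 qed
 have "tau Z = th rho Z" if Z: "Z:carrier C" for Z
 proof -
  obtain u where u: "u:carrier CR" "Z = cl u" using C_rep[OF Z] by auto
  obtain w where w: "w:carrier CR" "tau Z = cl w" using C_rep hom(1)[OF Z] by auto
  note ru = inert_seq(1)[OF r0 u(1)]
  \<comment> \<open>Both maps agree on the constant sequence with term u N, which lies within
    precision m of \<open>Z\<close>; continuity of both then bounds their difference at
    \<open>Z\<close>.\<close>
  have "EX N. ALL i>=N. cv (int m) (h (w i \<ominus> rho (u i)))" for m
  proof -
   obtain N where N: "ALL i>=N. ALL j>=N. cv (int m) (h (u i) - h (u j))" using u Cau by blast
   note uN = CauD(1)[OF u(1), of N] and eN = emb_hom(1,2)[OF CauD(1)[OF u(1), of N] CauD(1)[OF u(1), of N]]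
   have "cv (int m) (h (u i \<ominus> u N))" if "i >= N" for i using N that Lh(5)[OF CauD(1)[OF u(1)] uN] by simp
   hence D: "Z \<ominus>\<^bsub>C\<^esub> emb (u N):CG (int m)"
    using cl_minus[OF u(1) eN(2)] u eN CG_iff[OF cauchy_minus(2)[OF u(1) eN(2)]] by auto
   have eC: "emb (u N):carrier C" using emb_hom(3)[OF uN uN] .
   have "tau (Z \<ominus>\<^bsub>C\<^esub> emb (u N)) = tau Z \<ominus>\<^bsub>C\<^esub> emb (rho (u N))"
   proof -
    have d: "Z \<ominus>\<^bsub>C\<^esub> emb (u N):carrier C" using Z eC by simp
    have "tau Z = tau (Z \<ominus>\<^bsub>C\<^esub> emb (u N)) \<oplus>\<^bsub>C\<^esub> emb (rho (u N))"
     using hom(3)[OF d eC] te[OF uN] Z eC by (simp add: C.minus_eq C.a_assoc C.l_neg)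
    moreover have "emb (rho (u N)):carrier C" using emb_hom(3)[OF rL[OF uN] rL[OF uN]] .
    ultimately show ?thesis using hom(1)[OF d] by (simp add: C.minus_eq C.a_assoc C.r_neg)
   qed
   then obtain M where M: "ALL i>=M. cv (int m) (h (w i \<ominus> rho (u N)))"
    using CG_iff[OF cauchy_minus(2)[OF w(1) emb_hom(2)[OF rL[OF uN] rL[OF uN]]]] cl_minus[OF w(1) emb_hom(2)[OF rL[OF uN] rL[OF
     uN]]] w emb_hom(1)[OF rL[OF uN] rL[OF uN]] pres[OF D] by auto
   have "cv (int m) (h (w i \<ominus> rho (u i)))" if i: "i >= max N M" for i
   proof -
    note ui = CauD(1)[OF u(1), of i] and wi = CauD(1)[OF w(1), of i]
    have "cv (int m) (h (rho (u N \<ominus> u i)))" using N i inertD[OF r0] Lh(5)[OF uN ui] by simp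
    hence "cv (int m) (h (rho (u N)) - h (rho (u i)))" using inertD(9)[OF r0 uN ui] Lh(5)[OF rL[OF uN] rL[OF ui]] by simp
    moreover have "cv (int m) (h (w i) - h (rho (u N)))" using Lh(5)[OF wi rL[OF uN]] M i by auto
    ultimately show ?thesis using Lh(5)[OF wi rL[OF ui]] V.vge_trans[OF Lh(2)[OF wi] Lh(2)[OF rL[OF uN]] Lh(2)[OF rL[OF ui]]]
     by simp
   qed
   thus ?thesis by blast
  qed
  thus ?thesis using cl_eq[OF w(1) ru] w th_cl[OF r0 u(1)] u CauD[OF cauchy_minus(2)[OF w(1) ru]] V.vge_mono unfolding Nul
   by (metis int_nat_eq nle_le)
 qed
 hence "tau = th rho" using th by (intro extensionalityI[of _ "carrier C"]) (auto simp: th_def)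
 thus ?thesis using r0 by auto
qed

end

section \<open>The upper numbering expressed through group orders\<close>

context complet
begin

lemma lram_image: "lram i = th ` inert i"
proof
 show "th ` inert i <= lram i"
  using th_lower cram_facts(3)[OF G P, of 0 i] by (auto simp: inert_def)
 show "lram i <= th ` inert i"
 proof
  fix tau assume t: "tau:lram i"
  have "Z:CG 1" if Z: "Z:CG (int i + 1)" for Z
  proof -
   obtain s where s: "s:carrier CR" "Z = cl s" using Z C_rep by (auto simp: completion_val_ge_def)
   obtain N where "ALL j>=N. cv (int i + 1) (h (s j))" using Z CG_iff[OF s(1)] s by auto
   thus ?thesis using CG_iff[OF s(1)] s V.vge_mono[of "int i + 1" _ 1] by auto
  qed
  hence "tau:lram 0" using t by (auto simp: lower_ramification_def)
  then obtain rho where r: "rho:inert 0" "tau = th rho" using th_surj by auto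
  thus "tau:th ` inert i" using t th_lower by simp
 qed
qed

lemma th_inj: assumes "rho:inert 0" "rho':carrier (Gal R L K)" "!!x. x:L ==> th rho (emb x) = emb (rho' x)" shows "rho = rho'"
proof (rule extensionalityI[of _ L])
 show "rho:extensional L" "rho':extensional L" using GalD inertD(4)[OF assms(1)] assms by auto
 fix x assume x: "x:L"
 thus "rho x = rho' x"
  using th_emb[OF assms(1) x] assms(3)[OF x] emb_hom(5) inertD(1)[OF assms(1) x] GalD(1)[OF assms(2) x] by simp
qed

lemma inert_0: "rho:inert i ==> rho:inert 0" using cram_facts(3)[OF G P] by (auto simp: inert_def)

lemma card_lram: "card (lram i) = card (cram K L P i)"
proof -
 have "inj_on th (inert i)"
 by (auto simp: inj_onI th_emb th_inj inert_0 inertD)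
 hence "card (lram i) = card (inert i)" unfolding lram_image by (rule card_image)
 also have "\<dots> = card (conj L ` inert i)"
  using inj_on_subset[OF conj_inj[OF LR, of K]] by (intro card_image[symmetric]) (auto simp: inert_def)
 also have "conj L ` inert i = cram K L P i"
  using conj_surj[OF nf_sub(1)[OF nL] gxD(4)[OF G]] cramD by (auto simp: inert_def) blast
 finally show ?thesis .
qed

lemma one_lram: "\<one>\<^bsub>local_Gal R K L P\<^esub>:lram i"
proof -
 have one: "\<one>\<^bsub>local_Gal R K L P\<^esub> = (\<lambda>Z\<in>carrier C. Z)" by (simp add: Aut_over_def BijGroup_def)
 have z: "Z \<ominus>\<^bsub>C\<^esub> Z:CG m" if "Z:carrier C" for Z m
 proof -
  obtain s where s: "s:carrier CR" "Z = cl s" using C_rep \<open>Z:carrier C\<close> by auto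
  show ?thesis using cl_minus[OF s(1) s(1)] CG_iff[OF cauchy_minus(2)[OF s(1) s(1)]] s Lh(5)[OF CauD(1)[OF s(1)] CauD(1)[OF
   s(1)]] by simp
 qed
 have "\<one>\<^bsub>local_Gal R K L P\<^esub>:carrier (local_Gal R K L P)"
  unfolding local_Gal_iff one by (auto simp: ring_hom_def completion_subfield_def bij_betw_def)
 thus ?thesis using z by (auto simp: lower_ramification_def one completion_val_ge_def)
qed

definition lev :: "real => nat" where "lev v = nat \<lceil>herbrand_psi R K L P v\<rceil>"

lemma lev_iff: assumes "0 <= v"
 shows "lev v <= j <-> v * real (card (cram K L P 0)) <= real (\<Sum>i=1..j. card (cram K L P i))"
proof -
 have "1 <= card (cram K L P i)" for i
  using cram_facts[OF G P] by (simp add: Suc_le_eq card_gt_0_iff) blast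
 from herbrand_inverse[of "%i. card (cram K L P i)", OF this assms, of j] show ?thesis
  unfolding lev_def herbrand_psi_def herbrand_phi_def card_lram .
qed

lemma upper_trivial: "upper_ramification R K L P (real e) = {\<one>\<^bsub>local_Gal R K L P\<^esub>} <-> ctriv K L P e"
 "ctriv K L P e <-> cram K L P (lev (real e)) = {cidm L}"
proof -
 let ?m = "lev (real e)"
 have 1: "lram ?m = {\<one>\<^bsub>local_Gal R K L P\<^esub>} <-> card (lram ?m) = 1"
  using one_lram[of ?m] by (auto simp: card_1_singleton_iff)
 show 2: "ctriv K L P e <-> cram K L P ?m = {cidm L}"
 proof -
  have "cram K L P ?m = {cidm L} <-> (ALL j. cram K L P j ~= {cidm L} --> ~ ?m <= j)"
   using cram_facts[OF G P] by blast
  also have "\<dots> <-> ctriv K L P e" unfolding ctriv_def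
  proof (intro iff_allI imp_cong refl)
   fix j
   have "~ ?m <= j <-> real (\<Sum>i=1..j. card (cram K L P i)) < real (e * card (cram K L P 0))"
    using lev_iff by (simp add: not_le)
   thus "(~ ?m <= j) = ((\<Sum>i=1..j. card (cram K L P i)) < e * card (cram K L P 0))" by (simp only: of_nat_less_iff)
  qed
  finally show ?thesis by simp
 qed
 show "upper_ramification R K L P (real e) = {\<one>\<^bsub>local_Gal R K L P\<^esub>} <-> ctriv K L P e"
  using 1 cram_trivial_iff[OF G P] card_lram 2 by (simp add: upper_ramification_def lev_def)
qed

lemma global_upper: "global_upper_ramification R K L P v = inert (lev v)"
proof
 show "inert (lev v) <= global_upper_ramification R K L P v"
 proof
  fix rho assume r: "rho:inert (lev v)"
  show "rho:global_upper_ramification R K L P v"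
   using th_emb[OF inert_0[OF r]] inertD[OF inert_0[OF r]] r lram_image
    by (auto simp: global_upper_ramification_def upper_ramification_def lev_def)
 qed
 show "global_upper_ramification R K L P v <= inert (lev v)"
 using lram_image th_inj inert_0 by (fastforce simp: global_upper_ramification_def upper_ramification_def lev_def)
qed

end

context algnum
begin

definition glev :: "'a set => 'a set => 'a set => nat => nat" where
 "glev K L P n = nat \<lceil>herbrand_psi R K L P (real n)\<rceil>"

lemma complet_intro: "gx K L ==> P:primes R L ==> complet R E phi K L P"
 by unfold_locales

lemma glev_iff:
 assumes "gx K L" "P:primes R L"
 shows "glev K L P n <= j <-> real n * real (card (cram K L P 0)) <= real (\<Sum>i=1..j. card (cram K L P i))"
proof -
 interpret X: complet R E phi K L P using complet_intro[OF assms] .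
 show ?thesis using X.lev_iff by (simp add: glev_def X.lev_def)
qed

lemma glev_props:
 assumes "gx K L" "P:primes R L"
 shows "glev K L P 0 = 0" "m <= n ==> glev K L P m <= glev K L P n" "ctriv K L P n <-> cram K L P (glev K L P n) = {cidm L}"
  "upper_ramification R K L P (real n) = {\<one>\<^bsub>local_Gal R K L P\<^esub>} <-> ctriv K L P n"
  "global_upper_ramification R K L P (real n) = {rho:carrier (Gal R L K). conj L rho:cram K L P (glev K L P n)}"
proof -
 interpret X: complet R E phi K L P using complet_intro[OF assms] .
 show "ctriv K L P n <-> cram K L P (glev K L P n) = {cidm L}"
  "upper_ramification R K L P (real n) = {\<one>\<^bsub>local_Gal R K L P\<^esub>} <-> ctriv K L P n"
  "global_upper_ramification R K L P (real n) = {rho:carrier (Gal R L K). conj L rho:cram K L P (glev K L P n)}"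
   "glev K L P 0 = 0" using X.upper_trivial X.global_upper glev_iff[OF assms, of 0 0]
    by (auto simp: glev_def X.lev_def X.inert_def)
 assume mn: "m <= n"
 have "real m * real (card (cram K L P 0)) <= real n * real (card (cram K L P 0))" using mn by (intro mult_right_mono) auto
 thus "glev K L P m <= glev K L P n" using glev_iff[OF assms, of n "glev K L P n"] glev_iff[OF assms] by simp
qed

lemma glev_eq:
 assumes G: "gx K L" and P: "P:primes R L" and Q: "Q:primes R L" and eq: "P Int ints K = Q Int ints K"
 shows "glev K L P n = glev K L Q n"
proof -
 have "glev K L P n <= j <-> glev K L Q n <= j" for j
  unfolding glev_iff[OF G P] glev_iff[OF G Q] card_cram_eq[OF G P Q eq] ..
 thus ?thesis by (meson antisym order_refl)
qed

end

section \<open>Conductors and ramification subfields\<close>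

lemma (in algnum) Gal_group:
 assumes L: "subfield L R" "K <= L"
 shows "group (Gal R L K)" "\<one>\<^bsub>Gal R L K\<^esub> = (\<lambda>x\<in>L. x)" "(\<lambda>x\<in>L. x):carrier (Gal R L K)"
  "!!g k. g:carrier (Gal R L K) ==> k:carrier (Gal R L K) ==> g \<otimes>\<^bsub>Gal R L K\<^esub> k = compose L g k"
  "!!g k. g:carrier (Gal R L K) ==> k:carrier (Gal R L K) ==> compose L g k:carrier (Gal R L K)"
  "!!g. g:carrier (Gal R L K) ==> EX k:carrier (Gal R L K). ALL x:L. k (g x) = x & g (k x) = x"
proof -
 let ?G = "Gal R L K"
 have cl: "x \<oplus> y:L" "x \<otimes> y:L" "\<one>:L" if "x:L" "y:L" for x y
  using that L by auto
 have o: "\<one>:L" using L by simp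
 have B: "g:Bij L" if "g:carrier ?G" for g using that by (simp add: Bij_def Gal_iff)
 show one: "\<one>\<^bsub>?G\<^esub> = (\<lambda>x\<in>L. x)" by (simp add: Aut_over_def BijGroup_def)
 show mult: "g \<otimes>\<^bsub>?G\<^esub> k = compose L g k" if "g:carrier ?G" "k:carrier ?G" for g k
  using B[OF that(1)] B[OF that(2)] by (simp add: Aut_over_def BijGroup_def)
 show id: "(\<lambda>x\<in>L. x):carrier ?G"
  unfolding Gal_iff using cl o L by (auto simp: bij_betw_def)
 show comp: "compose L g k:carrier ?G" if g: "g:carrier ?G" and k: "k:carrier ?G" for g k
 proof -
  note gD = GalD[OF g] and kD = GalD[OF k]
  show ?thesis using gD kD cl o L compose_Bij[OF B[OF g] B[OF k]] unfolding Gal_iff by (auto simp: compose_def Bij_def)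
 qed
 show inv: "EX k:carrier ?G. ALL x:L. k (g x) = x & g (k x) = x" if g: "g:carrier ?G" for g
 proof -
  note gD = GalD[OF g]
  define k where "k = (\<lambda>x\<in>L. inv_into L g x)"
  have kg: "k (g x) = x" if "x:L" for x using that gD by (simp add: k_def)
  have gk: "g (k x) = x" "k x:L" if "x:L" for x using that gD f_inv_into_f[of x g L] inv_into_into[of x g L] by (auto simp: k_def)
  have eq: "k (g x \<oplus> g y) = x \<oplus> y" "k (g x \<otimes> g y) = x \<otimes> y" if "x:L" "y:L" for x y
   using kg cl[OF that] gD(6,7) that by metis+
  have "k (x \<oplus> y) = k x \<oplus> k y" "k (x \<otimes> y) = k x \<otimes> k y" if "x:L" "y:L" for x y
   using eq[OF gk(2)[OF that(1)] gk(2)[OF that(2)]] gk that by auto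
  moreover have "k x = x" if "x:K" for x using kg[of x] gD(3)[OF that] L that by auto
  moreover have "bij_betw k L L" using kg gk gD by (intro bij_betw_byWitness[where f' = g]) auto
  moreover have "k \<one> = \<one>" using kg[OF o] gD by simp
  ultimately have "k:carrier ?G" unfolding Gal_iff by (simp add: k_def)
  thus ?thesis using kg gk by auto
 qed
 show "group ?G"
 proof (rule groupI)
  fix g k l assume g: "g:carrier ?G" and k: "k:carrier ?G" and l: "l:carrier ?G"
  show "g \<otimes>\<^bsub>?G\<^esub> k:carrier ?G"
   "g \<otimes>\<^bsub>?G\<^esub> k \<otimes>\<^bsub>?G\<^esub> l = g \<otimes>\<^bsub>?G\<^esub> (k \<otimes>\<^bsub>?G\<^esub> l)" using mult comp g k l GalD[OF l] by (auto simp: compose_def)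
 next
  show "\<one>\<^bsub>?G\<^esub>:carrier ?G" using id one by simp
 next
  fix g assume g: "g:carrier ?G"
  show "\<one>\<^bsub>?G\<^esub> \<otimes>\<^bsub>?G\<^esub> g = g" using mult[OF id g] one GalD[OF g] by simp
  obtain k where k: "k:carrier ?G" "ALL x:L. k (g x) = x & g (k x) = x" using inv[OF g] by auto
  have "compose L k g = (\<lambda>x\<in>L. x)" using k by (auto simp: compose_def)
  thus "EX k:carrier ?G. k \<otimes>\<^bsub>?G\<^esub> g = \<one>\<^bsub>?G\<^esub>" using k mult[OF k(1) g] one by auto
 qed
qed

lemma (in algnum) fixed_field_generate:
 assumes L: "subfield L R" "K <= L" and H: "H <= carrier (Gal R L K)"
 shows "fixed_field L (generate (Gal R L K) H) = {x:L. ALL rho:H. rho x = x}"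
proof -
 note Gg = Gal_group[OF L]
 interpret group "Gal R L K" by (rule Gg)
 have "rho x = x" if x: "x:L" "ALL rho:H. rho x = x" and r: "rho:generate (Gal R L K) H" for rho x
  using r
 proof (induction rule: generate.induct)
  case one thus ?case using Gg x by simp
 next
  case (incl g) thus ?case using x by simp
 next
  case (inv g)
  have g: "g:carrier (Gal R L K)" using inv H by auto
  have "(inv\<^bsub>Gal R L K\<^esub> g \<otimes>\<^bsub>Gal R L K\<^esub> g) x = x" using Gg(2) x(1) g by simp
  hence "(inv\<^bsub>Gal R L K\<^esub> g) (g x) = x" using Gg(4)[OF inv_closed[OF g] g] x by (simp add: compose_def)
  moreover have "g x = x" using x inv by simp
  ultimately show ?case by simp
 next
  case (eng g k)
  thus ?case using Gg(4)[OF generate_in_carrier[OF H eng(1)] generate_in_carrier[OF H eng(2)]] x by (simp add: compose_def)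
 qed
 thus ?thesis using generate.incl by (fastforce simp: fixed_field_def)
qed

locale numf = algnum +
 fixes K assumes K: "subfield K R" and Kfin: "K:finite_extensions R prime_field"
begin

abbreviation "I == finite_galois_extensions R K"
abbreviation "IM == ideal_monoid R K"
abbreviation "v p d == ideal_val R K p d"
abbreviation "f L == ram_conductor R K L"
abbreviation "pK == primes R K"
abbreviation "OK == ints K"

lemma I_facts: assumes "L:I" shows "subfield L R" "K <= L" "L:finite_extensions R K"
 using assms by (auto simp: finite_galois_extensions_def finite_extensions_def)

lemma gx_I: assumes L: "L:I" shows "gx K L"
proof -
 note L' = I_facts[OF L]
 have "L:finite_extensions R prime_field" using L' Kfin telescopic_base_dim[OF prime_field_subfield K]
  by (auto simp: finite_extensions_def)
 then obtain Y where Y: "finite Y" "Y <= L" "!!M. subfield M R ==> prime_field <= M ==> Y <= M ==> L <= M"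
  using finite_extension_generators[OF prime_field_subfield] by metis
 have "Y <= carrier R" using Y(2) L'(1) subringE by (auto simp: subfield_def subdomain_def subcring_def)
 then obtain M where M: "M:finite_galois_extensions R prime_field" "Y <= M" using galois_closure[OF prime_field_subfield Y(1)]
  by auto
 hence "nf L" using L'(1) Y(3) by (auto simp: nf_def finite_galois_extensions_def finite_extensions_def)
 thus ?thesis unfolding gx_def using K L' galois_image[OF K L] by simp
qed

lemma I_sub: assumes L: "L:I" and M: "gx K M" "M <= L" shows "M:I"
 using galois_from_image[OF K finite_extension_sub[OF K I_facts(3)[OF L] nf_sub(1)[OF gxD(1)[OF M(1)]] gxD(4)[OF M(1)] M(2)]
  gxD(6)[OF M(1)]] .

lemma I_directed: "L:I ==> L':I ==> EX M:I. L <= M & L' <= M"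
 using galois_closure_two[OF K] I_facts by simp

lemma I_nonempty: "x:carrier R ==> EX L:I. x:L" using galois_closure[OF K, of "{x}"] by simp

lemma nK: "nf K" using I_nonempty[OF zero_closed] gxD(2) gx_I by auto

sublocale D: dedekind "\<O> K" by (rule nf_dedekind[OF nK])

lemmas IM = ideal_monoid_nzideals primes_maxs ideal_val_ival D.nzideals_simps

lemma IM_facts:
 assumes a: "a:carrier IM" and b: "b:carrier IM"
 shows "a divides\<^bsub>IM\<^esub> b <-> (ALL p:pK. v p a <= v p b)" "a \<otimes>\<^bsub>IM\<^esub> b:carrier IM"
  "p:pK ==> v p (a \<otimes>\<^bsub>IM\<^esub> b) = v p a + v p b"
  "(!!p. p:pK ==> v p a = v p b) ==> a = b" "ideal_gcd R K a b:carrier IM"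
  "p:pK ==> v p (ideal_gcd R K a b) = min (v p a) (v p b)" "\<one>\<^bsub>IM\<^esub>:carrier IM"
   "p:pK ==> v p \<one>\<^bsub>IM\<^esub> = 0"
proof -
 have nz: "D.nz a" "D.nz b" using a b by (simp_all only: IM mem_Collect_eq simp_thms)
 show "a divides\<^bsub>IM\<^esub> b <-> (ALL p:pK. v p a <= v p b)" "a \<otimes>\<^bsub>IM\<^esub> b:carrier IM"
  using D.nzideals_divides[OF nz] D.ival_subset[OF nz(2,1)] D.nz_prod[OF nz] by (simp only: IM mem_Collect_eq simp_thms)+
 show "p:pK ==> v p (a \<otimes>\<^bsub>IM\<^esub> b) = v p a + v p b" "(!!p. p:pK ==> v p a = v p b) ==> a = b"
  "ideal_gcd R K a b:carrier IM" using D.ival_prod[OF _ nz] D.ival_eqI[OF nz] D.gcd_ideal[OF nz]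
   by (simp only: IM mem_Collect_eq simp_thms)+
 show "p:pK ==> v p (ideal_gcd R K a b) = min (v p a) (v p b)" "\<one>\<^bsub>IM\<^esub>:carrier IM"
  using D.gcd_ideal[OF nz] D.nz_carrier by (simp only: IM mem_Collect_eq simp_thms)+
 show "p:pK ==> v p \<one>\<^bsub>IM\<^esub> = 0" using D.ival_carrier by (simp only: IM)
qed

lemma quot_val:
 assumes a: "a:carrier IM" and b: "b:carrier IM" and d: "b divides\<^bsub>IM\<^esub> a" and p: "p:pK"
 shows "v p (ideal_quot R K a b) = v p a - v p b"
proof -
 have nz: "D.nz a" "D.nz b" using a b by (simp_all only: IM mem_Collect_eq simp_thms)
 obtain c where c: "D.nz c" "a = b \<otimes>\<^bsub>IM\<^esub> c"
  using D.contains_divides[OF nz(2,1)] d D.nzideals_divides[OF nz(2,1)] by (auto simp only: IM)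
 have c': "c:carrier IM" using c by (simp only: IM mem_Collect_eq simp_thms)
 have "ideal_quot R K a b = c" unfolding ideal_quot_def
 proof (rule the_equality)
  fix e assume e: "e:carrier IM & a = b \<otimes>\<^bsub>IM\<^esub> e"
  thus "e = c" using D.ideal_cancel_eq[of b e c] nz c by (simp only: IM) blast
 qed (use c c' in blast)
 thus ?thesis using IM_facts(3)[OF b c' p] c by simp
qed

lemma ctriv_mono: "ctriv K L P m ==> m <= n ==> ctriv K L P n"
 unfolding ctriv_def by (meson less_le_trans mult_le_mono1)

lemma ctriv_ex: assumes "gx K L" "P:primes R L" shows "EX n. ctriv K L P n"
proof -
 obtain m where m: "cram K L P m = {cidm L}" using cram_facts[OF assms] by auto
 let ?n = "Suc (\<Sum>i=1..m. card (cram K L P i))"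
 have "ctriv K L P ?n" unfolding ctriv_def
 proof (intro allI impI)
  fix j assume j: "cram K L P j ~= {cidm L}"
  hence "j < m" using cram_facts(2,3)[OF assms] m by (metis not_le subset_singletonD empty_iff)
  hence "(\<Sum>i=1..j. card (cram K L P i)) <= (\<Sum>i=1..m. card (cram K L P i))" by (intro sum_mono2) auto
  hence "(\<Sum>i=1..j. card (cram K L P i)) < ?n * 1" by simp
  also have "1 <= card (cram K L P 0)" using cram_facts[OF assms] by (simp add: Suc_le_eq card_gt_0_iff) blast
  hence "?n * 1 <= ?n * card (cram K L P 0)" by (intro mult_left_mono) auto
  finally show "(\<Sum>i=1..j. card (cram K L P i)) < ?n * card (cram K L P 0)" .
 qed
 thus ?thesis by auto
qed

lemma ctriv_0: assumes "gx K L" "P:primes R L" shows "ctriv K L P 0 <-> cram K L P 0 = {cidm L}"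
proof -
 have "cram K L P j = {cidm L}" if "cram K L P 0 = {cidm L}" for j
  using cram_facts[OF assms] cram_facts(3)[OF assms, of 0 j] that by auto
 thus ?thesis unfolding ctriv_def by auto
qed

lemma over: assumes "gx K L" shows "P:primes R L ==> P Int OK:pK" "p:pK ==> EX P:primes R L. P Int OK = p"
 using contraction[OF gxD(1)[OF assms] _ K gxD(4)[OF assms]] lying_over[OF gxD(1)[OF assms] K gxD(4)[OF assms]] by auto

text \<open>The least n with trivial n-th upper group depends only on the prime below, by conjugacy,
  and is 0 at all but finitely many primes by \<open>finite_inertia\<close>. So exactly one ideal
  has these exponents, and the \<open>THE\<close> in \<open>ram_conductor\<close> denotes
  it.\<close>

lemma conductor:
 assumes G: "gx K L"
 shows "f L:carrier IM" "!!P n. P:primes R L ==> ctriv K L P n <-> v (P Int OK) (f L) <= n"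
proof -
 define k where "k p = (LEAST n. ctriv K L (SOME P. P:primes R L & P Int OK = p) n)" for p
 have k: "k (P Int OK) = (LEAST n. ctriv K L P n)" if P: "P:primes R L" for P
 proof -
  define Q where "Q = (SOME Q. Q:primes R L & Q Int OK = P Int OK)"
  have "Q:primes R L & Q Int OK = P Int OK" unfolding Q_def by (rule someI[of _ P]) (use P in simp)
  thus ?thesis using ctriv_eq[OF G _ P] unfolding k_def Q_def[symmetric] by metis
 qed
 have least: "ctriv K L P n <-> k (P Int OK) <= n" if P: "P:primes R L" for P n
 proof
  assume "ctriv K L P n" thus "k (P Int OK) <= n" unfolding k[OF P] by (rule Least_le)
 next
  show "k (P Int OK) <= n ==> ctriv K L P n" using ctriv_ex[OF G P] unfolding k[OF P] by (metis LeastI_ex ctriv_mono)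
 qed
 have "{p:pK. k p ~= 0} <= (%P. P Int OK) ` {P:primes R L. cram K L P 0 ~= {cidm L}}"
 proof
  fix p assume p: "p:{p:pK. k p ~= 0}"
  then obtain P where P: "P:primes R L" "P Int OK = p" using over[OF G] by auto
  thus "p:(%P. P Int OK) ` {P:primes R L. cram K L P 0 ~= {cidm L}}" using least[OF P(1)] ctriv_0[OF G P(1)] p by auto
 qed
 hence "finite {p:pK. k p ~= 0}" using finite_inertia[OF G] finite_surj by simp
 from D.ex1_ideal_ival[of k] this have ex: "EX! c. c:carrier IM & (ALL p:pK. v p c = k p)" by (simp only: IM)
 have spec: "(c:carrier IM & (ALL p:pK. ALL P:primes_over R K L p.
      v p c = (LEAST e. upper_ramification R K L P (real e) = {\<one>\<^bsub>local_Gal R K L P\<^esub>})))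
   <-> (c:carrier IM & (ALL p:pK. v p c = k p))" for c
 proof -
  have "(ALL p:pK. ALL P:primes_over R K L p. v p c = (LEAST e. upper_ramification R K L P (real e) = {\<one>\<^bsub>local_Gal R
   K L P\<^esub>}))
   <-> (ALL p:pK. ALL P:primes_over R K L p. v p c = k p)"
   using k glev_props[OF G] by (intro ball_cong refl) (auto simp: primes_over_eq)
  also have "\<dots> <-> (ALL p:pK. v p c = k p)" unfolding primes_over_eq using over[OF G] by auto
  finally show ?thesis by simp
 qed
 show "f L:carrier IM" "!!P n. P:primes R L ==> ctriv K L P n <-> v (P Int OK) (f L) <= n"
  using least over[OF G] theI'[OF ex] unfolding ram_conductor_def spec by auto
qed

text \<open>The descent of trivial upper groups in \<open>cram_ext\<close>, read as an inequality
  between least exponents.\<close>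

lemma conductor_mono:
 assumes "gx K L" "gx K L'" "L <= L'" "p:pK" shows "v p (f L) <= v p (f L')"
proof -
 obtain P where P: "P:primes R L'" "P Int OK = p" using over(2)[OF assms(2,4)] by auto
 have P': "P Int ints L:primes R L" using contraction[OF gxD(1)[OF assms(2)] P(1) nf_sub(1)[OF gxD(1)[OF assms(1)]] assms(3)] .
 have "P Int ints L Int OK = p" using P ints_mono[OF gxD(4)[OF assms(1)]] by auto
 thus ?thesis
  using cram_ext[OF assms(2,1,3) P(1)] conductor(2)[OF assms(2) P(1)] conductor(2)[OF assms(1) P'] P by simp
qed

text \<open>The fixed field of all upper ramification groups with index k(p). Allowing arbitrary
  exponent functions makes the intersection of two such fields correspond to the pointwise minimum
  (\<open>Fx_inter\<close>).\<close>

definition Fx :: "'a set => ('a set => nat) => 'a set" where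
 "Fx L k = {x:L. ALL P:primes R L. ALL t:cram K L P (glev K L P (k (P Int OK))). t (h x) = h x}"

lemma Fx_gx: assumes G: "gx K L" shows "gx K (Fx L k)"
proof -
 let ?N = "\<Union>P\<in>primes R L. cram K L P (glev K L P (k (P Int OK)))"
 have "gx K {x:L. ALL t:?N. t (h x) = h x}"
 proof (rule fixed_galois[OF G])
  show "?N <= cgal (h ` L) (h ` K)" using cramD by auto
  fix s t assume s: "s:cgal (h ` L) (h ` K)" and "t:?N"
  then obtain P where P: "P:primes R L" "t:cram K L P (glev K L P (k (P Int OK)))" by auto
  note Q = pullback[OF G P(1) s]
  show "EX u:?N. ALL x:h ` L. s (u x) = t (s x)" using cram_conj[OF G P(1) s P(2)] Q glev_eq[OF G P(1) Q(1)]
   by (metis (no_types, lifting) UN_iff)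
 qed
 also have "{x:L. ALL t:?N. t (h x) = h x} = Fx L k" by (auto simp: Fx_def)
 finally show ?thesis .
qed

lemma Fx_mono: assumes G: "gx K L" and le: "!!p. p:pK ==> k p <= k' p" shows "Fx L k <= Fx L k'"
proof -
 have "cram K L P (glev K L P (k' (P Int OK))) <= cram K L P (glev K L P (k (P Int OK)))" if P: "P:primes R L" for P
  by (rule cram_facts(3)[OF G P glev_props(2)[OF G P le[OF over(1)[OF G P]]]])
 thus ?thesis unfolding Fx_def by auto
qed

lemma Fx_inter: assumes G: "gx K L" shows "Fx L k Int Fx L k' = Fx L (%p. min (k p) (k' p))"
proof
 show "Fx L (%p. min (k p) (k' p)) <= Fx L k Int Fx L k'"
  using Fx_mono[OF G] Fx_mono[OF G] by simp
 show "Fx L k Int Fx L k' <= Fx L (%p. min (k p) (k' p))" unfolding Fx_def by (auto simp: min_def)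
qed

lemma Fx_cong: "gx K L ==> (!!p. p:pK ==> k p = k' p) ==> Fx L k = Fx L k'"
 by (intro subset_antisym Fx_mono) auto

lemma Fx_top: assumes G: "gx K L" shows "Fx L (%p. v p (f L)) = L"
proof -
 have "cram K L P (glev K L P (v (P Int OK) (f L))) = {cidm L}" if P: "P:primes R L" for P
  using glev_props[OF G P] conductor(2)[OF G P] by auto
 thus ?thesis by (auto simp: Fx_def cidm_def)
qed

text \<open>Exponents of a quotient of ideals subtract, the global images of the local groups are
  given by \<open>cram\<close>, and a fixed field can be tested on generators.\<close>

lemma D_field_eq:
 assumes G: "gx K L" and d: "d:carrier IM" "d divides\<^bsub>IM\<^esub> f L"
 shows "D_field R K L d = Fx L (%p. v p (f L) - v p d)"
proof -
 let ?k = "%p. v p (f L) - v p d" and ?c = "ideal_quot R K (f L) d"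
 let ?H = "\<Union>p\<in>pK. \<Union>P\<in>primes_over R K L p. global_upper_ramification R K L P (real (v p ?c))"
 have sL: "subfield L R" using nf_sub(1)[OF gxD(1)[OF G]] .
 have H: "?H = {rho:carrier (Gal R L K). EX P:primes R L. conj L rho:cram K L P (glev K L P (?k (P Int OK)))}"
 proof -
  have gl: "global_upper_ramification R K L P (real (v p ?c)) = {rho:carrier (Gal R L K). conj L rho:cram K L P (glev K L P (?k p))}"
   if "p:pK" "P:primes R L" for p P unfolding glev_props[OF G that(2)] quot_val[OF conductor(1)[OF G] d that(1)] ..
  show ?thesis
  proof (intro subset_antisym subsetI)
   fix rho assume "rho:?H"
   then obtain p P where p: "p:pK" "P:primes R L" "P Int OK = p" "rho:global_upper_ramification R K L P (real (v p ?c))"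
    by (auto simp only: primes_over_eq)
   thus "rho:{rho:carrier (Gal R L K). EX P:primes R L. conj L rho:cram K L P (glev K L P (?k (P Int OK)))}"
    unfolding gl[OF p(1,2)] by auto
  next
   fix rho assume "rho:{rho:carrier (Gal R L K). EX P:primes R L. conj L rho:cram K L P (glev K L P (?k (P Int OK)))}"
   then obtain P where P: "P:primes R L" "rho:carrier (Gal R L K)" "conj L rho:cram K L P (glev K L P (?k (P Int OK)))" by auto
   hence "rho:global_upper_ramification R K L P (real (v (P Int OK) ?c))" using gl[OF over(1)[OF G P(1)] P(1)] by simp
   moreover have "P:primes_over R K L (P Int OK)" using P by (simp add: primes_over_eq)
   ultimately show "rho:?H" using over(1)[OF G P(1)] by auto
  qed
 qed
 have "D_field R K L d = fixed_field L (generate (Gal R L K) ?H)" by (simp add: D_field_def ram_subfield_def)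
 also have "\<dots> = {x:L. ALL rho:?H. rho x = x}" by (rule fixed_field_generate[OF sL gxD(4)[OF G]]) (use H in blast)
 also have "\<dots> = Fx L ?k"
 proof -
  have LR: "L <= carrier R" using nf_sub(2)[OF gxD(1)[OF G]] .
  have "(ALL rho:?H. rho x = x) <-> (ALL P:primes R L. ALL t:cram K L P (glev K L P (?k (P Int OK))). t (h x) = h x)" if x:
   "x:L" for x
  proof -
   have r: "rho x = x <-> conj L rho (h x) = h x" if "rho:carrier (Gal R L K)" for rho
    using conj_apply[OF LR x] h_simps(9) GalD(1)[OF that x] LR x by auto
   show ?thesis
   proof
    assume a: "ALL rho:?H. rho x = x"
    show "ALL P:primes R L. ALL t:cram K L P (glev K L P (?k (P Int OK))). t (h x) = h x"
    proof (intro ballI)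
     fix P t assume P: "P:primes R L" and t: "t:cram K L P (glev K L P (?k (P Int OK)))"
     obtain rho where rho: "rho:carrier (Gal R L K)" "conj L rho = t" using conj_surj[OF sL gxD(4)[OF G] cramD(1)[OF t]] by auto
     thus "t (h x) = h x" using a r[OF rho(1)] P t unfolding H by auto
    qed
   next
    assume "ALL P:primes R L. ALL t:cram K L P (glev K L P (?k (P Int OK))). t (h x) = h x"
    thus "ALL rho:?H. rho x = x" unfolding H using r by auto
   qed
  qed
  thus ?thesis unfolding Fx_def by auto
 qed
 finally show ?thesis .
qed

end

section \<open>The largest subextension unramified outside a set of primes\<close>

context numf
begin

text \<open>The exponents of the conductor divided by e_T. They impose no condition at primes in
  \<open>S\<close>, where the group is trivial, and full inertia elsewhere, since
  \<open>glev\<close> sends 0 to 0.\<close>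

definition kS :: "'a set set => 'a set => 'a set => nat" where "kS S L p = (if p:S then v p (f L) else 0)"

abbreviation FS :: "'a set set => 'a set => 'a set" where "FS S L == Fx L (kS S L)"

lemma subfieldD: assumes "subfield F R"
 shows "subring F R" "x:F ==> x:carrier R" "x:F ==> y:F ==> x \<oplus> y:F" "x:F ==> y:F ==> x \<otimes> y:F"
  "\<one>:F" "\<zero>:F" "x:F ==> \<ominus> x:F" "x:F ==> x ~= \<zero> ==> inv x:F"
proof -
 show s: "subring F R" using assms by (simp add: subfield_def subdomain_def subcring_def)
 show "x:F ==> x:carrier R" "x:F ==> y:F ==> x \<oplus> y:F" "x:F ==> y:F ==> x \<otimes> y:F"
  "\<one>:F" "\<zero>:F" "x:F ==> \<ominus> x:F" "x:F ==> x ~= \<zero> ==> inv x:F"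
   using subringE[OF s] subfield_m_inv[OF assms] by auto
qed

lemma subfield_intro:
 assumes "M <= carrier R" "\<one>:M" "!!x y. x:M ==> y:M ==> x \<oplus> y:M & x \<otimes> y:M"
  "!!x. x:M ==> \<ominus> x:M" "!!x. x:M ==> x ~= \<zero> ==> inv x:M"
 shows "subfield M R"
 by (rule subfieldI'[OF subringI]) (use assms in auto)

text \<open>With the exponents \<open>kS\<close> the defining groups are the inertia groups at
  primes outside \<open>S\<close>, so \<open>unramified_iff\<close> applies prime by prime.\<close>

lemma FS_char:
 assumes L: "L:I" and F: "subfield F R" "K <= F" "F <= L"
 shows "F <= FS S L <-> (ALL p:pK - S. unramified_at R K F p)"
proof -
 note G = gx_I[OF L]
 have c: "cram K L P (glev K L P (kS S L (P Int OK))) = (if P Int OK:S then {cidm L} else cram K L P 0)" if P: "P:primes R L"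
  for P
  using glev_props[OF G P] conductor(2)[OF G P] by (auto simp: kS_def)
 have "F <= FS S L <-> (ALL P:primes R L. P Int OK ~: S --> (ALL s:cram K L P 0. ALL x:F. s (h x) = h x))"
 proof -
  have "F <= FS S L <-> (ALL P:primes R L. ALL t:cram K L P (glev K L P (kS S L (P Int OK))). ALL x:F. t (h x) = h x)"
   unfolding Fx_def using F by auto
  also have "\<dots> <-> (ALL P:primes R L. P Int OK ~: S --> (ALL s:cram K L P 0. ALL x:F. s (h x) = h x))"
   by (intro ball_cong refl) (use c F(3) in \<open>auto simp: cidm_def\<close>)
  finally show ?thesis .
 qed
 also have "\<dots> <-> (ALL p:pK - S. ALL P:primes_over R K L p. ALL s:cram K L P 0. ALL x:h ` F. s x = x)"
  unfolding primes_over_eq using over[OF G] by blast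
 also have "\<dots> <-> (ALL p:pK - S. unramified_at R K F p)"
  using unramified_iff[OF G F] by simp
 finally show ?thesis .
qed

lemma FS_sub: "L:I ==> FS S L <= L" "L:I ==> subfield (FS S L) R" "L:I ==> K <= FS S L" "L:I ==> gx K (FS S L)"
 "L:I ==> FS S L:I"
proof -
 assume L: "L:I"
 show s: "FS S L <= L" by (auto simp: Fx_def)
 show G: "gx K (FS S L)" by (rule Fx_gx[OF gx_I[OF L]])
 show "subfield (FS S L) R" "K <= FS S L" using nf_sub[OF gxD(1)[OF G]] gxD[OF G] by auto
 show "FS S L:I" by (rule I_sub[OF L G s])
qed

text \<open>Both sides are the largest subfield of \<open>L\<close> unramified outside
  \<open>S\<close>: use \<open>FS_char\<close> once in \<open>L\<close> and once in
  \<open>L'\<close>.\<close>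

lemma FS_restrict: assumes L: "L:I" "L':I" "L <= L'" shows "FS S L = L Int FS S L'"
proof
 show "FS S L <= L Int FS S L'" using FS_sub(1)[OF L(1)] FS_char[OF L(1) FS_sub(2,3,1)[OF L(1)], of S S] FS_char[OF L(2)
  FS_sub(2,3)[OF L(1)], of S S] L by auto
 let ?F = "L Int FS S L'"
 note a = subfieldD[OF I_facts(1)[OF L(1)]] and b = subfieldD[OF FS_sub(2)[OF L(2), of S]]
 have sF: "subfield ?F R" by (rule subfield_intro) (use a b in auto)
 have KF: "K <= ?F" using I_facts[OF L(1)] FS_sub[OF L(2)] by simp
 show "?F <= FS S L" using FS_char[OF L(2) sF KF] FS_char[OF L(1) sF KF] L by auto
qed

definition U :: "'a set set => 'a set" where "U S = (\<Union>L\<in>I. FS S L)"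

lemma U_int: assumes L: "L:I" shows "U S Int L = FS S L"
proof
 show "FS S L <= U S Int L" using L FS_sub[OF L] by (auto simp: U_def)
 show "U S Int L <= FS S L"
 proof
  fix x assume "x:U S Int L"
  then obtain L0 where L0: "L0:I" "x:FS S L0" "x:L" by (auto simp: U_def)
  obtain M where M: "M:I" "L <= M" "L0 <= M" using I_directed[OF L L0(1)] by auto
  show "x:FS S L" using FS_restrict[OF L M(1,2)] L0 FS_restrict[OF L0(1) M(1,3)] L0 by simp
 qed
qed

lemma U_sub: "subfield (U S) R" "K <= U S"
proof -
 have two: "EX L:I. x:FS S L & y:FS S L" if xy: "x:U S" "y:U S" for x y
 proof -
  obtain L0 L1 where L0: "L0:I" "x:FS S L0" "L1:I" "y:FS S L1" using xy by (auto simp: U_def)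
  obtain M where M: "M:I" "L0 <= M" "L1 <= M" using I_directed[OF L0(1,3)] by auto
  thus ?thesis using FS_restrict[OF L0(1) M(1,2)] FS_restrict[OF L0(3) M(1,3)] L0 by auto
 qed
 have in_U: "L:I ==> x:FS S L ==> x:U S" for L x by (auto simp: U_def)
 obtain L where L: "L:I" using I_nonempty[OF zero_closed] by auto
 show "K <= U S" using FS_sub(3)[OF L] in_U[OF L] by auto
 show "subfield (U S) R"
 proof (rule subfield_intro)
  show "\<one>:U S" using in_U[OF L] subfieldD[OF FS_sub(2)[OF L]] by simp
  fix x y assume "x:U S" "y:U S"
  then obtain M where "M:I" "x:FS S M" "y:FS S M" using two by auto
  thus "x \<oplus> y:U S & x \<otimes> y:U S" using in_U subfieldD[OF FS_sub(2)[of M S]] by simp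
 qed (use two in_U subfieldD(2,7,8)[OF FS_sub(2)] in blast)+
qed

text \<open>For maximality, an element of an extension \<open>M\<close> unramified outside
  \<open>S\<close> lies in some finite Galois \<open>L\<close>; the finite field
  \<open>M Int L\<close> then lies in \<open>FS S L\<close>.\<close>

lemma max_unramified: "max_unramified_extension R K S = U S"
 unfolding max_unramified_extension_def
proof (rule Greatest_equality)
 show "unramified_outside R K S (U S)" unfolding unramified_outside_def
 proof (intro conjI ballI impI U_sub)
  fix p F assume p: "p:pK - S" and F: "F:finite_extensions R K" "F <= U S"
  obtain L where L: "L:I" "F <= L" using galois_closure_two[OF K F(1,1)] by auto
  show "unramified_at R K F p" using FS_char[OF L(1) _ _ L(2)] F p U_int[OF L(1), of S] F L by (auto simp: finite_extensions_def)
 qed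
 fix M assume M: "unramified_outside R K S M"
 hence M': "subfield M R" "K <= M" by (auto simp: unramified_outside_def)
 show "M <= U S"
 proof
  fix x assume x: "x:M"
  obtain L where L: "L:I" "x:L" using I_nonempty subfieldD(2)[OF M'(1) x] by auto
  note a = subfieldD[OF I_facts(1)[OF L(1)]] and b = subfieldD[OF M'(1)]
  have sF: "subfield (M Int L) R" by (rule subfield_intro) (use a b in auto)
  have KF: "K <= M Int L" using M' I_facts[OF L(1)] by simp
  have "M Int L:finite_extensions R K" by (rule finite_extension_sub[OF K I_facts(3)[OF L(1)] sF KF]) blast
  thus "x:U S" using x L FS_char[OF L(1) sF KF, of S] M by (auto simp: U_def unramified_outside_def)
 qed
qed

definition ee :: "'a set set => 'a set => 'a set" where "ee S L = idem_ideal R K L (S Int ramified_primes R K L)"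

text \<open>Explains why intersecting \<open>S\<close> with the ramified primes does not change the
  exponents of \<open>ee\<close>: at unramified primes the conductor has exponent 0 anyway.\<close>

lemma conductor_unramified:
 assumes L: "L:I" and p: "p:pK" "p ~: ramified_primes R K L"
 shows "v p (f L) = 0"
proof -
 note G = gx_I[OF L]
 obtain P where P: "P:primes R L" "P Int OK = p" using over(2)[OF G p(1)] by auto
 have fixd: "ALL s:cram K L P 0. ALL x:h ` L. s x = x"
  using unramified_iff[OF G I_facts(1,2)[OF L] subset_refl p(1)] P p by (simp add: primes_over_eq ramified_primes_def)
 have "s = cidm L" if s: "s:cram K L P 0" for s
 by (metis cgal_eqI cramD s cram_facts G P fixd)
 thus ?thesis using conductor(2)[OF G P(1), of 0] P ctriv_0[OF G P(1)] cram_facts[OF G P(1)] by blast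
qed

lemma ee: assumes L: "L:I"
 shows "ee S L:carrier IM" "p:pK ==> v p (ee S L) = (if p:S then 0 else v p (f L))" "ee S L divides\<^bsub>IM\<^esub> f L"
  "D_field R K L (ee S L) = FS S L"
proof -
 note G = gx_I[OF L] and fL = conductor(1)[OF gx_I[OF L]]
 let ?k = "%p. if p:S Int ramified_primes R K L then 0 else v p (f L)"
 have "finite {p:pK. 0 < v p (f L)}" using D.finite_ival_pos fL by (simp only: IM mem_Collect_eq)
 hence "finite {p:pK. ?k p ~= 0}" by (rule rev_finite_subset) auto
 from D.ex1_ideal_ival[of ?k] this have ex: "EX! c. c:carrier IM & (ALL p:pK. v p c = ?k p)" by (simp only: IM)
 have e: "ee S L:carrier IM & (ALL p:pK. v p (ee S L) = ?k p)"
  unfolding ee_def idem_ideal_def by (rule theI'[OF ex])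
 thus eI: "ee S L:carrier IM" by simp
 show ev: "v p (ee S L) = (if p:S then 0 else v p (f L))" if "p:pK" for p
  using e that conductor_unramified[OF L that] by auto
 show d: "ee S L divides\<^bsub>IM\<^esub> f L" using IM_facts[OF eI fL] ev by simp
 show "D_field R K L (ee S L) = FS S L" unfolding D_field_eq[OF G eI d]
  by (rule Fx_cong[OF G]) (use ev in \<open>simp add: kS_def\<close>)
qed

text \<open>At primes in \<open>S\<close> the exponent of e_T is 0 and the quotient has exponent
  v(f) - v(d); elsewhere e_T has exponent v(f) and the quotient has exponent 0. In both cases this
  is the minimum of the exponents for e_T and for \<open>d\<close>, which corresponds to the
  intersection of their fields.\<close>

lemma ee_mult:
 assumes L: "L:I" and d: "d:carrier IM" "d divides\<^bsub>IM\<^esub> f L"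
 shows "D_field R K L (ideal_gcd R K (f L) (ee S L \<otimes>\<^bsub>IM\<^esub> d)) = FS S L Int D_field R K L d"
  "D_field R K L (ideal_gcd R K (f L) (d \<otimes>\<^bsub>IM\<^esub> ee S L)) = FS S L Int D_field R K L d"
proof -
 note G = gx_I[OF L] and fL = conductor(1)[OF gx_I[OF L]]
 have gcd: "D_field R K L (ideal_gcd R K (f L) c) = FS S L Int D_field R K L d"
  if c: "c:carrier IM" "!!p. p:pK ==> v p c = v p (ee S L) + v p d" for c
 proof -
  note g = IM_facts(5,6)[OF fL c(1)]
  have gd: "ideal_gcd R K (f L) c divides\<^bsub>IM\<^esub> f L" using IM_facts[OF g(1) fL] g by simp
  have "v p d <= v p (f L)" if "p:pK" for p using IM_facts[OF d(1) fL] d that by simp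
  hence "v p (f L) - v p (ideal_gcd R K (f L) c) = min (kS S L p) (v p (f L) - v p d)" if "p:pK" for p
   using g(2)[OF that] c(2)[OF that] ee(2)[OF L that] by (auto simp: kS_def)
  thus ?thesis unfolding D_field_eq[OF G g(1) gd] D_field_eq[OF G d] Fx_inter[OF G] by (rule Fx_cong[OF G])
 qed
 note e = ee(1)[OF L, of S]
 show "D_field R K L (ideal_gcd R K (f L) (ee S L \<otimes>\<^bsub>IM\<^esub> d)) = FS S L Int D_field R K L d"
  "D_field R K L (ideal_gcd R K (f L) (d \<otimes>\<^bsub>IM\<^esub> ee S L)) = FS S L Int D_field R K L d"
   using gcd IM_facts[OF e d(1)] IM_facts[OF d(1) e] by auto
qed

lemma restrict_Gal:
 assumes M: "gx K M" and N: "subfield N R" "M <= N" and g: "g:carrier (Gal R N K)"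
 shows "restrict g M:carrier (Gal R M K)"
proof -
 have KN: "K <= N" and NR: "N <= carrier R" using gxD[OF M] N by auto
 have MR: "M <= carrier R" using NR N(2) by simp
 obtain r where r: "r:carrier (Gal R M K)" "conj M r = restrict (conj N g) (h ` M)"
  using conj_surj[OF nf_sub(1)[OF gxD(1)[OF M]] gxD(4)[OF M]] galois_stable[OF gxD(6)[OF M] subfield_image(1)[OF N(1)] _
   conj_in[OF N(1) KN g]] N by auto
 have "r x = g x" if x: "x:M" for x
 proof -
  have xN: "x:N" using x N by auto
  have "h (r x) = h (g x)" using conj_apply[OF MR x, of r] conj_apply[OF NR xN] r x by simp
  moreover have "r x:carrier R" "g x:carrier R" using GalD(1)[OF r(1) x] GalD(1)[OF g xN] MR NR by auto
  ultimately show ?thesis using h_simps by simp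
 qed
 hence "restrict g M = r" using GalD[OF r(1)] by (auto simp: extensional_def)
 thus ?thesis using r by simp
qed

end

section \<open>The inverse limit and its regular class\<close>

context numf
begin

abbreviation "Dm L == D_monoid R K L"
abbreviation "DF L d == D_field R K L d"
abbreviation "pr L a b == ideal_gcd R K (f L) (a \<otimes>\<^bsub>IM\<^esub> b)"

definition dv :: "'a set => 'a set => bool" where "dv L d <-> L:I & d:carrier IM & d divides\<^bsub>IM\<^esub> f L"

lemma f_IM: "L:I ==> f L:carrier IM" using conductor(1)[OF gx_I] .

lemma DF: assumes "dv L d"
 shows "gx K (DF L d)" "DF L d <= L" "subfield (DF L d) R" "K <= DF L d" "p:pK ==> v p d <= v p (f L)"
  "dv L d' ==> (!!p. p:pK ==> v p d <= v p d') ==> DF L d' <= DF L d"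
proof -
 have L: "L:I" and d: "d:carrier IM" "d divides\<^bsub>IM\<^esub> f L" using assms by (auto simp: dv_def)
 note G = gx_I[OF L]
 have eq: "DF L d = Fx L (%p. v p (f L) - v p d)" by (rule D_field_eq[OF G d])
 show g: "gx K (DF L d)" unfolding eq by (rule Fx_gx[OF G])
 show "DF L d <= L" unfolding eq by (auto simp: Fx_def)
 show "subfield (DF L d) R" "K <= DF L d" using nf_sub[OF gxD(1)[OF g]] gxD[OF g] by auto
 show "v p d <= v p (f L)" if "p:pK" using IM_facts[OF d(1) f_IM[OF L]] d that by simp
 assume d': "dv L d'" and le: "!!p. p:pK ==> v p d <= v p d'"
 have "DF L d' = Fx L (%p. v p (f L) - v p d')" by (rule D_field_eq[OF G]) (use d' in \<open>auto simp: dv_def\<close>)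
 thus "DF L d' <= DF L d" unfolding eq using Fx_mono[OF G] le diff_le_mono2 by simp
qed

lemma pr: assumes "dv L a" "dv L b"
 shows "dv L (pr L a b)" "p:pK ==> v p (pr L a b) = min (v p (f L)) (v p a + v p b)"
  "DF L (pr L a b) <= DF L a" "DF L (pr L a b) <= DF L b"
proof -
 have L: "L:I" and a: "a:carrier IM" and b: "b:carrier IM" using assms by (auto simp: dv_def)
 note m = IM_facts(2,3)[OF a b] and g = IM_facts(5,6)[OF f_IM[OF L] IM_facts(2)[OF a b]]
 show v: "v p (pr L a b) = min (v p (f L)) (v p a + v p b)" if "p:pK" for p using g(2)[OF that] m(2)[OF that] by simp
 show d: "dv L (pr L a b)" using L g v IM_facts(1)[OF g(1) f_IM[OF L]] by (simp add: dv_def)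
 show "DF L (pr L a b) <= DF L a" "DF L (pr L a b) <= DF L b"
  using DF(6)[OF assms(1) d] DF(6)[OF assms(2) d] DF[OF assms(1)] DF[OF assms(2)] v by auto
qed

lemma dv_eqI: "dv L a ==> dv L b ==> (!!p. p:pK ==> v p a = v p b) ==> a = b"
 using IM_facts by (auto simp: dv_def)

lemma Dm_mem: "x:carrier (Dm L) & L:I <-> dv L (fst x) & snd x:carrier (Gal R (DF L (fst x)) K)"
 by (cases x) (auto simp: D_monoid_def dv_def)

lemma DmD: assumes "L:I" "x:carrier (Dm L)"
 shows "dv L (fst x)" "snd x:carrier (Gal R (DF L (fst x)) K)" "z:DF L (fst x) ==> snd x z:DF L (fst x)"
  "snd x:extensional (DF L (fst x))"
 using Dm_mem[of x L] assms GalD by auto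

lemma Dm_stable:
 assumes L: "L:I" and x: "x:carrier (Dm L)" and d: "dv L d" "DF L d <= DF L (fst x)" and z: "z:DF L d"
 shows "snd x z:DF L d"
 using GalD(1)[OF restrict_Gal[OF DF(1)[OF d(1)] DF(3)[OF DmD(1)[OF L x]] d(2) DmD(2)[OF L x]] z] z by simp

lemma Dm_mult:
 assumes L: "L:I" and x: "x:carrier (Dm L)" and y: "y:carrier (Dm L)"
 shows "x \<otimes>\<^bsub>Dm L\<^esub> y = (pr L (fst x) (fst y), \<lambda>z\<in>DF L (pr L (fst x) (fst y)). snd x (snd y z))"
  "x \<otimes>\<^bsub>Dm L\<^esub> y:carrier (Dm L)"
proof -
 let ?c = "pr L (fst x) (fst y)" and ?M = "DF L (pr L (fst x) (fst y))"
 note p = pr[OF DmD(1)[OF L x] DmD(1)[OF L y]]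
 have rx: "restrict (snd x) ?M:carrier (Gal R ?M K)" and ry: "restrict (snd y) ?M:carrier (Gal R ?M K)"
  using restrict_Gal[OF DF(1)[OF p(1)] DF(3)[OF DmD(1)[OF L x]] p(3) DmD(2)[OF L x]] restrict_Gal[OF DF(1)[OF p(1)] DF(3)[OF
   DmD(1)[OF L y]] p(4) DmD(2)[OF L y]] by auto
 note Gg = Gal_group[OF DF(3,4)[OF p(1)]]
 have xy: "x \<otimes>\<^bsub>Dm L\<^esub> y = (?c, compose ?M (restrict (snd x) ?M) (restrict (snd y) ?M))"
  using Gg(4)[OF rx ry] by (simp add: D_monoid_def Let_def split_beta)
 show "x \<otimes>\<^bsub>Dm L\<^esub> y = (?c, \<lambda>z\<in>?M. snd x (snd y z))"
  "x \<otimes>\<^bsub>Dm L\<^esub> y:carrier (Dm L)"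
   using xy Dm_stable[OF L y p(1,4)] Dm_mem[of "x \<otimes>\<^bsub>Dm L\<^esub> y" L] p Gg(5)[OF rx ry]
    by (auto simp: compose_def)
qed

lemma Dm_assoc:
 assumes L: "L:I" and x: "x:carrier (Dm L)" and y: "y:carrier (Dm L)" and z: "z:carrier (Dm L)"
 shows "x \<otimes>\<^bsub>Dm L\<^esub> y \<otimes>\<^bsub>Dm L\<^esub> z = x \<otimes>\<^bsub>Dm L\<^esub> (y \<otimes>\<^bsub>Dm L\<^esub> z)"
proof -
 note xd = DmD(1)[OF L x] and yd = DmD(1)[OF L y] and zd = DmD(1)[OF L z]
 note xy = Dm_mult[OF L x y] and yz = Dm_mult[OF L y z]
 note p1 = pr[OF xd yd] and p2 = pr[OF yd zd]
 let ?a = "pr L (pr L (fst x) (fst y)) (fst z)" and ?b = "pr L (fst x) (pr L (fst y) (fst z))"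
 note q1 = pr[OF p1(1) zd] and q2 = pr[OF xd p2(1)]
 have ab: "?a = ?b" using q1 q2 p1 p2 by (intro dv_eqI[OF q1(1) q2(1)]) simp
 have "(\<lambda>w\<in>DF L ?a. snd (x \<otimes>\<^bsub>Dm L\<^esub> y) (snd z w)) = (\<lambda>w\<in>DF L ?a. snd x (snd (y \<otimes>\<^bsub>Dm L\<^esub> z) w))"
 proof (rule restrict_ext)
  fix w assume w: "w:DF L ?a"
  show "snd (x \<otimes>\<^bsub>Dm L\<^esub> y) (snd z w) = snd x (snd (y \<otimes>\<^bsub>Dm L\<^esub> z) w)"
   using q1 q2(4) w ab Dm_stable[OF L z q1(1,4) w] unfolding xy yz by auto
 qed
 thus ?thesis using Dm_mult[OF L xy(2) z] Dm_mult[OF L x yz(2)] ab by (simp add: xy yz)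
qed

abbreviation "DD == DG R K"
abbreviation DD_mult (infixl "*D" 70) where "x *D y == monoid.mult DD x y"

lemma DG_mem: "x:carrier DD <-> x:extensional I & (ALL L:I. x L:carrier (Dm L)) &
  (ALL L:I. ALL L':I. L <= L' --> ideal_gcd R K (fst (x L')) (f L) = fst (x L) &
    restrict (snd (x L')) (DF L (fst (x L))) = snd (x L))"
proof -
 have "D_transition R K L y = z <-> ideal_gcd R K (fst y) (f L) = fst z & restrict (snd y) (DF L (fst z)) = snd z" for L y z
  by (cases y; cases z) (auto simp: D_transition_def Let_def)
 thus ?thesis by (auto simp: DG_def Let_def PiE_iff)
qed

lemma DG_mult: "x *D y = (\<lambda>L\<in>I. x L \<otimes>\<^bsub>Dm L\<^esub> y L)" by (simp add: DG_def Let_def)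

lemma DGD: assumes x: "x:carrier DD" and L: "L:I"
 shows "x L:carrier (Dm L)" "dv L (fst (x L))"
  "L':I ==> L <= L' ==> p:pK ==> v p (fst (x L)) = min (v p (fst (x L'))) (v p (f L))"
  "L':I ==> L <= L' ==> restrict (snd (x L')) (DF L (fst (x L))) = snd (x L)"
  "L':I ==> L <= L' ==> DF L (fst (x L)) <= DF L' (fst (x L'))"
proof -
 show xL: "x L:carrier (Dm L)" using x L DG_mem by simp
 show d: "dv L (fst (x L))" by (rule DmD[OF L xL])
 assume L': "L':I" "L <= L'"
 have xL': "x L':carrier (Dm L')" and c: "ideal_gcd R K (fst (x L')) (f L) = fst (x L)" and r:
  "restrict (snd (x L')) (DF L (fst (x L))) = snd (x L)" using x L' DG_mem L by auto
 show "restrict (snd (x L')) (DF L (fst (x L))) = snd (x L)" by (rule r)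
 show "v p (fst (x L)) = min (v p (fst (x L'))) (v p (f L))" if "p:pK"
  using IM_facts(6)[OF _ f_IM[OF L] that, of "fst (x L')"] DmD[OF L'(1) xL'] c by (simp add: dv_def)
 \<comment> \<open>The inclusion of fields is extracted from the element x. For z in the first field
   but not in the second, both z and z + 1 lie outside the domain of the map at \<open>L'\<close>,
   so both would be sent to \<open>undefined\<close> by its restriction, the injective map at
   \<open>L\<close>.\<close>
 show "DF L (fst (x L)) <= DF L' (fst (x L'))"
 proof (rule ccontr)
  let ?A = "DF L (fst (x L))" and ?B = "DF L' (fst (x L'))"
  assume "~ ?A <= ?B"
  then obtain z where z: "z:?A" "z ~: ?B" by auto
  note A = subfieldD[OF DF(3)[OF d]] and B = subfieldD[OF DF(3)[OF DmD(1)[OF L'(1) xL']]]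
  have zR: "z:carrier R" by (rule A(2)[OF z(1)])
  have "z \<oplus> \<one> ~: ?B"
  proof
   assume "z \<oplus> \<one>:?B"
   thus False using z zR B(3,5,7) by (fastforce simp: a_assoc r_neg)
  qed
  hence "snd (x L) (z \<oplus> \<one>) = snd (x L) z" using DmD[OF L'(1) xL'] z unfolding r[symmetric]
   by (simp add: extensional_def)
  thus False using zR GalD[OF DmD(2)[OF L xL]] z A(3)[OF z(1) A(5)] by (simp add: inj_on_eq_iff)
 qed
qed

text \<open>The product at \<open>L'\<close> is a function on its own field only; \<open>inc\<close>
  places the field at \<open>L\<close> inside it, so that restricting the product compares genuine
  values.\<close>

lemma DG_closed:
 assumes x: "x:carrier DD" and y: "y:carrier DD"
  and inc: "!!L L'. L:I ==> L':I ==> L <= L' ==> DF L (pr L (fst (x L)) (fst (y L))) <= DF L' (pr L' (fst (x L')) (fst (y L')))"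
 shows "x *D y:carrier DD"
 unfolding DG_mem DG_mult
proof (intro conjI ballI impI)
 fix L assume L: "L:I"
 note m = Dm_mult[OF L DGD(1)[OF x L] DGD(1)[OF y L]] and p = pr[OF DGD(2)[OF x L] DGD(2)[OF y L]]
 show "(\<lambda>L\<in>I. x L \<otimes>\<^bsub>Dm L\<^esub> y L) L:carrier (Dm L)" using m L by simp
 fix L' assume L': "L':I" "L <= L'"
 note m' = Dm_mult[OF L'(1) DGD(1)[OF x L'(1)] DGD(1)[OF y L'(1)]] and p' = pr[OF DGD(2)[OF x L'(1)] DGD(2)[OF y L'(1)]]
 let ?c = "pr L (fst (x L)) (fst (y L))" and ?c' = "pr L' (fst (x L')) (fst (y L'))"
 have c': "?c':carrier IM" using p' by (simp add: dv_def)
 note g = IM_facts(5,6)[OF c' f_IM[OF L]]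
 have "ideal_gcd R K ?c' (f L) = ?c"
 proof (rule dv_eqI)
  show "dv L ?c" by (rule p)
  show "dv L (ideal_gcd R K ?c' (f L))" using L g IM_facts(1)[OF g(1) f_IM[OF L]] by (simp add: dv_def)
  fix q assume q: "q:pK"
  show "v q (ideal_gcd R K ?c' (f L)) = v q ?c"
   using g(2)[OF q] p(2)[OF q] p'(2)[OF q] DGD(3)[OF x L L' q] DGD(3)[OF y L L' q] conductor_mono[OF gx_I[OF L] gx_I[OF L'(1)]
    L'(2) q] by linarith
 qed
 thus "ideal_gcd R K (fst ((\<lambda>L\<in>I. x L \<otimes>\<^bsub>Dm L\<^esub> y L) L')) (f L) = fst ((\<lambda>L\<in>I. x L \<otimes>\<^bsub>Dm L\<^esub> y L) L)"
  using L L' m m' by simp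
 have "restrict (\<lambda>z\<in>DF L' ?c'. snd (x L') (snd (y L') z)) (DF L ?c) = (\<lambda>z\<in>DF L ?c. snd (x L) (snd (y L) z))"
 proof (rule restrict_ext)
  fix z assume z: "z:DF L ?c"
  have z': "z:DF L' ?c'" "z:DF L (fst (y L))" using inc[OF L L'] z p by auto
  have "snd (y L) z:DF L (fst (x L))" using Dm_stable[OF L DGD(1)[OF y L] p(1,4) z] p by auto
  thus "(\<lambda>z\<in>DF L' ?c'. snd (x L') (snd (y L') z)) z = snd (x L) (snd (y L) z)"
   using z' DGD(4)[OF x L L'] DGD(4)[OF y L L'] by (metis restrict_apply')
 qed
 thus "restrict (snd ((\<lambda>L\<in>I. x L \<otimes>\<^bsub>Dm L\<^esub> y L) L')) (DF L (fst ((\<lambda>L\<in>I. x L \<otimes>\<^bsub>Dm L\<^esub> y L) L))) = snd ((\<lambda>L\<in>I. x L \<otimes>\<^bsub>Dm L\<^esub> y L) L)"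
  using L L' m m' by simp
qed simp

definition Hs :: "'a set set => ('a set => 'a set \<times> ('a => 'a)) set" where
 "Hs S = {y:carrier DD. ALL L:I. fst (y L) = ee S L}"

text \<open>With a factor in \<open>Hs\<close> the field of a product is
  \<open>FS S L Int DF L (fst (z L))\<close> by \<open>ee_mult\<close>. Both parts grow with
  \<open>L\<close>: the first by \<open>FS_restrict\<close>, the second because z belongs to the
  limit.\<close>

lemma Hs_closed:
 assumes y: "y:Hs S" and z: "z:carrier DD"
 shows "y *D z:carrier DD" "z *D y:carrier DD"
proof -
 have y': "y:carrier DD" "!!L. L:I ==> fst (y L) = ee S L" using y by (auto simp: Hs_def)
 have inc: "FS S L Int DF L (fst (z L)) <= FS S L' Int DF L' (fst (z L'))" if "L:I" "L':I" "L <= L'" for L L'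
  using FS_restrict[OF that] DGD(5)[OF z that] by auto
 have d: "fst (z L):carrier IM" "fst (z L) divides\<^bsub>IM\<^esub> f L" if "L:I" for L using DGD[OF z that]
  by (auto simp: dv_def)
 show "y *D z:carrier DD"
  by (rule DG_closed[OF y'(1) z]) (use inc y' ee_mult[OF _ d] in simp)
 show "z *D y:carrier DD"
  by (rule DG_closed[OF z y'(1)]) (use inc y' ee_mult[OF _ d] in simp)
qed

lemma DG_assoc: "x:carrier DD ==> y:carrier DD ==> z:carrier DD ==> x *D y *D z = x *D (y *D z)"
 unfolding DG_mult by (rule restrict_ext) (use Dm_assoc DGD in simp)

lemma dv_ee: "L:I ==> dv L (ee S L)" using ee by (simp add: dv_def)

lemma pr_ee: assumes L: "L:I" shows "pr L (ee S L) (ee S L) = ee S L"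
 by (rule dv_eqI[OF pr(1)[OF dv_ee[OF L] dv_ee[OF L]] dv_ee[OF L]]) (use pr[OF dv_ee[OF L, of S] dv_ee[OF L, of S]] ee(2)[OF L]
  in simp)

lemma Hs_I:
 assumes ext: "y:extensional I" and y: "!!L. L:I ==> fst (y L) = ee S L & snd (y L):carrier (Gal R (FS S L) K)"
  and r: "!!L L'. L:I ==> L':I ==> L <= L' ==> restrict (snd (y L')) (FS S L) = snd (y L)"
 shows "y:Hs S"
proof -
 have "ideal_gcd R K (ee S L') (f L) = ee S L" if L: "L:I" "L':I" "L <= L'" for L L'
 proof (rule dv_eqI[OF _ dv_ee[OF L(1)]])
  note g = IM_facts(5,6)[OF ee(1)[OF L(2), of S] f_IM[OF L(1)]]
  show "dv L (ideal_gcd R K (ee S L') (f L))" using L g IM_facts(1)[OF g(1) f_IM[OF L(1)]] by (simp add: dv_def)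
  fix p assume p: "p:pK"
  show "v p (ideal_gcd R K (ee S L') (f L)) = v p (ee S L)"
   using g(2)[OF p] ee(2)[OF L(1) p] ee(2)[OF L(2) p] conductor_mono[OF gx_I[OF L(1)] gx_I[OF L(2)] L(3) p] by simp
 qed
 moreover have "y L:carrier (Dm L)" if "L:I" for L using Dm_mem[of "y L" L] y[OF that] dv_ee[OF that] ee[OF that] by simp
 ultimately show ?thesis unfolding Hs_def DG_mem using ext y r ee by simp
qed

lemma HsD: assumes "y:Hs S"
 shows "y:carrier DD" "L:I ==> fst (y L) = ee S L" "L:I ==> snd (y L):carrier (Gal R (FS S L) K)" "y:extensional I"
  "L:I ==> L':I ==> L <= L' ==> restrict (snd (y L')) (FS S L) = snd (y L)"
  "L:I ==> L':I ==> L <= L' ==> z:FS S L ==> snd (y L') z = snd (y L) z"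
proof -
 show y: "y:carrier DD" "L:I ==> fst (y L) = ee S L" for L using assms by (auto simp: Hs_def)
 show "L:I ==> snd (y L):carrier (Gal R (FS S L) K)" "y:extensional I" and r:
  "L:I ==> L':I ==> L <= L' ==> restrict (snd (y L')) (FS S L) = snd (y L)" using DmD[OF _ DGD(1)[OF y(1)]] y ee DG_mem by auto
 show "L:I ==> L':I ==> L <= L' ==> z:FS S L ==> snd (y L') z = snd (y L) z" using r by (metis restrict_apply')
qed

lemma Hs_mult: assumes y: "y:Hs S" and z: "z:Hs S"
 shows "y *D z = (\<lambda>L\<in>I. (ee S L, \<lambda>w\<in>FS S L. snd (y L) (snd (z L) w)))" "y *D z:Hs S"
proof -
 have "y L \<otimes>\<^bsub>Dm L\<^esub> z L = (ee S L, \<lambda>w\<in>FS S L. snd (y L) (snd (z L) w))" if L: "L:I" for L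
  using Dm_mult[OF L DGD(1)[OF HsD(1)[OF y] L] DGD(1)[OF HsD(1)[OF z] L]] HsD(2)[OF y L] HsD(2)[OF z L] pr_ee[OF L] ee[OF L]
   by simp
 thus 1: "y *D z = (\<lambda>L\<in>I. (ee S L, \<lambda>w\<in>FS S L. snd (y L) (snd (z L) w)))" unfolding DG_mult by auto
 show "y *D z:Hs S" using Hs_closed[OF y HsD(1)[OF z]] 1 by (auto simp: Hs_def)
qed

definition ef :: "'a set set => 'a set => 'a set \<times> ('a => 'a)" where
 "ef S = (\<lambda>L\<in>I. (ee S L, \<lambda>x\<in>FS S L. x))"

lemma idem_family: "idem_family R K S = ef S"
 unfolding idem_family_def ef_def idem_component_def ee_def[symmetric]
  by (rule restrict_ext) (use ee Gal_group[OF FS_sub(2,3)] in simp)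

lemma ef: "ef S:Hs S"
proof (rule Hs_I)
 fix L assume L: "L:I"
 show "fst (ef S L) = ee S L & snd (ef S L):carrier (Gal R (FS S L) K)" using L Gal_group[OF FS_sub(2,3)[OF L]]
  by (simp add: ef_def)
 fix L' assume L': "L':I" "L <= L'"
 show "restrict (snd (ef S L')) (FS S L) = snd (ef S L)" using FS_restrict[OF L L'] L L' by (auto simp: ef_def)
qed (simp add: ef_def)

lemma Hs_unit: assumes y: "y:Hs S" shows "y *D ef S = y" "ef S *D y = y"
proof -
 have yL: "y L = (ee S L, snd (y L))" "snd (y L):extensional (FS S L)" "!!w. w:FS S L ==> snd (y L) w:FS S L" if "L:I" for L
  using HsD(2)[OF y that] GalD[OF HsD(3)[OF y that]] by (auto simp: prod_eq_iff)
 have "(\<lambda>w\<in>FS S L. snd (y L) (snd (ef S L) w)) = snd (y L)"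
  "(\<lambda>w\<in>FS S L. snd (ef S L) (snd (y L) w)) = snd (y L)" if "L:I" for L
  using yL[OF that] that by (auto simp: ef_def extensional_def)
 hence "(\<lambda>L\<in>I. (ee S L, \<lambda>w\<in>FS S L. snd (y L) (snd (ef S L) w))) = (\<lambda>L\<in>I. (ee S L, snd (y L)))"
  "(\<lambda>L\<in>I. (ee S L, \<lambda>w\<in>FS S L. snd (ef S L) (snd (y L) w))) = (\<lambda>L\<in>I. (ee S L, snd (y L)))"
  by auto
 moreover have "(\<lambda>L\<in>I. (ee S L, snd (y L))) = y"
  by (rule extensionalityI[OF restrict_extensional HsD(4)[OF y]]) (use yL in simp)
 ultimately show "y *D ef S = y" "ef S *D y = y" unfolding Hs_mult[OF y ef] Hs_mult[OF ef y] by auto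
qed

text \<open>Inverses are chosen level by level; uniqueness of inverse values makes the choices
  compatible.\<close>

lemma Hs_inverse: assumes y: "y:Hs S" shows "EX z:Hs S. y *D z = ef S & z *D y = ef S"
proof -
 have "ALL L:I. EX k. k:carrier (Gal R (FS S L) K) & (ALL x:FS S L. k (snd (y L) x) = x & snd (y L) (k x) = x)"
  using Gal_group(6)[OF FS_sub(2,3) HsD(3)[OF y]] by auto
 from bchoice[OF this] obtain k where k: "!!L. L:I ==> k L:carrier (Gal R (FS S L) K)"
  "!!L x. L:I ==> x:FS S L ==> k L (snd (y L) x) = x & snd (y L) (k L x) = x" by auto
 define z where "z = (\<lambda>L\<in>I. (ee S L, k L))"
 have z: "z:Hs S"
 proof (rule Hs_I)
  fix L assume L: "L:I"
  show "fst (z L) = ee S L & snd (z L):carrier (Gal R (FS S L) K)" using L k by (simp add: z_def)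
  fix L' assume L': "L':I" "L <= L'"
  have "k L' w = k L w" if w: "w:FS S L" for w
  proof -
   have kw: "k L w:FS S L" by (rule GalD(1)[OF k(1)[OF L] w])
   have "snd (y L') (k L w) = w" using HsD(6)[OF y L L' kw] k(2)[OF L w] by simp
   moreover have "k L w:FS S L'" using kw FS_restrict[OF L L'] by simp
   ultimately show ?thesis using k(2)[OF L'(1), of "k L w"] by simp
  qed
  thus "restrict (snd (z L')) (FS S L) = snd (z L)"
   using L L' GalD[OF k(1)[OF L]] by (auto simp: z_def extensional_def)
 qed (simp add: z_def)
 have "y *D z = ef S" "z *D y = ef S"
  unfolding Hs_mult[OF y z] Hs_mult[OF z y] ef_def using k by (auto simp: z_def intro!: restrict_ext)
 thus ?thesis using z by auto
qed

text \<open>Puts each element into the principal right ideal it generates, as needed to unfold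
  Green's relation. The unit ideal is paired with the identity of all of \<open>L\<close>, because
  its quotient is the conductor, whose upper groups are trivial.\<close>

lemma DG_one: "EX u:carrier DD. ALL x:carrier DD. x *D u = x"
proof -
 let ?o = "\<one>\<^bsub>IM\<^esub>"
 define u where "u = (\<lambda>L\<in>I. (?o, \<lambda>x\<in>L. x))"
 have o: "?o:carrier IM" "!!p. p:pK ==> v p ?o = 0" using IM_facts[OF f_IM f_IM] I_nonempty[OF zero_closed] by auto
 have dv: "dv L ?o" if "L:I" for L using that o IM_facts[OF o(1) f_IM[OF that]] by (simp add: dv_def)
 have DFo: "DF L ?o = L" if L: "L:I" for L
 proof -
  have "DF L ?o = Fx L (%p. v p (f L) - v p ?o)" using D_field_eq[OF gx_I[OF L]] dv[OF L] by (simp add: dv_def)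
  also have "\<dots> = Fx L (%p. v p (f L))" by (rule Fx_cong[OF gx_I[OF L]]) (use o in simp)
  finally show ?thesis using Fx_top[OF gx_I[OF L]] by simp
 qed
 have "u:carrier DD" unfolding DG_mem
 proof (intro conjI ballI impI)
  fix L assume L: "L:I"
  show "u L:carrier (Dm L)" using Dm_mem[of "u L" L] L dv[OF L] DFo[OF L] Gal_group[OF I_facts(1,2)[OF L]] by (simp add: u_def)
  fix L' assume L': "L':I" "L <= L'"
  note g = IM_facts(5,6)[OF o(1) f_IM[OF L]]
  have "dv L (ideal_gcd R K ?o (f L))" using L g IM_facts[OF g(1) f_IM[OF L]] by (simp add: dv_def)
  hence "ideal_gcd R K ?o (f L) = ?o" by (rule dv_eqI[OF _ dv[OF L]]) (use g o in simp)
  thus "ideal_gcd R K (fst (u L')) (f L) = fst (u L)" "restrict (snd (u L')) (DF L (fst (u L))) = snd (u L)"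
   using L L' DFo[OF L] by (auto simp: u_def fun_eq_iff)
 qed (simp add: u_def)
 moreover have "x *D u = x" if x: "x:carrier DD" for x
 proof -
  have "x L \<otimes>\<^bsub>Dm L\<^esub> u L = x L" if L: "L:I" for L
  proof -
   have uL: "u L = (?o, \<lambda>x\<in>L. x)" using L by (simp add: u_def)
   note xL = DGD(1,2)[OF x L]
   have "pr L (fst (x L)) ?o = fst (x L)"
    by (rule dv_eqI[OF pr(1)[OF xL(2) dv[OF L]] xL(2)]) (use pr[OF xL(2) dv[OF L]] o DF[OF xL(2)] in simp)
   moreover have "(\<lambda>z\<in>DF L (fst (x L)). snd (x L) ((\<lambda>x\<in>L. x) z)) = snd (x L)"
    using DmD[OF L xL(1)] DF[OF xL(2)] by (auto simp: fun_eq_iff extensional_def)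
   moreover have "u L:carrier (Dm L)" using DGD(1)[OF \<open>u:carrier DD\<close> L] .
   ultimately show ?thesis using Dm_mult[OF L xL(1)] unfolding uL by simp
  qed
  thus ?thesis unfolding DG_mult using x DG_mem by (auto simp: extensional_def)
 qed
 ultimately show ?thesis by auto
qed

lemma H_class_eq: "H_class DD (ef S) = Hs S"
proof
 note e = HsD(1)[OF ef[of S]]
 show "H_class DD (ef S) <= Hs S"
 proof
  fix y assume "y:H_class DD (ef S)"
  hence y: "y:carrier DD" "ef S <#\<^bsub>DD\<^esub> carrier DD = y <#\<^bsub>DD\<^esub> carrier DD"
   by (auto simp: H_class_def green_H_def)
  obtain u where u: "u:carrier DD" "ALL x:carrier DD. x *D u = x" using DG_one by auto
  have "y:y <#\<^bsub>DD\<^esub> carrier DD" "ef S:ef S <#\<^bsub>DD\<^esub> carrier DD" using u y(1) e unfolding l_coset_def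
   by force+
  then obtain w z where w: "w:carrier DD" "y = ef S *D w" and z: "z:carrier DD" "ef S = y *D z"
   using y(2) unfolding l_coset_def by blast
  \<comment> \<open>From y = e w and e = y z: exponents add and are then capped by those of the
    conductor, so the exponents of y and of e bound each other from below.\<close>
  have "fst (y L) = ee S L" if L: "L:I" for L
  proof (rule dv_eqI[OF DGD(2)[OF y(1) L] dv_ee[OF L]])
   fix p assume p: "p:pK"
   note yd = DGD(1,2)[OF y(1) L] and wd = DGD(1,2)[OF w(1) L] and zd = DGD(1,2)[OF z(1) L] and ed = DGD(1,2)[OF e L]
   have eL: "fst (ef S L) = ee S L" and yL: "y L = ef S L \<otimes>\<^bsub>Dm L\<^esub> w L" and efL:
    "ef S L = y L \<otimes>\<^bsub>Dm L\<^esub> z L" using L fun_cong[OF w(2)] fun_cong[OF z(2), of L]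
     by (auto simp: ef_def DG_mult)
   have "fst (y L) = pr L (fst (ef S L)) (fst (w L))" using yL unfolding Dm_mult[OF L ed(1) wd(1)] by simp
   moreover have "fst (ef S L) = pr L (fst (y L)) (fst (z L))" using efL unfolding Dm_mult[OF L yd(1) zd(1)] by simp
   ultimately show "v p (fst (y L)) = v p (ee S L)" using pr(2)[OF dv_ee[OF L, of S] wd(2) p] pr(2)[OF yd(2) zd(2) p]
    unfolding eL by simp
  qed
  thus "y:Hs S" using y by (simp add: Hs_def)
 qed
 show "Hs S <= H_class DD (ef S)"
 proof
  fix y assume y: "y:Hs S"
  note y' = HsD(1)[OF y]
  obtain z where z: "z:Hs S" "y *D z = ef S" "z *D y = ef S" using Hs_inverse[OF y] by auto
  note z' = HsD(1)[OF z(1)]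
  have l: "a <#\<^bsub>DD\<^esub> carrier DD <= b <#\<^bsub>DD\<^esub> carrier DD" if
   "!!w. w:carrier DD ==> c w:carrier DD & a *D w = b *D c w" for a b c
   unfolding l_coset_def using that by auto
  have r: "carrier DD #>\<^bsub>DD\<^esub> a <= carrier DD #>\<^bsub>DD\<^esub> b" if
   "!!w. w:carrier DD ==> c w:carrier DD & w *D a = c w *D b" for a b c
   unfolding r_coset_def using that by auto
  \<comment> \<open>Here e w = y (z w) and y w = e (y w), and the bracketed products stay in the
    limit by \<open>Hs_closed\<close>.\<close>
  have "ef S <#\<^bsub>DD\<^esub> carrier DD = y <#\<^bsub>DD\<^esub> carrier DD"
   by (intro subset_antisym l[of "%w. z *D w"] l[of "%w. y *D w"] conjI Hs_closed(1)[OF y] Hs_closed(1)[OF z(1)])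
    (simp_all add: DG_assoc[OF e y', symmetric] DG_assoc[OF y' z', symmetric] Hs_unit[OF y] z(2))
  moreover have "carrier DD #>\<^bsub>DD\<^esub> ef S = carrier DD #>\<^bsub>DD\<^esub> y"
   by (intro subset_antisym r[of "%w. w *D z"] r[of "%w. w *D y"] conjI Hs_closed(2)[OF y] Hs_closed(2)[OF z(1)])
    (simp_all add: DG_assoc[OF _ y' e] DG_assoc[OF _ z' y'] Hs_unit[OF y] z(3))
  moreover note y'
  ultimately show "y:H_class DD (ef S)" by (simp add: H_class_def green_H_def)
 qed
qed

lemma H_class_group: "group (H_class_group DD (ef S))"
proof (rule groupI, unfold H_class_group_def H_class_eq)
 let ?G = "DD\<lparr>carrier := Hs S, one := ef S\<rparr>"
 show "\<one>\<^bsub>?G\<^esub>:carrier ?G" using ef by simp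
 fix x assume x: "x:carrier ?G"
 show "\<one>\<^bsub>?G\<^esub> \<otimes>\<^bsub>?G\<^esub> x = x" using Hs_unit x by simp
 show "EX y:carrier ?G. y \<otimes>\<^bsub>?G\<^esub> x = \<one>\<^bsub>?G\<^esub>" using Hs_inverse x by auto
 fix y assume y: "y:carrier ?G"
 show "x \<otimes>\<^bsub>?G\<^esub> y:carrier ?G" using Hs_mult x y by simp
 fix z assume z: "z:carrier ?G"
 show "x \<otimes>\<^bsub>?G\<^esub> y \<otimes>\<^bsub>?G\<^esub> z = x \<otimes>\<^bsub>?G\<^esub> (y \<otimes>\<^bsub>?G\<^esub> z)" using DG_assoc HsD x y z by simp
qed

end

section \<open>The isomorphism and its continuity\<close>

context numf
begin

abbreviation "GU S == Gal R (U S) K"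
abbreviation "HG S == H_class_group DD (ef S)"

definition gg :: "'a set set => ('a => 'a) => 'a set => 'a set \<times> ('a => 'a)" where
 "gg S rho = (\<lambda>L\<in>I. (ee S L, restrict rho (FS S L)))"

lemma FS_U: "L:I ==> FS S L <= U S" by (auto simp: U_def)

lemma gg_Hs: assumes s: "rho:carrier (GU S)" shows "gg S rho:Hs S"
proof (rule Hs_I)
 fix L assume L: "L:I"
 show "fst (gg S rho L) = ee S L & snd (gg S rho L):carrier (Gal R (FS S L) K)"
  using restrict_Gal[OF FS_sub(4)[OF L] U_sub(1) FS_U[OF L] s] L by (simp add: gg_def)
 fix L' assume L': "L':I" "L <= L'"
 show "restrict (snd (gg S rho L')) (FS S L) = snd (gg S rho L)" using FS_restrict[OF L L'] L L' by (auto simp: gg_def)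
qed (simp add: gg_def)

lemma gg_eq: assumes "rho:carrier (GU S)" "tau:carrier (GU S)" "gg S rho = gg S tau" shows "rho = tau"
proof (rule extensionalityI[OF GalD(4)[OF assms(1)] GalD(4)[OF assms(2)]])
 fix x assume "x:U S"
 then obtain L where L: "L:I" "x:FS S L" by (auto simp: U_def)
 have "restrict rho (FS S L) = restrict tau (FS S L)" using fun_cong[OF assms(3), of L] L by (simp add: gg_def)
 thus "rho x = tau x" using L by (metis restrict_apply')
qed

text \<open>The components are glued: each x of \<open>U S\<close> lies in some
  \<open>FS S L\<close>, and any two such levels can be compared in a common larger one, so the
  chosen level does not affect the value.\<close>

lemma gg_surj: assumes y: "y:Hs S" shows "EX rho:carrier (GU S). gg S rho = y"
proof -
 define s where "s = (\<lambda>x\<in>U S. snd (y (SOME L. L:I & x:FS S L)) x)"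
 have s: "s x = snd (y L) x" if L: "L:I" "x:FS S L" for x L
 proof -
  define L0 where "L0 = (SOME L. L:I & x:FS S L)"
  have L0: "L0:I & x:FS S L0" unfolding L0_def by (rule someI[of _ L]) (use L in simp)
  obtain M where M: "M:I" "L <= M" "L0 <= M" using I_directed L L0 by blast
  have "snd (y L0) x = snd (y L) x" using HsD(6)[OF y _ M(1)] L L0 M by metis
  thus ?thesis using FS_U[OF L(1)] L unfolding s_def L0_def by auto
 qed
 have two: "EX L:I. x:FS S L & z:FS S L" if xy: "x:U S" "z:U S" for x z
 proof -
  obtain L0 L1 where L0: "L0:I" "x:FS S L0" "L1:I" "z:FS S L1" using xy by (auto simp: U_def)
  obtain M where M: "M:I" "L0 <= M" "L1 <= M" using I_directed[OF L0(1,3)] by auto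
  thus ?thesis using FS_restrict[OF L0(1) M(1,2)] FS_restrict[OF L0(3) M(1,3)] L0 by auto
 qed
 note yD = GalD[OF HsD(3)[OF y]]
 have sU: "s x:U S" if xU: "x:U S" for x
 proof -
  obtain L where L: "L:I" "x:FS S L" using two[OF xU xU] by auto
  thus ?thesis using yD(1)[OF L] s[OF L] FS_U[OF L(1)] by auto
 qed
 have hom: "s (x \<oplus> z) = s x \<oplus> s z & s (x \<otimes> z) = s x \<otimes> s z & (s x = s z --> x = z)" if xz: "x:U S"
  "z:U S" for x z
 proof -
  obtain L where L: "L:I" "x:FS S L" "z:FS S L" using two[OF xz] by auto
  show ?thesis using yD(6,7)[OF L] yD[OF L(1)] L s[OF L(1)] subfieldD(3,4)[OF FS_sub(2)[OF L(1)] L(2,3)]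
   by (simp add: inj_on_eq_iff)
 qed
 have "s ` U S = U S"
 proof
  show "U S <= s ` U S"
  proof
   fix x assume "x:U S"
   then obtain L where L: "L:I" "x:FS S L" by (auto simp: U_def)
   then obtain w where "w:FS S L" "x = snd (y L) w" using yD(2)[OF L(1)] by auto
   hence "x = s w" "w:U S" using s[OF L(1)] FS_U[OF L(1)] by auto
   thus "x:s ` U S" by simp
  qed
 qed (use sU in blast)
 hence "bij_betw s (U S) (U S)" using hom by (auto simp: bij_betw_def inj_on_def)
 moreover obtain L where L: "L:I" using I_nonempty[OF zero_closed] by auto
 have "s \<one> = \<one>" using s[OF L subfieldD(5)[OF FS_sub(2)[OF L]]] yD[OF L] by simp
 moreover have "s x = x" if "x:K" for x using s[OF L subsetD[OF FS_sub(3)[OF L] that]] yD(3)[OF L that] by simp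
 moreover have "s:extensional (U S)" by (simp add: s_def)
 ultimately have "s:carrier (GU S)" unfolding Gal_iff using hom by simp
 moreover have "gg S s = y"
 proof (rule extensionalityI[OF _ HsD(4)[OF y]])
  fix L assume L: "L:I"
  have "restrict s (FS S L) = snd (y L)"
   by (rule extensionalityI[OF restrict_extensional yD(4)[OF L]]) (use s[OF L] in simp)
  thus "gg S s L = y L" using HsD(2)[OF y L] L by (simp add: gg_def prod_eq_iff)
 qed (simp add: gg_def)
 ultimately show ?thesis by auto
qed

lemma gg_iso: "gg S:iso (GU S) (HG S)" "gg S ` carrier (GU S) = Hs S" "inj_on (gg S) (carrier (GU S))"
proof -
 show 1: "gg S ` carrier (GU S) = Hs S" using gg_Hs gg_surj by blast
 show 2: "inj_on (gg S) (carrier (GU S))" using gg_eq by (rule inj_onI)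
 have "gg S (rho \<otimes>\<^bsub>GU S\<^esub> tau) = gg S rho *D gg S tau" if st: "rho:carrier (GU S)" "tau:carrier (GU S)" for
  rho tau
  unfolding Hs_mult(1)[OF gg_Hs[OF st(1)] gg_Hs[OF st(2)]] Gal_group(4)[OF U_sub st]
  unfolding gg_def
 proof (rule restrict_ext)
  fix L assume L: "L:I"
  have "restrict tau (FS S L) w:FS S L" if "w:FS S L" for w
   using GalD(1)[OF restrict_Gal[OF FS_sub(4)[OF L] U_sub(1) FS_U[OF L] st(2)] that] .
  hence "restrict (compose (U S) rho tau) (FS S L) = (\<lambda>w\<in>FS S L. restrict rho (FS S L) (restrict tau (FS S L) w))"
   using FS_U[OF L] by (intro restrict_ext) (auto simp: compose_def)
  thus "(ee S L, restrict (compose (U S) rho tau) (FS S L)) = (ee S L,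
    \<lambda>w\<in>FS S L. snd ((\<lambda>L\<in>I. (ee S L, restrict rho (FS S L))) L) (snd ((\<lambda>L\<in>I. (ee S L,
     restrict tau (FS S L))) L) w))" using L by simp
 qed
 thus "gg S:iso (GU S) (HG S)"
  using 1 2 by (auto simp: iso_def hom_def bij_betw_def H_class_group_def H_class_eq)
qed

definition kr :: "'a set set => ('a => 'a) set set" where
 "kr S = {rho <#\<^bsub>GU S\<^esub> carrier (Gal R (U S) F) | rho F. rho:carrier (GU S) & F:I & F <= U S}"

lemma krull_kr: "krull_topology R (U S) K = topology_generated_by (kr S)" by (simp add: krull_topology_def kr_def)

lemma coset_eq:
 assumes s: "rho:carrier (GU S)" and F: "F:I" "F <= U S"
 shows "rho <#\<^bsub>GU S\<^esub> carrier (Gal R (U S) F) = {tau:carrier (GU S). ALL x:F. tau x = rho x}"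
proof
 have sub: "\<kappa>:carrier (GU S)" if "\<kappa>:carrier (Gal R (U S) F)" for \<kappa> using that I_facts[OF F(1)]
  unfolding Gal_iff by auto
 show "rho <#\<^bsub>GU S\<^esub> carrier (Gal R (U S) F) <= {tau:carrier (GU S). ALL x:F. tau x = rho x}"
 proof
  fix tau assume "tau:rho <#\<^bsub>GU S\<^esub> carrier (Gal R (U S) F)"
  then obtain \<kappa> where k: "\<kappa>:carrier (Gal R (U S) F)" "tau = rho \<otimes>\<^bsub>GU S\<^esub> \<kappa>"
   by (auto simp: l_coset_def)
  show "tau:{tau:carrier (GU S). ALL x:F. tau x = rho x}"
   using Gal_group(5)[OF U_sub s sub[OF k(1)]] GalD[OF k(1)] F(2) k Gal_group(4)[OF U_sub s sub[OF k(1)]]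
    by (auto simp: compose_def)
 qed
 show "{tau:carrier (GU S). ALL x:F. tau x = rho x} <= rho <#\<^bsub>GU S\<^esub> carrier (Gal R (U S) F)"
 proof
  fix tau assume "tau:{tau:carrier (GU S). ALL x:F. tau x = rho x}"
  hence t: "tau:carrier (GU S)" "ALL x:F. tau x = rho x" by auto
  obtain r where r: "r:carrier (GU S)" "ALL x:U S. r (rho x) = x & rho (r x) = x" using Gal_group(6)[OF U_sub s] by auto
  let ?k = "compose (U S) r tau"
  have k: "?k:carrier (GU S)" using Gal_group(5)[OF U_sub r(1) t(1)] .
  have "?k x = x" if x: "x:F" for x using r t F x by (auto simp: compose_def)
  hence kF: "?k:carrier (Gal R (U S) F)" using k unfolding Gal_iff by simp
  have "compose (U S) rho ?k = tau"
   by (rule extensionalityI[OF compose_extensional GalD(4)[OF t(1)]]) (use r GalD[OF t(1)] in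
    \<open>simp add: compose_def\<close>)
  hence "tau = rho \<otimes>\<^bsub>GU S\<^esub> ?k" using Gal_group(4)[OF U_sub s k] by simp
  thus "tau:rho <#\<^bsub>GU S\<^esub> carrier (Gal R (U S) F)" using kF by (auto simp: l_coset_def)
 qed
qed

lemma krull_topspace: "topspace (krull_topology R (U S) K) = carrier (GU S)"
proof -
 obtain L where L: "L:I" using I_nonempty[OF zero_closed] by auto
 have "rho:\<Union> (kr S)" if s: "rho:carrier (GU S)" for rho
 proof -
  show ?thesis using s FS_sub(5)[OF L] FS_U[OF L] coset_eq[OF s FS_sub(5)[OF L] FS_U[OF L]] unfolding kr_def by blast
 qed
 moreover have "\<Union> (kr S) <= carrier (GU S)" using coset_eq by (auto simp: kr_def)
 ultimately show ?thesis unfolding krull_kr by auto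
qed

abbreviation "PT == product_topology (%L. discrete_topology (carrier (Dm L))) I"
abbreviation "HT S == subtopology (DG_topology R K) (H_class DD (ef S))"

lemma HT: "HT S = subtopology PT (Hs S)" "topspace (HT S) = Hs S"
proof -
 have s: "Hs S <= carrier DD" by (auto simp: Hs_def)
 show e: "HT S = subtopology PT (Hs S)"
  unfolding DG_topology_def H_class_eq subtopology_subtopology using s by (simp add: Int_absorb1)
 show "topspace (HT S) = Hs S" using s DG_mem unfolding e by (auto simp: extensional_def)
qed

text \<open>The coordinate at \<open>L\<close> depends only on the restriction to
  \<open>FS S L\<close>, a finite Galois extension of \<open>K\<close>, hence it is constant on
  cosets that belong to the generating sets of the Krull topology.\<close>

lemma gg_continuous: "continuous_map (krull_topology R (U S) K) (HT S) (gg S)"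
 unfolding HT(1) continuous_map_in_subtopology continuous_map_componentwise
proof (intro conjI ballI)
 let ?X = "krull_topology R (U S) K"
 show "gg S ` topspace ?X <= extensional I" "gg S:topspace ?X \<rightarrow> Hs S" using gg_Hs
  by (auto simp: gg_def krull_topspace)
 fix L assume L: "L:I"
 show "continuous_map ?X (discrete_topology (carrier (Dm L))) (%x. gg S x L)"
  unfolding continuous_map_def
 proof (intro conjI allI impI)
  show "(%x. gg S x L):topspace ?X \<rightarrow> topspace (discrete_topology (carrier (Dm L)))"
   using DGD[OF HsD(1)[OF gg_Hs] L] by (simp add: krull_topspace)
  fix V
  let ?A = "{x:topspace ?X. gg S x L:V}"
  show "openin ?X ?A"
  proof (subst openin_subopen, intro ballI)
   fix rho assume "rho:?A"
   hence s: "rho:carrier (GU S)" "gg S rho L:V" by (auto simp: krull_topspace)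
   let ?T = "rho <#\<^bsub>GU S\<^esub> carrier (Gal R (U S) (FS S L))"
   note c = coset_eq[OF s(1) FS_sub(5)[OF L] FS_U[OF L]]
   have "?T:kr S" unfolding kr_def using s FS_sub[OF L] FS_U[OF L] by blast
   hence "openin ?X ?T" unfolding krull_kr by (rule topology_generated_by_Basis)
   moreover have "gg S tau L = gg S rho L" if "tau:?T" for tau
    using that unfolding c by (auto simp: gg_def)
   hence "?T <= ?A" using s(2) c by (auto simp: krull_topspace)
   ultimately show "EX T. openin ?X T & rho:T & T <= ?A" using s c by auto
  qed
 qed
qed

abbreviation "hh S == inv_into (carrier (GU S)) (gg S)"

lemma hh: "y:Hs S ==> hh S y:carrier (GU S)" "y:Hs S ==> gg S (hh S y) = y"
 using gg_iso inv_into_into f_inv_into_f by metis+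

lemma hh_continuous: "continuous_map (HT S) (krull_topology R (U S) K) (hh S)"
 unfolding krull_kr
proof (rule continuous_on_generated_topo)
 show "hh S ` topspace (HT S) <= \<Union> (kr S)"
  using hh krull_topspace unfolding krull_kr HT by auto
 fix A assume "A:kr S"
 then obtain rho F where A: "A = rho <#\<^bsub>GU S\<^esub> carrier (Gal R (U S) F)" "rho:carrier (GU S)" "F:I" "F <= U S"
  by (auto simp: kr_def)
 \<comment> \<open>A Galois \<open>F\<close> inside \<open>U S\<close> is its own largest part
   unramified outside \<open>S\<close>. So the coordinate at \<open>F\<close> sees the whole
   restriction to \<open>F\<close>, and the preimage of the coset is given by a single value of this
   coordinate.\<close>
 have FF: "FS S F = F" using U_int[OF A(3)] A by auto
 have "hh S -` A Int topspace (HT S) = {y:topspace (HT S). y F:{gg S rho F}}"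
 proof -
  have "hh S y:A <-> y F = gg S rho F" if y: "y:Hs S" for y
  proof -
   have "y F = gg S (hh S y) F" using hh[OF y] by simp
   hence "y F = gg S rho F <-> restrict (hh S y) F = restrict rho F" using A FF by (simp add: gg_def)
   also have "\<dots> <-> (ALL x:F. hh S y x = rho x)" by (auto simp: fun_eq_iff)
   finally show ?thesis unfolding A coset_eq[OF A(2-4)] using hh[OF y] by simp
  qed
  thus ?thesis unfolding HT by auto
 qed
 moreover have "openin (HT S) {y:topspace (HT S). y F:{gg S rho F}}"
 proof (rule openin_continuous_map_preimage)
  show "continuous_map (HT S) (discrete_topology (carrier (Dm F))) (%y. y F)"
   unfolding HT by (rule continuous_map_from_subtopology[OF continuous_map_product_projection[OF A(3)]])
  show "openin (discrete_topology (carrier (Dm F))) {gg S rho F}" using DGD[OF HsD(1)[OF gg_Hs[OF A(2)]] A(3)] by simp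
 qed
 ultimately show "openin (HT S) (hh S -` A Int topspace (HT S))" by simp
qed

lemma main: "topological_group_iso (HG S) (HT S) (GU S) (krull_topology R (U S) K)"
 unfolding topological_group_iso_def
proof (intro conjI bexI)
 show "group (HG S)" by (rule H_class_group)
 show g: "group (GU S)" by (rule Gal_group[OF U_sub])
 show "hh S:iso (HG S) (GU S)" by (rule group.iso_set_sym[OF g gg_iso(1)])
 show "homeomorphic_map (HT S) (krull_topology R (U S) K) (hh S)"
  using hh_continuous gg_continuous[of S] hh inv_into_f_f[OF gg_iso(3)[of S]]
   unfolding homeomorphic_map_maps homeomorphic_maps_def HT krull_topspace by auto
qed

end

section \<open>Existence of the complex model\<close>

lemma (in complex_hom) ev_image: "p:pols E ==> z:E ==> ev (phi z) p = phi (poly p z)"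
proof (induction p)
 case 0
 thus ?case using ev_0[OF closed] zero by simp
next
 case (pCons c p)
 hence p: "p:pols E" "c:E" using pols_simps[OF E] by auto
 thus ?case using pCons ev_pCons[OF closed] pols_simps(9)[OF E p(1)] add mult E' by simp
qed

lemma algnum_exists:
 assumes nf: "number_field W K" and ac: "algebraic_closure W K"
 shows "EX E phi. numf W E phi K"
proof -
 obtain E phi where ch: "complex_hom W E phi" and E: "alg_closed_in E" "phi ` E = carrier W" using embedding_exists[OF nf ac]
  by auto
 interpret C: complex_hom W E phi by (rule ch)
 interpret A: algebraic_closure W K by (rule ac)
 have QE: "\<rat> <= E" by (rule Rats_subset[OF C.E])
 interpret Q: complex_hom W \<rat> phi
 proof
  show "csub \<rat>" "phi 1 = \<one>\<^bsub>W\<^esub>" by (rule csub_Rats, rule C.one)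
  show "phi x:carrier W" if "x:\<rat>" for x using C.closed QE that by auto
  show "phi (x + y) = phi x \<oplus>\<^bsub>W\<^esub> phi y" "phi (x * y) = phi x \<otimes>\<^bsub>W\<^esub> phi y" if
   "x:\<rat>" "y:\<rat>" for x y
   using C.add C.mult QE that by blast+
 qed
 have prime: "generate_field W {} <= phi ` \<rat>" by (rule C.generate_field_min_subfield1[OF _ Q.image_subfield]) auto
 have "algnum W E phi"
 proof (rule algnum.intro[OF ch], rule algnum_axioms.intro)
  show "alg_closed_in E" "phi ` E = carrier W" "algebraically_closed W" by (rule E A.algebraically_closed_axioms)+
  fix z assume z: "z:E"
  obtain p where p: "set p <= generate_field W {}" "p ~= []" "hd p ~= \<zero>\<^bsub>W\<^esub>"
   "C.eval p (phi z) = \<zero>\<^bsub>W\<^esub>"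
   using algebraic_over_prime_field[OF nf ac C.closed[OF z]] by auto
  have "p:lists (phi ` \<rat>)" using p prime by auto
  then obtain ps where ps: "p = map phi ps" "set ps <= \<rat>" unfolding lists_image by auto
  let ?q = "Poly (rev ps)"
  have ne: "ps ~= []" "hd ps ~= 0" using p ps C.zero by (auto simp: hd_map)
  have co: "coeffs ?q = rev ps" using ne by (cases ps) (simp_all add: strip_while_def)
  have qQ: "?q:pols \<rat>"
   unfolding pols_def using ps by (auto simp: nth_default_def) (metis length_rev nth_mem set_rev subsetD)
  hence qE: "?q:pols E" using pols_mono[OF QE] by auto
  have "phi (poly ?q z) = C.ev (phi z) ?q" using C.ev_image[OF qE z] by simp
  also have "\<dots> = \<zero>\<^bsub>W\<^esub>" using C.ev_eval[OF C.closed[OF z] qE] p ps co by simp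
  finally have "poly ?q z = 0" using C.nonzero pols_simps(9)[OF C.E qE z] by simp
  moreover have "?q ~= 0" using co ne by (metis coeffs_eq_Nil rev_is_Nil_conv)
  ultimately show "EX p. p:pols \<rat> & p ~= 0 & poly p z = 0" using qQ by auto
 qed
 then interpret N: algnum W E phi .
 have K: "subfield K W" "ring.finite_dimension W (generate_field W {}) K" using nf by (auto simp: number_field_def)
 moreover have "generate_field W {} <= K" by (rule C.generate_field_min_subfield1[OF _ K(1)]) auto
 ultimately have "numf W E phi K" by unfold_locales (auto simp: finite_extensions_def)
 thus ?thesis by auto
qed

theorem theorem5p9:
  fixes \<Omega> :: "('a, 'm) ring_scheme" and K :: "'a set" and S :: "'a set set"
  assumes "number_field \<Omega> K"
    and "algebraic_closure \<Omega> K"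
    and "S \<subseteq> primes \<Omega> K"
  shows "idem_family \<Omega> K S \<in> carrier (DG \<Omega> K) \<and>
         idem_family \<Omega> K S \<otimes>\<^bsub>DG \<Omega> K\<^esub> idem_family \<Omega> K S = idem_family \<Omega> K S \<and>
         topological_group_iso
           (H_class_group (DG \<Omega> K) (idem_family \<Omega> K S))
           (subtopology (DG_topology \<Omega> K) (H_class (DG \<Omega> K) (idem_family \<Omega> K S)))
           (Gal \<Omega> (max_unramified_extension \<Omega> K S) K)
           (krull_topology \<Omega> (max_unramified_extension \<Omega> K S) K)"
proof -
  obtain E phi where "numf \<Omega> E phi K" using algnum_exists[OF assms(1,2)] by auto
  then interpret N: numf \<Omega> E phi K .
  show ?thesis
    unfolding N.idem_family N.max_unramified using N.HsD[OF N.ef] N.Hs_unit[OF N.ef] N.main by simp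
qed

end
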